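(* Let $\mathbb{K}$ be a field of characteristic $0$. For a positive integer $n$, let $V=\mathbb{K}^n$ with standard basis $e_1,\dots,e_n$ and let $$\operatorname{perm}_n=\sum_{\sigma\in\mathfrak{S}_n}e_{\sigma(1)}\otimes e_{\sigma(2)}\otimes\cdots\otimes e_{\sigma(n)}\in V^{\otimes n}$$ be the permanent tensor. Then the following hold: (1) $\mathbf{R}(\operatorname{perm}_4)=\underline{\mathbf{R}}(\operatorname{perm}_4)=8$; (2) $\underline{\mathbf{R}}(\operatorname{perm}_5)\geq 15$; (3) $\underline{\mathbf{R}}(\operatorname{perm}_6)\geq 29$; (4) $\underline{\mathbf{R}}(\operatorname{perm}_7)\geq 55$.
   Context: $\mathfrak{S}_n$ is the symmetric group on $n$ letters. For finite-dimensional $\mathbb{K}$-vector spaces $V_1,\dots,V_d$ and $T\in V_1\otimes\cdots\otimes V_d$, the tensor rank $\mathbf{R}(T)$ is the minimal $k$ such that $T=\sum_{i=1}^k v_{i,1}\otimes\cdots\otimes v_{i,d}$ with $v_{i,j}\in V_j$. The border rank $\underline{\mathbf{R}}(T)$ is the minimal $k$ such that $T$ lies in the Zariski closure, in $V_1\otimes\cdots\otimes V_d$, of the set of tensors of tensor rank $\le k$. *)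

theory Defs
  imports "HOL-Library.FuncSet" "HOL-Combinatorics.Permutations" "Jordan_Normal_Form.Matrix"
begin

(* A tensor in K^(m 0) (x) ... (x) K^(m (d - 1)) is represented by its coordinate array with
   respect to the standard bases, a function on multi-indices that vanishes off multi_index d m.
   All indices start at 0. *)

type_synonym 'a tensor = "(nat \<Rightarrow> nat) \<Rightarrow> 'a"

definition multi_index :: "nat \<Rightarrow> (nat \<Rightarrow> nat) \<Rightarrow> (nat \<Rightarrow> nat) set" where
  "multi_index d m = (\<Pi>\<^sub>E j\<in>{..<d}. {..<m j})"

definition tensor_space :: "nat \<Rightarrow> (nat \<Rightarrow> nat) \<Rightarrow> 'a::field tensor set" where
  "tensor_space d m = {T. \<forall>i. i \<notin> multi_index d m \<longrightarrow> T i = 0}"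

definition pure_tensor :: "nat \<Rightarrow> (nat \<Rightarrow> 'a::field vec) \<Rightarrow> 'a tensor" where
  "pure_tensor d v =
     (\<lambda>i. if i \<in> multi_index d (\<lambda>j. dim_vec (v j)) then \<Prod>j<d. v j $ i j else 0)"

definition sum_of_pure_tensors :: "nat \<Rightarrow> (nat \<Rightarrow> nat) \<Rightarrow> nat \<Rightarrow> 'a::field tensor \<Rightarrow> bool" where
  "sum_of_pure_tensors d m k T \<longleftrightarrow>
     (\<exists>v. (\<forall>l<k. \<forall>j<d. v l j \<in> carrier_vec (m j)) \<and>
          T = (\<lambda>i. \<Sum>l<k. pure_tensor d (v l) i))"

definition tensor_rank :: "nat \<Rightarrow> (nat \<Rightarrow> nat) \<Rightarrow> 'a::field tensor \<Rightarrow> nat" where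
  "tensor_rank d m T = (LEAST k. sum_of_pure_tensors d m k T)"

inductive polynomial_fun :: "(('i \<Rightarrow> 'a::field) \<Rightarrow> 'a) \<Rightarrow> bool" where
  const: "polynomial_fun (\<lambda>T. c)"
| coord: "polynomial_fun (\<lambda>T. T i)"
| add: "polynomial_fun f \<Longrightarrow> polynomial_fun g \<Longrightarrow> polynomial_fun (\<lambda>T. f T + g T)"
| mult: "polynomial_fun f \<Longrightarrow> polynomial_fun g \<Longrightarrow> polynomial_fun (\<lambda>T. f T * g T)"

(* The polynomials may mention coordinates outside multi_index d m; these are identically 0 on
   tensor_space d m, so they add no closed sets. *)
definition zariski_closed :: "nat \<Rightarrow> (nat \<Rightarrow> nat) \<Rightarrow> 'a::field tensor set \<Rightarrow> bool" where
  "zariski_closed d m X \<longleftrightarrow>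
     (\<exists>F. (\<forall>f\<in>F. polynomial_fun f) \<and> X = {T \<in> tensor_space d m. \<forall>f\<in>F. f T = 0})"

definition border_rank :: "nat \<Rightarrow> (nat \<Rightarrow> nat) \<Rightarrow> 'a::field tensor \<Rightarrow> nat" where
  "border_rank d m T =
     (LEAST k. T \<in> zariski_closed d m hull {S \<in> tensor_space d m. tensor_rank d m S \<le> k})"

definition perm_tensor :: "nat \<Rightarrow> 'a::field tensor" where
  "perm_tensor n =
     (\<lambda>i. \<Sum>\<sigma> | \<sigma> permutes {..<n}. pure_tensor n (\<lambda>j. unit_vec n (\<sigma> j)) i)"

(* For d > 0 every element of tensor_space d m is a finite sum of pure tensors, so the LEAST in
   tensor_rank and border_rank is attained there. *)
lemma ex_sum_of_pure_tensors:
  fixes T :: "'a::field tensor"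
  assumes T: "T \<in> tensor_space d m" and d: "d > 0"
  shows "\<exists>k. sum_of_pure_tensors d m k T"
proof -
  let ?I = "multi_index d m"
  have fin: "finite ?I"
    unfolding multi_index_def by (rule finite_PiE) auto
  then obtain h where h: "bij_betw h {..<card ?I} ?I"
    using ex_bij_betw_nat_finite[OF fin] by (auto simp: atLeast0LessThan)
  define w :: "(nat \<Rightarrow> nat) \<Rightarrow> nat \<Rightarrow> 'a vec" where
    "w i' j = (if j = 0 then T i' else 1) \<cdot>\<^sub>v unit_vec (m j) (i' j)" for i' j
  have w: "w i' j \<in> carrier_vec (m j)" for i' j
    by (simp add: w_def)
  have pure: "pure_tensor d (w i') i = (if i' = i then T i else 0)" if "i' \<in> ?I" for i' i
  proof (cases "i \<in> ?I")
    case True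
    have eq: "w i' j $ i j = (if j = 0 then T i' else 1) * (if i' j = i j then 1 else 0)"
      if "j < d" for j
      using True \<open>i' \<in> ?I\<close> that by (auto simp: w_def multi_index_def PiE_def Pi_def)
    have "pure_tensor d (w i') i
        = (\<Prod>j<d. if j = 0 then T i' else 1) * (\<Prod>j<d. if i' j = i j then 1 else 0)"
      using True by (simp add: pure_tensor_def w_def eq[unfolded w_def] prod.distrib)
    also have "(\<Prod>j<d. if j = 0 then T i' else 1) = T i'"
      using d by (simp add: prod.delta)
    also have "(\<Prod>j<d. if i' j = i j then 1 else (0::'a)) = (if i' = i then 1 else 0)"
    proof (cases "i' = i")
      case False
      then obtain j where "j < d" "i' j \<noteq> i j"
        using True \<open>i' \<in> ?I\<close> unfolding multi_index_def by (metis PiE_ext lessThan_iff)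
      then show ?thesis using False by (auto intro!: prod_zero)
    qed simp
    finally show ?thesis by simp
  next
    case False
    then show ?thesis using that by (auto simp: pure_tensor_def w_def)
  qed
  have "T i = (\<Sum>l<card ?I. pure_tensor d (w (h l)) i)" for i
  proof -
    have "(\<Sum>l<card ?I. pure_tensor d (w (h l)) i) = (\<Sum>i'\<in>?I. pure_tensor d (w i') i)"
      using h by (rule sum.reindex_bij_betw)
    also have "\<dots> = (\<Sum>i'\<in>?I. if i' = i then T i else 0)"
      by (intro sum.cong) (auto simp: pure)
    also have "\<dots> = T i"
      using T fin by (simp add: tensor_space_def)
    finally show ?thesis by simp
  qed
  then have "sum_of_pure_tensors d m (card ?I) T"
    unfolding sum_of_pure_tensors_def using w by (intro exI[of _ "\<lambda>l. w (h l)"]) auto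
  then show ?thesis ..
qed

lemma perm_tensor_in_tensor_space: "perm_tensor n \<in> tensor_space n (\<lambda>_. n)"
  by (auto simp: tensor_space_def perm_tensor_def pure_tensor_def)

end

theory Submission
  imports Defs "HOL-Library.Function_Algebras" "HOL-Library.Product_Lexorder" "HOL-Computational_Algebra.Polynomial" "Jordan_Normal_Form.Determinant"
begin

text \<open>
A flattening of Koszul type sends a tensor of order \<open>s + 2\<close> to a linear map between sections of
exterior products. It has rank at most \<open>r = (\<Prod>t<s. (n - 1) choose Suc t)\<close> on a pure tensor, and
having rank at most \<open>K * r\<close> is a polynomial condition, so a larger rank on the permanent
tensor bounds the border rank from below. On the permanent tensor the rank is full up to the homology of
families of subsets of a grid with prescribed bounds on their row and column sizes; this defect
is estimated by long exact sequences, removing one row or column bound at a time. The matching upper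
bound for order four is Glynn's formula, which writes the permanent with signs
\<open>(1, \<plusminus>1, \<plusminus>1, \<plusminus>1)\<close>.
\<close>

text \<open>Write n = s + 2 and let A = K[x_1,...,x_(n-1)]/(x_i^2), of dimension 2^(n-1), with x_0 =
  1. In row t of the grid, multiply by w_t = sum_i x_i e_(t,i), where e_(t,i) is an exterior
  generator. As the coefficient x_0 of w_t is a unit, the product of these operators over the s rows
  has rank at least 2^(n-1) * r on exterior powers tensored with A. The permanent flattening is its
  compression to inputs of degree at most 1 and outputs of degree at least n - 2 in A, each spanned
  by n monomials. The losses on the two sides are bounded by dim \<open>E1\<close> and dim
  \<open>E2\<close>, and complementation gives dim \<open>E2\<close> \<le> dim \<open>E1\<close>. So
  the rank is at least 2^(n-1) * r - 2 * dim \<open>E1\<close>, and the bounds 8, 15, 29, 55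
  tolerate dim \<open>E1\<close> up to 4, 95, 4999 and 809999; what is proved is 1, 55, 4854 and
  808962. The last margin is narrow: for order seven, two homology numbers are bounded by following
  the gl_3-action that moves cells between three rows.\<close>

definition fscale :: "'a::field => ('b => 'a) => 'b => 'a" where
 "fscale c f = (\<lambda>x. c * f x)"

lemma fscale_apply [simp]: "fscale c f x = c * f x"
 by (simp add: fscale_def)

interpretation fs: vector_space "fscale :: 'a::field => ('b => 'a) => 'b => 'a"
 by unfold_locales (auto simp: fun_eq_iff algebra_simps)

interpretation fsp: vector_space_pair
 "fscale :: 'a::field => ('b => 'a) => 'b => 'a" "fscale :: 'a::field => ('c => 'a) => 'c => 'a"
 by unfold_locales

abbreviation lin :: "(('b => 'a::field) => 'c => 'a) => bool" where
 "lin \<equiv> Vector_Spaces.linear fscale fscale"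

lemma linI:
 assumes "\<And>f g. F (f + g) = F f + F g" "\<And>c f. F (fscale c f) = fscale c (F f)"
 shows "lin F"
 unfolding Vector_Spaces.linear_iff
 by (intro conjI allI fs.vector_space_axioms assms)

lemma sum_apply: "(\<Sum>x\<in>X. f x) y = (\<Sum>x\<in>X. f x (y :: 'b) :: 'a::comm_monoid_add)"
 by (induction X rule: infinite_finite_induct) auto

lemma lin_simps:
 assumes "lin F"
 shows "F (f + g) = F f + F g" "F (fscale c f) = fscale c (F f)" "F (f - g) = F f - F g" "F 0 = 0"
  "F (- f) = - F f"
 using assms by (auto simp: fsp.linear_add fsp.linear_scale fsp.linear_diff fsp.linear_0 fsp.linear_neg)

lemma lin_comp: "lin F ==> lin G ==> lin (\<lambda>x. G (F x))"
 by (rule linI) (simp_all only: lin_simps)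

section \<open>Dimension counts in spaces of functions\<close>

definition findim :: "('b => 'a::field) set => bool" where
 "findim V \<longleftrightarrow> (\<exists>T. finite T \<and> V \<subseteq> fs.span T)"

lemma findim_mono: "findim W ==> V \<subseteq> W ==> findim V"
 by (auto simp: findim_def)

lemma findim_indep: "findim V ==> B \<subseteq> V ==> fs.independent B ==> finite B"
 unfolding findim_def using fs.independent_span_bound by blast

lemma dim_mono:
 assumes "findim W" "V \<subseteq> W"
 shows "fs.dim V \<le> fs.dim W"
proof -
 obtain B where B: "B \<subseteq> V" "fs.independent B" "V \<subseteq> fs.span B" "card B = fs.dim V"
  using fs.basis_exists by blast
 obtain C where C: "C \<subseteq> W" "fs.independent C" "W \<subseteq> fs.span C" "card C = fs.dim W"
  using fs.basis_exists by blast
 have "finite C" using findim_indep[OF assms(1) C(1,2)] .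
 then show ?thesis
  using fs.independent_span_bound[of C B] B C assms(2) by (metis order.trans)
qed

lemma findim_image:
 assumes "lin F" "findim V"
 shows "findim (F ` V)"
proof -
 obtain T where T: "finite T" "V \<subseteq> fs.span T" using assms(2) by (auto simp: findim_def)
 have "F ` V \<subseteq> fs.span (F ` T)"
  using T(2) fsp.linear_span_image[OF assms(1)] by blast
 then show ?thesis unfolding findim_def using T(1) by blast
qed

lemma rank_nullity:
 assumes F: "lin F" and V: "fs.subspace V" "findim V"
 shows "fs.dim V = fs.dim {v\<in>V. F v = 0} + fs.dim (F ` V)"
proof -
 let ?K = "{v\<in>V. F v = 0}"
 obtain A where A: "A \<subseteq> ?K" "fs.independent A" "?K \<subseteq> fs.span A" "card A = fs.dim ?K"
  using fs.basis_exists by blast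
 obtain B where B: "A \<subseteq> B" "B \<subseteq> V" "fs.independent B" "V \<subseteq> fs.span B"
  using fs.maximal_independent_subset_extend[of A V] A by auto
 have fB: "finite B" using findim_indep[OF V(2) B(2,3)] .
 have dV: "fs.dim V = card B" using B by (intro fs.dim_unique) auto
 have key: "\<forall>v\<in>B - A. c v = 0" if s: "F (\<Sum>v\<in>B - A. fscale (c v) v) = 0" for c
 proof -
  have "(\<Sum>v\<in>B - A. fscale (c v) v) \<in> ?K"
   using s B(2) by (auto intro!: fs.subspace_sum[OF V(1)] fs.subspace_scale[OF V(1)])
  then have "(\<Sum>v\<in>B - A. fscale (c v) v) \<in> fs.span A" using A(3) by blast
  then obtain d where d: "(\<Sum>v\<in>B - A. fscale (c v) v) = (\<Sum>v\<in>A. fscale (d v) v)"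
   using fs.span_finite[of A] finite_subset[OF B(1) fB] by auto
  have "(\<Sum>v\<in>B. fscale (if v \<in> A then - d v else c v) v)
    = (\<Sum>v\<in>B - A. fscale (if v \<in> A then - d v else c v) v) + (\<Sum>v\<in>A. fscale (if v \<in> A then - d v else c v) v)"
   by (rule sum.subset_diff[OF B(1) fB])
  also have "\<dots> = (\<Sum>v\<in>B - A. fscale (c v) v) + (\<Sum>v\<in>A. - fscale (d v) v)"
   by (intro arg_cong2[where f="(+)"] sum.cong) auto
  also have "\<dots> = 0" by (simp only: d sum_negf add.right_inverse)
  finally have "\<forall>v\<in>B. (if v \<in> A then - d v else c v) = 0"
   using fs.independentD[OF B(3) fB order_refl, where u="\<lambda>v. if v \<in> A then - d v else c v"]
   by blast
  then show ?thesis by auto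
 qed
 have Fsum: "F (\<Sum>v\<in>S. fscale (c v) v) = (\<Sum>v\<in>S. fscale (c v) (F v))" for c S
  by (simp add: fsp.linear_sum[OF F] lin_simps[OF F])
 have inj: "inj_on F (B - A)"
 proof (rule inj_onI)
  fix x y assume xy: "x \<in> B - A" "y \<in> B - A" "F x = F y"
  show "x = y"
  proof (rule ccontr)
   assume "x \<noteq> y"
   define c where "c v = (if v = x then 1 else if v = y then -1 else 0 :: 'a)" for v
   have "(\<Sum>v\<in>B - A. fscale (c v) v) = (\<Sum>v\<in>{x,y}. fscale (c v) v)"
    using xy fB by (intro sum.mono_neutral_right) (auto simp: c_def fun_eq_iff)
   also have "\<dots> = x - y" using \<open>x \<noteq> y\<close> by (auto simp: c_def fun_eq_iff)
   finally have "F (\<Sum>v\<in>B - A. fscale (c v) v) = 0"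
    using xy by (simp add: lin_simps[OF F])
   from key[OF this] xy(1) have "c x = 0" by blast
   then show False by (simp add: c_def)
  qed
 qed
 have "fs.independent (F ` (B - A))"
 proof (rule fs.independent_if_scalars_zero)
  show "finite (F ` (B - A))" using fB by blast
  fix g x assume g: "(\<Sum>x\<in>F ` (B - A). fscale (g x) x) = 0" and x: "x \<in> F ` (B - A)"
  have "F (\<Sum>v\<in>B - A. fscale (g (F v)) v) = 0"
   using g by (simp add: Fsum sum.reindex[OF inj])
  from key[OF this] x show "g x = 0" by auto
 qed
 moreover have "F ` V \<subseteq> fs.span (F ` (B - A))"
 proof -
  have "F ` V \<subseteq> fs.span (F ` B)" using B(4) fsp.linear_span_image[OF F] by blast
  moreover have "F ` B \<subseteq> fs.span (F ` (B - A))"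
  proof
   fix y assume "y \<in> F ` B"
   then obtain x where x: "x \<in> B" "y = F x" by blast
   show "y \<in> fs.span (F ` (B - A))"
   proof (cases "x \<in> A")
    case True
    then have "y = 0" using x A(1) by blast
    then show ?thesis by (simp only: fs.span_zero)
   qed (use x in \<open>blast intro: fs.span_base\<close>)
  qed
  ultimately show ?thesis using fs.span_minimal[OF _ fs.subspace_span] by blast
 qed
 ultimately have "fs.dim (F ` V) = card (F ` (B - A))"
  using B(2) by (intro fs.dim_unique) auto
 also have "\<dots> = card B - card A" using inj B(1) fB
  by (simp add: card_image card_Diff_subset finite_subset)
 finally show ?thesis using dV A(4) card_mono[OF fB B(1)] by simp
qed

text \<open>A linear map with kernel exactly B plays the role of the quotient map by B: a basis of B
  is extended to a basis of the whole space, and the map kills the former and fixes the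
  rest.\<close>

lemma exists_projection:
 fixes B :: "('b => 'a::field) set"
 assumes "fs.subspace B"
 obtains \<pi> :: "('b => 'a) => 'b => 'a" where "lin \<pi>" "\<And>x. \<pi> x = 0 \<longleftrightarrow> x \<in> B"
proof -
 obtain A where A: "A \<subseteq> B" "fs.independent A" "B \<subseteq> fs.span A" "card A = fs.dim B"
  by (rule fs.basis_exists)
 obtain C where C: "A \<subseteq> C" "fs.independent C" "UNIV \<subseteq> fs.span C"
  by (rule fs.maximal_independent_subset_extend[OF subset_UNIV A(2)])
 let ?f = "\<lambda>x. if x \<in> A then 0 else x"
 obtain \<pi> :: "('b => 'a) => 'b => 'a" where p: "lin \<pi>" "\<And>x. x \<in> C ==> \<pi> x = ?f x"
 proof -
  have "\<exists>g :: ('b => 'a) => 'b => 'a. lin g \<and> (\<forall>x\<in>C. g x = ?f x)"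
   by (rule fsp.linear_independent_extend[OF C(2)])
  then show ?thesis using that by (elim exE conjE) simp
 qed
 have spA: "fs.span A = B"
  using A assms fs.span_minimal by blast
 have "\<pi> x = 0 \<longleftrightarrow> x \<in> B" for x
 proof
  assume "x \<in> B"
  have "\<pi> x = (\<lambda>_. 0) x"
  proof (rule fsp.linear_eq_on[OF p(1), of "\<lambda>_. 0" x A])
   show "lin (\<lambda>x::'b => 'a. (0 :: 'b => 'a))" by (rule linI) auto
   show "x \<in> fs.span A" using \<open>x \<in> B\<close> spA by simp
  qed (use p(2) C(1) in auto)
  then show "\<pi> x = 0" by simp
 next
  assume z: "\<pi> x = 0"
  have "x - \<pi> x \<in> fs.span A"
  proof -
   have "x \<in> fs.span C" using C(3) by blast
   then show ?thesis
   proof (induction rule: fs.span_induct_alt)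
    case base then show ?case by (simp only: lin_simps(4)[OF p(1)] diff_self fs.span_zero)
   next
    case (step c b y)
    have "b - \<pi> b \<in> fs.span A" using step(1) p(2) by (auto intro: fs.span_base fs.span_zero)
    moreover have "fscale c b + y - \<pi> (fscale c b + y) = fscale c (b - \<pi> b) + (y - \<pi> y)"
     by (auto simp: lin_simps[OF p(1)] fun_eq_iff algebra_simps)
    ultimately show ?case using step(2) by (metis fs.span_add fs.span_scale)
   qed
  qed
  then show "x \<in> B" using z spA by simp
 qed
 then show ?thesis by (rule that[OF p(1)])
qed

text \<open>F induces an injection of A modulo the preimage of B into W modulo B.\<close>

lemma dim_modular:
 fixes F :: "('b => 'a::field) => 'c => 'a"
 assumes F: "lin F" and A: "fs.subspace A" "findim A" and W: "fs.subspace W" "findim W"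
  and B: "fs.subspace B" "B \<subseteq> W" and FA: "F ` A \<subseteq> W"
 shows "fs.dim A + fs.dim B \<le> fs.dim {a\<in>A. F a \<in> B} + fs.dim W"
proof -
 obtain \<pi> :: "('c => 'a) => 'c => 'a" where p: "lin \<pi>" "\<And>x. \<pi> x = 0 \<longleftrightarrow> x \<in> B"
  by (rule exists_projection[OF B(1)]) (rule that)
 have "fs.dim A = fs.dim {a\<in>A. \<pi> (F a) = 0} + fs.dim ((\<lambda>a. \<pi> (F a)) ` A)"
  by (rule rank_nullity[OF lin_comp[OF F p(1)] A])
 moreover have "fs.dim W = fs.dim {w\<in>W. \<pi> w = 0} + fs.dim (\<pi> ` W)"
  by (rule rank_nullity[OF p(1) W])
 moreover have "{w\<in>W. \<pi> w = 0} = B" using p(2) B(2) by auto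
 moreover have "fs.dim ((\<lambda>a. \<pi> (F a)) ` A) \<le> fs.dim (\<pi> ` W)"
  using FA by (intro dim_mono findim_image[OF p(1) W(2)]) auto
 ultimately show ?thesis using p(2) by simp
qed

text \<open>Writing h = dim Z - dim B and so on, this is h \<le> h' + h'' for H'' -> H -> H' exact
  in the middle, arranged with sums so that no subtraction is truncated. Assumption
  \<open>ex\<close> is exactness, and \<open>gB\<close> makes g well defined on classes.\<close>

lemma dim_exact:
 fixes f :: "('b => 'a::field) => 'c => 'a" and g :: "('d => 'a) => 'b => 'a"
 assumes f: "lin f" and g: "lin g"
  and Z: "fs.subspace Z" "findim Z" and B: "fs.subspace B" "B \<subseteq> Z"
  and Z': "fs.subspace Z'" "findim Z'" and B': "fs.subspace B'" "B' \<subseteq> Z'"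
  and Z'': "fs.subspace Z''" "findim Z''" and B'': "B'' \<subseteq> Z''"
  and fZ: "\<And>z. z \<in> Z ==> f z \<in> Z'"
  and ex: "\<And>z. z \<in> Z ==> f z \<in> B' ==> \<exists>y\<in>Z''. z - g y \<in> B"
  and gB: "\<And>y. y \<in> B'' ==> g y \<in> B"
 shows "fs.dim Z + fs.dim B' + fs.dim B'' \<le> fs.dim B + fs.dim Z' + fs.dim Z''"
proof -
 let ?K = "{z\<in>Z. f z \<in> B'}"
 have 1: "fs.dim Z + fs.dim B' \<le> fs.dim ?K + fs.dim Z'"
  using fZ by (intro dim_modular[OF f Z Z' B']) auto
 obtain \<pi> :: "('b => 'a) => 'b => 'a" where p: "lin \<pi>" "\<And>x. \<pi> x = 0 \<longleftrightarrow> x \<in> B"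
  by (rule exists_projection[OF B(1)]) (rule that)
 have sK: "fs.subspace ?K"
  using Z(1) B'(1) by (auto simp: fs.subspace_def lin_simps[OF f])
 have fK: "findim ?K" by (rule findim_mono[OF Z(2)]) auto
 have "fs.dim ?K = fs.dim {z\<in>?K. \<pi> z = 0} + fs.dim (\<pi> ` ?K)"
  by (rule rank_nullity[OF p(1) sK fK])
 moreover have "fs.dim {z\<in>?K. \<pi> z = 0} \<le> fs.dim B"
  using p(2) by (intro dim_mono findim_mono[OF Z(2) B(2)]) auto
 moreover have "\<pi> ` ?K \<subseteq> (\<lambda>y. \<pi> (g y)) ` Z''"
 proof
  fix x assume "x \<in> \<pi> ` ?K"
  then obtain z where z: "z \<in> Z" "f z \<in> B'" "x = \<pi> z" by blast
  from ex[OF z(1,2)] obtain y where y: "y \<in> Z''" "z - g y \<in> B" by blast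
  have "\<pi> z = \<pi> (g y)" using p(2)[of "z - g y"] y(2) by (simp add: lin_simps[OF p(1)])
  then show "x \<in> (\<lambda>y. \<pi> (g y)) ` Z''" using z y by blast
 qed
 then have "fs.dim (\<pi> ` ?K) \<le> fs.dim ((\<lambda>y. \<pi> (g y)) ` Z'')"
  by (intro dim_mono findim_image[OF lin_comp[OF g p(1)] Z''(2)])
 moreover have "fs.dim Z'' = fs.dim {y\<in>Z''. \<pi> (g y) = 0} + fs.dim ((\<lambda>y. \<pi> (g y)) ` Z'')"
  by (rule rank_nullity[OF lin_comp[OF g p(1)] Z''])
 moreover have "fs.dim B'' \<le> fs.dim {y\<in>Z''. \<pi> (g y) = 0}"
  using gB B'' p(2) by (intro dim_mono findim_mono[OF Z''(2)]) auto
 ultimately show ?thesis using 1 by linarith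
qed

definition supp_on :: "'b set => ('b => 'a::field) set" where
 "supp_on X = {f. \<forall>x. x \<notin> X --> f x = 0}"

lemma subspace_supp_on [simp]: "fs.subspace (supp_on X)"
 by (auto simp: fs.subspace_def supp_on_def)

lemma supp_on_basis:
 assumes "finite X"
 defines "D \<equiv> (\<lambda>x. (\<lambda>y. if y = x then 1 else 0 :: 'a::field)) ` X"
 shows "fs.independent D" "supp_on X = fs.span D" "card D = card X" "finite D"
proof -
 let ?d = "\<lambda>x. (\<lambda>y. if y = x then 1 else 0 :: 'a)"
 have inj: "inj_on ?d X" by (rule inj_onI) (metis zero_neq_one)
 show fin: "finite D" and "card D = card X"
  using assms(1) inj by (auto simp: D_def card_image)
 have ev: "(\<Sum>x\<in>X. fscale (c x) (?d x)) y = (if y \<in> X then c y else 0)" for c y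
 proof -
  have "(\<Sum>x\<in>X. fscale (c x) (?d x)) y = (\<Sum>x\<in>X. if x = y then c x else 0)"
   by (simp add: sum_apply) (intro sum.cong, auto)
  then show ?thesis using assms(1) by simp
 qed
 show "fs.independent D"
 proof (rule fs.independent_if_scalars_zero[OF fin])
  fix g v assume "(\<Sum>x\<in>D. fscale (g x) x) = 0" "v \<in> D"
  then obtain x where x: "x \<in> X" "v = ?d x" by (auto simp: D_def)
  have "(\<Sum>x\<in>X. fscale (g (?d x)) (?d x)) = 0"
   using \<open>(\<Sum>x\<in>D. fscale (g x) x) = 0\<close> unfolding D_def sum.reindex[OF inj] o_def .
  from fun_cong[OF this, of x] show "g v = 0" using x by (simp only: ev) simp
 qed
 have "D \<subseteq> supp_on X" by (auto simp: D_def supp_on_def)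
 then have "fs.span D \<subseteq> supp_on X" by (rule fs.span_minimal) simp
 moreover have "f \<in> fs.span D" if "f \<in> supp_on X" for f
 proof -
  have "f = (\<Sum>x\<in>X. fscale (f x) (?d x))"
   using that by (intro ext) (auto simp: ev supp_on_def)
  also have "\<dots> \<in> fs.span D" by (intro fs.span_sum fs.span_scale fs.span_base) (auto simp: D_def)
  finally show ?thesis .
 qed
 ultimately show "supp_on X = fs.span D" by blast
qed

lemma findim_supp_on [simp]: "finite X ==> findim (supp_on X)"
 unfolding findim_def using supp_on_basis(2,4)[of X] by (metis order_refl)

lemma dim_supp_on [simp]: "finite X ==> fs.dim (supp_on X :: ('b => 'a::field) set) = card X"
 using supp_on_basis[of X, where 'a='a] fs.dim_eq_card_independent fs.dim_span by metis

section \<open>Contraction and multiplication in an exterior algebra\<close>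

definition sg :: "'c::linorder => 'c set => 'a::field_char_0" where
 "sg x J = (if finite J then (-1) ^ card {y\<in>J. y < x} else 0)"

text \<open>A function f on sets stands for the element sum_J f(J) e_J of the exterior algebra on
  linearly ordered generators. \<open>an x\<close> is contraction with the dual of e_x and
  \<open>cr x\<close> is left multiplication by e_x; \<open>sg\<close> counts the generators that
  e_x has to pass.\<close>

definition an :: "'c::linorder => ('c set => 'a::field_char_0) => 'c set => 'a" where
 "an x f J = (if x \<in> J then 0 else sg x J * f (insert x J))"

definition cr :: "'c::linorder => ('c set => 'a::field_char_0) => 'c set => 'a" where
 "cr x f J = (if x \<in> J then sg x (J - {x}) * f (J - {x}) else 0)"

lemma sg_insert: "x \<notin> J ==> sg y (insert x J) = (if x < y then - sg y J else sg y J :: 'a::field_char_0)"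
proof -
 assume x: "x \<notin> J"
 show ?thesis
 proof (cases "finite J")
  case True
  have "{z. (z = x \<or> z \<in> J) \<and> z < y} = (if x < y then insert x {z\<in>J. z < y} else {z\<in>J. z < y})"
   by auto
  then show ?thesis using True x by (auto simp: sg_def)
 qed (simp add: sg_def)
qed

lemma sg_sq: "finite J ==> sg x J * (sg x J :: 'a::field_char_0) = 1"
 by (simp add: sg_def flip: power_mult_distrib)

lemma sg_sq': "finite J ==> sg x J * (sg x J * (c :: 'a::field_char_0)) = c"
 by (simp add: sg_sq flip: mult.assoc)

lemma an_an: "an x (an y f) = - an y (an x (f :: 'c::linorder set => 'a::field_char_0))"
proof (cases "x = y")
 case True
 then show ?thesis by (auto simp: an_def fun_eq_iff)
next
 case False
 then show ?thesis by (auto simp: an_def fun_eq_iff sg_insert insert_commute not_less)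
qed

lemma cr_cr: "cr x (cr y f) = - cr y (cr x (f :: 'c::linorder set => 'a::field_char_0))"
proof (cases "x = y")
 case True
 then show ?thesis by (auto simp: cr_def fun_eq_iff)
next
 case False
 show ?thesis
 proof
  fix J
  have 1: "sg x (J - {x}) = (if y < x then - sg x (J - {x} - {y}) else sg x (J - {x} - {y}) :: 'a)"
   if "x \<in> J" "y \<in> J"
  proof -
   have "J - {x} = insert y (J - {x} - {y})" using that False by auto
   then show ?thesis using sg_insert[of y "J - {x} - {y}" x] by simp
  qed
  have 2: "sg y (J - {y}) = (if x < y then - sg y (J - {y} - {x}) else sg y (J - {y} - {x}) :: 'a)"
   if "x \<in> J" "y \<in> J"
  proof -
   have "J - {y} = insert x (J - {y} - {x})" using that False by auto
   then show ?thesis using sg_insert[of x "J - {y} - {x}" y] by simp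
  qed
  moreover have "J - {y} - {x} = J - {x} - {y}" by auto
  ultimately show "cr x (cr y f) J = (- cr y (cr x f)) J" using False 1 2
   by (cases "x \<in> J"; cases "y \<in> J"; cases "x < y") (simp_all add: cr_def)
 qed
qed

lemma an_cr: "x \<noteq> y ==> an x (cr y f) = - cr y (an x (f :: 'c::linorder set => 'a::field_char_0))"
proof
 fix J assume xy: "x \<noteq> y"
 show "an x (cr y f) J = (- cr y (an x f)) J"
 proof (cases "y \<in> J")
  case True
  then obtain K where K: "J = insert y K" "y \<notin> K" by (metis mk_disjoint_insert)
  have e: "insert x (insert y K) - {y} = insert x K" "insert y K - {y} = K" using K(2) xy by auto
  show ?thesis
  proof (cases "x \<in> K")
   case True
   then show ?thesis using K xy by (simp add: an_def cr_def e)
  next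
   case False
   have "an x (cr y f) J = sg x (insert y K) * (sg y (insert x K) * f (insert x K))"
    using K False xy by (simp add: an_def cr_def e)
   moreover have "cr y (an x f) J = sg y K * (sg x K * f (insert x K))"
    using K False xy by (simp add: an_def cr_def e)
   ultimately show ?thesis using sg_insert[OF K(2), of x, where 'a='a] sg_insert[OF False, of y, where 'a='a] xy
    by (cases "x < y") auto
  qed
 qed (use xy in \<open>simp add: an_def cr_def\<close>)
qed

text \<open>With \<open>an_an\<close>, \<open>cr_cr\<close> and \<open>an_cr\<close> this completes
  the canonical anticommutation relations. At an infinite set \<open>sg\<close> is 0 and the left
  side vanishes, hence the finiteness condition.\<close>

lemma an_cr_same: "finite J ==> an x (cr x f) J + cr x (an x f) J = (f J :: 'a::field_char_0)"
 by (auto simp: an_def cr_def sg_sq' insert_absorb)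

lemma lin_an: "lin (an x)" and lin_cr: "lin (cr x)"
 by (auto intro!: linI simp: an_def cr_def fun_eq_iff algebra_simps)

text \<open>Contraction with the functional that is 1 on every generator of C, that is, the
  simplicial boundary operator on chains.\<close>

definition bd :: "'c::linorder set => ('c set => 'a::field_char_0) => 'c set => 'a" where
 "bd C f = (\<Sum>x\<in>C. an x f)"

lemma lin_sum: "(\<And>x. x \<in> X ==> lin (F x)) ==> lin (\<lambda>f. \<Sum>x\<in>X. F x f)"
proof (rule linI)
 assume l: "\<And>x. x \<in> X ==> lin (F x)"
 fix f g c
 have "(\<Sum>x\<in>X. F x (f + g)) = (\<Sum>x\<in>X. F x f + F x g)"
  by (intro sum.cong refl lin_simps(1) l)
 then show "(\<Sum>x\<in>X. F x (f + g)) = (\<Sum>x\<in>X. F x f) + (\<Sum>x\<in>X. F x g)"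
  by (simp only: sum.distrib)
 have "(\<Sum>x\<in>X. F x (fscale c f)) = (\<Sum>x\<in>X. fscale c (F x f))"
  by (intro sum.cong refl lin_simps(2) l)
 then show "(\<Sum>x\<in>X. F x (fscale c f)) = fscale c (\<Sum>x\<in>X. F x f)"
  by (simp only: fs.scale_sum_right)
qed

lemma lin_bd: "lin (bd C)"
 unfolding bd_def by (rule lin_sum) (rule lin_an)

lemma bd_apply: "bd C f J = (\<Sum>x\<in>C - J. sg x J * f (insert x J))" if "finite C"
 unfolding bd_def sum_apply by (rule sum.mono_neutral_cong_right) (use that in \<open>auto simp: an_def\<close>)

lemma bd_cong:
 assumes "finite C" "\<And>x. x \<in> C - J ==> f (insert x J) = g (insert x J)"
 shows "bd C f J = bd C g J"
 using assms by (simp add: bd_apply)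

lemma bd_eq_0: "finite C ==> (\<And>x. x \<in> C - J ==> f (insert x J) = 0) ==> bd C f J = 0"
 by (simp add: bd_apply)

lemma neg_self_eq: "f = - f ==> f = (0 :: 'b => 'a::field_char_0)"
proof -
 assume "f = - f"
 then have "f x = 0" for x using fun_cong[of f "- f" x] by simp
 then show "f = 0" by auto
qed

lemma bd_bd: "bd C (bd C f) = (0 :: 'c::linorder set => 'a::field_char_0)"
proof (rule neg_self_eq)
 have "bd C (bd C f) = (\<Sum>x\<in>C. \<Sum>y\<in>C. an x (an y f))"
  by (simp add: bd_def fsp.linear_sum[OF lin_an])
 also have "\<dots> = (\<Sum>y\<in>C. \<Sum>x\<in>C. an x (an y f))" by (rule sum.swap)
 also have "\<dots> = (\<Sum>y\<in>C. \<Sum>x\<in>C. - an y (an x f))" by (intro sum.cong refl an_an)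
 also have "\<dots> = - bd C (bd C f)"
  by (simp add: bd_def fsp.linear_sum[OF lin_an] sum_negf)
 finally show "bd C (bd C f) = - bd C (bd C f)" .
qed

definition res :: "'b set => ('b => 'a::field) => 'b => 'a" where
 "res X f x = (if x \<in> X then f x else 0)"

lemma lin_res: "lin (res X)"
 by (auto intro!: linI simp: res_def fun_eq_iff)

section \<open>Homology of interval-closed families of finite sets\<close>

definition gr :: "'c set set => nat => 'c set set" where
 "gr F g = {I\<in>F. card I = g}"

definition cyc :: "'c::linorder set => 'c set set => nat => ('c set => 'a::field_char_0) set" where
 "cyc C F g = {f\<in>supp_on (gr F g). res F (bd C f) = 0}"

definition bnd :: "'c::linorder set => 'c set set => nat => ('c set => 'a::field_char_0) set" where
 "bnd C F g = (\<lambda>u. res F (bd C u)) ` supp_on (gr F (Suc g))"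

text \<open>Sets of size g sit in degree g, so for a simplicial complex this is reduced homology in
  dimension g - 1. Boundaries are cycles for every \<open>family\<close>, so the subtraction is
  exact there (\<open>dim_cyc\<close>). The type argument fixes the field.\<close>

definition hh :: "'a::field_char_0 itself => 'c::linorder set => 'c set set => nat => nat" where
 "hh t C F g = fs.dim (cyc C F g :: ('c set => 'a) set) - fs.dim (bnd C F g :: ('c set => 'a) set)"

text \<open>An interval-closed family is a difference of two simplicial complexes, and its homology
  is relative homology. Interval-closedness is what makes the restricted boundary square to
  zero.\<close>

definition family :: "'c set => 'c set set => bool" where
 "family C F \<longleftrightarrow> finite C \<and> F \<subseteq> Pow C \<and> (\<forall>I\<in>F. \<forall>J\<in>F. \<forall>K. J \<subseteq> K \<and> K \<subseteq> I --> K \<in> F)"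

lemma familyD:
 assumes "family C F"
 shows "finite C" "I \<in> F ==> I \<subseteq> C" "I \<in> F ==> finite I" "finite F"
  "I \<in> F ==> J \<in> F ==> J \<subseteq> K ==> K \<subseteq> I ==> K \<in> F" "finite (gr F g)"
proof -
 show C: "finite C" and "I \<in> F ==> I \<subseteq> C" using assms by (auto simp: family_def)
 then show "I \<in> F ==> finite I" by (auto intro: finite_subset)
 show "finite F" using assms C by (auto simp: family_def intro: finite_subset)
 then show "finite (gr F g)" by (simp add: gr_def)
 have "\<forall>I\<in>F. \<forall>J\<in>F. \<forall>K. J \<subseteq> K \<and> K \<subseteq> I --> K \<in> F" using assms unfolding family_def by (elim conjE)
 from this[rule_format, of I J K]
 show "I \<in> F ==> J \<in> F ==> J \<subseteq> K ==> K \<subseteq> I ==> K \<in> F" by simp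
qed

lemma lin_rbd: "lin (\<lambda>u. res F (bd C u))"
 by (rule lin_comp[OF lin_bd lin_res])

lemma subspace_cyc: "fs.subspace (cyc C F g)"
 unfolding cyc_def fs.subspace_def supp_on_def by (auto simp: lin_simps[OF lin_rbd])

lemma subspace_bnd: "fs.subspace (bnd C F g)"
 unfolding bnd_def by (rule fsp.linear_subspace_image[OF lin_rbd]) simp

text \<open>Restriction to F discards bd u only at sets K outside F. If K covers J in F, then bd u
  is 0 at K anyway: a set of F above K would, together with J, force K into F.\<close>

lemma bd_res:
 assumes "family C F" "u \<in> supp_on F" "J \<in> F"
 shows "bd C (res F (bd C u)) J = (0 :: 'a::field_char_0)"
proof -
 have "bd C (res F (bd C u)) J = bd C (bd C u) J"
 proof (rule bd_cong[OF familyD(1)[OF assms(1)]])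
  fix x assume x: "x \<in> C - J"
  show "res F (bd C u) (insert x J) = bd C u (insert x J)"
  proof (cases "insert x J \<in> F")
   case False
   have "bd C u (insert x J) = 0"
   proof (rule bd_eq_0[OF familyD(1)[OF assms(1)]])
    fix y show "u (insert y (insert x J)) = 0"
     using assms(2) False familyD(5)[OF assms(1) _ assms(3), of "insert y (insert x J)" "insert x J"]
     by (auto simp: supp_on_def)
   qed
   then show ?thesis by (simp add: res_def)
  qed (simp add: res_def)
 qed
 then show ?thesis by (simp add: bd_bd)
qed

lemma supp_gr: "u \<in> supp_on (gr F g) ==> u \<in> supp_on F"
 by (auto simp: supp_on_def gr_def)

lemma res_bd_supp:
 assumes "family C F" "u \<in> supp_on (gr F (Suc g))" "Y \<subseteq> F"
 shows "res Y (bd C u) \<in> supp_on (gr Y g)"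
proof -
 have "res Y (bd C u) J = 0" if "J \<notin> gr Y g" for J
 proof (cases "J \<in> Y")
  case True
  then have J: "card J \<noteq> g" "finite J" using that familyD(3)[OF assms(1)] assms(3) by (auto simp: gr_def)
  have "bd C u J = 0"
   by (rule bd_eq_0[OF familyD(1)[OF assms(1)]])
    (use J assms(2) in \<open>auto simp: supp_on_def gr_def\<close>)
  then show ?thesis by (simp add: res_def)
 qed (simp add: res_def)
 then show ?thesis by (simp add: supp_on_def)
qed

lemma bnd_cyc: "family C F ==> bnd C F g \<subseteq> cyc C F g"
 unfolding bnd_def cyc_def
 using res_bd_supp[of C F _ g F] bd_res[of C F] supp_gr by (fastforce simp: res_def[of F "bd C (res F _)"] fun_eq_iff)

lemma findim_cyc: "family C F ==> findim (cyc C F g)"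
 by (rule findim_mono[OF findim_supp_on[OF familyD(6)]]) (auto simp: cyc_def)

lemma dim_cyc:
 assumes "family C F"
 shows "fs.dim (cyc C F g :: ('c::linorder set => 'a::field_char_0) set)
  = hh TYPE('a) C F g + fs.dim (bnd C F g :: ('c set => 'a) set)"
proof -
 have "fs.dim (bnd C F g :: ('c set => 'a) set) \<le> fs.dim (cyc C F g :: ('c set => 'a) set)"
  by (rule dim_mono[OF findim_cyc[OF assms] bnd_cyc[OF assms]])
 then show ?thesis by (simp add: hh_def)
qed

lemma hh_exact:
 fixes f :: "('c::linorder set => 'a::field_char_0) => 'd::linorder set => 'a" and q :: "('e::linorder set => 'a) => 'c set => 'a"
 assumes F: "family C F" "family C' F'" "family C'' F''" and l: "lin f" "lin q"
  and 1: "\<And>z. z \<in> cyc C F g ==> f z \<in> cyc C' F' g'"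
  and 2: "\<And>z. z \<in> cyc C F g ==> f z \<in> bnd C' F' g' ==> \<exists>y\<in>cyc C'' F'' g''. z - q y \<in> bnd C F g"
  and 3: "\<And>y. y \<in> bnd C'' F'' g'' ==> q y \<in> bnd C F g"
 shows "hh TYPE('a) C F g \<le> hh TYPE('a) C' F' g' + hh TYPE('a) C'' F'' g''"
proof -
 have "fs.dim (cyc C F g :: ('c set => 'a) set) + fs.dim (bnd C' F' g' :: ('d set => 'a) set) + fs.dim (bnd C'' F'' g'' :: ('e set => 'a) set)
  \<le> fs.dim (bnd C F g :: ('c set => 'a) set) + fs.dim (cyc C' F' g' :: ('d set => 'a) set) + fs.dim (cyc C'' F'' g'' :: ('e set => 'a) set)"
  by (rule dim_exact[OF l subspace_cyc findim_cyc[OF F(1)] subspace_bnd bnd_cyc[OF F(1)]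
     subspace_cyc findim_cyc[OF F(2)] subspace_bnd bnd_cyc[OF F(2)]
     subspace_cyc findim_cyc[OF F(3)] bnd_cyc[OF F(3)]]) (use 1 2 3 in auto)
 then show ?thesis by (simp add: dim_cyc F)
qed

text \<open>Down-closed relative to F: chains on Y form a subcomplex of the chains on F, and chains
  on F - Y form the quotient complex.\<close>

definition closed_in :: "'c set set => 'c set set => bool" where
 "closed_in F Y \<longleftrightarrow> Y \<subseteq> F \<and> (\<forall>I\<in>Y. \<forall>J\<in>F. J \<subseteq> I --> J \<in> Y)"

lemma familyI:
 assumes "finite C" "\<And>I. I \<in> F ==> I \<subseteq> C"
  "\<And>I J K. I \<in> F ==> J \<in> F ==> J \<subseteq> K ==> K \<subseteq> I ==> K \<in> F"
 shows "family C F"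
 unfolding family_def
proof (intro conjI ballI allI impI)
 show "F \<subseteq> Pow C" using assms(2) by blast
 fix I J K assume "I \<in> F" "J \<in> F" "J \<subseteq> K \<and> K \<subseteq> I"
 then show "K \<in> F" using assms(3)[of I J K] by (elim conjE)
qed (rule assms(1))

lemma closed_inD: "closed_in F Y ==> I \<in> Y ==> J \<in> F ==> J \<subseteq> I ==> J \<in> Y"
 "closed_in F Y ==> I \<in> Y ==> I \<in> F"
 by (auto simp: closed_in_def)

lemma family_closed:
 assumes F: "family C F" and Y: "closed_in F Y"
 shows "family C Y \<and> family C (F - Y)"
proof
 note D = familyD[OF F] and E = closed_inD[OF Y]
 show "family C Y"
 proof (rule familyI[OF D(1)])
  fix I J K assume a: "I \<in> Y" "J \<in> Y" "J \<subseteq> K" "K \<subseteq> I"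
  then have "K \<in> F" using D(5)[of I J K] E(2) by simp
  then show "K \<in> Y" using E(1)[of I K] a by simp
 qed (use D(2) E(2) in simp)
 show "family C (F - Y)"
 proof (rule familyI[OF D(1)])
  fix I J K assume a: "I \<in> F - Y" "J \<in> F - Y" "J \<subseteq> K" "K \<subseteq> I"
  then have "K \<in> F" using D(5)[of I J K] by simp
  moreover have "K \<notin> Y" using E(1)[of K J] a by auto
  ultimately show "K \<in> F - Y" by simp
 qed (use D(2) in simp)
qed

lemma closed_bd:
 assumes "finite C" "closed_in F Y" "J \<in> F - Y" "u \<in> supp_on Y"
 shows "bd C u J = 0"
proof (rule bd_eq_0[OF assms(1)])
 fix x
 have "insert x J \<notin> Y" using assms(2,3) by (auto simp: closed_in_def)
 then show "u (insert x J) = 0" using assms(4) by (simp add: supp_on_def)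
qed

lemma bd_split:
 assumes "finite C" "closed_in F Y" "u \<in> supp_on F"
 shows "bd C u J = bd C (res Y u) J + bd C (res (F - Y) u) J"
proof -
 have "u = res Y u + res (F - Y) u"
  using assms(2,3) by (auto simp: res_def supp_on_def fun_eq_iff closed_in_def)
 then have "bd C u = bd C (res Y u) + bd C (res (F - Y) u)" by (metis lin_simps(1)[OF lin_bd])
 then show ?thesis by simp
qed

lemma res_mem: "u \<in> supp_on (gr F g) ==> Y \<subseteq> F ==> res Y u \<in> supp_on (gr Y g)"
 by (auto simp: res_def supp_on_def gr_def)

lemma supp_mono: "u \<in> supp_on X ==> X \<subseteq> Y ==> u \<in> supp_on Y"
 by (auto simp: supp_on_def)

lemma gr_mono: "Y \<subseteq> F ==> gr Y g \<subseteq> gr F g"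
 by (auto simp: gr_def)

lemma supp_res: "res Y u \<in> supp_on Y"
 by (auto simp: res_def supp_on_def)

lemma bd_quot:
 assumes "finite C" "closed_in F Y" "u \<in> supp_on F" "J \<in> F - Y"
 shows "bd C (res (F - Y) u) J = bd C u J"
 using bd_split[OF assms(1-3), of J] closed_bd[OF assms(1,2,4) supp_res] by simp

lemma cycD:
 assumes "z \<in> cyc C F g"
 shows "z \<in> supp_on (gr F g)" "z \<in> supp_on F" "J \<in> F ==> bd C z J = 0"
proof -
 show "z \<in> supp_on (gr F g)" "z \<in> supp_on F" using assms by (auto simp: cyc_def intro: supp_gr)
 have "res F (bd C z) J = 0" using assms by (simp add: cyc_def)
 then show "J \<in> F ==> bd C z J = 0" by (simp add: res_def)
qed

lemma cycI: "z \<in> supp_on (gr F g) ==> (\<And>J. J \<in> F ==> bd C z J = 0) ==> z \<in> cyc C F g"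
 by (auto simp: cyc_def res_def fun_eq_iff)

lemma bndI: "u \<in> supp_on (gr F (Suc g)) ==> z = res F (bd C u) ==> z \<in> bnd C F g"
 by (auto simp: bnd_def)

lemma bndE:
 assumes "z \<in> bnd C F g"
 obtains u where "u \<in> supp_on (gr F (Suc g))" "z = res F (bd C u)"
 using assms by (auto simp: bnd_def)

text \<open>Position H_g(Y) -> H_g(F) -> H_g(F - Y) of the long exact sequence of the pair;
  \<open>les3\<close> and \<open>les2\<close> are the other two positions, where the connecting map
  is \<open>res Y (bd C _)\<close>.\<close>

lemma les1:
 assumes F: "family C F" and Y: "closed_in F Y"
 shows "hh TYPE('a::field_char_0) C F g \<le> hh TYPE('a) C Y g + hh TYPE('a) C (F - Y) g"
proof -
 note fin = familyD(1)[OF F]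
 have YF: "Y \<subseteq> F" using Y by (simp add: closed_in_def)
 have "hh TYPE('a) C F g \<le> hh TYPE('a) C (F - Y) g + hh TYPE('a) C Y g"
 proof (rule hh_exact[OF F conjunct2[OF family_closed[OF F Y]] conjunct1[OF family_closed[OF F Y]]
    lin_res[of "F - Y"] fs.linear_id[unfolded id_def]])
  fix z :: "'b set => 'a" assume z: "z \<in> cyc C F g"
  show "res (F - Y) z \<in> cyc C (F - Y) g"
   by (rule cycI) (use res_mem[OF cycD(1)[OF z]] bd_quot[OF fin Y cycD(2)[OF z]] cycD(3)[OF z] in auto)
  assume "res (F - Y) z \<in> bnd C (F - Y) g"
  then obtain u where u: "u \<in> supp_on (gr (F - Y) (Suc g))" "res (F - Y) z = res (F - Y) (bd C u)"
   by (rule bndE)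
  have uF: "u \<in> supp_on (gr F (Suc g))" by (rule supp_mono[OF u(1) gr_mono]) auto
  let ?b = "res F (bd C u)"
  have b: "?b \<in> bnd C F g" "?b \<in> cyc C F g"
   using bndI[OF uF refl] bnd_cyc[OF F] by auto
  have d: "z - ?b \<in> cyc C F g" by (rule fs.subspace_diff[OF subspace_cyc z b(2)])
  have "z - ?b \<in> supp_on (gr Y g)"
  proof -
   have "z J = ?b J" if "J \<in> F - Y" for J
    using fun_cong[OF u(2), of J] that by (simp add: res_def)
   then show ?thesis using cycD(1)[OF d] by (auto simp: supp_on_def gr_def)
  qed
  then have "z - ?b \<in> cyc C Y g"
   by (rule cycI) (use cycD(3)[OF d] YF in auto)
  then show "\<exists>y\<in>cyc C Y g. z - y \<in> bnd C F g" using b(1) by (intro bexI[of _ "z - ?b"]) auto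
 next
  fix y :: "'b set => 'a" assume "y \<in> bnd C Y g"
  then obtain u where u: "u \<in> supp_on (gr Y (Suc g))" "y = res Y (bd C u)" by (rule bndE)
  have "y = res F (bd C u)"
   using closed_bd[OF fin Y _ supp_gr[OF u(1)]] YF by (auto simp: u(2) res_def fun_eq_iff)
  then show "y \<in> bnd C F g" by (rule bndI[OF supp_mono[OF u(1) gr_mono[OF YF]]])
 qed
 then show ?thesis by simp
qed

lemma les3:
 assumes F: "family C F" and Y: "closed_in F Y"
 shows "hh TYPE('a::field_char_0) C Y g \<le> hh TYPE('a) C F g + hh TYPE('a) C (F - Y) (Suc g)"
proof -
 note fin = familyD(1)[OF F]
 have YF: "Y \<subseteq> F" using Y by (simp add: closed_in_def)
 note fY = conjunct1[OF family_closed[OF F Y]] and fQ = conjunct2[OF family_closed[OF F Y]]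
 show ?thesis
 proof (rule hh_exact[OF fY F fQ fs.linear_id[unfolded id_def] lin_rbd[of Y C]])
  fix z :: "'b set => 'a" assume z: "z \<in> cyc C Y g"
  show "z \<in> cyc C F g"
  proof (rule cycI)
   show "z \<in> supp_on (gr F g)" by (rule supp_mono[OF cycD(1)[OF z] gr_mono[OF YF]])
   show "bd C z J = 0" if "J \<in> F" for J
    using cycD(3)[OF z, of J] closed_bd[OF fin Y _ cycD(2)[OF z], of J] that by auto
  qed
  assume "z \<in> bnd C F g"
  then obtain u where u: "u \<in> supp_on (gr F (Suc g))" "z = res F (bd C u)" by (rule bndE)
  let ?q = "res (F - Y) u"
  have zQ: "z J = 0" if "J \<in> F - Y" for J using cycD(2)[OF z] that by (auto simp: supp_on_def)
  have "?q \<in> cyc C (F - Y) (Suc g)"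
  proof (rule cycI)
   show "?q \<in> supp_on (gr (F - Y) (Suc g))" by (rule res_mem[OF u(1)]) auto
   show "bd C ?q J = 0" if "J \<in> F - Y" for J
    using bd_quot[OF fin Y supp_gr[OF u(1)] that] zQ[OF that] that by (auto simp: u(2) res_def)
  qed
  moreover have "z - res Y (bd C ?q) = res Y (bd C (res Y u))"
  proof
   fix J
   show "(z - res Y (bd C ?q)) J = res Y (bd C (res Y u)) J"
    using bd_split[OF fin Y supp_gr[OF u(1)], of J] zQ[of J] YF
    by (cases "J \<in> Y"; cases "J \<in> F") (auto simp: u(2) res_def)
  qed
  then have "z - res Y (bd C ?q) \<in> bnd C Y g" by (rule bndI[OF res_mem[OF u(1) YF]])
  ultimately show "\<exists>y\<in>cyc C (F - Y) (Suc g). z - res Y (bd C y) \<in> bnd C Y g" by blast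
 next
  fix q :: "'b set => 'a" assume "q \<in> bnd C (F - Y) (Suc g)"
  then obtain u where u: "u \<in> supp_on (gr (F - Y) (Suc (Suc g)))" "q = res (F - Y) (bd C u)" by (rule bndE)
  have uF: "u \<in> supp_on (gr F (Suc (Suc g)))" by (rule supp_mono[OF u(1) gr_mono]) auto
  \<comment> \<open>Since bd bd u = 0, the part of bd u on F - Y and the part on Y have opposite
    boundaries, so the connecting map sends a boundary of the quotient to the boundary of this chain
    on Y.\<close>
  let ?v = "- res Y (bd C u)"
  have "res Y (bd C u) \<in> supp_on (gr Y (Suc g))" by (rule res_bd_supp[OF F uF YF])
  then have "?v \<in> supp_on (gr Y (Suc g))" by (auto simp: supp_on_def)
  moreover have "q = res F (bd C u) + ?v" using YF by (auto simp: u(2) res_def fun_eq_iff)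
  then have "bd C q = bd C (res F (bd C u)) + bd C ?v" by (metis lin_simps(1)[OF lin_bd])
  then have "res Y (bd C q) = res Y (bd C ?v)"
   using bd_res[OF F supp_gr[OF uF]] YF by (auto simp: res_def fun_eq_iff)
  ultimately show "res Y (bd C q) \<in> bnd C Y g" by (rule bndI)
 qed
qed

lemma les2:
 assumes F: "family C F" and Y: "closed_in F Y"
 shows "hh TYPE('a::field_char_0) C (F - Y) g \<le> hh TYPE('a) C F g + hh TYPE('a) C Y (g - 1)"
proof (cases g)
 \<comment> \<open>Here g - 1 is truncated to 0 and there is no connecting map. Either the empty set
   lies in F - Y, which makes Y empty, or F - Y has nothing in degree 0.\<close>
 case 0
 show ?thesis
 proof (cases "{} \<in> F - Y")
  case True
  then have "Y = {}" using Y by (auto simp: closed_in_def)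
  then show ?thesis by simp
 next
  case False
  then have "gr (F - Y) 0 = {}" using familyD(3)[OF F] by (auto simp: gr_def)
  then have "cyc C (F - Y) 0 \<subseteq> {0 :: _ => 'a}" by (auto simp: cyc_def supp_on_def fun_eq_iff)
  then have "fs.dim (cyc C (F - Y) 0 :: ('b set => 'a) set) \<le> fs.dim {0 :: 'b set => 'a}"
   by (intro dim_mono) (auto simp: findim_def intro!: exI[of _ "{}"])
  moreover have "fs.dim {0 :: 'b set => 'a} = 0" by (rule fs.dim_unique[of "{}"]) (auto simp: fs.independent_empty)
  ultimately show ?thesis using 0 by (simp add: hh_def)
 qed
next
 case (Suc k)
 note fin = familyD(1)[OF F]
 have YF: "Y \<subseteq> F" using Y by (simp add: closed_in_def)
 note fY = conjunct1[OF family_closed[OF F Y]] and fQ = conjunct2[OF family_closed[OF F Y]]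
 have "hh TYPE('a) C (F - Y) (Suc k) \<le> hh TYPE('a) C Y k + hh TYPE('a) C F (Suc k)"
 proof (rule hh_exact[OF fQ fY F lin_rbd[of Y C] lin_res[of "F - Y"]])
  fix q :: "'b set => 'a" assume q: "q \<in> cyc C (F - Y) (Suc k)"
  have qF: "q \<in> supp_on (gr F (Suc k))" by (rule supp_mono[OF cycD(1)[OF q] gr_mono]) auto
  have e: "res Y (bd C q) = res F (bd C q)"
   using cycD(3)[OF q] YF by (auto simp: res_def fun_eq_iff)
  show "res Y (bd C q) \<in> cyc C Y k"
   by (rule cycI) (use res_bd_supp[OF F qF YF] bd_res[OF F supp_gr[OF qF]] YF in \<open>auto simp: e\<close>)
  assume "res Y (bd C q) \<in> bnd C Y k"
  then obtain y where y: "y \<in> supp_on (gr Y (Suc k))" "res Y (bd C q) = res Y (bd C y)" by (rule bndE)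
  have "q - y \<in> cyc C F (Suc k)"
  proof (rule cycI)
   show "q - y \<in> supp_on (gr F (Suc k))"
    by (rule fs.subspace_diff[OF subspace_supp_on qF supp_mono[OF y(1) gr_mono[OF YF]]])
   show "bd C (q - y) J = 0" if "J \<in> F" for J
    using fun_cong[OF y(2), of J] cycD(3)[OF q, of J] closed_bd[OF fin Y _ supp_gr[OF y(1)], of J] that
    by (cases "J \<in> Y") (auto simp: lin_simps[OF lin_bd] res_def)
  qed
  moreover have "q - res (F - Y) (q - y) = 0"
   using cycD(2)[OF q] supp_gr[OF y(1)] by (auto simp: supp_on_def res_def fun_eq_iff)
  ultimately show "\<exists>y\<in>cyc C F (Suc k). q - res (F - Y) y \<in> bnd C (F - Y) (Suc k)"
   using fs.subspace_0[OF subspace_bnd] by metis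
 next
  fix y :: "'b set => 'a" assume "y \<in> bnd C F (Suc k)"
  then obtain u where u: "u \<in> supp_on (gr F (Suc (Suc k)))" "y = res F (bd C u)" by (rule bndE)
  have "res (F - Y) y = res (F - Y) (bd C (res (F - Y) u))"
   using bd_quot[OF fin Y supp_gr[OF u(1)]] by (auto simp: u(2) res_def fun_eq_iff)
  then show "res (F - Y) y \<in> bnd C (F - Y) (Suc k)" by (rule bndI[OF res_mem[OF u(1)], rotated]) auto
 qed
 then show ?thesis using Suc by simp
qed

lemma dim_eq_0D:
 assumes "findim V" "fs.dim V = 0" "v \<in> V"
 shows "v = 0"
proof (rule ccontr)
 assume "v \<noteq> 0"
 then have "fs.dim {v} = 1"
  by (intro fs.dim_unique[of "{v}"]) (auto intro: fs.span_base simp: fs.dependent_single)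
 moreover have "fs.dim {v} \<le> fs.dim V" using assms by (intro dim_mono) auto
 ultimately show False using assms(2) by simp
qed

lemma hh_zeroD:
 fixes z :: "'c::linorder set => 'a::field_char_0"
 assumes F: "family C F" and h: "hh TYPE('a) C F g = 0" and z: "z \<in> cyc C F g"
 shows "z \<in> bnd C F g"
proof -
 obtain \<pi> :: "('c set => 'a) => 'c set => 'a"
  where p: "lin \<pi>" "\<And>x. \<pi> x = 0 \<longleftrightarrow> x \<in> bnd C F g"
  by (rule exists_projection[OF subspace_bnd[of C F g]]) (rule that)
 have "fs.dim (cyc C F g :: ('c set => 'a) set)
   = fs.dim {z\<in>cyc C F g. \<pi> z = 0} + fs.dim (\<pi> ` cyc C F g)"
  by (rule rank_nullity[OF p(1) subspace_cyc findim_cyc[OF F]])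
 moreover have "{z\<in>cyc C F g. \<pi> z = 0} = bnd C F g" using p(2) bnd_cyc[OF F] by blast
 ultimately have "fs.dim (\<pi> ` cyc C F g) = 0" using h dim_cyc[OF F, of g, where 'a='a] by simp
 then have "\<pi> z = 0" using dim_eq_0D[OF findim_image[OF p(1) findim_cyc[OF F]]] z by blast
 then show ?thesis using p(2) by simp
qed

lemma hh_zeroI:
 assumes "family C F" "\<And>z :: 'c::linorder set => 'a::field_char_0. z \<in> cyc C F g ==> z \<in> bnd C F g"
 shows "hh TYPE('a) C F g = 0"
proof -
 have "cyc C F g = (bnd C F g :: ('c set => 'a) set)" using assms(2) bnd_cyc[OF assms(1)] by blast
 then show ?thesis by (simp add: hh_def)
qed

lemma hh_le_card:
 fixes C :: "'c::linorder set"
 assumes "family C F"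
 shows "hh TYPE('a::field_char_0) C F g \<le> card (gr F g)"
proof -
 have "fs.dim (cyc C F g :: ('c set => 'a) set) \<le> fs.dim (supp_on (gr F g) :: ('c set => 'a) set)"
  using familyD(6)[OF assms] by (intro dim_mono) (auto simp: cyc_def)
 then show ?thesis using familyD(6)[OF assms] by (simp add: hh_def)
qed

lemma hh_empty_gr: "family C F ==> gr F g = {} ==> hh TYPE('a::field_char_0) C F g = 0"
 using hh_le_card[of C F g, where 'a='a] by simp

text \<open>Rank-nullity splits each chain space into cycles and boundaries; the partial alternating
  sums telescope up to the last boundary term, which is 0 above the top degree.\<close>

lemma euler:
 fixes F :: "'c::linorder set set"
 assumes F: "family C F" and G: "\<And>I. I \<in> F ==> card I \<le> G"
 shows "(\<Sum>g\<le>G. (-1) ^ g * int (hh TYPE('a::field_char_0) C F g)) = (\<Sum>g\<le>G. (-1) ^ g * int (card (gr F g)))"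
proof -
 define z where "z g = fs.dim (cyc C F g :: ('c set => 'a) set)" for g
 define b where "b g = fs.dim (bnd C F g :: ('c set => 'a) set)" for g
 have zb: "z g = hh TYPE('a) C F g + b g" for g
  unfolding z_def b_def by (rule dim_cyc[OF F])
 have S: "card (gr F (Suc g)) = z (Suc g) + b g" for g
 proof -
  have "fs.dim (supp_on (gr F (Suc g)) :: ('c set => 'a) set) = z (Suc g) + b g"
   unfolding cyc_def bnd_def z_def b_def
   by (rule rank_nullity[OF lin_rbd subspace_supp_on findim_supp_on[OF familyD(6)[OF F]]])
  then show ?thesis using familyD(6)[OF F, of "Suc g"] by simp
 qed
 have z0: "card (gr F 0) = z 0"
 proof -
  have "bd C f J = 0" if "f \<in> supp_on (gr F 0)" "J \<in> F" for f :: "'c set => 'a" and J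
   by (rule bd_eq_0[OF familyD(1)[OF F]])
    (use that familyD(3)[OF F that(2)] in \<open>auto simp: supp_on_def gr_def\<close>)
  then have "cyc C F 0 = (supp_on (gr F 0) :: ('c set => 'a) set)"
   by (auto intro: cycI dest: cycD(1))
  then show ?thesis using familyD(6)[OF F, of 0] by (simp add: z_def)
 qed
 have "(\<Sum>g\<le>k. (-1) ^ g * int (hh TYPE('a) C F g)) = (\<Sum>g\<le>k. (-1) ^ g * int (card (gr F g))) - (-1) ^ k * int (b k)" for k
 proof (induction k)
  case 0 show ?case using z0 zb[of 0] by simp
 next
  case (Suc k) then show ?case using S[of k] zb[of "Suc k"] by (simp add: algebra_simps)
 qed
 moreover have "gr F (Suc G) = {}" using G by (force simp: gr_def)
 then have "b G = 0" using S[of G] by simp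
 ultimately show ?thesis by simp
qed

lemma family_sub:
 assumes "family C F" "\<And>I J K. I \<in> F ==> P I ==> J \<in> F ==> P J ==> J \<subseteq> K ==> K \<subseteq> I ==> K \<in> F ==> P K"
 shows "family C {I\<in>F. P I}"
proof (rule familyI[OF familyD(1)[OF assms(1)]])
 fix I J K assume a: "I \<in> {I\<in>F. P I}" "J \<in> {I\<in>F. P I}" "J \<subseteq> K" "K \<subseteq> I"
 then have "K \<in> F" using familyD(5)[OF assms(1), of I J K] by simp
 then show "K \<in> {I\<in>F. P I}" using assms(2)[of I J K] a by simp
qed (use familyD(2)[OF assms(1)] in simp)

text \<open>Filtration by a monotone map into a poset: the fibre over a minimal value is closed in F
  and is split off with \<open>les1\<close>.\<close>

lemma hh_union:
 fixes \<rho> :: "'c::linorder set => 'o::order"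
 assumes "family C F" "\<And>I J. I \<in> F ==> J \<in> F ==> J \<subseteq> I ==> \<rho> J \<le> \<rho> I"
 shows "hh TYPE('a::field_char_0) C F g \<le> (\<Sum>r\<in>\<rho> ` F. hh TYPE('a) C {I\<in>F. \<rho> I = r} g)"
 using assms
proof (induction "card (\<rho> ` F)" arbitrary: F)
 case 0
 then have "F = {}" using familyD(4)[OF 0(2)] by simp
 then show ?case using hh_empty_gr[OF 0(2)] by (simp add: gr_def)
next
 case (Suc k)
 note F = Suc.prems(1)
 have fin: "finite (\<rho> ` F)" "\<rho> ` F \<noteq> {}" using Suc.hyps(2) familyD(4)[OF F] by auto
 then obtain m where m: "m \<in> \<rho> ` F" "\<And>b. b \<in> \<rho> ` F ==> b \<le> m ==> b = m"
  using finite_has_minimal by metis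
 let ?Y = "{I\<in>F. \<rho> I = m}"
 have Y: "closed_in F ?Y" using Suc.prems(2) m(2) by (auto simp: closed_in_def)
 have im: "\<rho> ` (F - ?Y) = \<rho> ` F - {m}" by auto
 have "card (\<rho> ` (F - ?Y)) = k" unfolding im using Suc.hyps(2) fin m by simp
 then have "hh TYPE('a) C (F - ?Y) g \<le> (\<Sum>r\<in>\<rho> ` (F - ?Y). hh TYPE('a) C {I\<in>F - ?Y. \<rho> I = r} g)"
  by (intro Suc.hyps(1) conjunct2[OF family_closed[OF F Y]]) (use Suc.prems(2) in auto)
 also have "\<dots> = (\<Sum>r\<in>\<rho> ` F - {m}. hh TYPE('a) C {I\<in>F. \<rho> I = r} g)"
  unfolding im by (intro sum.cong refl arg_cong[where f="\<lambda>F. hh TYPE('a) C F g"]) auto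
 finally have "hh TYPE('a) C F g \<le> hh TYPE('a) C ?Y g + (\<Sum>r\<in>\<rho> ` F - {m}. hh TYPE('a) C {I\<in>F. \<rho> I = r} g)"
  using les1[OF F Y, of g, where 'a='a] by linarith
 also have "\<dots> = (\<Sum>r\<in>\<rho> ` F. hh TYPE('a) C {I\<in>F. \<rho> I = r} g)"
  using sum.remove[OF fin(1) m(1), of "\<lambda>r. hh TYPE('a) C {I\<in>F. \<rho> I = r} g"] by simp
 finally show ?case .
qed

lemma bd_cr:
 fixes f :: "'c::linorder set => 'a::field_char_0"
 assumes "finite C" "x \<in> C" "finite J"
 shows "bd C (cr x f) J = f J - cr x (bd C f) J"
proof -
 have "bd C (cr x f) J = an x (cr x f) J + (\<Sum>y\<in>C - {x}. an y (cr x f) J)"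
  unfolding bd_def sum_apply using assms by (simp add: sum.remove)
 also have "(\<Sum>y\<in>C - {x}. an y (cr x f) J) = (\<Sum>y\<in>C - {x}. - cr x (an y f) J)"
  by (intro sum.cong refl) (simp add: an_cr)
 also have "an x (cr x f) J = f J - cr x (an x f) J" using an_cr_same[OF assms(3), of x f] by (simp add: algebra_simps)
 also have "f J - cr x (an x f) J + (\<Sum>y\<in>C - {x}. - cr x (an y f) J) = f J - (\<Sum>y\<in>C. cr x (an y f) J)"
  using assms by (simp add: sum.remove sum_negf)
 also have "(\<Sum>y\<in>C. cr x (an y f) J) = cr x (bd C f) J"
  unfolding bd_def fsp.linear_sum[OF lin_cr] sum_apply ..
 finally show ?thesis .
qed

text \<open>Multiplication by the apex, \<open>cr x\<close>, is a contracting homotopy by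
  \<open>bd_cr\<close>.\<close>

lemma hh_cone:
 assumes F: "family C F" and x: "x \<in> C" and t: "\<And>I. I \<in> F ==> insert x I \<in> F \<and> I - {x} \<in> F"
 shows "hh TYPE('a::field_char_0) C F g = 0"
proof (rule hh_zeroI[OF F])
 fix z :: "'b set => 'a" assume z: "z \<in> cyc C F g"
 show "z \<in> bnd C F g"
 proof (rule bndI)
  show "cr x z \<in> supp_on (gr F (Suc g))"
  proof -
   have "cr x z I = 0" if "I \<notin> gr F (Suc g)" for I
   proof (rule ccontr)
    assume n: "cr x z I \<noteq> 0"
    then have "x \<in> I" "z (I - {x}) \<noteq> 0" by (auto simp: cr_def split: if_splits)
    then have "I - {x} \<in> gr F g" using cycD(1)[OF z] by (auto simp: supp_on_def)
    then have "I - {x} \<in> F" "card (I - {x}) = g" by (auto simp: gr_def)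
    moreover have "insert x (I - {x}) = I" using \<open>x \<in> I\<close> by auto
    ultimately have "I \<in> F" using t by metis
    moreover have "card I = Suc g"
     using \<open>card (I - {x}) = g\<close> \<open>x \<in> I\<close> familyD(3)[OF F \<open>I \<in> F\<close>] by (metis card_Suc_Diff1)
    ultimately show False using that by (simp add: gr_def)
   qed
   then show ?thesis by (simp add: supp_on_def)
  qed
  show "z = res F (bd C (cr x z))"
  proof
   fix J
   show "z J = res F (bd C (cr x z)) J"
   proof (cases "J \<in> F")
    case True
    have "cr x (bd C z) J = 0" using cycD(3)[OF z, of "J - {x}"] t[OF True] by (simp add: cr_def)
    then show ?thesis using bd_cr[OF familyD(1)[OF F] x familyD(3)[OF F True], of z] True by (simp add: res_def)
   qed (use cycD(2)[OF z] in \<open>simp add: res_def supp_on_def\<close>)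
  qed
 qed
qed

text \<open>Cycles are transported along \<beta> with signs \<sigma>; the shift k serves maps that
  delete k fixed elements. In \<open>hh_exact\<close> the third family is empty, so exactness
  becomes injectivity on homology, which is why an inequality is stated.\<close>

lemma hh_iso:
 fixes F :: "'c::linorder set set" and F' :: "'d::linorder set set" and \<sigma> :: "'c set => 'a::field_char_0"
 assumes F: "family C F" and F': "family C' F'"
  and b: "bij_betw \<beta> F F'" and c: "\<And>I. I \<in> F ==> card I = card (\<beta> I) + k"
  and s: "\<And>I. I \<in> F ==> \<sigma> I * \<sigma> I = 1"
  and comp: "\<And>u J. u \<in> supp_on F' ==> J \<in> F ==>
   bd C (\<lambda>I. if I \<in> F then \<sigma> I * u (\<beta> I) else 0) J = \<sigma> J * bd C' u (\<beta> J)"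
 shows "hh TYPE('a) C F (g + k) \<le> hh TYPE('a) C' F' g"
proof -
 let ?\<gamma> = "inv_into F \<beta>"
 let ?f = "\<lambda>(z :: 'c set => 'a) I. if I \<in> F' then \<sigma> (?\<gamma> I) * z (?\<gamma> I) else 0"
 let ?T = "\<lambda>(u :: 'd set => 'a) I. if I \<in> F then \<sigma> I * u (\<beta> I) else 0"
 have \<beta>: "I \<in> F ==> \<beta> I \<in> F'" "I \<in> F ==> ?\<gamma> (\<beta> I) = I" "J \<in> F' ==> ?\<gamma> J \<in> F \<and> \<beta> (?\<gamma> J) = J" for I J
  using b by (auto simp: bij_betw_def inv_into_into f_inv_into_f)
 have Tf: "?T (?f z) = z" if "z \<in> supp_on F" for z
 proof
  fix I
  have "\<sigma> I * (\<sigma> I * z I) = z I" if "I \<in> F" using s[OF that] by (simp flip: mult.assoc)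
  then show "?T (?f z) I = z I" using that \<beta> by (auto simp: supp_on_def)
 qed
 have e: "family {} ({} :: 'c set set)" by (simp add: family_def)
 have "hh TYPE('a) C F (g + k) \<le> hh TYPE('a) C' F' g + hh TYPE('a) {} ({} :: 'c set set) 0"
 proof (rule hh_exact[OF F F' e])
  show "lin ?f" by (rule linI) (auto simp: fun_eq_iff algebra_simps)
  show "lin (\<lambda>_ :: 'c set => 'a. 0 :: 'c set => 'a)" by (rule linI) auto
  fix z :: "'c set => 'a" assume z: "z \<in> cyc C F (g + k)"
  show "?f z \<in> cyc C' F' g"
  proof (rule cycI)
   show "?f z \<in> supp_on (gr F' g)"
   proof -
    have "?f z I = 0" if "I \<notin> gr F' g" for I
    proof (cases "I \<in> F'")
     case True
     then have "card (?\<gamma> I) \<noteq> g + k" using that c[of "?\<gamma> I"] \<beta>(3) by (auto simp: gr_def)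
     then show ?thesis using cycD(1)[OF z] by (auto simp: supp_on_def gr_def)
    qed simp
    then show ?thesis by (simp add: supp_on_def)
   qed
   fix J assume J: "J \<in> F'"
   have fz: "?f z \<in> supp_on F'" by (simp add: supp_on_def)
   have "\<sigma> (?\<gamma> J) * bd C' (?f z) J = bd C (?T (?f z)) (?\<gamma> J)"
    using comp[OF fz, of "?\<gamma> J"] \<beta>(3)[OF J] by simp
   also have "\<dots> = 0" unfolding Tf[OF cycD(2)[OF z]] using cycD(3)[OF z] \<beta>(3)[OF J] by simp
   finally show "bd C' (?f z) J = 0" using s[of "?\<gamma> J"] \<beta>(3)[OF J] by force
  qed
  assume "?f z \<in> bnd C' F' g"
  then obtain u where u: "u \<in> supp_on (gr F' (Suc g))" "?f z = res F' (bd C' u)" by (rule bndE)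
  have "z \<in> bnd C F (g + k)"
  proof (rule bndI)
   show "?T u \<in> supp_on (gr F (Suc (g + k)))"
   proof -
    have "?T u I = 0" if "I \<notin> gr F (Suc (g + k))" for I
     using u(1) that c[of I] \<beta>(1)[of I] by (auto simp: supp_on_def gr_def)
    then show ?thesis by (simp add: supp_on_def)
   qed
   show "z = res F (bd C (?T u))"
   proof
    fix J
    show "z J = res F (bd C (?T u)) J"
    proof (cases "J \<in> F")
     case True
     have "z J = ?T (?f z) J" by (rule fun_cong[OF Tf[OF cycD(2)[OF z]], of J, symmetric])
     also have "\<dots> = \<sigma> J * ?f z (\<beta> J)" using True by (simp only: if_True)
     also have "?f z (\<beta> J) = bd C' u (\<beta> J)"
      using fun_cong[OF u(2), of "\<beta> J"] \<beta>(1)[OF True] by (simp only: res_def if_True)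
     finally show ?thesis using comp[OF supp_gr[OF u(1)] True] True by (simp add: res_def)
    qed (use cycD(2)[OF z] in \<open>simp add: res_def supp_on_def\<close>)
   qed
  qed
  then show "\<exists>y\<in>cyc {} {} 0. z - 0 \<in> bnd C F (g + k)"
   using fs.subspace_0[OF subspace_cyc[of "{}" "{}" 0]] by auto
 next
  show "0 \<in> bnd C F (g + k)" by (rule fs.subspace_0[OF subspace_bnd])
 qed
 moreover have "hh TYPE('a) {} ({} :: 'c set set) 0 = 0" by (rule hh_empty_gr[OF e]) (simp add: gr_def)
 ultimately show ?thesis by simp
qed

section \<open>Subsets of a grid with bounded rows and columns\<close>

definition rw :: "nat => (nat \<times> nat) set => nat set" where "rw t I = {j. (t, j) \<in> I}"
definition cw :: "nat => (nat \<times> nat) set => nat set" where "cw j I = {t. (t, j) \<in> I}"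

abbreviation cells :: "nat => nat => (nat \<times> nat) set" where "cells s n \<equiv> {..<s} \<times> {..<n}"

text \<open>The chessboard complex is the case in which all bounds are 1.\<close>

definition Dl :: "nat => nat => (nat => nat) => (nat => nat) => (nat \<times> nat) set set" where
 "Dl s n p w = {I. I \<subseteq> cells s n \<and> (\<forall>t<s. card (rw t I) \<le> p t) \<and> (\<forall>j<n. card (cw j I) \<le> w j)}"

definition hD :: "'a::field_char_0 itself => nat => nat => (nat => nat) => (nat => nat) => nat => nat" where
 "hD a s n p w g = hh a (cells s n) (Dl s n p w) g"

lemma rw_mono: "J \<subseteq> I ==> rw t J \<subseteq> rw t I" and cw_mono: "J \<subseteq> I ==> cw t J \<subseteq> cw t I"
 by (auto simp: rw_def cw_def)

lemma fin_rw: "I \<subseteq> cells s n ==> finite (rw t I)" "I \<subseteq> cells s n ==> rw t I \<subseteq> {..<n}"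
 and fin_cw: "I \<subseteq> cells s n ==> finite (cw j I)" "I \<subseteq> cells s n ==> cw j I \<subseteq> {..<s}"
 by (auto simp: rw_def cw_def intro: finite_subset[of _ "{..<n}"] finite_subset[of _ "{..<s}"])

lemma card_rows: "I \<subseteq> cells s n ==> card I = (\<Sum>t<s. card (rw t I))"
proof -
 assume I: "I \<subseteq> cells s n"
 have "I = (SIGMA t:{..<s}. rw t I)" using I by (auto simp: rw_def)
 then have "card I = card (SIGMA t:{..<s}. rw t I)" by simp
 also have "\<dots> = (\<Sum>t<s. card (rw t I))" using fin_rw(1)[OF I] by (intro card_SigmaI) auto
 finally show ?thesis .
qed

lemma card_cols: "I \<subseteq> cells s n ==> card I = (\<Sum>j<n. card (cw j I))"
proof -
 assume I: "I \<subseteq> cells s n"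
 have "I = prod.swap ` (SIGMA j:{..<n}. cw j I)" using I by (force simp: cw_def)
 then have "card I = card (prod.swap ` (SIGMA j:{..<n}. cw j I))" by simp
 also have "\<dots> = card (SIGMA j:{..<n}. cw j I)" by (rule card_image) auto
 also have "\<dots> = (\<Sum>j<n. card (cw j I))" using fin_cw(1)[OF I] by (intro card_SigmaI) auto
 finally show ?thesis .
qed

lemma Dl_subset: "I \<in> Dl s n p w ==> J \<subseteq> I ==> J \<in> Dl s n p w"
proof -
 assume I: "I \<in> Dl s n p w" and J: "J \<subseteq> I"
 then have "I \<subseteq> cells s n" by (simp add: Dl_def)
 then have rc: "card (rw t J) \<le> card (rw t I)" "card (cw j J) \<le> card (cw j I)" for t j
  using J by (auto intro!: card_mono fin_rw(1) fin_cw(1) rw_mono cw_mono)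
 then have "card (rw t J) \<le> p t" if "t < s" for t
  using I that le_trans[of "card (rw t J)" "card (rw t I)" "p t"] by (simp add: Dl_def)
 moreover have "card (cw j J) \<le> w j" if "j < n" for j
  using I that le_trans[OF rc(2)[of j], of "w j"] by (simp add: Dl_def)
 ultimately show ?thesis using I J unfolding Dl_def by blast
qed

lemma family_Dl: "family (cells s n) (Dl s n p w)"
proof (rule familyI)
 show "I \<in> Dl s n p w ==> I \<subseteq> cells s n" for I by (simp add: Dl_def)
 show "I \<in> Dl s n p w ==> J \<in> Dl s n p w ==> J \<subseteq> K ==> K \<subseteq> I ==> K \<in> Dl s n p w" for I J K
  by (rule Dl_subset)
qed simp

lemma DlD: "I \<in> Dl s n p w ==> I \<subseteq> cells s n" "I \<in> Dl s n p w ==> t < s ==> card (rw t I) \<le> p t"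
 "I \<in> Dl s n p w ==> j < n ==> card (cw j I) \<le> w j"
 by (auto simp: Dl_def)

lemma family_rw: "family (cells s n) {I\<in>Dl s n p w. rw t I = R}"
 by (rule family_sub[OF family_Dl]) (use rw_mono in blast)

lemma hD_card: "N < g ==> (\<Sum>j<n. w j) = N ==> hD TYPE('a::field_char_0) s n p w g = 0"
proof -
 assume N: "N < g" "(\<Sum>j<n. w j) = N"
 have "card I \<noteq> g" if "I \<in> Dl s n p w" for I
  using card_cols[OF DlD(1)[OF that]] sum_mono[of "{..<n}" "\<lambda>j. card (cw j I)" w] DlD(3)[OF that] N by auto
 then show ?thesis unfolding hD_def by (intro hh_empty_gr[OF family_Dl]) (auto simp: gr_def)
qed

lemma sg_Un: "finite A ==> finite B ==> A \<inter> B = {} ==> sg x (A \<union> B) = sg x A * (sg x B :: 'a::field_char_0)"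
proof -
 assume a: "finite A" "finite B" "A \<inter> B = {}"
 have "{y\<in>A \<union> B. y < x} = {y\<in>A. y < x} \<union> {y\<in>B. y < x}" by auto
 then have "card {y\<in>A \<union> B. y < x} = card {y\<in>A. y < x} + card {y\<in>B. y < x}"
  using a by (auto intro!: card_Un_disjoint)
 then show ?thesis using a by (simp add: sg_def power_add)
qed

lemma hh_fix_row:
 assumes t: "t < s"
 shows "hh TYPE('a::field_char_0) (cells s n) {I\<in>Dl s n p w. rw t I = R} (g + card R)
  \<le> hD TYPE('a) s n (p(t := 0)) (\<lambda>j. if j \<in> R then w j - 1 else w j) g"
proof (cases "{I\<in>Dl s n p w. rw t I = R} = {}")
 case True
 then have "gr {I\<in>Dl s n p w. rw t I = R} (g + card R) = {}" unfolding gr_def by blast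
 from hh_empty_gr[OF family_rw this, where 'a='a] show ?thesis by (simp only: le0)
next
 case False
 let ?F = "{I\<in>Dl s n p w. rw t I = R}" and ?K = "{t} \<times> R"
  and ?w = "\<lambda>j. if j \<in> R then w j - 1 else w j"
 let ?F' = "Dl s n (p(t := 0)) ?w"
 obtain I0 where I0: "I0 \<in> Dl s n p w" "rw t I0 = R" using False by blast
 have R: "R \<subseteq> {..<n}" "card R \<le> p t" "finite R"
  using fin_rw[OF DlD(1)[OF I0(1)], of t] DlD(2)[OF I0(1) t] I0(2) by auto
 have w: "1 \<le> w j" if "j \<in> R" for j
 proof -
  have "t \<in> cw j I0" using that I0(2) by (auto simp: rw_def cw_def)
  then have "0 < card (cw j I0)" using fin_cw(1)[OF DlD(1)[OF I0(1)]] card_gt_0_iff by blast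
  then show ?thesis using DlD(3)[OF I0(1), of j] that R(1) by fastforce
 qed
 have K: "?K \<subseteq> cells s n" "finite ?K" using R t by auto
 have rK: "rw t' (I - ?K) = (if t' = t then rw t I - R else rw t' I)" for t' I by (auto simp: rw_def)
 have cK: "cw j (I - ?K) = (if j \<in> R then cw j I - {t} else cw j I)" for j I by (auto simp: cw_def)
 have rU: "rw t' (I \<union> ?K) = (if t' = t then rw t I \<union> R else rw t' I)" for t' I by (auto simp: rw_def)
 have cU: "cw j (I \<union> ?K) = (if j \<in> R then insert t (cw j I) else cw j I)" for j I by (auto simp: cw_def)
 have in1: "I - ?K \<in> ?F'" "?K \<subseteq> I" if I: "I \<in> ?F" for I
 proof -
  have sub: "I \<subseteq> cells s n" using I DlD(1) by blast
  show KI: "?K \<subseteq> I" using I by (auto simp: rw_def)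
  have "card (cw j I - {t}) \<le> w j - 1" if "j \<in> R" "j < n" for j
  proof -
   have "t \<in> cw j I" using KI that by (auto simp: cw_def)
   then show ?thesis using DlD(3)[of I s n p w j] I that fin_cw(1)[OF sub, of j] by (auto simp: card_Diff_singleton)
  qed
  then have cl: "card (cw j (I - ?K)) \<le> ?w j" if "j < n" for j
   using DlD(3)[of I s n p w j] I that by (cases "j \<in> R") (simp_all add: cK)
  have rl: "card (rw t' (I - ?K)) \<le> (p(t := 0)) t'" if "t' < s" for t'
  proof (cases "t' = t")
   case True then show ?thesis using I by (simp add: rK)
  next
   case False then show ?thesis using DlD(2)[of I s n p w t'] I that by (simp add: rK)
  qed
  have "I - ?K \<subseteq> cells s n" using sub by (rule order_trans[OF Diff_subset])
  with cl rl show "I - ?K \<in> ?F'" by (simp only: Dl_def mem_Collect_eq) simp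
 qed
 have in2: "I \<union> ?K \<in> ?F" "I \<inter> ?K = {}" if I: "I \<in> ?F'" for I
 proof -
  have sub: "I \<subseteq> cells s n" using I DlD(1) by blast
  have r0: "rw t I = {}" using DlD(2)[OF I t] fin_rw(1)[OF sub, of t] by simp
  then show "I \<inter> ?K = {}" by (auto simp: rw_def)
  have "card (insert t (cw j I)) \<le> w j" if "j \<in> R" "j < n" for j
   using DlD(3)[OF I that(2)] w[OF that(1)] that card_insert_le_m1[of "w j" "cw j I" t] by auto
  then have cl: "card (cw j (I \<union> ?K)) \<le> w j" if "j < n" for j
   using DlD(3)[OF I that] that by (cases "j \<in> R") (simp_all add: cU)
  have rl: "card (rw t' (I \<union> ?K)) \<le> p t'" if "t' < s" for t'
  proof (cases "t' = t")
   case True then show ?thesis using R(2) r0 by (simp add: rU)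
  next
   case False then show ?thesis using DlD(2)[OF I that] by (simp add: rU)
  qed
  have "I \<union> ?K \<subseteq> cells s n" using sub K(1) by (rule Un_least)
  with cl rl have "I \<union> ?K \<in> Dl s n p w" by (simp only: Dl_def mem_Collect_eq) simp
  then show "I \<union> ?K \<in> ?F" using r0 rU[of t I] by simp
 qed
 have "hh TYPE('a) (cells s n) ?F (g + card R) \<le> hh TYPE('a) (cells s n) ?F' g"
 proof (rule hh_iso[where \<beta> = "\<lambda>I. I - ?K" and \<sigma> = "\<lambda>I. \<Prod>x\<in>I - ?K. sg x ?K", OF family_rw family_Dl])
  show "bij_betw (\<lambda>I. I - ?K) ?F ?F'"
  proof (rule bij_betw_byWitness[where f' = "\<lambda>I. I \<union> ?K"])
   show "\<forall>I\<in>?F. I - ?K \<union> ?K = I" "\<forall>I\<in>?F'. I \<union> ?K - ?K = I"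
    by (intro ballI, drule in1(2), simp only: Un_Diff_cancel2 Un_absorb2)
     (intro ballI, drule in2(2), simp only: Un_Diff Diff_cancel Un_empty_right Diff_triv)
   show "(\<lambda>I. I - ?K) ` ?F \<subseteq> ?F'" by (intro image_subsetI in1(1))
   show "(\<lambda>I. I \<union> ?K) ` ?F' \<subseteq> ?F" by (intro image_subsetI in2(1))
  qed
  show "card I = card (I - ?K) + card R" if "I \<in> ?F" for I
  proof -
   have "finite I" by (rule familyD(3)[OF family_rw that])
   then have "card (I - ?K) = card I - card ?K" "card ?K \<le> card I"
    using in1(2)[OF that] K(2) by (auto intro: card_Diff_subset card_mono)
   then show ?thesis by (simp add: card_cartesian_product)
  qed
  show "(\<Prod>x\<in>I - ?K. sg x ?K) * (\<Prod>x\<in>I - ?K. sg x ?K) = (1 :: 'a)" for I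
   by (simp add: sg_sq[OF K(2)] flip: prod.distrib)
  fix u :: "(nat \<times> nat) set => 'a" and J assume u: "u \<in> supp_on ?F'" and J: "J \<in> ?F"
  let ?\<sigma> = "\<lambda>I. \<Prod>x\<in>I - ?K. sg x ?K :: 'a"
  have fJ: "finite J" "?K \<subseteq> J" by (rule familyD(3)[OF family_rw J]) (rule in1(2)[OF J])
  have "bd (cells s n) (\<lambda>I. if I \<in> ?F then ?\<sigma> I * u (I - ?K) else 0) J
    = (\<Sum>x\<in>cells s n - J. sg x J * (if insert x J \<in> ?F then ?\<sigma> (insert x J) * u (insert x J - ?K) else 0))"
   by (simp add: bd_apply)
  also have "\<dots> = (\<Sum>x\<in>cells s n - J. ?\<sigma> J * (sg x (J - ?K) * u (insert x (J - ?K))))"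
  proof (intro sum.cong refl)
   fix x assume x: "x \<in> cells s n - J"
   then have xK: "x \<notin> ?K" "insert x J - ?K = insert x (J - ?K)" using fJ(2) by blast+
   show "sg x J * (if insert x J \<in> ?F then ?\<sigma> (insert x J) * u (insert x J - ?K) else 0)
     = ?\<sigma> J * (sg x (J - ?K) * u (insert x (J - ?K)))"
   proof (cases "insert x J \<in> ?F")
    case True
    have "J = (J - ?K) \<union> ?K" using fJ(2) by blast
    then have "sg x J = sg x (J - ?K) * (sg x ?K :: 'a)"
     using sg_Un[of "J - ?K" ?K x, where 'a='a] fJ(1) K(2) by auto
    moreover have "?\<sigma> (insert x J) = sg x ?K * ?\<sigma> J"
     unfolding xK(2) using x fJ(1) by simp
    ultimately show ?thesis using True by (simp add: xK(2) sg_sq'[OF K(2)] mult_ac)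
   next
    case False
    have "insert x (J - ?K) \<notin> ?F'"
    proof
     assume "insert x (J - ?K) \<in> ?F'"
     from in2(1)[OF this] have "insert x (J - ?K) \<union> ?K \<in> ?F" .
     moreover have "insert x (J - ?K) \<union> ?K = insert x J" using fJ(2) by blast
     ultimately show False using False by simp
    qed
    then have u0: "u (insert x (J - ?K)) = 0" using u by (simp add: supp_on_def)
    show ?thesis unfolding xK(2) u0 if_not_P[OF False] by (simp only: mult_zero_right)
   qed
  qed
  also have "\<dots> = ?\<sigma> J * (\<Sum>x\<in>cells s n - J. sg x (J - ?K) * u (insert x (J - ?K)))"
   by (simp add: sum_distrib_left)
  also have "(\<Sum>x\<in>cells s n - J. sg x (J - ?K) * u (insert x (J - ?K)))
    = (\<Sum>x\<in>cells s n - (J - ?K). sg x (J - ?K) * u (insert x (J - ?K)))"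
  proof (rule sum.mono_neutral_left)
   have "insert x (J - ?K) \<notin> ?F'" if "x \<in> ?K" for x using in2(2)[of "insert x (J - ?K)"] that by blast
   then show "\<forall>x\<in>cells s n - (J - ?K) - (cells s n - J). sg x (J - ?K) * u (insert x (J - ?K)) = 0"
    using u by (auto simp: supp_on_def)
  qed auto
  also have "\<dots> = bd (cells s n) u (J - ?K)" by (simp add: bd_apply)
  finally show "bd (cells s n) (\<lambda>I. if I \<in> ?F then ?\<sigma> I * u (I - ?K) else 0) J
    = ?\<sigma> J * bd (cells s n) u (J - ?K)" .
 qed
 then show ?thesis by (simp add: hD_def)
qed

section \<open>Changing one row bound, and vanishing of homology\<close>

definition Rset :: "nat => (nat => nat) => nat => nat set set" where
 "Rset n w k = {R. R \<subseteq> {j. j < n \<and> 1 \<le> w j} \<and> card R = k}"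

abbreviation wR :: "(nat => nat) => nat set => nat => nat" where
 "wR w R \<equiv> (\<lambda>j. if j \<in> R then w j - 1 else w j)"

lemma finite_Rset [simp]: "finite (Rset n w k)"
 by (rule finite_subset[of _ "Pow {..<n}"]) (auto simp: Rset_def)

lemma sum_wR: "R \<in> Rset n w k ==> (\<Sum>j<n. wR w R j) + k = (\<Sum>j<n. w j)"
proof -
 assume "R \<in> Rset n w k"
 then have R: "R \<subseteq> {..<n}" "card R = k" "\<forall>j\<in>R. 1 \<le> w j" by (auto simp: Rset_def)
 have "(\<Sum>j<n. wR w R j) + k = (\<Sum>j<n. wR w R j) + (\<Sum>j<n. if j \<in> R then 1 else 0)"
  using R by (simp add: sum.If_cases Int_absorb1)
 also have "\<dots> = (\<Sum>j<n. w j)" unfolding sum.distrib[symmetric] using R(3) by (intro sum.cong) auto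
 finally show ?thesis .
qed

lemma rowk_bound:
 assumes t: "t < s"
 shows "hh TYPE('a::field_char_0) (cells s n) {I\<in>Dl s n p w. card (rw t I) = k} g
  \<le> (if k \<le> g then \<Sum>R\<in>Rset n w k. hD TYPE('a) s n (p(t := 0)) (wR w R) (g - k) else 0)"
proof -
 let ?G = "{I\<in>Dl s n p w. card (rw t I) = k}"
 have G: "family (cells s n) ?G"
 proof (rule family_sub[OF family_Dl])
  fix I J K assume a: "I \<in> Dl s n p w" "card (rw t I) = k" "card (rw t J) = k" "J \<subseteq> K" "K \<subseteq> I" "K \<in> Dl s n p w"
  have "card (rw t J) \<le> card (rw t K)" "card (rw t K) \<le> card (rw t I)"
   by (rule card_mono[OF fin_rw(1)[OF DlD(1)[OF a(6)]] rw_mono[OF a(4)]])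
    (rule card_mono[OF fin_rw(1)[OF DlD(1)[OF a(1)]] rw_mono[OF a(5)]])
  then show "card (rw t K) = k" using a by simp
 qed
 show ?thesis
 proof (cases "k \<le> g")
  case False
  have "card I \<noteq> g" if "I \<in> ?G" for I
  proof -
   have "I \<subseteq> cells s n" using that DlD(1) by blast
   then have "card (rw t I) \<le> card I" unfolding card_rows[OF \<open>I \<subseteq> cells s n\<close>]
    using t by (intro member_le_sum) auto
   then show ?thesis using that False by auto
  qed
  then have "gr ?G g = {}" by (auto simp: gr_def)
  then show ?thesis using hh_empty_gr[OF G, of g, where 'a='a] by simp
 next
  case True
  have im: "rw t ` ?G \<subseteq> Rset n w k"
  proof
   fix R assume "R \<in> rw t ` ?G"
   then obtain I where I: "I \<in> Dl s n p w" "card (rw t I) = k" "R = rw t I" by blast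
   have "j < n \<and> 1 \<le> w j" if "j \<in> R" for j
   proof -
    have j: "j < n" "t \<in> cw j I" using that I DlD(1)[OF I(1)] by (auto simp: rw_def cw_def)
    then have "0 < card (cw j I)" using fin_cw(1)[OF DlD(1)[OF I(1)]] card_gt_0_iff by blast
    then show ?thesis using DlD(3)[OF I(1) j(1)] j(1) by simp
   qed
   then show "R \<in> Rset n w k" using I by (auto simp: Rset_def)
  qed
  have "hh TYPE('a) (cells s n) ?G g \<le> (\<Sum>R\<in>rw t ` ?G. hh TYPE('a) (cells s n) {I\<in>?G. rw t I = R} g)"
   by (rule hh_union[OF G]) (rule rw_mono)
  also have "\<dots> \<le> (\<Sum>R\<in>rw t ` ?G. hD TYPE('a) s n (p(t := 0)) (wR w R) (g - k))"
  proof (rule sum_mono)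
   fix R assume "R \<in> rw t ` ?G"
   then have k: "card R = k" by auto
   have "{I\<in>?G. rw t I = R} = {I\<in>Dl s n p w. rw t I = R}" using k by auto
   then show "hh TYPE('a) (cells s n) {I\<in>?G. rw t I = R} g \<le> hD TYPE('a) s n (p(t := 0)) (wR w R) (g - k)"
    using hh_fix_row[OF t, of n p w R "g - k", where 'a='a] True k by simp
  qed
  also have "\<dots> \<le> (\<Sum>R\<in>Rset n w k. hD TYPE('a) s n (p(t := 0)) (wR w R) (g - k))"
   by (rule sum_mono2[OF finite_Rset im]) simp
  finally show ?thesis using True by simp
 qed
qed

lemma closed_Dl_row: "t < s ==> q \<le> p t ==> closed_in (Dl s n p w) (Dl s n (p(t := q)) w)"
 unfolding closed_in_def
proof (intro conjI ballI impI subsetI)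
 fix I assume "t < s" "q \<le> p t" "I \<in> Dl s n (p(t := q)) w"
 then show "I \<in> Dl s n p w" unfolding Dl_def by (auto split: if_splits intro: order_trans)
qed (rule Dl_subset)

lemma Dl_row_diff: "t < s ==> Dl s n (p(t := Suc q)) w - Dl s n (p(t := q)) w
  = {I\<in>Dl s n (p(t := Suc q)) w. card (rw t I) = Suc q}"
proof -
 assume t: "t < s"
 have "I \<in> Dl s n (p(t := q)) w \<longleftrightarrow> I \<in> Dl s n (p(t := Suc q)) w \<and> card (rw t I) \<le> q" for I
 proof
  assume I: "I \<in> Dl s n (p(t := q)) w"
  then show "I \<in> Dl s n (p(t := Suc q)) w \<and> card (rw t I) \<le> q"
   using DlD(2)[OF I t] closed_Dl_row[OF t, of q "p(t := Suc q)" n w] by (auto simp: closed_in_def)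
 next
  assume "I \<in> Dl s n (p(t := Suc q)) w \<and> card (rw t I) \<le> q"
  then show "I \<in> Dl s n (p(t := q)) w" using t by (auto simp: Dl_def)
 qed
 moreover have "card (rw t I) \<le> Suc q" if "I \<in> Dl s n (p(t := Suc q)) w" for I
  using DlD(2)[OF that t] by simp
 ultimately show ?thesis by (auto simp: not_le) (metis Suc_leI le_antisym)
qed

text \<open>The quotient of the complexes with bounds q + 1 and q consists of the sets with exactly
  q + 1 cells in row t, and splits by the set R of these cells. \<open>R1\<close> uses the middle
  position of the long exact sequence; \<open>R2\<close> uses the one with a degree shift, where g +
  1 - (q + 1) = g - q appears.\<close>

lemma R1:
 assumes t: "t < s"
 shows "hD TYPE('a::field_char_0) s n (p(t := Suc q)) w g \<le> hD TYPE('a) s n (p(t := q)) w g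
  + (if Suc q \<le> g then \<Sum>R\<in>Rset n w (Suc q). hD TYPE('a) s n (p(t := 0)) (wR w R) (g - Suc q) else 0)"
 using les1[OF family_Dl closed_Dl_row[OF t, of q "p(t := Suc q)" n w], of g, where 'a='a]
  rowk_bound[OF t, of n "p(t := Suc q)" w "Suc q" g, where 'a='a]
 by (simp add: hD_def Dl_row_diff[OF t] split: if_splits)

lemma R2:
 assumes t: "t < s"
 shows "hD TYPE('a::field_char_0) s n (p(t := q)) w g \<le> hD TYPE('a) s n (p(t := Suc q)) w g
  + (if q \<le> g then \<Sum>R\<in>Rset n w (Suc q). hD TYPE('a) s n (p(t := 0)) (wR w R) (g - q) else 0)"
 using les3[OF family_Dl closed_Dl_row[OF t, of q "p(t := Suc q)" n w], of g, where 'a='a]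
  rowk_bound[OF t, of n "p(t := Suc q)" w "Suc q" "Suc g", where 'a='a]
 by (simp add: hD_def Dl_row_diff[OF t] split: if_splits)

text \<open>A bound p t of at least n restricts nothing in row t. Fix the cells outside row t. If
  some column j has room left, the fibre is a cone with apex (t, j). Otherwise the columns are full
  without row t, so the sets have size equal to the sum of w and at most the sum of p minus p t; the
  assumption on g excludes this.\<close>

lemma base_row:
 assumes t: "t < s" "n \<le> p t" and g: "g \<noteq> (\<Sum>j<n. w j) \<or> (\<Sum>t<s. p t) < g + p t"
 shows "hD TYPE('a::field_char_0) s n p w g = 0"
proof -
 let ?F = "Dl s n p w" and ?\<rho> = "\<lambda>I. {x\<in>I. fst x \<noteq> t}"
 have "hh TYPE('a) (cells s n) {I\<in>?F. ?\<rho> I = r} g = 0" for r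
 proof -
  have fam: "family (cells s n) {I\<in>?F. ?\<rho> I = r}" by (rule family_sub[OF family_Dl]) blast
  show ?thesis
  proof (cases "\<exists>j<n. card (cw j r) < w j")
   case True
   then obtain j where j: "j < n" "card (cw j r) < w j" by blast
   show ?thesis
   proof (rule hh_cone[OF fam, of "(t, j)"])
    fix I assume I: "I \<in> {I\<in>?F. ?\<rho> I = r}"
    then have sub: "I \<subseteq> cells s n" using DlD(1) by blast
    have r1: "rw t' (insert (t, j) I) = (if t' = t then insert j (rw t I) else rw t' I)" for t' by (auto simp: rw_def)
    have c1: "cw j' (insert (t, j) I) = (if j' = j then insert t (cw j I) else cw j' I)" for j' by (auto simp: cw_def)
    have "insert t (cw j I) = insert t (cw j r)" using I by (auto simp: cw_def)
    then have "card (insert t (cw j I)) \<le> w j" using card_insert_le_m1[of "w j" "cw j r" t] j(2) by auto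
    moreover have "card (insert j (rw t I)) \<le> p t"
    proof -
     have "insert j (rw t I) \<subseteq> {..<n}" using fin_rw(2)[OF sub, of t] j(1) by blast
     then have "card (insert j (rw t I)) \<le> card {..<n}" by (intro card_mono) simp
     then show ?thesis using t(2) by simp
    qed
    moreover have IF: "I \<in> ?F" using I by simp
    ultimately have cc: "card (insert t (cw j I)) \<le> w j" "card (insert j (rw t I)) \<le> p t" "I \<in> ?F"
     by blast+
    have "card (rw t' (insert (t, j) I)) \<le> p t'" if "t' < s" for t'
     using cc(2) DlD(2)[OF cc(3) that] by (cases "t' = t") (simp_all only: r1 if_True if_False simp_thms)
    moreover have "card (cw j' (insert (t, j) I)) \<le> w j'" if "j' < n" for j'
     using cc(1) DlD(3)[OF cc(3) that] by (cases "j' = j") (simp_all only: c1 if_True if_False simp_thms)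
    moreover have "insert (t, j) I \<subseteq> cells s n" using sub t(1) j(1) by blast
    ultimately have "insert (t, j) I \<in> ?F" by (simp only: Dl_def mem_Collect_eq) blast
    then show "insert (t, j) I \<in> {I\<in>?F. ?\<rho> I = r} \<and> I - {(t, j)} \<in> {I\<in>?F. ?\<rho> I = r}"
     using I Dl_subset[of I s n p w "I - {(t, j)}"] by auto
   qed (use t j in auto)
  next
   case False
   have "card I \<noteq> g" if I: "I \<in> ?F" "?\<rho> I = r" for I
   proof
    assume c: "card I = g"
    have sub: "I \<subseteq> cells s n" by (rule DlD(1)[OF I(1)])
    have cj: "cw j I = cw j r \<and> card (cw j I) = w j" if "j < n" for j
    proof -
     have "cw j r \<subseteq> cw j I" using I(2) by (auto simp: cw_def)
     moreover have "card (cw j I) \<le> card (cw j r)" using DlD(3)[OF I(1) that] False that by force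
     ultimately have "cw j r = cw j I" using fin_cw(1)[OF sub, of j] by (intro card_seteq) auto
     then show ?thesis using DlD(3)[OF I(1) that] False that by force
    qed
    then have geq: "g = (\<Sum>j<n. w j)"
     unfolding c[symmetric] card_cols[OF sub] using cj by (intro sum.cong refl) (metis lessThan_iff)
    have "rw t I = {}"
    proof (rule ccontr)
     assume "rw t I \<noteq> {}"
     then obtain j where "(t, j) \<in> I" by (auto simp: rw_def)
     then have "t \<in> cw j r" using cj[of j] sub by (auto simp: cw_def)
     then show False using I(2) by (auto simp: cw_def)
    qed
    then have ceq: "card I = (\<Sum>t'\<in>{..<s} - {t}. card (rw t' I))"
     unfolding card_rows[OF sub] using t(1) by (simp add: sum.remove)
    have "(\<Sum>t'\<in>{..<s} - {t}. card (rw t' I)) \<le> (\<Sum>t'\<in>{..<s} - {t}. p t')" using DlD(2)[OF I(1)] by (intro sum_mono) auto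
    then have "g + p t \<le> (\<Sum>t<s. p t)" using t(1) c ceq by (simp add: sum.remove)
    then show False using g geq by simp
   qed
   then have "gr {I\<in>?F. ?\<rho> I = r} g = {}" by (auto simp: gr_def)
   then show ?thesis by (rule hh_empty_gr[OF fam])
  qed
 qed
 moreover have "hh TYPE('a) (cells s n) ?F g \<le> (\<Sum>r\<in>?\<rho> ` ?F. hh TYPE('a) (cells s n) {I\<in>?F. ?\<rho> I = r} g)"
  by (rule hh_union[OF family_Dl]) blast
 ultimately show ?thesis by (simp add: hD_def)
qed

text \<open>Induction on the number of active rows. The bound q of one row t is raised by
  \<open>R2\<close> until \<open>base_row\<close> applies. A correction term has one row fewer,
  degree smaller by q and column total smaller by q + 1, so both sides of the first inequality drop
  by q + 1, and the second one survives because row t contributed q to the sum of p.\<close>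

lemma vanish_regular:
 assumes "A \<subseteq> {..<s}" "\<And>t. t < s ==> t \<notin> A ==> p t = 0"
  and "card A + g \<le> (\<Sum>j<n. w j)" "g < (\<Sum>t<s. p t)"
 shows "hD TYPE('a::field_char_0) s n p w g = 0"
 using assms
proof (induction "card A" arbitrary: A p w g rule: less_induct)
 case less
 note IH = less.hyps
 have finA: "finite A" by (rule finite_subset[OF less.prems(1)]) simp
 have "A \<noteq> {}" using less.prems(2,4) by (metis empty_iff finite_lessThan lessThan_iff not_less0 sum.neutral)
 then obtain t where t: "t \<in> A" by blast
 then have ts: "t < s" using less.prems(1) by auto
 have cA: "card (A - {t}) < card A" "card A = Suc (card (A - {t}))"
  using card_Suc_Diff1[OF finA t] by simp_all
 define P0 where "P0 = (\<Sum>t'<s. (p(t := 0)) t')"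
 have P: "(\<Sum>t'<s. (p(t := q)) t') = P0 + q" for q
  unfolding P0_def using ts by (simp add: sum.remove)
 have main: "hD TYPE('a) s n (p(t := q)) w g = 0" if "p t \<le> q" for q
  using that
 proof (induction "n - q" arbitrary: q rule: less_induct)
  case (less q)
  have gP: "g < P0 + q" using P[of "p t"] less.prems \<open>g < (\<Sum>t<s. p t)\<close> by simp
  show ?case
  proof (cases "n \<le> q")
   case True
   have "g \<noteq> (\<Sum>j<n. w j)" using \<open>card A + g \<le> _\<close> cA by linarith
   then show ?thesis by (intro base_row[OF ts]) (use True in simp_all)
  next
   case False
   have 1: "hD TYPE('a) s n (p(t := Suc q)) w g = 0" using less.hyps[of "Suc q"] less.prems False by simp
   have 2: "hD TYPE('a) s n (p(t := 0)) (wR w R) (g - q) = 0" if "q \<le> g" "R \<in> Rset n w (Suc q)" for R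
   proof (rule IH[OF cA(1)])
    show "A - {t} \<subseteq> {..<s}" using \<open>A \<subseteq> {..<s}\<close> by blast
    show "(p(t := 0)) t' = 0" if "t' < s" "t' \<notin> A - {t}" for t'
     using that \<open>\<And>t. t < s ==> t \<notin> A ==> p t = 0\<close> by auto
    show "card (A - {t}) + (g - q) \<le> (\<Sum>j<n. wR w R j)"
     using sum_wR[OF that(2)] \<open>card A + g \<le> _\<close> cA(2) that(1) by linarith
    show "g - q < (\<Sum>t'<s. (p(t := 0)) t')" unfolding P0_def[symmetric] using gP that(1) by simp
   qed
   have "hD TYPE('a) s n (p(t := q)) w g \<le> 0"
    by (rule order_trans[OF R2[OF ts, of n p q w g]]) (use 1 2 in simp)
   then show ?thesis by simp
  qed
 qed
 from main[of "p t"] show ?case by simp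
qed

text \<open>A trade-off: each row t of T relaxes the condition on the column total by 1 and costs p
  t in the condition on the degree. Rows of T are lowered to bound 0 by \<open>R1\<close>, which
  ends in \<open>vanish_regular\<close>.\<close>

lemma vanish_small:
 assumes "A \<subseteq> {..<s}" "\<And>t. t < s ==> t \<notin> A ==> p t = 0" "T \<subseteq> A"
  and "card A + g \<le> (\<Sum>j<n. w j) + card T" "(\<Sum>t\<in>T. p t) + g < (\<Sum>t<s. p t)"
 shows "hD TYPE('a::field_char_0) s n p w g = 0"
 using assms
proof (induction "(\<Sum>t\<in>T. p t) + card T" arbitrary: A T p w g rule: less_induct)
 case less
 have fin: "finite A" by (rule finite_subset[OF less.prems(1)]) simp
 have fin: "finite A" "finite T" by (rule fin, rule finite_subset[OF less.prems(3) fin])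
 show ?case
 proof (cases "T = {}")
  case True
  show ?thesis
  proof (rule vanish_regular[OF less.prems(1)])
   show "p t = 0" if "t < s" "t \<notin> A" for t using that by (rule less.prems(2))
   show "card A + g \<le> (\<Sum>j<n. w j)" using less.prems(4) True by simp
   show "g < (\<Sum>t<s. p t)" using less.prems(5) True by simp
  qed
 next
  case False
  then obtain t where t: "t \<in> T" by blast
  then have ts: "t < s" "t \<in> A" using less.prems by auto
  have c: "card T = Suc (card (T - {t}))" "card A = Suc (card (A - {t}))"
   using card_Suc_Diff1[OF fin(2) t] card_Suc_Diff1[OF fin(1) ts(2)] by simp_all
  have sT: "(\<Sum>t\<in>T. p t) = p t + (\<Sum>t\<in>T - {t}. p t)" using t fin by (simp add: sum.remove)
  have sT': "(\<Sum>t'\<in>T - {t}. (p(t := q)) t') = (\<Sum>t\<in>T - {t}. p t)" for q by (intro sum.cong) auto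
  define P0 where "P0 = (\<Sum>t'<s. (p(t := 0)) t')"
  have P: "(\<Sum>t'<s. (p(t := q)) t') = P0 + q" for q
   unfolding P0_def using ts by (simp add: sum.remove)
  have Pp: "(\<Sum>t<s. p t) = P0 + p t" using P[of "p t"] by simp
  show ?thesis
  proof (cases "p t")
   case p0: 0
   show ?thesis
   proof (rule less.hyps[where T="T - {t}" and A="A - {t}"])
    show "(\<Sum>t\<in>T - {t}. p t) + card (T - {t}) < (\<Sum>t\<in>T. p t) + card T" using sT c(1) by simp
    show "A - {t} \<subseteq> {..<s}" "T - {t} \<subseteq> A - {t}" using less.prems(1,3) by blast+
    show "p t' = 0" if "t' < s" "t' \<notin> A - {t}" for t'
     using that less.prems(2)[of t'] p0 by (cases "t' = t") simp_all
    show "card (A - {t}) + g \<le> (\<Sum>j<n. w j) + card (T - {t})" using less.prems(4) c by simp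
    show "(\<Sum>t\<in>T - {t}. p t) + g < (\<Sum>t<s. p t)" using less.prems(5) sT p0 by simp
   qed
  next
   case (Suc q)
   have 1: "hD TYPE('a) s n (p(t := q)) w g = 0"
   proof (rule less.hyps[where T=T and A=A])
    have e: "(\<Sum>t'\<in>T. (p(t := q)) t') = q + (\<Sum>t\<in>T - {t}. p t)"
     using t fin by (simp add: sum.remove)
    show "(\<Sum>t'\<in>T. (p(t := q)) t') + card T < (\<Sum>t\<in>T. p t) + card T" using e sT Suc by simp
    show "(\<Sum>t'\<in>T. (p(t := q)) t') + g < (\<Sum>t'<s. (p(t := q)) t')"
     using less.prems(5) e sT Suc P Pp by simp
    show "(p(t := q)) t' = 0" if "t' < s" "t' \<notin> A" for t' using that less.prems(2)[of t'] ts(2) by (cases "t' = t") simp_all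
   qed (use less.prems(1,3,4) in simp_all)
   have 2: "hD TYPE('a) s n (p(t := 0)) (wR w R) (g - Suc q) = 0" if "Suc q \<le> g" "R \<in> Rset n w (Suc q)" for R
   proof (rule less.hyps[where T="T - {t}" and A="A - {t}"])
    show "(\<Sum>t'\<in>T - {t}. (p(t := 0)) t') + card (T - {t}) < (\<Sum>t\<in>T. p t) + card T"
     using sT sT' c by simp
    show "(p(t := 0)) t' = 0" if "t' < s" "t' \<notin> A - {t}" for t' using that less.prems(2)[of t'] by (cases "t' = t") simp_all
    show "A - {t} \<subseteq> {..<s}" "T - {t} \<subseteq> A - {t}" using less.prems(1,3) by blast+
    show "card (A - {t}) + (g - Suc q) \<le> (\<Sum>j<n. wR w R j) + card (T - {t})"
     using sum_wR[OF that(2)] less.prems(4) c that(1) by linarith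
    show "(\<Sum>t'\<in>T - {t}. (p(t := 0)) t') + (g - Suc q) < (\<Sum>t'<s. (p(t := 0)) t')"
     using less.prems(5) sT sT' Pp Suc that(1) unfolding P0_def[symmetric] by simp
   qed
   have "hD TYPE('a) s n (p(t := Suc q)) w g \<le> 0"
    by (rule order_trans[OF R1[OF ts(1), of n p q w g]]) (use 1 2 in simp)
   then show ?thesis using Suc by (metis fun_upd_triv le_zero_eq)
  qed
 qed
qed

text \<open>Vanishing near the top, where g lies only c below the column total. One row of U is
  raised by \<open>R2\<close>; in a correction term the degree drops by q \<le> n - 1 and the column
  total by q + 1, so c drops by 1. At c = 0 the correction has degree above its column
  total.\<close>

lemma vanish_large:
 assumes "U \<subseteq> {..<s}" "card U = Suc c" "(\<Sum>j<n. w j) = g + c"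
  and "c * (n - 1) + (\<Sum>t<s. p t) < (\<Sum>t\<in>U. p t) + g"
 shows "hD TYPE('a::field_char_0) s n p w g = 0"
 using assms
proof (induction c arbitrary: U p w g)
 case base: 0
 then obtain t where U: "U = {t}" by (auto simp: card_Suc_eq)
 have ts: "t < s" using base(1) U by simp
 define P0 where "P0 = (\<Sum>t'<s. (p(t := 0)) t')"
 have P: "(\<Sum>t'<s. (p(t := q)) t') = P0 + q" for q
  unfolding P0_def using ts by (simp add: sum.remove)
 have gP: "P0 < g" using base(4) P[of "p t"] U by simp
 have "hD TYPE('a) s n (p(t := q)) w g = 0" for q
 proof (induction "n - q" arbitrary: q rule: less_induct)
  case (less q)
  show ?case
  proof (cases "n \<le> q")
   case True
   show ?thesis by (rule base_row[OF ts]) (use True gP P in simp_all)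
  next
   case False
   have 1: "hD TYPE('a) s n (p(t := Suc q)) w g = 0" using less[of "Suc q"] False by simp
   have 2: "hD TYPE('a) s n (p(t := 0)) (wR w R) (g - q) = 0" if "q \<le> g" "R \<in> Rset n w (Suc q)" for R
    by (rule hD_card[OF _ refl]) (use sum_wR[OF that(2)] base(3) that(1) in linarith)
   have "hD TYPE('a) s n (p(t := q)) w g \<le> 0"
    by (rule order_trans[OF R2[OF ts, of n p q w g]]) (use 1 2 in simp)
   then show ?thesis by simp
  qed
 qed
 from this[of "p t"] show ?case by simp
next
 case (Suc c)
 then obtain t where t: "t \<in> U" by force
 have fin: "finite U" by (rule finite_subset[OF Suc.prems(1)]) simp
 have ts: "t < s" using t Suc.prems(1) by auto
 define P0 where "P0 = (\<Sum>t'<s. (p(t := 0)) t')"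
 have P: "(\<Sum>t'<s. (p(t := q)) t') = P0 + q" for q
  unfolding P0_def using ts by (simp add: sum.remove)
 have sU: "(\<Sum>t\<in>U. p t) = p t + (\<Sum>t\<in>U - {t}. p t)" using t fin by (simp add: sum.remove)
 have sU': "(\<Sum>t'\<in>U - {t}. (p(t := 0)) t') = (\<Sum>t\<in>U - {t}. p t)" by (intro sum.cong) auto
 have key: "Suc c * (n - 1) + P0 < (\<Sum>t\<in>U - {t}. p t) + g" using Suc.prems(4) sU P[of "p t"] by simp
 have "hD TYPE('a) s n (p(t := q)) w g = 0" for q
 proof (induction "n - q" arbitrary: q rule: less_induct)
  case (less q)
  show ?case
  proof (cases "n \<le> q")
   case True
   show ?thesis by (rule base_row[OF ts]) (use True Suc.prems(3) in simp_all)
  next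
   case False
   have 1: "hD TYPE('a) s n (p(t := Suc q)) w g = 0" using less[of "Suc q"] False by simp
   have 2: "hD TYPE('a) s n (p(t := 0)) (wR w R) (g - q) = 0" if "q \<le> g" "R \<in> Rset n w (Suc q)" for R
   proof (rule Suc.IH[of "U - {t}"])
    show "(\<Sum>j<n. wR w R j) = g - q + c" using sum_wR[OF that(2)] Suc.prems(3) that(1) by linarith
    show "c * (n - 1) + (\<Sum>t'<s. (p(t := 0)) t') < (\<Sum>t'\<in>U - {t}. (p(t := 0)) t') + (g - q)"
     unfolding sU' P0_def[symmetric] using key that(1) False by simp
   qed (use Suc.prems t fin in auto)
   have "hD TYPE('a) s n (p(t := q)) w g \<le> 0"
    by (rule order_trans[OF R2[OF ts, of n p q w g]]) (use 1 2 in simp)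
   then show ?thesis by simp
  qed
 qed
 from this[of "p t"] show ?case by simp
qed

text \<open>The boundary case of \<open>vanish_large\<close> with U = A, where c * (n - 1) < g
  becomes an equality. Corrections vanish until the raised row has bound n - 1, and there only the
  full row R = {0,...,n-1} survives. It lowers every column by 1 and c by 1, so the recursion
  reaches the empty set only from the constant column bound c.\<close>

lemma corner:
 assumes "A \<subseteq> {..<s}" "\<And>t. t < s ==> t \<notin> A ==> p t = 0" "card A = Suc c"
  and "g = c * (n - 1)" "(\<Sum>j<n. w j) = g + c" "0 < n"
 shows "hD TYPE('a::field_char_0) s n p w g \<le> 1 \<and> ((\<exists>j<n. w j \<noteq> c) --> hD TYPE('a) s n p w g = 0)"
 using assms
proof (induction c arbitrary: A p w g)
 case 0
 have "gr (Dl s n p w) 0 \<subseteq> {{}}" using familyD(3)[OF family_Dl] by (auto simp: gr_def)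
 then have "card (gr (Dl s n p w) 0) \<le> card {{} :: (nat \<times> nat) set}" by (intro card_mono) auto
 then have "hD TYPE('a) s n p w 0 \<le> 1"
  unfolding hD_def using hh_le_card[OF family_Dl[of s n p w], of 0, where 'a='a] by simp
 moreover have "w j = 0" if "j < n" for j using 0 that by simp
 then have "\<not> (\<exists>j<n. w j \<noteq> 0)" by simp
 ultimately show ?case unfolding 0(4) by (intro conjI impI) (simp_all only: mult_0 simp_thms)
next
 case (Suc c)
 have fin: "finite A" by (rule finite_subset[OF Suc.prems(1)]) simp
 obtain t where t: "t \<in> A" using Suc.prems(3) by force
 have ts: "t < s" using t Suc.prems(1) by auto
 have c: "card (A - {t}) = Suc c" using Suc.prems(3) t fin by simp
 define P0 where "P0 = (\<Sum>t'<s. (p(t := 0)) t')"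
 have PA: "P0 = (\<Sum>t'\<in>A - {t}. (p(t := 0)) t')"
  unfolding P0_def proof (rule sum.mono_neutral_right)
  show "A - {t} \<subseteq> {..<s}" using Suc.prems(1) by blast
  show "\<forall>i\<in>{..<s} - (A - {t}). (p(t := 0)) i = 0"
  proof
   fix i assume "i \<in> {..<s} - (A - {t})"
   then show "(p(t := 0)) i = 0" using Suc.prems(2)[of i] by (cases "i = t") simp_all
  qed
 qed simp
 have "hD TYPE('a) s n (p(t := q)) w g \<le> 1 \<and> ((\<exists>j<n. w j \<noteq> Suc c) --> hD TYPE('a) s n (p(t := q)) w g = 0)" for q
 proof (induction "n - q" arbitrary: q rule: less_induct)
  case (less q)
  show ?case
  proof (cases "n \<le> q")
   case True
   have "hD TYPE('a) s n (p(t := q)) w g = 0"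
    by (rule base_row[OF ts]) (use True Suc.prems(5) in simp_all)
   then show ?thesis by simp
  next
   case False
   show ?thesis
   proof (cases "Suc q < n")
    case True
    have 2: "hD TYPE('a) s n (p(t := 0)) (wR w R) (g - q) = 0" if "q \<le> g" "R \<in> Rset n w (Suc q)" for R
    proof (rule vanish_large[OF _ c])
     show "(\<Sum>j<n. wR w R j) = g - q + c" using sum_wR[OF that(2)] Suc.prems(5) that(1) by linarith
     show "c * (n - 1) + (\<Sum>t'<s. (p(t := 0)) t') < (\<Sum>t'\<in>A - {t}. (p(t := 0)) t') + (g - q)"
      unfolding PA[symmetric] P0_def[symmetric] using Suc.prems(4) True that(1) by simp
    qed (use Suc.prems in auto)
    then have le: "hD TYPE('a) s n (p(t := q)) w g \<le> hD TYPE('a) s n (p(t := Suc q)) w g"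
     using R2[OF ts, of n p q w g, where 'a='a] by (simp split: if_splits)
    have l: "n - Suc q < n - q" using False by simp
    show ?thesis
    proof
     show "hD TYPE('a) s n (p(t := q)) w g \<le> 1" by (rule order_trans[OF le conjunct1[OF less[OF l]]])
     show "(\<exists>j<n. w j \<noteq> Suc c) --> hD TYPE('a) s n (p(t := q)) w g = 0"
     proof
      assume "\<exists>j<n. w j \<noteq> Suc c"
      from mp[OF conjunct2[OF less[OF l]] this] le show "hD TYPE('a) s n (p(t := q)) w g = 0" by linarith
     qed
    qed
   next
    case qn: False
    then have qe: "n = Suc q" using \<open>\<not> n \<le> q\<close> by simp
    have 1: "hD TYPE('a) s n (p(t := Suc q)) w g = 0"
     by (rule base_row[OF ts]) (use qe Suc.prems(5) in simp_all)
    have q: "q \<le> g" "g - q = c * (n - 1)" using Suc.prems(4) qe by auto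
    have le: "hD TYPE('a) s n (p(t := q)) w g \<le> (\<Sum>R\<in>Rset n w n. hD TYPE('a) s n (p(t := 0)) (wR w R) (g - q))"
     using R2[OF ts, of n p q w g, where 'a='a] 1 q(1) qe by simp
    show ?thesis
    proof (cases "\<forall>j<n. 1 \<le> w j")
     case True
     have R: "Rset n w n = {{..<n}}"
     proof -
      have "R = {..<n}" if "R \<subseteq> {..<n}" "card R = n" for R
       using card_subset_eq[of "{..<n}" R] that by simp
      then show ?thesis using True by (auto simp: Rset_def)
     qed
     have mem: "{..<n} \<in> Rset n w n" using R by simp
     have IH: "hD TYPE('a) s n (p(t := 0)) (wR w {..<n}) (g - q) \<le> 1 \<and>
      ((\<exists>j<n. wR w {..<n} j \<noteq> c) --> hD TYPE('a) s n (p(t := 0)) (wR w {..<n}) (g - q) = 0)"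
     proof (rule Suc.IH[of "A - {t}"])
      show "(\<Sum>j<n. wR w {..<n} j) = g - q + c"
       using sum_wR[OF mem] Suc.prems(5) q(1) qe by linarith
      show "(p(t := 0)) t' = 0" if "t' < s" "t' \<notin> A - {t}" for t' using that Suc.prems(2) by auto
     qed (use c q(2) Suc.prems(1,6) in auto)
     have ex: "(\<exists>j<n. w j \<noteq> Suc c) --> (\<exists>j<n. wR w {..<n} j \<noteq> c)"
     proof
      assume "\<exists>j<n. w j \<noteq> Suc c"
      then obtain j where j: "j < n" "w j \<noteq> Suc c" by (elim exE conjE)
      have "wR w {..<n} j \<noteq> c" using j True[rule_format, OF j(1)] by simp
      then show "\<exists>j<n. wR w {..<n} j \<noteq> c" using j(1) by (intro exI[of _ j] conjI)
     qed
     have le': "hD TYPE('a) s n (p(t := q)) w g \<le> hD TYPE('a) s n (p(t := 0)) (wR w {..<n}) (g - q)"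
      using le by (simp only: R sum.insert sum.empty finite.emptyI empty_iff not_False_eq_True add_0_right)
     show ?thesis
     proof
      show "hD TYPE('a) s n (p(t := q)) w g \<le> 1" by (rule order_trans[OF le' conjunct1[OF IH]])
      show "(\<exists>j<n. w j \<noteq> Suc c) --> hD TYPE('a) s n (p(t := q)) w g = 0"
      proof
       assume "\<exists>j<n. w j \<noteq> Suc c"
       then have "hD TYPE('a) s n (p(t := 0)) (wR w {..<n}) (g - q) = 0"
        by (rule mp[OF conjunct2[OF IH] mp[OF ex]])
       then show "hD TYPE('a) s n (p(t := q)) w g = 0" using le' by linarith
      qed
     qed
    next
     case False
     then have "Rset n w n = {}"
     proof -
      have "R = {..<n}" if "R \<in> Rset n w n" for R
       using card_subset_eq[of "{..<n}" R] that by (auto simp: Rset_def)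
      then show ?thesis using False by (auto simp: Rset_def)
     qed
     then show ?thesis using le by simp
    qed
   qed
  qed
 qed
 from this[of "p t"] show ?case by simp
qed

section \<open>Homology summed over all column bounds with a given total\<close>

definition WS :: "nat => nat => nat list set" where
 "WS n N = {l. length l = n \<and> sum_list l = N}"

lemma WS_D: "l \<in> WS n N ==> length l = n" "l \<in> WS n N ==> (\<Sum>j<n. l ! j) = N"
 by (auto simp: WS_def sum_list_sum_nth atLeast0LessThan)

lemma WS_I: "length l = n ==> (\<Sum>j<n. l ! j) = N ==> l \<in> WS n N"
 by (auto simp: WS_def sum_list_sum_nth atLeast0LessThan)

lemma finite_WS [simp]: "finite (WS n N)"
proof (rule finite_subset)
 show "WS n N \<subseteq> {l. set l \<subseteq> {..N} \<and> length l = n}" using member_le_sum_list by (force simp: WS_def)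
qed (simp add: finite_lists_length_eq)

lemma card_WS: "0 < n ==> card (WS n N) = (N + (n - 1)) choose (n - 1)"
proof -
 assume "0 < n"
 then have "N + n - 1 = N + (n - 1)" by simp
 then show ?thesis unfolding WS_def card_length_sum_list by (simp add: binomial_symmetric[of N])
qed

text \<open>Summing over the column bounds makes the row recursions and Euler characteristics close
  up: only the total N enters, and each choice of R in \<open>R1\<close> and \<open>R2\<close>
  becomes a binomial factor.\<close>

definition HL :: "'a::field_char_0 itself => nat => nat list => nat => nat => nat" where
 "HL a n ps N g = (\<Sum>l\<in>WS n N. hD a (length ps) n ((!) ps) ((!) l) g)"

lemma Dl_cong: "(\<And>t. t < s ==> p t = p' t) ==> (\<And>j. j < n ==> w j = w' j) ==> Dl s n p w = Dl s n p' w'"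
 by (simp add: Dl_def)

lemma hD_cong: "(\<And>t. t < s ==> p t = p' t) ==> (\<And>j. j < n ==> w j = w' j) ==> hD a s n p w g = hD a s n p' w' g"
 unfolding hD_def using Dl_cong[of s p p' n w w'] by simp

text \<open>For fixed R, subtracting 1 on R is injective on the lists that are positive on R and
  lowers the total by k; the binomial coefficient counts the sets R.\<close>

lemma sum_WS_wR:
 fixes X :: "(nat => nat) => nat"
 assumes X: "\<And>w w'. (\<And>j. j < n ==> w j = w' j) ==> X w = X w'"
 shows "(\<Sum>l\<in>WS n N. \<Sum>R\<in>Rset n ((!) l) k. X (wR ((!) l) R)) \<le> (n choose k) * (\<Sum>l\<in>WS n (N - k). X ((!) l))"
proof -
 let ?RR = "{R. R \<subseteq> {..<n} \<and> card R = k}"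
 have finR: "finite ?RR" by (rule finite_subset[of _ "Pow {..<n}"]) auto
 have "(\<Sum>l\<in>WS n N. \<Sum>R\<in>Rset n ((!) l) k. X (wR ((!) l) R))
   = (\<Sum>l\<in>WS n N. \<Sum>R\<in>{R\<in>?RR. \<forall>j\<in>R. 1 \<le> l ! j}. X (wR ((!) l) R))"
  by (intro sum.cong refl) (auto simp: Rset_def)
 also have "\<dots> = (\<Sum>R\<in>?RR. \<Sum>l\<in>{l\<in>WS n N. \<forall>j\<in>R. 1 \<le> l ! j}. X (wR ((!) l) R))"
  by (rule sum.swap_restrict[OF finite_WS finR])
 also have "\<dots> \<le> (\<Sum>R\<in>?RR. \<Sum>l\<in>WS n (N - k). X ((!) l))"
 proof (rule sum_mono)
  fix R assume R: "R \<in> ?RR"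
  let ?A = "{l\<in>WS n N. \<forall>j\<in>R. 1 \<le> l ! j}" and ?d = "\<lambda>l. map (wR ((!) l) R) [0..<n]"
  have d: "?d l ! j = wR ((!) l) R j" if "j < n" for l j using that by simp
  have "(\<Sum>l\<in>?A. X (wR ((!) l) R)) = (\<Sum>l\<in>?A. X ((!) (?d l)))"
   by (intro sum.cong refl X) (simp add: d)
  also have "\<dots> = (\<Sum>l\<in>?d ` ?A. X ((!) l))"
  proof (rule sum.reindex[symmetric, unfolded o_def])
   show "inj_on ?d ?A"
   proof (rule inj_onI)
    fix l l' assume l: "l \<in> ?A" "l' \<in> ?A" "?d l = ?d l'"
    show "l = l'"
    proof (rule nth_equalityI)
     show "length l = length l'" using l WS_D(1) by auto
     fix j assume "j < length l"
     then have j: "j < n" using l WS_D(1) by auto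
     have "wR ((!) l) R j = wR ((!) l') R j" using d[OF j, of l] d[OF j, of l'] l(3) by simp
     then show "l ! j = l' ! j" using l by (cases "j \<in> R") (auto simp: le_diff_iff Suc_le_eq eq_diff_iff)
    qed
   qed
  qed
  also have "\<dots> \<le> (\<Sum>l\<in>WS n (N - k). X ((!) l))"
  proof (rule sum_mono2[OF finite_WS])
   show "?d ` ?A \<subseteq> WS n (N - k)"
   proof (rule image_subsetI)
    fix l assume l: "l \<in> ?A"
    then have "R \<in> Rset n ((!) l) k" using R by (auto simp: Rset_def)
    from sum_wR[OF this] have "(\<Sum>j<n. wR ((!) l) R j) + k = N" using WS_D(2)[of l n N] l by simp
    moreover have "(\<Sum>j<n. ?d l ! j) = (\<Sum>j<n. wR ((!) l) R j)" by (intro sum.cong refl d) simp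
    ultimately show "?d l \<in> WS n (N - k)" by (intro WS_I) simp_all
   qed
  qed simp
  finally show "(\<Sum>l\<in>?A. X (wR ((!) l) R)) \<le> (\<Sum>l\<in>WS n (N - k). X ((!) l))" .
 qed
 also have "\<dots> = (n choose k) * (\<Sum>l\<in>WS n (N - k). X ((!) l))"
  using n_subsets[of "{..<n}" k] by simp
 finally show ?thesis .
qed

lemma HL_rule:
 assumes t: "t < length ps"
  and le: "\<And>l. l \<in> WS n N ==> hD TYPE('a::field_char_0) (length ps) n ((!) ps) ((!) l) g
   \<le> hD TYPE('a) (length ps) n (((!) ps)(t := q)) ((!) l) g
    + (if c then \<Sum>R\<in>Rset n ((!) l) k. hD TYPE('a) (length ps) n (((!) ps)(t := 0)) (wR ((!) l) R) g' else 0)"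
 shows "HL TYPE('a) n ps N g \<le> HL TYPE('a) n (ps[t := q]) N g
  + (if c then (n choose k) * HL TYPE('a) n (ps[t := 0]) (N - k) g' else 0)"
proof -
 have e: "hD TYPE('a) (length ps) n (((!) ps)(t := q)) w g = hD TYPE('a) (length ps) n ((!) (ps[t := q])) w g" for q w g
  using t by (intro hD_cong) (auto simp: nth_list_update)
 have "HL TYPE('a) n ps N g \<le> (\<Sum>l\<in>WS n N. hD TYPE('a) (length ps) n ((!) (ps[t := q])) ((!) l) g
   + (if c then \<Sum>R\<in>Rset n ((!) l) k. hD TYPE('a) (length ps) n ((!) (ps[t := 0])) (wR ((!) l) R) g' else 0))"
  unfolding HL_def by (rule sum_mono) (use le in \<open>simp only: e\<close>)
 also have "\<dots> = HL TYPE('a) n (ps[t := q]) N g + (if c then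
   \<Sum>l\<in>WS n N. \<Sum>R\<in>Rset n ((!) l) k. hD TYPE('a) (length ps) n ((!) (ps[t := 0])) (wR ((!) l) R) g' else 0)"
  by (cases c) (simp_all add: HL_def sum.distrib)
 also have "\<dots> \<le> HL TYPE('a) n (ps[t := q]) N g
   + (if c then (n choose k) * HL TYPE('a) n (ps[t := 0]) (N - k) g' else 0)"
  using sum_WS_wR[of n "\<lambda>w. hD TYPE('a) (length ps) n ((!) (ps[t := 0])) w g'" k N, OF hD_cong]
  by (cases c) (simp_all add: HL_def)
 finally show ?thesis .
qed

lemma HL_R1:
 assumes t: "t < length ps" "ps ! t = Suc q"
 shows "HL TYPE('a::field_char_0) n ps N g \<le> HL TYPE('a) n (ps[t := q]) N g
  + (if Suc q \<le> g then (n choose Suc q) * HL TYPE('a) n (ps[t := 0]) (N - Suc q) (g - Suc q) else 0)"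
proof (rule HL_rule[OF t(1)])
 fix l
 show "hD TYPE('a) (length ps) n ((!) ps) ((!) l) g
   \<le> hD TYPE('a) (length ps) n (((!) ps)(t := q)) ((!) l) g
    + (if Suc q \<le> g then \<Sum>R\<in>Rset n ((!) l) (Suc q). hD TYPE('a) (length ps) n (((!) ps)(t := 0)) (wR ((!) l) R) (g - Suc q) else 0)"
  using R1[OF t(1), of n "(!) ps" q "(!) l" g, where 'a='a] fun_upd_idem[of "(!) ps" t "Suc q"] t(2) by simp
qed

lemma HL_R2:
 assumes t: "t < length ps"
 shows "HL TYPE('a::field_char_0) n ps N g \<le> HL TYPE('a) n (ps[t := Suc (ps ! t)]) N g
  + (if ps ! t \<le> g then (n choose Suc (ps ! t)) * HL TYPE('a) n (ps[t := 0]) (N - Suc (ps ! t)) (g - ps ! t) else 0)"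
proof (rule HL_rule[OF t(1)])
 fix l
 show "hD TYPE('a) (length ps) n ((!) ps) ((!) l) g
   \<le> hD TYPE('a) (length ps) n (((!) ps)(t := Suc (ps ! t))) ((!) l) g
    + (if ps ! t \<le> g then \<Sum>R\<in>Rset n ((!) l) (Suc (ps ! t)). hD TYPE('a) (length ps) n (((!) ps)(t := 0)) (wR ((!) l) R) (g - ps ! t) else 0)"
  using R2[OF t(1), of n "(!) ps" "ps ! t" "(!) l" g, where 'a='a] by simp
qed

abbreviation supp_rows :: "nat list => nat set" where "supp_rows ps \<equiv> {t. t < length ps \<and> ps ! t \<noteq> 0}"

lemma card_supp_rows: "card (supp_rows ps) = length (filter (\<lambda>x. x \<noteq> 0) ps)"
 by (rule length_filter_conv_card[symmetric])

lemma sum_rows: "(\<Sum>t<length ps. ps ! t) = sum_list (ps :: nat list)"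
 by (simp add: sum_list_sum_nth atLeast0LessThan)

lemma hD_small:
 assumes "(\<Sum>j<n. w j) = N" "T \<subseteq> supp_rows ps" "length (filter (\<lambda>x. x \<noteq> 0) ps) + g \<le> N + card T"
  and "(\<Sum>t\<in>T. ps ! t) + g < sum_list ps"
 shows "hD TYPE('a::field_char_0) (length ps) n ((!) ps) w g = 0"
 by (rule vanish_small[where A = "supp_rows ps" and T = T]) (use assms in \<open>simp_all only: card_supp_rows sum_rows, auto\<close>)

lemma hD_large:
 assumes "(\<Sum>j<n. w j) = N" "U \<subseteq> {..<length ps}" "card U = Suc (N - g)" "g \<le> N"
  and "(N - g) * (n - 1) + sum_list ps < (\<Sum>t\<in>U. ps ! t) + g"
 shows "hD TYPE('a::field_char_0) (length ps) n ((!) ps) w g = 0"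
 by (rule vanish_large[where U = U and c = "N - g"]) (use assms in \<open>auto simp: sum_rows\<close>)

lemma HL_small:
 assumes "T \<subseteq> supp_rows ps" "length (filter (\<lambda>x. x \<noteq> 0) ps) + g \<le> N + card T"
  and "(\<Sum>t\<in>T. ps ! t) + g < sum_list ps"
 shows "HL TYPE('a::field_char_0) n ps N g = 0"
 unfolding HL_def by (intro sum.neutral ballI hD_small[where N = N, OF _ assms]) (rule WS_D)

lemma HL_large:
 assumes "U \<subseteq> {..<length ps}" "card U = Suc (N - g)" "g \<le> N"
  and "(N - g) * (n - 1) + sum_list ps < (\<Sum>t\<in>U. ps ! t) + g"
 shows "HL TYPE('a::field_char_0) n ps N g = 0"
 unfolding HL_def by (intro sum.neutral ballI hD_large[where N = N, OF _ assms]) (rule WS_D)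

lemma HL_gr: "N < g ==> HL TYPE('a::field_char_0) n ps N g = 0"
 unfolding HL_def by (intro sum.neutral ballI hD_card) (auto dest: WS_D)

lemma HL_top:
 assumes "sum_list ps < g"
 shows "HL TYPE('a::field_char_0) n ps N g = 0"
 unfolding HL_def
proof (intro sum.neutral ballI)
 fix l
 have "card I \<noteq> g" if "I \<in> Dl (length ps) n ((!) ps) ((!) l)" for I
  using card_rows[OF DlD(1)[OF that]] sum_mono[of "{..<length ps}" "\<lambda>t. card (rw t I)" "(!) ps"] DlD(2)[OF that]
   assms sum_rows[of ps] by auto
 then have "gr (Dl (length ps) n ((!) ps) ((!) l)) g = {}" by (auto simp: gr_def)
 then show "hD TYPE('a) (length ps) n ((!) ps) ((!) l) g = 0"
  unfolding hD_def by (rule hh_empty_gr[OF family_Dl])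
qed

lemma HL_corner:
 assumes "length (filter (\<lambda>x. x \<noteq> 0) ps) = Suc c" "g = c * (n - 1)" "N = g + c" "0 < n"
 shows "HL TYPE('a::field_char_0) n ps N g \<le> 1"
proof -
 have c: "hD TYPE('a) (length ps) n ((!) ps) ((!) l) g \<le> 1 \<and>
  ((\<exists>j<n. l ! j \<noteq> c) --> hD TYPE('a) (length ps) n ((!) ps) ((!) l) g = 0)" if "l \<in> WS n N" for l
 proof (rule corner[where A = "supp_rows ps"])
  show "(\<Sum>j<n. l ! j) = g + c" using WS_D(2)[OF that] assms(3) by simp
 qed (use assms in \<open>simp_all only: card_supp_rows, auto\<close>)
 let ?X = "{l\<in>WS n N. \<forall>j<n. l ! j = c}"
 have "?X \<subseteq> {replicate n c}"
 proof
  fix l assume "l \<in> ?X"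
  then show "l \<in> {replicate n c}" using WS_D(1)[of l n N] by (auto intro: nth_equalityI)
 qed
 then have X: "card ?X \<le> 1" using card_mono[of "{replicate n c}" ?X] by simp
 have "HL TYPE('a) n ps N g = (\<Sum>l\<in>?X. hD TYPE('a) (length ps) n ((!) ps) ((!) l) g)"
  unfolding HL_def by (rule sum.mono_neutral_right) (use c in auto)
 also have "\<dots> \<le> (\<Sum>l\<in>?X. 1)" by (rule sum_mono) (use c in auto)
 finally show ?thesis using X by simp
qed

section \<open>Generating functions of row-bounded sets and Euler characteristics\<close>

definition rp :: "nat => nat list => nat poly" where
 "rp n ps = prod_list (map (\<lambda>q. Poly (map ((choose) n) [0..<Suc q])) ps)"

definition RF :: "nat => nat => (nat => nat) => nat => (nat \<times> nat) set set" where
 "RF s n p g = {I. I \<subseteq> cells s n \<and> (\<forall>t<s. card (rw t I) \<le> p t) \<and> card I = g}"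

lemma finite_RF: "finite (RF s n p g)"
 by (rule finite_subset[of _ "Pow (cells s n)"]) (auto simp: RF_def)

lemma RF_Suc: "card (RF (Suc s) n p g) = (\<Sum>a\<le>g. (if a \<le> p s then n choose a else 0) * card (RF s n p (g - a)))"
proof -
 let ?S = "SIGMA a:{..g}. {R. R \<subseteq> {..<n} \<and> card R = a \<and> a \<le> p s} \<times> RF s n p (g - a)"
 have "bij_betw (\<lambda>I. (card (rw s I), rw s I, {x\<in>I. fst x \<noteq> s})) (RF (Suc s) n p g) ?S"
 proof (rule bij_betw_byWitness[where f' = "\<lambda>(a, R, I). I \<union> {s} \<times> R"])
  show "\<forall>I\<in>RF (Suc s) n p g. (\<lambda>(a, R, I). I \<union> {s} \<times> R) (card (rw s I), rw s I, {x\<in>I. fst x \<noteq> s}) = I"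
   by (auto simp: rw_def)
  have r1: "rw t ({x\<in>I. fst x \<noteq> s}) = rw t I" if "t < s" for t I using that by (auto simp: rw_def)
  have r2: "rw t (I \<union> {s} \<times> R) = (if t = s then R else rw t I)" if "I \<subseteq> cells s n" for t I R
   using that by (auto simp: rw_def)
  have sub: "{x\<in>I. fst x \<noteq> s} \<subseteq> cells s n" if "I \<subseteq> cells (Suc s) n" for I using that by force
  have cI: "card I = card (rw s I) + card {x\<in>I. fst x \<noteq> s}" if I: "I \<subseteq> cells (Suc s) n" for I
   unfolding card_rows[OF I] card_rows[OF sub[OF I]] by (simp add: r1)
  show "(\<lambda>I. (card (rw s I), rw s I, {x\<in>I. fst x \<noteq> s})) ` RF (Suc s) n p g \<subseteq> ?S"
  proof (rule image_subsetI)
   fix I assume "I \<in> RF (Suc s) n p g"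
   then have I: "I \<subseteq> cells (Suc s) n" "\<And>t. t < Suc s ==> card (rw t I) \<le> p t" "card I = g" by (auto simp: RF_def)
   have "{x\<in>I. fst x \<noteq> s} \<in> RF s n p (g - card (rw s I))"
    using I(2) sub[OF I(1)] cI[OF I(1)] I(3) by (auto simp: RF_def r1)
   then show "(card (rw s I), rw s I, {x\<in>I. fst x \<noteq> s}) \<in> ?S"
    using I(2)[of s] cI[OF I(1)] I(3) fin_rw(2)[OF I(1), of s] by simp
  qed
  show "(\<lambda>(a, R, I). I \<union> {s} \<times> R) ` ?S \<subseteq> RF (Suc s) n p g"
  proof
   fix K assume "K \<in> (\<lambda>(a, R, I). I \<union> {s} \<times> R) ` ?S"
   then obtain a R I where K: "K = I \<union> {s} \<times> R" "a \<le> g" "R \<subseteq> {..<n}" "card R = a" "a \<le> p s" "I \<in> RF s n p (g - a)" by auto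
   have I: "I \<subseteq> cells s n" "\<And>t. t < s ==> card (rw t I) \<le> p t" "card I = g - a" using K(6) by (auto simp: RF_def)
   have KK: "K \<subseteq> cells (Suc s) n" using K(1,3) I(1) by (auto simp: less_Suc_eq)
   have "{x\<in>K. fst x \<noteq> s} = I" using K(1) I(1) by auto
   then have "card K = g" using cI[OF KK] r2[OF I(1), of s R] K I(3) by simp
   moreover have "card (rw t K) \<le> p t" if "t < Suc s" for t
    using I(2)[of t] K(4,5) that by (cases "t = s") (simp_all add: K(1) r2[OF I(1)])
   ultimately show "K \<in> RF (Suc s) n p g" using KK by (simp add: RF_def)
  qed
  show "\<forall>y\<in>?S. (card (rw s ((\<lambda>(a, R, I). I \<union> {s} \<times> R) y)), rw s ((\<lambda>(a, R, I). I \<union> {s} \<times> R) y),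
    {x\<in>(\<lambda>(a, R, I). I \<union> {s} \<times> R) y. fst x \<noteq> s}) = y"
  proof
   fix y assume "y \<in> ?S"
   then obtain a R I where K: "y = (a, R, I)" "card R = a" "I \<subseteq> cells s n" by (auto simp: RF_def)
   have "{x\<in>I \<union> {s} \<times> R. fst x \<noteq> s} = I" using K(3) by auto
   then show "(card (rw s ((\<lambda>(a, R, I). I \<union> {s} \<times> R) y)), rw s ((\<lambda>(a, R, I). I \<union> {s} \<times> R) y),
    {x\<in>(\<lambda>(a, R, I). I \<union> {s} \<times> R) y. fst x \<noteq> s}) = y" using K r2[OF K(3), of s R] by simp
  qed
 qed
 then have "card (RF (Suc s) n p g) = card ?S" by (rule bij_betw_same_card)
 also have "\<dots> = (\<Sum>a\<le>g. card ({R. R \<subseteq> {..<n} \<and> card R = a \<and> a \<le> p s} \<times> RF s n p (g - a)))"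
  by (intro card_SigmaI) (auto intro!: finite_cartesian_product finite_RF intro: finite_subset[of _ "Pow {..<n}"])
 also have "\<dots> = (\<Sum>a\<le>g. (if a \<le> p s then n choose a else 0) * card (RF s n p (g - a)))"
  using n_subsets[of "{..<n}"] by (intro sum.cong refl) (simp add: card_cartesian_product)
 finally show ?thesis .
qed

lemma card_RF: "card (RF (length ps) n ((!) ps) g) = coeff (rp n ps) g"
proof (induction ps arbitrary: g rule: rev_induct)
 case Nil
 have "RF 0 n p g = (if g = 0 then {{}} else {})" for p by (auto simp: RF_def)
 then show ?case by (simp add: rp_def)
next
 case (snoc q ps)
 have e: "RF (length ps) n ((!) (ps @ [q])) g = RF (length ps) n ((!) ps) g" for g
  unfolding RF_def by (simp add: nth_append)
 have c: "nth_default 0 (map ((choose) n) [0..<Suc q]) b = (if b \<le> q then n choose b else 0)" for b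
  unfolding nth_default_def by (auto simp del: upt_Suc)
 have "rp n (ps @ [q]) = Poly (map ((choose) n) [0..<Suc q]) * rp n ps" by (simp add: rp_def mult.commute)
 then show ?case using snoc by (simp add: RF_Suc e coeff_mult c del: upt_Suc)
qed

text \<open>Double counting of pairs of a row-bounded set I and an admissible l: if I has g cells,
  then l is the vector of column counts of I plus a weak composition of N - g into n parts.\<close>

lemma HL_euler:
 assumes "0 < n"
 shows "(\<Sum>g\<leftarrow>[0..<Suc N]. (-1) ^ g * int (HL TYPE('a::field_char_0) n ps N g))
  = (\<Sum>g\<leftarrow>[0..<Suc N]. (-1) ^ g * int (coeff (rp n ps) g * ((N - g + (n - 1)) choose (n - 1))))"
proof -
 let ?D = "\<lambda>l. Dl (length ps) n ((!) ps) ((!) l)"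
 have c: "(\<Sum>g\<leftarrow>[0..<Suc N]. f g) = (\<Sum>g\<le>N. f g)" for f :: "nat => int"
  by (simp only: sum_set_upt_conv_sum_list_nat[symmetric] set_upt atLeast0LessThan lessThan_Suc_atMost)
 have "(\<Sum>g\<le>N. (-1) ^ g * int (HL TYPE('a) n ps N g))
   = (\<Sum>l\<in>WS n N. \<Sum>g\<le>N. (-1) ^ g * int (hD TYPE('a) (length ps) n ((!) ps) ((!) l) g))"
  unfolding HL_def of_nat_sum sum_distrib_left by (rule sum.swap)
 also have "\<dots> = (\<Sum>l\<in>WS n N. \<Sum>g\<le>N. (-1) ^ g * int (card (gr (?D l) g)))"
 proof (rule sum.cong[OF refl])
  fix l assume l: "l \<in> WS n N"
  have "card I \<le> N" if "I \<in> ?D l" for I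
   using card_cols[OF DlD(1)[OF that]] sum_mono[of "{..<n}" "\<lambda>j. card (cw j I)" "(!) l"] DlD(3)[OF that] WS_D(2)[OF l]
   by auto
  then show "(\<Sum>g\<le>N. (-1) ^ g * int (hD TYPE('a) (length ps) n ((!) ps) ((!) l) g))
    = (\<Sum>g\<le>N. (-1) ^ g * int (card (gr (?D l) g)))"
   unfolding hD_def by (rule euler[OF family_Dl])
 qed
 also have "\<dots> = (\<Sum>g\<le>N. (-1) ^ g * int (\<Sum>l\<in>WS n N. card (gr (?D l) g)))"
  unfolding of_nat_sum sum_distrib_left by (rule sum.swap)
 also have "\<dots> = (\<Sum>g\<le>N. (-1) ^ g * int (coeff (rp n ps) g * ((N - g + (n - 1)) choose (n - 1))))"
 proof (rule sum.cong[OF refl])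
  fix g assume g: "g \<in> {..N}"
  let ?P = "\<lambda>l I. \<forall>j<n. card (cw j I) \<le> l ! j" and ?RF = "RF (length ps) n ((!) ps) g"
  have "(\<Sum>l\<in>WS n N. card (gr (?D l) g)) = (\<Sum>l\<in>WS n N. \<Sum>I\<in>{I\<in>?RF. ?P l I}. 1)"
  proof (intro sum.cong refl)
   fix l :: "nat list"
   have "gr (?D l) g = {I\<in>?RF. ?P l I}" by (auto simp: gr_def Dl_def RF_def)
   then show "card (gr (?D l) g) = (\<Sum>I\<in>{I\<in>?RF. ?P l I}. 1)" by simp
  qed
  also have "\<dots> = (\<Sum>I\<in>?RF. \<Sum>l\<in>{l\<in>WS n N. ?P l I}. 1)"
   by (rule sum.swap_restrict[OF finite_WS finite_RF])
  also have "\<dots> = (\<Sum>I\<in>?RF. card (WS n (N - g)))"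
  proof (intro sum.cong refl)
   fix I assume "I \<in> ?RF"
   then have I: "I \<subseteq> cells (length ps) n" "card I = g" by (auto simp: RF_def)
   let ?c = "\<lambda>j. card (cw j I)"
   have sc: "(\<Sum>j<n. ?c j) = g" using card_cols[OF I(1)] I(2) by simp
   have "bij_betw (\<lambda>l. map (\<lambda>j. l ! j + ?c j) [0..<n]) (WS n (N - g)) {l\<in>WS n N. ?P l I}"
   proof (rule bij_betw_byWitness[where f' = "\<lambda>l. map (\<lambda>j. l ! j - ?c j) [0..<n]"])
    show "\<forall>l\<in>WS n (N - g). map (\<lambda>j. map (\<lambda>j. l ! j + ?c j) [0..<n] ! j - ?c j) [0..<n] = l"
     by (auto intro!: nth_equalityI dest: WS_D(1))
    show "\<forall>l\<in>{l\<in>WS n N. ?P l I}. map (\<lambda>j. map (\<lambda>j. l ! j - ?c j) [0..<n] ! j + ?c j) [0..<n] = l"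
     by (auto intro!: nth_equalityI dest: WS_D(1))
    show "(\<lambda>l. map (\<lambda>j. l ! j + ?c j) [0..<n]) ` WS n (N - g) \<subseteq> {l\<in>WS n N. ?P l I}"
    proof (rule image_subsetI)
     fix l assume l: "l \<in> WS n (N - g)"
     have "(\<Sum>j<n. l ! j + ?c j) = N" using WS_D(2)[OF l] sc g by (simp add: sum.distrib)
     then have "map (\<lambda>j. l ! j + ?c j) [0..<n] \<in> WS n N" by (intro WS_I) simp_all
     then show "map (\<lambda>j. l ! j + ?c j) [0..<n] \<in> {l\<in>WS n N. ?P l I}" by simp
    qed
    show "(\<lambda>l. map (\<lambda>j. l ! j - ?c j) [0..<n]) ` {l\<in>WS n N. ?P l I} \<subseteq> WS n (N - g)"
    proof (rule image_subsetI)
     fix l assume l: "l \<in> {l\<in>WS n N. ?P l I}"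
     have "(\<Sum>j<n. l ! j - ?c j) = (\<Sum>j<n. l ! j) - (\<Sum>j<n. ?c j)"
      by (rule sum_subtractf_nat) (use l in simp)
     then have "(\<Sum>j<n. l ! j - ?c j) = N - g" using l WS_D(2)[of l n N] sc by simp
     then show "map (\<lambda>j. l ! j - ?c j) [0..<n] \<in> WS n (N - g)" by (intro WS_I) simp_all
    qed
   qed
   then have "card {l\<in>WS n N. ?P l I} = card (WS n (N - g))" by (rule bij_betw_same_card[symmetric])
   then show "(\<Sum>l\<in>{l\<in>WS n N. ?P l I}. 1) = card (WS n (N - g))" by simp
  qed
  also have "\<dots> = coeff (rp n ps) g * ((N - g + (n - 1)) choose (n - 1))"
   by (simp add: card_RF card_WS[OF assms])
  finally have eq: "(\<Sum>l\<in>WS n N. card (gr (?D l) g)) = coeff (rp n ps) g * ((N - g + (n - 1)) choose (n - 1))" .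
  show "(-1) ^ g * int (\<Sum>l\<in>WS n N. card (gr (?D l) g))
   = (-1) ^ g * int (coeff (rp n ps) g * ((N - g + (n - 1)) choose (n - 1)))" unfolding eq ..
 qed
 finally show ?thesis unfolding c .
qed

section \<open>Columns that miss their bound by at most one\<close>

definition DQ :: "nat set => nat => nat => (nat => nat) => (nat => nat) => (nat \<times> nat) set set" where
 "DQ Q s n p w = {I\<in>Dl s n p w. \<forall>j\<in>Q. w j \<le> Suc (card (cw j I))}"

definition HQ :: "'a::field_char_0 itself => nat set => nat => nat list => nat => nat => nat" where
 "HQ a Q n ps N g = (\<Sum>l\<in>WS n N. hh a (cells (length ps) n) (DQ Q (length ps) n ((!) ps) ((!) l)) g)"

lemma card_cw_mono: "K \<in> Dl s n p w ==> J \<subseteq> K ==> card (cw j J) \<le> card (cw j K)"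
 by (rule card_mono[OF fin_cw(1)[OF DlD(1)] cw_mono])

lemma family_DQ: "family (cells s n) (DQ Q s n p w)"
 unfolding DQ_def
proof (rule family_sub[OF family_Dl])
 fix I J K assume a: "\<forall>j\<in>Q. w j \<le> Suc (card (cw j J))" "J \<subseteq> K" "K \<in> Dl s n p w"
 show "\<forall>j\<in>Q. w j \<le> Suc (card (cw j K))"
 proof
  fix j assume "j \<in> Q"
  then show "w j \<le> Suc (card (cw j K))" using a(1) card_cw_mono[OF a(3,2), of j] by fastforce
 qed
qed

text \<open>The new condition on column j removes the closed subfamily of sets with at most w j - 2
  cells there, which is the same kind of family with w j lowered by 2. The bound is
  \<open>les2\<close> for this pair.\<close>

lemma hh_DQ_insert:
 assumes j: "j < n" "j \<notin> Q"
 shows "hh TYPE('a::field_char_0) (cells s n) (DQ (insert j Q) s n p w) g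
  \<le> hh TYPE('a) (cells s n) (DQ Q s n p w) g
   + (if 2 \<le> w j then hh TYPE('a) (cells s n) (DQ Q s n p (w(j := w j - 2))) (g - 1) else 0)"
proof -
 let ?Y = "{I\<in>DQ Q s n p w. Suc (card (cw j I)) < w j}"
 have Y: "closed_in (DQ Q s n p w) ?Y"
  unfolding closed_in_def
 proof (intro conjI ballI impI)
  fix I J assume "I \<in> ?Y" "J \<in> DQ Q s n p w" "J \<subseteq> I"
  then show "J \<in> ?Y" using card_cw_mono[of I s n p w J j] by (auto simp: DQ_def)
 qed auto
 have e: "DQ (insert j Q) s n p w = DQ Q s n p w - ?Y" by (auto simp: DQ_def)
 have "hh TYPE('a) (cells s n) ?Y (g - 1)
   = (if 2 \<le> w j then hh TYPE('a) (cells s n) (DQ Q s n p (w(j := w j - 2))) (g - 1) else 0)"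
 proof (cases "2 \<le> w j")
  case True
  have "I \<in> ?Y \<longleftrightarrow> I \<in> DQ Q s n p (w(j := w j - 2))" for I
  proof -
   have a: "(\<forall>i\<in>Q. (w(j := w j - 2)) i \<le> Suc (card (cw i I))) = (\<forall>i\<in>Q. w i \<le> Suc (card (cw i I)))"
    using j(2) by (intro ball_cong refl) auto
   have b: "(\<forall>i<n. card (cw i I) \<le> (w(j := w j - 2)) i)
     = ((\<forall>i<n. card (cw i I) \<le> w i) \<and> Suc (card (cw j I)) < w j)" (is "?l = ?r")
   proof
    assume l: ?l
    have "card (cw i I) \<le> w i" if "i < n" for i using l[rule_format, OF that] by (cases "i = j") auto
    moreover have "Suc (card (cw j I)) < w j" using l[rule_format, OF j(1)] True by simp
    ultimately show ?r by simp
   next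
    assume r: ?r
    have "card (cw i I) \<le> (w(j := w j - 2)) i" if "i < n" for i using r that by (cases "i = j") auto
    then show ?l by simp
   qed
   show ?thesis unfolding DQ_def Dl_def mem_Collect_eq a b by blast
  qed
  then have "?Y = DQ Q s n p (w(j := w j - 2))" by blast
  then show ?thesis using True by simp
 next
  case False
  then have "?Y = {}" by auto
  then have "gr ?Y (g - 1) = {}" unfolding gr_def by blast
  from hh_empty_gr[OF conjunct1[OF family_closed[OF family_DQ Y]] this, where 'a='a] show ?thesis using False by simp
 qed
 then show ?thesis unfolding e using les2[OF family_DQ Y, of g, where 'a='a] by simp
qed

lemma HQ_insert:
 assumes j: "j < n" "j \<notin> Q"
 shows "HQ TYPE('a::field_char_0) (insert j Q) n ps N g
  \<le> HQ TYPE('a) Q n ps N g + (if 2 \<le> N then HQ TYPE('a) Q n ps (N - 2) (g - 1) else 0)"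
proof -
 define X where "X w g = hh TYPE('a) (cells (length ps) n) (DQ Q (length ps) n ((!) ps) w) g" for w g
 have Xc: "X w g = X w' g" if "\<And>j. j < n ==> w j = w' j" "\<And>j. j \<in> Q ==> w j = w' j" for w w' g
  using that Dl_cong[of "length ps" "(!) ps" "(!) ps" n w w'] by (simp add: X_def DQ_def)
 let ?A = "{l\<in>WS n N. 2 \<le> l ! j}" and ?d = "\<lambda>l. l[j := l ! j - 2]"
 have "HQ TYPE('a) (insert j Q) n ps N g
   \<le> (\<Sum>l\<in>WS n N. X ((!) l) g + (if 2 \<le> l ! j then X (((!) l)(j := l ! j - 2)) (g - 1) else 0))"
  unfolding HQ_def X_def by (intro sum_mono hh_DQ_insert j)
 also have "\<dots> = HQ TYPE('a) Q n ps N g + (\<Sum>l\<in>?A. X (((!) l)(j := l ! j - 2)) (g - 1))"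
  unfolding sum.distrib HQ_def X_def[symmetric] by (simp add: sum.inter_filter del: One_nat_def)
 also have "(\<Sum>l\<in>?A. X (((!) l)(j := l ! j - 2)) (g - 1)) = (\<Sum>l\<in>?A. X ((!) (?d l)) (g - 1))"
 proof (rule sum.cong[OF refl])
  fix l assume l: "l \<in> ?A"
  then have "((!) l)(j := l ! j - 2) = (!) (?d l)" using j(1) WS_D(1)[of l n N] by (auto simp: fun_eq_iff nth_list_update)
  then show "X (((!) l)(j := l ! j - 2)) (g - 1) = X ((!) (?d l)) (g - 1)" by simp
 qed
 also have "\<dots> = (\<Sum>l\<in>?d ` ?A. X ((!) l) (g - 1))"
 proof (rule sum.reindex[symmetric, unfolded o_def])
  show "inj_on ?d ?A"
  proof (rule inj_onI)
   fix l l' assume l: "l \<in> ?A" "l' \<in> ?A" "?d l = ?d l'"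
   have len: "length l = n" "length l' = n" using l WS_D(1) by auto
   have "l ! j - 2 = l' ! j - 2" using arg_cong[OF l(3), of "\<lambda>l. l ! j"] j len by simp
   then have ej: "l ! j = l' ! j" using l by auto
   have "(?d l)[j := l ! j] = (?d l')[j := l' ! j]" using l(3) ej by simp
   then show "l = l'" by simp
  qed
 qed
 also have "\<dots> \<le> (if 2 \<le> N then HQ TYPE('a) Q n ps (N - 2) (g - 1) else 0)"
 proof -
  have im: "?d l \<in> WS n (N - 2) \<and> 2 \<le> N" if "l \<in> ?A" for l
  proof -
   have len: "length l = n" "(\<Sum>i<n. l ! i) = N" using that WS_D by auto
   have "N = l ! j + (\<Sum>i\<in>{..<n} - {j}. l ! i)" unfolding len(2)[symmetric] by (rule sum.remove) (use j in auto)
   moreover have "(\<Sum>i<n. ?d l ! i) = ?d l ! j + (\<Sum>i\<in>{..<n} - {j}. ?d l ! i)" by (rule sum.remove) (use j in auto)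
   moreover have "(\<Sum>i\<in>{..<n} - {j}. ?d l ! i) = (\<Sum>i\<in>{..<n} - {j}. l ! i)" by (intro sum.cong) auto
   ultimately show ?thesis using that j len(1) by (intro conjI WS_I) auto
  qed
  show ?thesis
  proof (cases "2 \<le> N")
   case True
   have "(\<Sum>l\<in>?d ` ?A. X ((!) l) (g - 1)) \<le> (\<Sum>l\<in>WS n (N - 2). X ((!) l) (g - 1))"
    by (rule sum_mono2[OF finite_WS]) (use im in auto)
   then show ?thesis using True by (simp add: HQ_def X_def)
  next
   case False
   then have "?A = {}" using im by blast
   then show ?thesis by (simp only: image_empty sum.empty le0)
  qed
 qed
 finally show ?thesis by simp
qed

text \<open>Unfolded, this is the sum over k with 2 k \<le> N of (c choose k) times
  \<open>HL\<close> at column total N - 2 k and degree g - k.\<close>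

fun ch :: "'a::field_char_0 itself => nat => nat list => nat => nat => nat => nat" where
 "ch a n ps 0 N g = HL a n ps N g"
| "ch a n ps (Suc c) N g = ch a n ps c N g + (if 2 \<le> N then ch a n ps c (N - 2) (g - 1) else 0)"

lemma HQ_le_ch: "finite Q ==> Q \<subseteq> {..<n} ==> HQ TYPE('a::field_char_0) Q n ps N g \<le> ch TYPE('a) n ps (card Q) N g"
proof (induction Q arbitrary: N g rule: finite_induct)
 case empty
 then show ?case by (simp add: HQ_def HL_def DQ_def hD_def)
next
 case (insert j Q)
 then have "j < n" "Q \<subseteq> {..<n}" by auto
 have "HQ TYPE('a) (insert j Q) n ps N g
  \<le> HQ TYPE('a) Q n ps N g + (if 2 \<le> N then HQ TYPE('a) Q n ps (N - 2) (g - 1) else 0)"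
  by (rule HQ_insert[OF \<open>j < n\<close> insert.hyps(2)])
 also have "\<dots> \<le> ch TYPE('a) n ps (card Q) N g + (if 2 \<le> N then ch TYPE('a) n ps (card Q) (N - 2) (g - 1) else 0)"
  using insert.IH[OF \<open>Q \<subseteq> {..<n}\<close>] by (intro add_mono) auto
 finally show ?case using insert.hyps by simp
qed

section \<open>Numerical values for the orders four to seven\<close>

lemma binomialI: "k \<le> n ==> fact k * fact (n - k) * x = (fact n :: nat) ==> n choose k = x"
 using binomial_fact_lemma[of k n] by (metis fact_nonzero mult_cancel_left mult_eq_0_iff)

lemma choose_6:
 "7 choose 6 = (7::nat)"
 "8 choose 6 = (28::nat)"
 "9 choose 6 = (84::nat)"
 "10 choose 6 = (210::nat)"
 "11 choose 6 = (462::nat)"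
 "12 choose 6 = (924::nat)"
 "13 choose 6 = (1716::nat)"
 "14 choose 6 = (3003::nat)"
 "15 choose 6 = (5005::nat)"
 "16 choose 6 = (8008::nat)"
 "17 choose 6 = (12376::nat)"
 "18 choose 6 = (18564::nat)"
 "19 choose 6 = (27132::nat)"
 "20 choose 6 = (38760::nat)"
 "21 choose 6 = (54264::nat)"
 "22 choose 6 = (74613::nat)"
 "23 choose 6 = (100947::nat)"
 "24 choose 6 = (134596::nat)"
 "25 choose 6 = (177100::nat)"
 by (rule binomialI; simp add: fact_numeral)+
lemma choose_5:
 "6 choose 5 = (6::nat)"
 "7 choose 5 = (21::nat)"
 "8 choose 5 = (56::nat)"
 "9 choose 5 = (126::nat)"
 "10 choose 5 = (252::nat)"
 "11 choose 5 = (462::nat)"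
 "12 choose 5 = (792::nat)"
 "13 choose 5 = (1287::nat)"
 "14 choose 5 = (2002::nat)"
 "15 choose 5 = (3003::nat)"
 "16 choose 5 = (4368::nat)"
 "17 choose 5 = (6188::nat)"
 "18 choose 5 = (8568::nat)"
 by (rule binomialI; simp add: fact_numeral)+
lemma choose_4:
 "5 choose 4 = (5::nat)"
 "6 choose 4 = (15::nat)"
 "7 choose 4 = (35::nat)"
 "8 choose 4 = (70::nat)"
 "9 choose 4 = (126::nat)"
 "10 choose 4 = (210::nat)"
 "11 choose 4 = (330::nat)"
 "12 choose 4 = (495::nat)"
 by (rule binomialI; simp add: fact_numeral)+
lemma choose_rows:
 "5 choose 2 = (10::nat)"
 "5 choose 3 = (10::nat)"
 "6 choose 2 = (15::nat)"
 "6 choose 3 = (20::nat)"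
 "6 choose 4 = (15::nat)"
 "7 choose 2 = (21::nat)"
 "7 choose 3 = (35::nat)"
 "7 choose 4 = (35::nat)"
 "7 choose 5 = (21::nat)"
 by (rule binomialI; simp add: fact_numeral)+

lemma upts: "[0..<2] = [0, 1]" "[0..<3] = [0, 1, 2]" "[0..<4] = [0, 1, 2, 3]" "[0..<5] = [0, 1, 2, 3, 4]"
 "[0..<6] = [0, 1, 2, 3, 4, 5 :: nat]" "[0..<Suc (Suc 0)] = [0, 1]"
 by (simp_all add: numeral_eq_Suc)

lemma upts_long:
 "[0..<9] = [0, 1, 2, 3, 4, 5, 6, 7, 8 :: nat]"
 "[0..<12] = [0, 1, 2, 3, 4, 5, 6, 7, 8, 9, 10, 11 :: nat]"
 "[0..<14] = [0, 1, 2, 3, 4, 5, 6, 7, 8, 9, 10, 11, 12, 13 :: nat]"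
 "[0..<16] = [0, 1, 2, 3, 4, 5, 6, 7, 8, 9, 10, 11, 12, 13, 14, 15 :: nat]"
 "[0..<18] = [0, 1, 2, 3, 4, 5, 6, 7, 8, 9, 10, 11, 12, 13, 14, 15, 16, 17 :: nat]"
 "[0..<20] = [0, 1, 2, 3, 4, 5, 6, 7, 8, 9, 10, 11, 12, 13, 14, 15, 16, 17, 18, 19 :: nat]"
 by (simp_all add: numeral_eq_Suc)

lemma rp5: "rp 5 [1,2,3] = [:1, 15, 95, 335, 700, 850, 500:]"
 by (simp add: rp_def choose_rows upts del: upt_Suc)

lemma rp6: "rp 6 [1,2,3,4] = [:1, 24, 261, 1714, 7566, 23610, 53185, 86190, 97575, 71550, 27000:]"
 by (simp add: rp_def choose_rows upts del: upt_Suc)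

lemma rp7: "rp 7 [1,2,3,4,5] = [:1, 35, 574, 5887, 42357, 227087, 939918, 3067841, 7989107, 16670192, 27792261, 36601873, 37198007, 27923630, 14153895, 3781575:]"
 by (simp add: rp_def choose_rows upts del: upt_Suc)

lemma euler_5_8: "(\<Sum>g\<leftarrow>[0..<Suc 8]. (-1) ^ g * int (HL TYPE('a::field_char_0) 5 [1,2,3] 8 g)) = 35"
 unfolding HL_euler[of 5, OF zero_less_numeral] rp5 by (simp add: upts_long coeff_pCons' choose_4)

lemma euler_6_13: "(\<Sum>g\<leftarrow>[0..<Suc 13]. (-1) ^ g * int (HL TYPE('a::field_char_0) 6 [1,2,3,4] 13 g)) = 2364"
 unfolding HL_euler[of 6, OF zero_less_numeral] rp6 by (simp add: upts_long coeff_pCons' choose_5)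

lemma euler_6_11: "(\<Sum>g\<leftarrow>[0..<Suc 11]. (-1) ^ g * int (HL TYPE('a::field_char_0) 6 [1,2,3,4] 11 g)) = -318"
 unfolding HL_euler[of 6, OF zero_less_numeral] rp6 by (simp add: upts_long coeff_pCons' choose_5)

lemma euler_7_19: "(\<Sum>g\<leftarrow>[0..<Suc 19]. (-1) ^ g * int (HL TYPE('a::field_char_0) 7 [1,2,3,4,5] 19 g)) = -366919"
 unfolding HL_euler[of 7, OF zero_less_numeral] rp7 by (simp add: upts_long coeff_pCons' choose_6)

lemma euler_7_17: "(\<Sum>g\<leftarrow>[0..<Suc 17]. (-1) ^ g * int (HL TYPE('a::field_char_0) 7 [1,2,3,4,5] 17 g)) = 41601"
 unfolding HL_euler[of 7, OF zero_less_numeral] rp7 by (simp add: upts_long coeff_pCons' choose_6)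

lemma euler_7_15: "(\<Sum>g\<leftarrow>[0..<Suc 15]. (-1) ^ g * int (HL TYPE('a::field_char_0) 7 [1,2,3,4,5] 15 g)) = -6139"
 unfolding HL_euler[of 7, OF zero_less_numeral] rp7 by (simp add: upts_long coeff_pCons' choose_6)


declare One_nat_def [simp del]

text \<open>The vanishing theorems leave one or two degrees in each Euler characteristic. One
  remaining degree gives the value, two give a linear relation between them.\<close>

lemma HL_123456:
 shows HL7_19: "HL TYPE('a::field_char_0) 7 [1,2,3,4,5] 19 15 = 366919"
  and HL6_13: "HL TYPE('a) 6 [1,2,3,4] 13 10 = 2364"
  and HL6_11: "HL TYPE('a) 6 [1,2,3,4] 11 9 = 318"
  and HL5_8: "HL TYPE('a) 5 [1,2,3] 8 6 = 35"
  and HL7_15: "HL TYPE('a) 7 [1,2,3,4,5] 15 13 = 6139 + HL TYPE('a) 7 [1,2,3,4,5] 15 12"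
  and HL7_17: "HL TYPE('a) 7 [1,2,3,4,5] 17 14 = 41601 + HL TYPE('a) 7 [1,2,3,4,5] 17 15"
proof -
 have 1: "HL TYPE('a) 7 [1,2,3,4,5] 19 g = 0" if "g < 15" for g
  by (rule HL_small[where T = "{}"]) (use that in auto)
 have 2: "HL TYPE('a) 7 [1,2,3,4,5] N g = 0" if "15 < g" for g N by (rule HL_top) (use that in auto)
 show "HL TYPE('a::field_char_0) 7 [1,2,3,4,5] 19 15 = 366919"
  using euler_7_19[where 'a='a] by (simp add: upts_long 1 2)
 have 3: "HL TYPE('a) 6 [1,2,3,4] 13 g = 0" if "g < 10" for g
  by (rule HL_small[where T = "{}"]) (use that in auto)
 have 4: "HL TYPE('a) 6 [1,2,3,4] N g = 0" if "10 < g" for g N by (rule HL_top) (use that in auto)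
 show "HL TYPE('a) 6 [1,2,3,4] 13 10 = 2364"
  using euler_6_13[where 'a='a] by (simp add: upts_long 3 4)
 have 5: "HL TYPE('a) 6 [1,2,3,4] 11 g = 0" if "g < 8" for g
  by (rule HL_small[where T = "{}"]) (use that in auto)
 have 6: "HL TYPE('a) 6 [1,2,3,4] 11 8 = 0"
  by (rule HL_small[where T = "{0}"]) auto
 have 7: "HL TYPE('a) 6 [1,2,3,4] 11 10 = 0"
  by (rule HL_large[where U = "{2,3}"]) auto
 show "HL TYPE('a) 6 [1,2,3,4] 11 9 = 318"
  using euler_6_11[where 'a='a] by (simp add: upts_long 4 5 6 7)
 have 8: "HL TYPE('a) 5 [1,2,3] 8 g = 0" if "g < 6" for g
  by (rule HL_small[where T = "{}"]) (use that in auto)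
 have 9: "HL TYPE('a) 5 [1,2,3] N g = 0" if "6 < g" for g N by (rule HL_top) (use that in auto)
 show "HL TYPE('a) 5 [1,2,3] 8 6 = 35"
  using euler_5_8[where 'a='a] by (simp add: upts_long 8 9)
 have 10: "HL TYPE('a) 7 [1,2,3,4,5] 15 g = 0" if "g < 11" for g
  by (rule HL_small[where T = "{}"]) (use that in auto)
 have 11: "HL TYPE('a) 7 [1,2,3,4,5] 15 11 = 0"
  by (rule HL_small[where T = "{0}"]) auto
 have 12: "HL TYPE('a) 7 [1,2,3,4,5] 15 14 = 0"
  by (rule HL_large[where U = "{3,4}"]) auto
 have 13: "HL TYPE('a) 7 [1,2,3,4,5] 15 15 = 0"
  by (rule HL_large[where U = "{4}"]) auto
 show "HL TYPE('a) 7 [1,2,3,4,5] 15 13 = 6139 + HL TYPE('a) 7 [1,2,3,4,5] 15 12"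
  using euler_7_15[where 'a='a] by (simp add: upts_long 2 10 11 12 13)
 have 14: "HL TYPE('a) 7 [1,2,3,4,5] 17 g = 0" if "g < 13" for g
  by (rule HL_small[where T = "{}"]) (use that in auto)
 have 15: "HL TYPE('a) 7 [1,2,3,4,5] 17 13 = 0"
  by (rule HL_small[where T = "{0}"]) auto
 show "HL TYPE('a) 7 [1,2,3,4,5] 17 14 = 41601 + HL TYPE('a) 7 [1,2,3,4,5] 17 15"
  using euler_7_17[where 'a='a] by (simp add: upts_long 2 14 15)
qed

text \<open>Lowering the first rows to 0 with \<open>R1\<close> ends in a corner complex, whose
  homology is at most 1. The constants count the row sets chosen on the way: 147 = 7 * 21, 90 = 6 *
  15 and 5.\<close>

lemma HL_bounds:
 shows HL7_17': "HL TYPE('a::field_char_0) 7 [1,2,3,4,5] 17 15 \<le> 147"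
  and HL6_9: "HL TYPE('a) 6 [1,2,3,4] 9 8 \<le> 90"
  and HL5_6: "HL TYPE('a) 5 [1,2,3] 6 5 \<le> 5"
proof -
 have 1: "HL TYPE('a) 7 [0,1,3,4,5] 16 14 = 0" "HL TYPE('a) 7 [0,2,3,4,5] 17 15 = 0" by (rule HL_top; simp)+
 have 2: "HL TYPE('a) 7 [0,0,3,4,5] 14 12 \<le> 1" by (rule HL_corner[where c = 2]) auto
 have "HL TYPE('a) 7 [1,2,3,4,5] 17 15 \<le> 7 * HL TYPE('a) 7 [0,2,3,4,5] 16 14"
  using HL_R1[of 0 "[1,2,3,4,5]" 0 7 17 15, where 'a='a] 1 by simp
 moreover have "HL TYPE('a) 7 [0,2,3,4,5] 16 14 \<le> 21 * HL TYPE('a) 7 [0,0,3,4,5] 14 12"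
  using HL_R1[of "Suc 0" "[0,2,3,4,5]" 1 7 16 14, where 'a='a] 1 by (simp add: choose_rows)
 ultimately show "HL TYPE('a) 7 [1,2,3,4,5] 17 15 \<le> 147" using 2 by linarith
 have 3: "HL TYPE('a) 6 [0,2,3,4] 9 8 = 0" "HL TYPE('a) 6 [0,1,3,4] 8 7 = 0"
  by (rule HL_large[where U = "{2,3}"]; simp)+
 have 4: "HL TYPE('a) 6 [0,0,3,4] 6 5 \<le> 1" by (rule HL_corner[where c = 1]) auto
 have "HL TYPE('a) 6 [1,2,3,4] 9 8 \<le> 6 * HL TYPE('a) 6 [0,2,3,4] 8 7"
  using HL_R1[of 0 "[1,2,3,4]" 0 6 9 8, where 'a='a] 3 by simp
 moreover have "HL TYPE('a) 6 [0,2,3,4] 8 7 \<le> 15 * HL TYPE('a) 6 [0,0,3,4] 6 5"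
  using HL_R1[of "Suc 0" "[0,2,3,4]" 1 6 8 7, where 'a='a] 3 by (simp add: choose_rows)
 ultimately show "HL TYPE('a) 6 [1,2,3,4] 9 8 \<le> 90" using 4 by linarith
 have 5: "HL TYPE('a) 5 [0,2,3] 6 5 = 0" by (rule HL_large[where U = "{1,2}"]) auto
 have 6: "HL TYPE('a) 5 [0,2,3] 5 4 \<le> 1" by (rule HL_corner[where c = 1]) auto
 show "HL TYPE('a) 5 [1,2,3] 6 5 \<le> 5"
  using HL_R1[of 0 "[1,2,3]" 0 5 6 5, where 'a='a] 5 6 by simp
qed

text \<open>The expansion of \<open>ch\<close> stops early: the term with N = g vanishes by
  \<open>HL_large\<close> and the later ones have degree above the total. The constants are 41748 =
  41601 + 147, 4854 = 2364 + 5 * 318 + 10 * 90 and 55 = 35 + 4 * 5. For order seven two terms stay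
  symbolic and are bounded separately by \<open>HL_u\<close> and \<open>HL_v\<close>.\<close>

lemma ch_bounds:
 shows ch7: "ch TYPE('a::field_char_0) 7 [1,2,3,4,5] (Suc (Suc (Suc (Suc (Suc (Suc 0)))))) 19 15
   \<le> 366919 + 6 * 41748 + 15 * (6139 + HL TYPE('a) 7 [1,2,3,4,5] 15 12) + 20 * HL TYPE('a) 7 [1,2,3,4,5] 13 12"
  and ch6: "ch TYPE('a) 6 [1,2,3,4] (Suc (Suc (Suc (Suc (Suc 0))))) 13 10 \<le> 4854"
  and ch5: "ch TYPE('a) 5 [1,2,3] (Suc (Suc (Suc (Suc 0)))) 8 6 \<le> 55"
  and ch4: "ch TYPE('a) 4 [1,2] (Suc (Suc (Suc 0))) 4 3 \<le> 1"
proof -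
 have 1: "HL TYPE('a) 7 [1,2,3,4,5] 11 11 = 0" by (rule HL_large[where U = "{4}"]) auto
 have 2: "HL TYPE('a) 6 [1,2,3,4] 7 7 = 0" by (rule HL_large[where U = "{3}"]) auto
 have 3: "HL TYPE('a) 5 [1,2,3] 4 4 = 0" by (rule HL_large[where U = "{2}"]) auto
 have 4: "HL TYPE('a) 4 [1,2] 2 2 = 0" by (rule HL_large[where U = "{1}"]) auto
 have 5: "HL TYPE('a) 4 [1,2] 4 3 \<le> 1" by (rule HL_corner[where c = 1]) auto
 note g = HL_gr[where 'a='a]
 show "ch TYPE('a) 7 [1,2,3,4,5] (Suc (Suc (Suc (Suc (Suc (Suc 0)))))) 19 15
   \<le> 366919 + 6 * 41748 + 15 * (6139 + HL TYPE('a) 7 [1,2,3,4,5] 15 12) + 20 * HL TYPE('a) 7 [1,2,3,4,5] 13 12"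
  using HL7_17'[where 'a='a] by (simp add: HL7_19 HL7_17 HL7_15 1 g)
 show "ch TYPE('a) 6 [1,2,3,4] (Suc (Suc (Suc (Suc (Suc 0))))) 13 10 \<le> 4854"
  using HL6_9[where 'a='a] by (simp add: HL6_13 HL6_11 2 g)
 show "ch TYPE('a) 5 [1,2,3] (Suc (Suc (Suc (Suc 0)))) 8 6 \<le> 55"
  using HL5_6[where 'a='a] by (simp add: HL5_8 3 g)
 show "ch TYPE('a) 4 [1,2] (Suc (Suc (Suc 0))) 4 3 \<le> 1"
  using 5 by (simp add: 4 g)
qed

declare One_nat_def [simp]

section \<open>The gl-action on the exterior algebra of the grid: matrix units E_ab move a cell from
  row b to row a\<close>

definition EE :: "nat => nat => nat => ((nat \<times> nat) set => 'a::field_char_0) => (nat \<times> nat) set => 'a" where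
 "EE n a b f = (\<Sum>j<n. cr (a, j) (an (b, j) f))"

text \<open>The contribution of row t to the boundary operator (\<open>bd_AA\<close>).\<close>

definition AA :: "nat => nat => ((nat \<times> nat) set => 'a::field_char_0) => (nat \<times> nat) set => 'a" where
 "AA n t f = (\<Sum>j<n. an (t, j) f)"

lemma lin_EE: "lin (EE n a b)" and lin_AA: "lin (AA n t)"
 unfolding EE_def AA_def by (intro lin_sum lin_comp[OF lin_an lin_cr] lin_an)+

text \<open>At infinite sets \<open>sg\<close> is 0, so contraction and multiplication by the same
  generator satisfy their relation there only for chains that vanish at such sets.\<close>

definition fin_supp :: "('c set => 'a::zero) set" where
 "fin_supp = {f. \<forall>J. infinite J --> f J = 0}"

lemma fin_supp_an [simp]: "an x f \<in> fin_supp" and fin_supp_cr [simp]: "cr x f \<in> fin_supp"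
 by (auto simp: fin_supp_def an_def cr_def sg_def)

lemma fin_supp_sum: "(\<And>x. x \<in> X ==> f x \<in> fin_supp) ==> (\<Sum>x\<in>X. f x) \<in> (fin_supp :: ('c set => 'a::field_char_0) set)"
 by (simp add: fin_supp_def sum_apply)

lemma fin_supp_EE [simp]: "EE n a b f \<in> fin_supp" and fin_supp_AA [simp]: "AA n t f \<in> fin_supp"
 unfolding EE_def AA_def by (intro fin_supp_sum fin_supp_cr fin_supp_an)+

lemma an_cr_if:
 assumes "f \<in> fin_supp"
 shows "an x (cr y f) = (if x = y then f else 0) - cr y (an x (f :: 'c::linorder set => 'a::field_char_0))"
proof (cases "x = y")
 case True
 show ?thesis
 proof
  fix J show "an x (cr y f) J = ((if x = y then f else 0) - cr y (an x f)) J"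
  proof (cases "finite J")
   case True then show ?thesis using an_cr_same[of J x f] \<open>x = y\<close> by (simp add: algebra_simps)
  next
   case False
   then have "f J = 0" "an x (cr y f) J = 0" "cr y (an x f) J = 0"
    using assms fin_supp_an[of x "cr y f"] fin_supp_cr[of y "an x f"] by (auto simp: fin_supp_def)
   then show ?thesis by simp
  qed
 qed
next
 case False then show ?thesis using an_cr[OF False, of f] by simp
qed

text \<open>This is [E_ab, E_cd] = \<delta>_bc E_ad - \<delta>_da E_cb. Each product is a
  contraction term minus a normally ordered quartic term \<open>Q\<close>, and \<open>Q\<close> is
  unchanged when the two factors are exchanged.\<close>

lemma EE_comm:
 assumes f: "f \<in> fin_supp"
 shows "EE n a b (EE n c d f) = EE n c d (EE n a b f)
  + (if b = c then EE n a d f else 0) - (if d = a then EE n c b f else 0)"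
proof -
 define Q where "Q a b c d = (\<Sum>j<n. \<Sum>k<n. cr (a, j) (cr (c, k) (an (b, j) (an (d, k) f))))" for a b c d :: nat
 have E: "EE n a b (EE n c d f) = (if b = c then EE n a d f else 0) - Q a b c d" for a b c d
 proof -
  have "EE n a b (EE n c d f) = (\<Sum>j<n. \<Sum>k<n. cr (a, j) (an (b, j) (cr (c, k) (an (d, k) f))))"
   unfolding EE_def by (simp add: fsp.linear_sum[OF lin_an] fsp.linear_sum[OF lin_cr])
  also have "\<dots> = (\<Sum>j<n. \<Sum>k<n. (if b = c \<and> j = k then cr (a, j) (an (d, k) f) else 0)
    - cr (a, j) (cr (c, k) (an (b, j) (an (d, k) f))))"
   by (intro sum.cong refl) (simp add: an_cr_if lin_simps[OF lin_cr])
  also have "\<dots> = (\<Sum>j<n. \<Sum>k<n. if b = c \<and> j = k then cr (a, j) (an (d, k) f) else 0) - Q a b c d"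
   by (simp add: sum_subtractf Q_def)
  also have "(\<Sum>j<n. \<Sum>k<n. if b = c \<and> j = k then cr (a, j) (an (d, k) f) else 0) = (if b = c then EE n a d f else 0)"
   by (cases "b = c") (simp_all add: EE_def)
  finally show ?thesis .
 qed
 have "Q c d a b = (\<Sum>k<n. \<Sum>j<n. cr (c, j) (cr (a, k) (an (d, j) (an (b, k) f))))"
  unfolding Q_def by (rule sum.swap)
 also have "\<dots> = Q a b c d"
 proof -
  have "cr (c, j) (cr (a, k) (an (d, j) (an (b, k) f))) = cr (a, k) (cr (c, j) (an (b, k) (an (d, j) f)))" for j k
   using cr_cr[of "(c, j)" "(a, k)" "an (d, j) (an (b, k) f)"] an_an[of "(d, j)" "(b, k)" f]
   by (simp add: lin_simps[OF lin_cr])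
  then show ?thesis unfolding Q_def by (intro sum.cong refl)
 qed
 finally have "Q c d a b = Q a b c d" .
 then show ?thesis unfolding E[of a b c d] E[of c d a b] by (simp add: algebra_simps)
qed

lemma EE_diag: "finite J ==> EE n a a f J = of_nat (card (rw a J \<inter> {..<n})) * (f J :: 'a::field_char_0)"
proof -
 assume J: "finite J"
 have "EE n a a f J = (\<Sum>j<n. if j \<in> rw a J then f J else 0)"
  unfolding EE_def sum_apply using J
  by (intro sum.cong refl) (auto simp: cr_def an_def sg_sq' rw_def insert_absorb)
 also have "\<dots> = of_nat (card (rw a J \<inter> {..<n})) * f J" by (simp add: sum.If_cases Int_commute)
 finally show ?thesis .
qed

declare One_nat_def [simp del]

text \<open>Stated for an abstract gl_3-action so that it serves both \<open>EE\<close> and its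
  dual. In the applications x and y have weights (0, 2, 4) and (1, 1, 4), and \<open>van\<close>
  says that nothing can be taken from an empty row. Applying E_31 to the relation gives 4 x = E_21
  y, so only y matters; the relations then force E_32 y = 0 and E_12 y = 0, and finally y =
  0.\<close>

lemma gl3:
 fixes e :: "nat => nat => ('c => 'a::field_char_0) => 'c => 'a"
 assumes l: "\<And>i j. lin (e i j)" and P: "\<And>i j f. f \<in> P ==> e i j f \<in> P"
  and rel: "\<And>i j k l f. f \<in> P ==> e i j (e k l f) = e k l (e i j f)
   + (if j = k then e i l f else 0) - (if l = i then e k j f else 0)"
  and van: "\<And>i j f. f \<in> P ==> e j j f = 0 ==> i \<noteq> j ==> e i j f = 0"
  and m: "x \<in> P" "y \<in> P"
  and wx: "e 1 1 x = 0" "e 3 3 x = fscale 4 x"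
  and wy: "e 1 1 y = y" "e 2 2 y = y" "e 3 3 y = fscale 4 y"
  and xy: "e 1 3 x + e 2 3 y = 0" and y: "e 3 1 y = 0"
 shows "x = 0 \<and> y = 0"
proof -
 note s = lin_simps[OF l]
 have ee: "e 1 3 x = - e 2 3 y" using xy by (simp add: eq_neg_iff_add_eq_0)
 have x1: "e 3 1 x = 0" by (rule van[OF m(1) wx(1)]) simp
 have r1: "e 3 1 (e 1 3 x) = fscale 4 x" using rel[OF m(1), of 3 1 1 3] by (simp add: x1 wx s)
 have r2: "e 3 1 (e 2 3 y) = - e 2 1 y" using rel[OF m(2), of 3 1 2 3] by (simp add: y s)
 have x4: "fscale 4 x = e 2 1 y" using r1 r2 unfolding ee by (simp only: s minus_minus)
 have r3: "e 1 3 (e 2 1 y) = e 2 1 (e 1 3 y) - e 2 3 y" using rel[OF m(2), of 1 3 2 1] by simp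
 have "e 1 3 (e 2 1 y) = fscale 4 (e 1 3 x)" unfolding x4[symmetric] by (simp add: s)
 then have r4: "e 2 1 (e 1 3 y) = fscale (-3) (e 2 3 y)"
  unfolding r3 ee by (simp add: fun_eq_iff algebra_simps)
 define c where "c = e 3 2 y"
 define w where "w = e 1 2 y"
 have cP: "c \<in> P" "w \<in> P" unfolding c_def w_def by (rule P[OF m(2)])+
 have c3: "e 3 3 c = fscale 5 c" and c2: "e 2 2 c = 0" and c1: "e 1 1 c = c"
  unfolding c_def using rel[OF m(2), of 3 3 3 2] rel[OF m(2), of 2 2 3 2] rel[OF m(2), of 1 1 3 2]
  by (simp_all add: wy s fun_eq_iff)
 have w1: "e 1 1 w = fscale 2 w" and w2: "e 2 2 w = 0"
  unfolding w_def using rel[OF m(2), of 1 1 1 2] rel[OF m(2), of 2 2 1 2] by (simp_all add: wy s fun_eq_iff)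
 have v: "e 3 2 c = 0" "e 1 2 c = 0" "e 1 2 w = 0" by (rule van[OF cP(1) c2] van[OF cP(2) w2], simp)+
 have cy: "e 3 1 c = 0" unfolding c_def using rel[OF m(2), of 3 1 3 2] by (simp add: y s)
 have r5: "e 3 2 (e 2 3 y) = e 2 3 c + fscale 3 y"
  using rel[OF m(2), of 3 2 2 3] by (simp add: wy c_def fun_eq_iff)
 have r6: "e 3 2 (e 1 3 y) = e 1 3 c - w" using rel[OF m(2), of 3 2 1 3] by (simp add: c_def w_def)
 have r7: "e 3 1 (e 1 3 y) = fscale 3 y" using rel[OF m(2), of 3 1 1 3] by (simp add: wy y s fun_eq_iff)
 have r8: "e 3 2 (e 2 1 (e 1 3 y)) = e 2 1 (e 1 3 c - w) + fscale 3 y"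
  using rel[OF P[OF m(2)], of 3 2 2 1 1 3] by (simp add: r6 r7)
 have "e 3 2 (e 2 1 (e 1 3 y)) = fscale (-3) (e 2 3 c + fscale 3 y)" unfolding r4 by (simp only: s r5)
 then have key: "fscale 12 y = e 2 1 w - e 2 1 (e 1 3 c) - fscale 3 (e 2 3 c)"
  unfolding r8 by (simp add: s fun_eq_iff algebra_simps)
 have k1: "e 3 2 (e 2 1 w) = c"
  using rel[OF cP(2), of 3 2 2 1] rel[OF m(2), of 3 2 1 2] rel[OF m(2), of 3 1 1 2]
  by (simp add: w_def[symmetric] c_def[symmetric] v y s)
 have k2: "e 3 2 (e 2 1 (e 1 3 c)) = fscale 4 c"
  using rel[OF P[OF cP(1)], of 3 2 2 1 1 3] rel[OF cP(1), of 3 2 1 3] rel[OF cP(1), of 3 1 1 3]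
  by (simp add: v cy c3 c1 s fun_eq_iff)
 have k3: "e 3 2 (e 2 3 c) = fscale 5 c"
  using rel[OF cP(1), of 3 2 2 3] by (simp add: v c3 c2 s)
 \<comment> \<open>Applying E_32 to \<open>key\<close> gives 12 c = c - 4 c - 15 c. Below, applying
   E_12 to 12 y = E_21 w gives 12 w = 2 w in the same way. Characteristic 0 makes both
   vanish.\<close>
 have "fscale 12 c = e 3 2 (fscale 12 y)" by (simp add: s c_def)
 also have "\<dots> = c - fscale 4 c - fscale 15 c" unfolding key by (simp only: s k1 k2 k3) (simp add: fun_eq_iff)
 finally have "fscale 30 c = 0" by (simp add: fun_eq_iff algebra_simps)
 then have c0: "c = 0" by (simp add: fun_eq_iff)
 have y12: "fscale 12 y = e 2 1 w" using key unfolding c0 s by (simp add: fun_eq_iff)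
 have "fscale 12 w = e 1 2 (fscale 12 y)" by (simp add: s w_def)
 also have "\<dots> = fscale 2 w" unfolding y12 using rel[OF cP(2), of 1 2 2 1] by (simp add: v w1 w2 s)
 finally have "w = 0" by (simp add: fun_eq_iff)
 then have "fscale 12 y = 0" using y12 by (simp only: s)
 then have y0: "y = 0" by (simp add: fun_eq_iff)
 have "fscale 4 x = 0" using x4 unfolding y0 by (simp only: s)
 then have "x = 0" by (simp add: fun_eq_iff)
 with y0 show ?thesis by simp
qed

declare One_nat_def [simp]

text \<open>Supports of joint weight vectors: k is the weight for the gl-action on rows, l the one
  for columns.\<close>

definition WW :: "nat => nat set => (nat => nat) => nat list => (nat \<times> nat) set set" where
 "WW n S k l = {I. I \<subseteq> S \<times> {..<n} \<and> (\<forall>t\<in>S. card (rw t I) = k t) \<and> (\<forall>j<n. card (cw j I) = l ! j)}"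

lemma finite_WW [simp]: "finite S ==> finite (WW n S k l)"
 by (rule finite_subset[of _ "Pow (S \<times> {..<n})"]) (auto simp: WW_def)

lemma supp_fin_supp: "finite S ==> f \<in> supp_on (WW n S k l) ==> f \<in> fin_supp"
 by (auto simp: supp_on_def fin_supp_def WW_def) (metis finite_SigmaI finite_lessThan finite_subset)

lemma EE_diag_supp:
 assumes "finite S" "f \<in> supp_on (WW n S k l)" "t \<in> S"
 shows "EE n t t f = fscale (of_nat (k t)) (f :: _ => 'a::field_char_0)"
proof
 fix J show "EE n t t f J = fscale (of_nat (k t)) f J"
 proof (cases "J \<in> WW n S k l")
  case True
  then have J: "J \<subseteq> S \<times> {..<n}" "card (rw t J) = k t" using assms(3) by (auto simp: WW_def)
  have "finite J" by (rule finite_subset[OF J(1)]) (use assms(1) in simp)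
  moreover have "rw t J \<inter> {..<n} = rw t J" using J(1) by (auto simp: rw_def)
  ultimately show ?thesis using EE_diag[of J n t f] J(2) by simp
 next
  case False
  have "EE n t t f J = 0"
  proof (cases "finite J")
   case True then show ?thesis using False assms(2) by (simp add: EE_diag supp_on_def)
  next
   case inf: False then show ?thesis using fin_supp_EE[of n t t f] by (simp add: fin_supp_def)
  qed
  then show ?thesis using False assms(2) by (simp add: supp_on_def)
 qed
qed

lemma EE_supp:
 assumes f: "f \<in> supp_on (WW n S k l)" and ab: "a \<in> S" "b \<in> S" "a \<noteq> b"
  and k': "\<And>t. t \<in> S ==> t \<noteq> a ==> t \<noteq> b ==> k' t = k t" "k' a = Suc (k a)" "Suc (k' b) = k b" and S: "finite S"
 shows "EE n a b f \<in> supp_on (WW n S k' (l :: nat list))"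
proof -
 have "EE n a b f J = (0 :: 'a::field_char_0)" if J: "J \<notin> WW n S k' l" for J
  unfolding EE_def sum_apply
 proof (intro sum.neutral ballI)
  fix j assume "j \<in> {..<n}"
  then have jn: "j < n" by simp
  show "cr (a, j) (an (b, j) f) J = 0"
  proof (rule ccontr)
   assume n0: "cr (a, j) (an (b, j) f) J \<noteq> 0"
   define I where "I = insert (b, j) (J - {(a, j)})"
   have 1: "(a, j) \<in> J" "(b, j) \<notin> J" "f I \<noteq> 0"
    using n0 ab(3) by (auto simp: cr_def an_def I_def split: if_splits)
   have I: "I \<in> WW n S k l" using 1(3) f by (auto simp: supp_on_def)
   then have Is: "I \<subseteq> S \<times> {..<n}" "finite I"
    using S by (auto simp: WW_def intro: finite_subset[of _ "S \<times> {..<n}"])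
   have JI: "J = insert (a, j) (I - {(b, j)})" using 1 ab(3) by (auto simp: I_def)
   have aI: "(a, j) \<notin> I" "(b, j) \<in> I" using ab(3) by (auto simp: I_def)
   have rJ: "rw t J = (if t = a then insert j (rw a I) else if t = b then rw b I - {j} else rw t I)" for t
    using ab(3) by (auto simp: JI rw_def)
   have cJ: "cw i J = (if i = j then insert a (cw j I - {b}) else cw i I)" for i
    by (auto simp: JI cw_def)
   have fr: "finite (rw t I)" for t using Is(1) by (auto simp: rw_def intro: finite_subset[of _ "{..<n}"])
   have fc: "finite (cw i I)" for i using Is(1) S by (auto simp: cw_def intro: finite_subset[of _ S])
   have "J \<subseteq> S \<times> {..<n}" using Is(1) ab(1) jn by (auto simp: JI)
   moreover have "card (rw t J) = k' t" if "t \<in> S" for t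
   proof -
    have c: "card (rw t I) = k t" using I that by (simp add: WW_def)
    have "j \<notin> rw a I" "j \<in> rw b I" using aI by (auto simp: rw_def)
    then show ?thesis using c k' that fr ab(3) by (auto simp: rJ)
   qed
   moreover have "card (cw i J) = l ! i" if "i < n" for i
   proof -
    have c: "card (cw i I) = l ! i" using I that by (simp add: WW_def)
    have "a \<notin> cw j I" "b \<in> cw j I" using aI by (auto simp: cw_def)
    then have "card (insert a (cw j I - {b})) = card (cw j I)"
     using fc[of j] card_gt_0_iff[of "cw j I"] by (auto simp: card.insert_remove)
    then show ?thesis using c by (auto simp: cJ)
   qed
   ultimately have "J \<in> WW n S k' l" by (simp add: WW_def)
   then show False using J by simp
  qed
 qed
 then show ?thesis by (simp add: supp_on_def)
qed

lemma EE_van: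
 assumes f: "f \<in> fin_supp" and z: "EE n b b f = (0 :: _ => 'a::field_char_0)"
 shows "EE n a b f = 0"
proof -
 have "an (b, j) f = 0" if j: "j < n" for j
 proof
  fix J
  have "f (insert (b, j) J) = 0"
  proof (cases "finite J")
   case True
   have "j \<in> rw b (insert (b, j) J) \<inter> {..<n}" using j by (simp add: rw_def)
   then have "card (rw b (insert (b, j) J) \<inter> {..<n}) \<noteq> 0" by (metis card_0_eq empty_iff finite_Int finite_lessThan)
   then show ?thesis using EE_diag[of "insert (b, j) J" n b f] True z by simp
  next
   case False then show ?thesis using f by (simp add: fin_supp_def)
  qed
  then show "an (b, j) f J = 0 J" by (simp add: an_def)
 qed
 then show ?thesis by (simp add: EE_def lin_simps[OF lin_cr])
qed

lemma EE_van_full: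
 assumes f: "f \<in> fin_supp" and z: "EE n a a f = fscale (of_nat n) (f :: _ => 'a::field_char_0)" and ab: "a \<noteq> b"
 shows "EE n a b f = 0"
proof -
 have "cr (a, j) (an (b, j) f) = 0" if j: "j < n" for j
 proof
  fix J
  define I where "I = insert (b, j) (J - {(a, j)})"
  have "f I = 0"
  proof (cases "finite I")
   case True
   have "rw a I \<inter> {..<n} \<subset> {..<n}" using j ab by (auto simp: rw_def I_def)
   then have "card (rw a I \<inter> {..<n}) < n" using psubset_card_mono[of "{..<n}" "rw a I \<inter> {..<n}"] by simp
   moreover have "of_nat (card (rw a I \<inter> {..<n})) * f I = of_nat n * f I"
    unfolding EE_diag[OF True, of n a f, symmetric] using fun_cong[OF z, of I] by (simp only: fscale_apply)
   ultimately show ?thesis by (metis less_irrefl mult_cancel_right of_nat_eq_iff)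
  next
   case False then show ?thesis using f by (simp add: fin_supp_def)
  qed
  then show "cr (a, j) (an (b, j) f) J = 0 J" by (simp add: cr_def an_def I_def)
 qed
 then show ?thesis by (simp add: EE_def)
qed

lemma fin_supp_ops: "f \<in> fin_supp ==> fscale c f \<in> fin_supp" "f \<in> fin_supp ==> g \<in> fin_supp ==> f - g \<in> fin_supp"
 "(0 :: _ => 'a::field) \<in> fin_supp"
 by (auto simp: fin_supp_def)

abbreviation k3 :: "(nat => nat) => nat => nat => nat => nat => nat" where
 "k3 r x y z \<equiv> (\<lambda>t. if t = r 1 then x else if t = r 2 then y else z)"

abbreviation W3 :: "nat => (nat => nat) => nat list => nat => nat => nat => (nat \<times> nat) set set" where
 "W3 n r l x y z \<equiv> WW n {r 1, r 2, r 3} (k3 r x y z) l"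

text \<open>On the kernel of (f, g) -> e1 f + e2 g, the map e3 applied to the second component is
  injective by \<open>z\<close>, so the kernel embeds into the functions on C. The intended use is
  E_13, E_23, E_31 from \<open>gl3\<close>.\<close>

lemma ker_pair_dim:
 fixes e1 e2 e3 :: "('b => 'a::field) => 'b => 'a"
 assumes l: "lin e1" "lin e2" "lin e3" and fin: "finite A" "finite B" "finite C"
  and e3: "\<And>f. f \<in> supp_on B ==> e3 f \<in> supp_on C"
  and z: "\<And>f g. f \<in> supp_on A ==> g \<in> supp_on B ==> e1 f + e2 g = 0 ==> e3 g = 0 ==> f = 0 \<and> g = 0"
 shows "fs.dim {f\<in>supp_on (A \<union> B). e1 (res A f) + e2 (res B f) = 0} \<le> card C"
proof -
 let ?V = "{f\<in>supp_on (A \<union> B). e1 (res A f) + e2 (res B f) = 0}" and ?T = "\<lambda>f. e3 (res B f)"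
 have r: "res A f \<in> supp_on A" "res B f \<in> supp_on B" for f by (auto simp: supp_on_def res_def)
 have lT: "lin ?T" by (rule lin_comp[OF lin_res l(3)])
 have lV: "lin (\<lambda>f. e1 (res A f) + e2 (res B f))"
  by (rule linI) (auto simp: lin_simps[OF l(1)] lin_simps[OF l(2)] lin_simps[OF lin_res] fun_eq_iff algebra_simps)
 have sV: "fs.subspace ?V" by (auto simp: fs.subspace_def supp_on_def lin_simps[OF lV])
 have fV: "findim ?V" by (rule findim_mono[OF findim_supp_on[of "A \<union> B"]]) (use fin in auto)
 have "{v\<in>?V. ?T v = 0} \<subseteq> {0}"
 proof
  fix v assume v: "v \<in> {v\<in>?V. ?T v = 0}"
  then have "res A v = 0 \<and> res B v = 0" using z[OF r, of v v] by simp
  note v0 = fun_cong[OF conjunct1[OF this], unfolded res_def] fun_cong[OF conjunct2[OF this], unfolded res_def]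
  have "v x = 0" if "x \<in> A \<union> B" for x using that v0[of x] by (auto split: if_splits)
  then show "v \<in> {0}" using v by (auto simp: supp_on_def fun_eq_iff)
 qed
 then have "fs.dim {v\<in>?V. ?T v = 0} \<le> fs.dim ({0} :: ('b => 'a) set)"
  by (intro dim_mono) (auto simp: findim_def)
 moreover have "fs.dim ({0} :: ('b => 'a) set) = 0" using fs.dim_le_card[of "{0 :: 'b => 'a}" "{}"] by simp
 moreover have "fs.dim (?T ` ?V) \<le> fs.dim (supp_on C :: ('b => 'a) set)"
  using e3[OF r(2)] fin by (intro dim_mono) auto
 ultimately show ?thesis using rank_nullity[OF lT sV fV] fin by simp
qed

lemma perp_dim:
 fixes V :: "('b => 'a::field) set"
 assumes "finite X" "V \<subseteq> supp_on X"
 shows "card X \<le> fs.dim V + fs.dim {f\<in>supp_on X. \<forall>v\<in>V. (\<Sum>x\<in>X. v x * f x) = 0}"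
proof -
 have fV: "findim V" by (rule findim_mono[OF findim_supp_on[OF assms(1)] assms(2)])
 obtain B where B: "B \<subseteq> V" "fs.independent B" "V \<subseteq> fs.span B" "card B = fs.dim V"
  using fs.basis_exists by blast
 have fB: "finite B" by (rule findim_indep[OF fV B(1,2)])
 let ?F = "\<lambda>f b. if b \<in> B then \<Sum>x\<in>X. b x * f x else (0::'a)"
 have lF: "lin ?F" by (rule linI) (auto simp: fun_eq_iff algebra_simps sum.distrib sum_distrib_left)
 have "{f\<in>supp_on X. ?F f = 0} \<subseteq> {f\<in>supp_on X. \<forall>v\<in>V. (\<Sum>x\<in>X. v x * f x) = 0}"
 proof
  fix f assume f: "f \<in> {f\<in>supp_on X. ?F f = 0}"
  have "(\<Sum>x\<in>X. v x * f x) = 0" if "v \<in> fs.span B" for v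
   using that
  proof (induction rule: fs.span_induct_alt)
   case base then show ?case by simp
  next
   case (step c b y)
   have "?F f = 0" using f by blast
   from fun_cong[OF this, of b] have "(\<Sum>x\<in>X. b x * f x) = 0" using step(1) by simp
   moreover have "(\<Sum>x\<in>X. (fscale c b + y) x * f x) = c * (\<Sum>x\<in>X. b x * f x) + (\<Sum>x\<in>X. y x * f x)"
    by (simp add: algebra_simps sum.distrib sum_distrib_left)
   ultimately show ?case using step by simp
  qed
  then show "f \<in> {f\<in>supp_on X. \<forall>v\<in>V. (\<Sum>x\<in>X. v x * f x) = 0}" using f B(3) by auto
 qed
 then have "fs.dim {f\<in>supp_on X. ?F f = 0} \<le> fs.dim {f\<in>supp_on X. \<forall>v\<in>V. (\<Sum>x\<in>X. v x * f x) = 0}"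
  by (intro dim_mono findim_mono[OF findim_supp_on[OF assms(1)]]) auto
 moreover have "fs.dim (?F ` supp_on X) \<le> fs.dim (supp_on B :: (('b => 'a) => 'a) set)"
  by (rule dim_mono[OF findim_supp_on[OF fB]]) (auto simp: supp_on_def)
 moreover have "card X = fs.dim {f\<in>supp_on X. ?F f = 0} + fs.dim (?F ` supp_on X)"
  using rank_nullity[OF lF subspace_supp_on[of X] findim_supp_on[OF assms(1)]] assms(1) by simp
 ultimately show ?thesis using fB B(4) by simp
qed

declare One_nat_def [simp del]

lemma gl3_EE:
 fixes x y :: "(nat \<times> nat) set => 'a::field_char_0"
 assumes r: "inj r" and x: "x \<in> supp_on (W3 n r l 0 2 4)" and y: "y \<in> supp_on (W3 n r l 1 1 4)"
  and z: "EE n (r 1) (r 3) x + EE n (r 2) (r 3) y = 0" "EE n (r 3) (r 1) y = 0"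
 shows "x = 0 \<and> y = 0"
proof (rule gl3[where e = "\<lambda>i j. EE n (r i) (r j)" and P = fin_supp])
 have d: "r 1 \<noteq> r 2" "r 1 \<noteq> r 3" "r 2 \<noteq> r 3" by (simp_all add: inj_eq[OF r])
 have S: "finite {r 1, r 2, r 3}" by simp
 show "EE n (r i) (r j) (EE n (r k) (r l) f) = EE n (r k) (r l) (EE n (r i) (r j) f)
   + (if j = k then EE n (r i) (r l) f else 0) - (if l = i then EE n (r k) (r j) f else 0)"
  if "f \<in> fin_supp" for i j k l and f :: "(nat \<times> nat) set => 'a"
  using EE_comm[OF that, of n "r i" "r j" "r k" "r l"] inj_eq[OF r] by simp
 show "x \<in> fin_supp" "y \<in> fin_supp" by (rule supp_fin_supp[OF S x], rule supp_fin_supp[OF S y])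
 show "EE n (r 1) (r 1) x = 0" using EE_diag_supp[OF S x, of "r 1"] by (simp add: fun_eq_iff)
 show "EE n (r 3) (r 3) x = fscale 4 x" using EE_diag_supp[OF S x, of "r 3"] d by (simp add: fun_eq_iff)
 show "EE n (r 1) (r 1) y = y" using EE_diag_supp[OF S y, of "r 1"] by (simp add: fun_eq_iff)
 show "EE n (r 2) (r 2) y = y" using EE_diag_supp[OF S y, of "r 2"] d by (simp add: fun_eq_iff)
 show "EE n (r 3) (r 3) y = fscale 4 y" using EE_diag_supp[OF S y, of "r 3"] d by (simp add: fun_eq_iff)
qed (use z in \<open>simp_all add: lin_EE EE_van\<close>)

text \<open>The operators n \<delta>_ij - E_ji satisfy the same commutation relations; they describe
  the action on complements of rows. Row sizes k become n - k, which turns the weights here into (0,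
  2, 4) and (1, 1, 4).\<close>

lemma gl3_EE_dual:
 fixes x y :: "(nat \<times> nat) set => 'a::field_char_0"
 assumes r: "inj r" and x: "x \<in> supp_on (W3 n r l n (n - 2) (n - 4))" and y: "y \<in> supp_on (W3 n r l (n - 1) (n - 1) (n - 4))"
  and n: "4 \<le> n"
  and z: "EE n (r 3) (r 1) x + EE n (r 3) (r 2) y = 0" "EE n (r 1) (r 3) y = 0"
 shows "x = 0 \<and> y = 0"
proof (rule gl3[where e = "\<lambda>i j f. (if i = j then fscale (of_nat n) f else 0) - EE n (r j) (r i) f" and P = fin_supp])
 have d: "r 1 \<noteq> r 2" "r 1 \<noteq> r 3" "r 2 \<noteq> r 3" by (simp_all add: inj_eq[OF r])
 have S: "finite {r 1, r 2, r 3}" by simp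
 show l: "lin (\<lambda>f. (if i = j then fscale (of_nat n) f else 0) - EE n (r j) (r i) f)" for i j
  by (rule linI) (auto simp: lin_simps[OF lin_EE] fun_eq_iff algebra_simps)
 show "(if i = j then fscale (of_nat n) f else 0) - EE n (r j) (r i) f \<in> fin_supp"
  if "f \<in> fin_supp" for i j and f :: "(nat \<times> nat) set => 'a"
  using that by (simp add: fin_supp_ops)
 show "(if i = j then fscale (of_nat n) ((if k = l then fscale (of_nat n) f else 0) - EE n (r l) (r k) f) else 0)
    - EE n (r j) (r i) ((if k = l then fscale (of_nat n) f else 0) - EE n (r l) (r k) f)
   = (if k = l then fscale (of_nat n) ((if i = j then fscale (of_nat n) f else 0) - EE n (r j) (r i) f) else 0)
    - EE n (r l) (r k) ((if i = j then fscale (of_nat n) f else 0) - EE n (r j) (r i) f)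
   + (if j = k then (if i = l then fscale (of_nat n) f else 0) - EE n (r l) (r i) f else 0)
   - (if l = i then (if k = j then fscale (of_nat n) f else 0) - EE n (r j) (r k) f else 0)"
  if "f \<in> fin_supp" for i j k l and f :: "(nat \<times> nat) set => 'a"
 proof -
  let ?A = "EE n (r j) (r i)" and ?B = "EE n (r l) (r k)"
  have 1: "?A ((if k = l then fscale (of_nat n) f else 0) - ?B f) = (if k = l then fscale (of_nat n) (?A f) else 0) - ?A (?B f)"
   by (simp add: lin_simps[OF lin_EE])
  have 2: "?B ((if i = j then fscale (of_nat n) f else 0) - ?A f) = (if i = j then fscale (of_nat n) (?B f) else 0) - ?B (?A f)"
   by (simp add: lin_simps[OF lin_EE])
  have 3: "?A (?B f) = ?B (?A f) + (if i = l then EE n (r j) (r k) f else 0) - (if k = j then EE n (r l) (r i) f else 0)"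
   using EE_comm[OF that, of n "r j" "r i" "r l" "r k"] by (simp add: inj_eq[OF r])
  show ?thesis unfolding 1 2 3 by (rule ext) (auto simp: algebra_simps)
 qed
 show "(if i = j then fscale (of_nat n) f else 0) - EE n (r j) (r i) f = 0"
  if "f \<in> fin_supp" "(if j = j then fscale (of_nat n) f else 0) - EE n (r j) (r j) f = 0" "i \<noteq> j"
  for i j and f :: "(nat \<times> nat) set => 'a"
  using EE_van_full[OF that(1), of n "r j" "r i"] that inj_eq[OF r] by simp
 show "x \<in> fin_supp" "y \<in> fin_supp" by (rule supp_fin_supp[OF S x], rule supp_fin_supp[OF S y])
 have nn: "of_nat (n - k) = (of_nat n - of_nat k :: 'a)" if "k \<le> 4" for k using that n by (simp add: of_nat_diff)
 have x1: "EE n (r 1) (r 1) x = fscale (of_nat n) x" using EE_diag_supp[OF S x, of "r 1"] by simp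
 have x3: "EE n (r 3) (r 3) x = fscale (of_nat n - 4) x"
  using EE_diag_supp[OF S x, of "r 3"] d nn[of 4] by simp
 have y1: "EE n (r 1) (r 1) y = fscale (of_nat n - 1) y"
  using EE_diag_supp[OF S y, of "r 1"] nn[of 1] by simp
 have y2: "EE n (r 2) (r 2) y = fscale (of_nat n - 1) y"
  using EE_diag_supp[OF S y, of "r 2"] d nn[of 1] by simp
 have y3: "EE n (r 3) (r 3) y = fscale (of_nat n - 4) y"
  using EE_diag_supp[OF S y, of "r 3"] d nn[of 4] by simp
 show "(if 1 = (1::nat) then fscale (of_nat n) x else 0) - EE n (r 1) (r 1) x = 0"
  "(if 3 = (3::nat) then fscale (of_nat n) x else 0) - EE n (r 3) (r 3) x = fscale 4 x"
  "(if 1 = (1::nat) then fscale (of_nat n) y else 0) - EE n (r 1) (r 1) y = y"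
  "(if 2 = (2::nat) then fscale (of_nat n) y else 0) - EE n (r 2) (r 2) y = y"
  "(if 3 = (3::nat) then fscale (of_nat n) y else 0) - EE n (r 3) (r 3) y = fscale 4 y"
  unfolding x1 x3 y1 y2 y3 by (simp_all add: fun_eq_iff algebra_simps)
 show "(if 1 = (3::nat) then fscale (of_nat n) x else 0) - EE n (r 3) (r 1) x
   + ((if 2 = (3::nat) then fscale (of_nat n) y else 0) - EE n (r 3) (r 2) y) = 0"
  using z(1) by (simp add: fun_eq_iff) (metis add.inverse_inverse add_eq_0_iff neg_eq_iff_add_eq_0)
 show "(if 3 = (1::nat) then fscale (of_nat n) y else 0) - EE n (r 1) (r 3) y = 0" using z(2) by simp
qed

declare One_nat_def [simp]

section \<open>Reindexing of grids and chain maps between row bounds\<close>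

lemma sg_prod: "finite J ==> sg x J = (\<Prod>y\<in>J. if y < x then - 1 else 1 :: 'a::field_char_0)"
 by (simp add: sg_def prod.If_cases Int_def)

text \<open>The order of the generators enters only through signs. The correcting sign of I is the
  product of \<tau> over its pairs, that is, the sign of the permutation that sorts the image of I
  under \<phi>.\<close>

lemma hh_reindex:
 fixes \<phi> :: "'c::linorder => 'd::linorder"
 assumes F: "family C F" and inj: "inj_on \<phi> C"
 shows "hh TYPE('a::field_char_0) C F g \<le> hh TYPE('a) (\<phi> ` C) ((`) \<phi> ` F) g"
proof -
 define \<tau> :: "'c => 'c => 'a" where "\<tau> x y = (if x < y \<and> \<phi> y < \<phi> x then - 1 else 1)" for x y
 have \<tau>2: "\<tau> x y * \<tau> x y = 1" for x y by (simp add: \<tau>_def)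
 have inj2: "\<phi> ` I = \<phi> ` J \<longleftrightarrow> I = J" if "I \<subseteq> C" "J \<subseteq> C" for I J
  using inj_on_image_eq_iff[OF inj that] .
 have F': "family (\<phi> ` C) ((`) \<phi> ` F)"
 proof (rule familyI)
  show "finite (\<phi> ` C)" using familyD(1)[OF F] by simp
  show "I \<subseteq> \<phi> ` C" if "I \<in> (`) \<phi> ` F" for I using that familyD(2)[OF F] by blast
  fix I J K assume a: "I \<in> (`) \<phi> ` F" "J \<in> (`) \<phi> ` F" "J \<subseteq> K" "K \<subseteq> I"
  obtain I' J' where b: "I' \<in> F" "J' \<in> F" "I = \<phi> ` I'" "J = \<phi> ` J'" using a(1,2) by auto
  obtain K' where K: "K' \<subseteq> I'" "K = \<phi> ` K'" using a(4) b(3) subset_imageE by metis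
  have "J' \<subseteq> K'"
  proof
   fix x assume x: "x \<in> J'"
   then obtain y where y: "y \<in> K'" "\<phi> x = \<phi> y" using a(3) b(4) K(2) by blast
   have "x \<in> C" "y \<in> C" using familyD(2)[OF F] x y(1) b(1,2) K(1) by blast+
   then show "x \<in> K'" using inj_onD[OF inj y(2)] y(1) by simp
  qed
  then have "K' \<in> F" using familyD(5)[OF F b(1,2) _ K(1)] by simp
  then show "K \<in> (`) \<phi> ` F" using K(2) by simp
 qed
 have "hh TYPE('a) C F (g + 0) \<le> hh TYPE('a) (\<phi> ` C) ((`) \<phi> ` F) g"
 proof (rule hh_iso[OF F F', where \<beta> = "(`) \<phi>" and \<sigma> = "\<lambda>I. \<Prod>x\<in>I. \<Prod>y\<in>I. \<tau> x y"])
  show "bij_betw ((`) \<phi>) F ((`) \<phi> ` F)"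
  proof (rule inj_on_imp_bij_betw, rule inj_onI)
   fix I J assume "I \<in> F" "J \<in> F" "\<phi> ` I = \<phi> ` J"
   then show "I = J" using inj2[of I J] familyD(2)[OF F] by simp
  qed
  show "card I = card (\<phi> ` I) + 0" if "I \<in> F" for I
   using card_image[OF inj_on_subset[OF inj familyD(2)[OF F that]]] by simp
  show "(\<Prod>x\<in>I. \<Prod>y\<in>I. \<tau> x y) * (\<Prod>x\<in>I. \<Prod>y\<in>I. \<tau> x y) = 1" for I
   by (simp add: \<tau>2 flip: prod.distrib)
  fix u :: "'d set => 'a" and J assume u: "u \<in> supp_on ((`) \<phi> ` F)" and J: "J \<in> F"
  let ?s = "\<lambda>I. \<Prod>x\<in>I. \<Prod>y\<in>I. \<tau> x y"
  have JC: "J \<subseteq> C" "finite J" using familyD[OF F] J by blast+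
  have "bd C (\<lambda>I. if I \<in> F then ?s I * u (\<phi> ` I) else 0) J
    = (\<Sum>x\<in>C - J. sg x J * (if insert x J \<in> F then ?s (insert x J) * u (\<phi> ` insert x J) else 0))"
   by (rule bd_apply[OF familyD(1)[OF F]])
  also have "\<dots> = (\<Sum>x\<in>C - J. ?s J * (sg (\<phi> x) (\<phi> ` J) * u (insert (\<phi> x) (\<phi> ` J))))"
  proof (rule sum.cong[OF refl])
   fix x assume x: "x \<in> C - J"
   show "sg x J * (if insert x J \<in> F then ?s (insert x J) * u (\<phi> ` insert x J) else 0)
    = ?s J * (sg (\<phi> x) (\<phi> ` J) * u (insert (\<phi> x) (\<phi> ` J)))"
   proof (cases "insert x J \<in> F")
    case True
    have neq: "\<phi> y \<noteq> \<phi> x \<and> y \<noteq> x" if "y \<in> J" for y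
     using that x JC inj_onD[OF inj, of y x] by auto
    have "?s (insert x J) = (\<Prod>y\<in>J. \<tau> x y) * (\<Prod>y\<in>J. \<tau> y x) * ?s J"
     using x JC by (simp add: prod.distrib \<tau>_def[of x x])
    moreover have "sg (\<phi> x) (\<phi> ` J) = (\<Prod>y\<in>J. if \<phi> y < \<phi> x then - 1 else 1 :: 'a)"
     using JC by (simp add: sg_prod prod.reindex[OF inj_on_subset[OF inj JC(1)]])
    moreover have "sg x J * ((\<Prod>y\<in>J. \<tau> x y) * (\<Prod>y\<in>J. \<tau> y x)) = (\<Prod>y\<in>J. if \<phi> y < \<phi> x then - 1 else 1 :: 'a)"
     unfolding sg_prod[OF JC(2)] prod.distrib[symmetric]
    proof (rule prod.cong[OF refl])
     fix y assume "y \<in> J"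
     then show "(if y < x then - 1 else 1) * (\<tau> x y * \<tau> y x) = (if \<phi> y < \<phi> x then - 1 else 1)"
      using neq[of y] by (cases "y < x"; cases "\<phi> y < \<phi> x") (auto simp: \<tau>_def)
    qed
    ultimately show ?thesis using True by (simp add: mult_ac)
   next
    case False
    have "\<phi> ` insert x J \<notin> (`) \<phi> ` F"
    proof
     assume "\<phi> ` insert x J \<in> (`) \<phi> ` F"
     then obtain I where I: "I \<in> F" "\<phi> ` insert x J = \<phi> ` I" by auto
     then have "insert x J = I" using inj2[of "insert x J" I] familyD(2)[OF F] x JC(1) by blast
     then show False using False I by simp
    qed
    then show ?thesis using False u by (simp add: supp_on_def)
   qed
  qed
  also have "\<dots> = ?s J * (\<Sum>x\<in>C - J. sg (\<phi> x) (\<phi> ` J) * u (insert (\<phi> x) (\<phi> ` J)))"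
   by (simp only: sum_distrib_left)
  also have "(\<Sum>x\<in>C - J. sg (\<phi> x) (\<phi> ` J) * u (insert (\<phi> x) (\<phi> ` J)))
    = (\<Sum>y\<in>\<phi> ` (C - J). sg y (\<phi> ` J) * u (insert y (\<phi> ` J)))"
   by (rule sum.reindex[symmetric, unfolded o_def]) (rule inj_on_subset[OF inj Diff_subset])
  also have "\<phi> ` (C - J) = \<phi> ` C - \<phi> ` J"
   by (rule inj_on_image_set_diff[OF inj]) (use JC in auto)
  also have "(\<Sum>y\<in>\<phi> ` C - \<phi> ` J. sg y (\<phi> ` J) * u (insert y (\<phi> ` J))) = bd (\<phi> ` C) u (\<phi> ` J)"
   by (rule bd_apply[symmetric]) (use familyD(1)[OF F] in simp)
  finally show "bd C (\<lambda>I. if I \<in> F then ?s I * u (\<phi> ` I) else 0) J = ?s J * bd (\<phi> ` C) u (\<phi> ` J)" .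
 qed
 then show ?thesis by simp
qed

lemma swap_Dl: "(`) prod.swap ` Dl s n p w = Dl n s w p"
proof -
 have r: "rw t (prod.swap ` I) = cw t I" and c: "cw t (prod.swap ` I) = rw t I" for t I
  by (force simp: rw_def cw_def)+
 have i: "prod.swap ` prod.swap ` I = I" for I :: "(nat \<times> nat) set" by (simp add: image_image)
 have "prod.swap ` I \<in> Dl n s w p" if "I \<in> Dl s n p w" for I s n p w
  using that by (auto simp: Dl_def r c)
 then show ?thesis using i by (metis (no_types, lifting) image_subsetI subsetI subset_antisym image_eqI)
qed

lemma hD_transpose: "hD TYPE('a::field_char_0) s n p w g \<le> hD TYPE('a) n s w p g"
proof -
 have "prod.swap ` cells s n = cells n s" by force
 then show ?thesis
  using hh_reindex[OF family_Dl[of s n p w], of prod.swap g, where 'a='a] by (simp add: swap_Dl hD_def)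
qed

text \<open>\<open>Dl\<close> is down-closed, so a boundary never leaves it; this removes the
  restrictions from \<open>cyc\<close> and \<open>bnd\<close> for these families.\<close>

lemma bd_outside:
 assumes "u \<in> supp_on (gr (Dl s n p w) g)" "J \<notin> Dl s n p w"
 shows "bd (cells s n) u J = 0"
proof (rule bd_eq_0)
 fix x
 have "insert x J \<notin> Dl s n p w" using assms(2) Dl_subset[of "insert x J" s n p w J] by blast
 then show "u (insert x J) = 0" using assms(1) by (simp add: supp_on_def gr_def)
qed simp

lemma cyc_Dl: "z \<in> cyc (cells s n) (Dl s n p w) g \<longleftrightarrow> z \<in> supp_on (gr (Dl s n p w) g) \<and> bd (cells s n) z = 0"
proof
 assume z: "z \<in> cyc (cells s n) (Dl s n p w) g"
 have "bd (cells s n) z J = 0" for J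
  using cycD(3)[OF z, of J] bd_outside[OF cycD(1)[OF z], of J] by (cases "J \<in> Dl s n p w") auto
 then show "z \<in> supp_on (gr (Dl s n p w) g) \<and> bd (cells s n) z = 0" using cycD(1)[OF z] by auto
next
 assume "z \<in> supp_on (gr (Dl s n p w) g) \<and> bd (cells s n) z = 0"
 then show "z \<in> cyc (cells s n) (Dl s n p w) g" by (intro cycI) auto
qed

lemma bnd_Dl: "z \<in> bnd (cells s n) (Dl s n p w) g \<longleftrightarrow> (\<exists>u\<in>supp_on (gr (Dl s n p w) (Suc g)). z = bd (cells s n) u)"
proof -
 have "res (Dl s n p w) (bd (cells s n) u) = bd (cells s n) u" if "u \<in> supp_on (gr (Dl s n p w) (Suc g))" for u
  using bd_outside[OF that] by (auto simp: res_def fun_eq_iff)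
 then show ?thesis unfolding bnd_def by auto
qed

lemma bd_EE:
 assumes f: "f \<in> fin_supp" and b: "b < s"
 shows "bd (cells s n) (EE n b a f) = EE n b a (bd (cells s n) f) + (AA n a f :: _ => 'a::field_char_0)"
proof -
 have "bd (cells s n) (EE n b a f) = (\<Sum>x\<in>cells s n. \<Sum>j<n. an x (cr (b, j) (an (a, j) f)))"
  unfolding bd_def EE_def by (simp add: fsp.linear_sum[OF lin_an])
 also have "\<dots> = (\<Sum>x\<in>cells s n. \<Sum>j<n. (if x = (b, j) then an (a, j) f else 0) + cr (b, j) (an (a, j) (an x f)))"
  using an_an by (intro sum.cong refl) (simp add: an_cr_if lin_simps[OF lin_cr] an_an[of _ "(a, _)"])
 also have "\<dots> = (\<Sum>j<n. \<Sum>x\<in>cells s n. if x = (b, j) then an (a, j) f else 0)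
   + (\<Sum>j<n. \<Sum>x\<in>cells s n. cr (b, j) (an (a, j) (an x f)))"
  unfolding sum.distrib by (intro arg_cong2[where f="(+)"]) (rule sum.swap)+
 also have "(\<Sum>j<n. \<Sum>x\<in>cells s n. if x = (b, j) then an (a, j) f else 0) = AA n a f"
  unfolding AA_def using b by (intro sum.cong refl) simp
 also have "(\<Sum>j<n. \<Sum>x\<in>cells s n. cr (b, j) (an (a, j) (an x f))) = EE n b a (bd (cells s n) f)"
  unfolding EE_def bd_def by (simp add: fsp.linear_sum[OF lin_an] fsp.linear_sum[OF lin_cr])
 finally show ?thesis by (simp only: add.commute)
qed

text \<open>A chain-level version of moving one unit of row bound from a to b. By
  \<open>bd_EE\<close> the commutator of bd with E_ba is the row boundary \<open>AA n a\<close>; the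
  diagonal term has the opposite commutator, so the sum is a chain map.\<close>

definition cE :: "nat => (nat => nat) => nat => nat => ((nat \<times> nat) set => 'a::field_char_0) => (nat \<times> nat) set => 'a" where
 "cE n p a b f J = EE n b a f J + (of_nat (p a) - of_nat (card (rw a J))) * f J"

lemma bd_cE:
 assumes f: "f \<in> fin_supp" and ab: "a < s" "b < s" and True: "J \<subseteq> cells s n"
 shows "bd (cells s n) (cE n p a b f) J = (cE n p a b (bd (cells s n) f) J :: 'a::field_char_0)"
proof -
 let ?C = "cells s n" and ?k = "\<lambda>J. of_nat (p a) - of_nat (card (rw a J)) :: 'a"
 have k: "?k (insert x J) = ?k J - (if fst x = a then 1 else 0)" if "x \<in> ?C - J" for x
 proof (cases "fst x = a")
  case t: True
  have "rw a (insert x J) = insert (snd x) (rw a J)" "snd x \<notin> rw a J" using t that by (auto simp: rw_def)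
  then show ?thesis using fin_rw(1)[OF True, of a] t by simp
 next
  case False
  then have "rw a (insert x J) = rw a J" by (auto simp: rw_def)
  then show ?thesis using False by simp
 qed
 have A: "AA n a f J = (\<Sum>x\<in>?C - J. if fst x = a then sg x J * f (insert x J) else 0)"
 proof -
  have "AA n a f J = (\<Sum>j\<in>{j\<in>{..<n}. (a, j) \<notin> J}. sg (a, j) J * f (insert (a, j) J))"
   unfolding AA_def sum_apply by (rule sum.mono_neutral_cong_right) (auto simp: an_def)
  also have "\<dots> = (\<Sum>x\<in>Pair a ` {j\<in>{..<n}. (a, j) \<notin> J}. sg x J * f (insert x J))"
   by (rule sum.reindex[symmetric, unfolded o_def]) (auto intro: inj_onI)
  also have "\<dots> = (\<Sum>x\<in>?C - J. if fst x = a then sg x J * f (insert x J) else 0)"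
   by (rule sum.mono_neutral_cong_left) (use ab(1) in auto)
  finally show ?thesis .
 qed
 have "bd ?C (\<lambda>I. ?k I * f I) J = (\<Sum>x\<in>?C - J. sg x J * (?k (insert x J) * f (insert x J)))"
  by (rule bd_apply) simp
 also have "\<dots> = (\<Sum>x\<in>?C - J. ?k J * (sg x J * f (insert x J)) - (if fst x = a then sg x J * f (insert x J) else 0))"
  by (intro sum.cong refl) (simp only: k, simp add: algebra_simps)
 also have "\<dots> = ?k J * bd ?C f J - AA n a f J" by (simp add: sum_subtractf sum_distrib_left A bd_apply)
 finally have 1: "bd ?C (\<lambda>I. ?k I * f I) J = ?k J * bd ?C f J - AA n a f J" .
 have "cE n p a b f = EE n b a f + (\<lambda>I. ?k I * f I)" by (simp add: cE_def fun_eq_iff)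
 then have "bd ?C (cE n p a b f) J = bd ?C (EE n b a f) J + bd ?C (\<lambda>I. ?k I * f I) J"
  by (simp add: lin_simps[OF lin_bd])
 then show ?thesis unfolding 1 using fun_cong[OF bd_EE[OF f ab(2), of n a], of J] by (simp add: cE_def)
qed


lemma EE_nonzero:
 fixes f :: "(nat \<times> nat) set => 'a::field_char_0"
 assumes n0: "EE n b a f J \<noteq> 0" and ab: "a \<noteq> b"
 obtains j I where "j < n" "(b, j) \<notin> I" "(a, j) \<in> I" "f I \<noteq> 0" "J = insert (b, j) (I - {(a, j)})"
proof -
 obtain j where j: "j < n" "cr (b, j) (an (a, j) f) J \<noteq> 0"
 proof -
  have "\<exists>j\<in>{..<n}. cr (b, j) (an (a, j) f) J \<noteq> 0"
  proof (rule ccontr)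
   assume "\<not> ?thesis"
   then have "EE n b a f J = 0" unfolding EE_def sum_apply by (intro sum.neutral) simp
   then show False using n0 by simp
  qed
  then show ?thesis using that by (elim bexE) simp
 qed
 show ?thesis
 proof (rule that[of j "insert (a, j) (J - {(b, j)})"])
  show "j < n" by fact
  have 1: "(b, j) \<in> J" "(a, j) \<notin> J" "f (insert (a, j) (J - {(b, j)})) \<noteq> 0"
   using j(2) ab by (auto simp: cr_def an_def split: if_splits)
  show "f (insert (a, j) (J - {(b, j)})) \<noteq> 0" by (rule 1(3))
  show "J = insert (b, j) (insert (a, j) (J - {(b, j)}) - {(a, j)})" using 1 ab by auto
 qed (use ab in auto)
qed

lemma move_shape:
 assumes I: "I \<subseteq> cells s n" "(b, j) \<notin> I" "(a, j) \<in> I" and ab: "a \<noteq> b" "b < s"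
  and J: "J = insert (b, j) (I - {(a, j)})"
 shows "J \<subseteq> cells s n" "card J = card I" "Suc (card (rw a J)) = card (rw a I)" "card (rw b J) = Suc (card (rw b I))"
  "t \<noteq> a ==> t \<noteq> b ==> rw t J = rw t I" "card (cw i J) = card (cw i I)"
proof -
 have fI: "finite I" by (rule finite_subset[OF I(1)]) simp
 show "J \<subseteq> cells s n" using I(1,3) ab(2) by (auto simp: J)
 have "0 < card I" using fI I(3) by (auto simp: card_gt_0_iff)
 then show "card J = card I" using fI I by (simp add: J)
 have r: "rw a J = rw a I - {j}" "rw b J = insert j (rw b I)" using ab(1) by (auto simp: J rw_def)
 have ja: "j \<in> rw a I" "j \<notin> rw b I" using I by (auto simp: rw_def)
 show "Suc (card (rw a J)) = card (rw a I)" unfolding r by (rule card_Suc_Diff1[OF fin_rw(1)[OF I(1)] ja(1)])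
 show "card (rw b J) = Suc (card (rw b I))" unfolding r using fin_rw(1)[OF I(1), of b] ja(2) by simp
 show "t \<noteq> a ==> t \<noteq> b ==> rw t J = rw t I" by (auto simp: J rw_def)
 show "card (cw i J) = card (cw i I)"
 proof (cases "i = j")
  case True
  have "cw j J = insert b (cw j I - {a})" using ab(1) by (auto simp: J cw_def)
  moreover have "a \<in> cw j I" "b \<notin> cw j I" using I by (auto simp: cw_def)
  ultimately show ?thesis using True fin_cw(1)[OF I(1), of j] card_gt_0_iff[of "cw j I"] by (auto simp: card.insert_remove)
 next
  case False
  then have "cw i J = cw i I" by (auto simp: J cw_def)
  then show ?thesis by simp
 qed
qed

lemma supp_Dl_fin: "f \<in> supp_on (gr (Dl s n p w) g) ==> f \<in> fin_supp"
proof -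
 assume f: "f \<in> supp_on (gr (Dl s n p w) g)"
 have "f J = 0" if "infinite J" for J
  using f that familyD(3)[OF family_Dl, of J s n p w] by (auto simp: supp_on_def gr_def)
 then show ?thesis by (simp add: fin_supp_def)
qed

text \<open>The diagonal coefficient vanishes exactly at the sets whose row a still has p a cells,
  and the moving term takes a cell out of row a; so the smaller bound on row a holds
  throughout.\<close>

lemma cE_supp:
 fixes f :: "(nat \<times> nat) set => 'a::field_char_0"
 assumes f: "f \<in> supp_on (gr (Dl s n p w) g)" and ab: "a \<noteq> b" "a < s" "b < s"
  and p': "Suc (p' a) = p a" "p' b = Suc (p b)" "\<And>t. t < s ==> t \<noteq> a ==> t \<noteq> b ==> p' t = p t"
 shows "cE n p a b f \<in> supp_on (gr (Dl s n p' w) g)"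
proof -
 have "J \<in> gr (Dl s n p' w) g" if n0: "cE n p a b f J \<noteq> 0" for J
 proof (cases "EE n b a f J = 0")
  case False
  obtain j I where j: "j < n" "(b, j) \<notin> I" "(a, j) \<in> I" "f I \<noteq> 0" "J = insert (b, j) (I - {(a, j)})"
   by (rule EE_nonzero[OF False ab(1)]) (rule that)
  have I: "I \<in> Dl s n p w" "card I = g" using j(4) f by (auto simp: supp_on_def gr_def)
  note sh = move_shape[OF DlD(1)[OF I(1)] j(2,3) ab(1,3) j(5)]
  have "card (rw t J) \<le> p' t" if t: "t < s" for t
   using DlD(2)[OF I(1) t] sh(3,4) sh(5)[of t] p' t by (cases "t = a"; cases "t = b") auto
  moreover have "card (cw i J) \<le> w i" if "i < n" for i using DlD(3)[OF I(1) that] sh(6) by simp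
  ultimately show ?thesis using sh(1,2) I(2) by (simp add: gr_def Dl_def)
 next
  case True
  then have n1: "(of_nat (p a) - of_nat (card (rw a J))) * f J \<noteq> 0" using n0 by (simp add: cE_def)
  then have J: "J \<in> Dl s n p w" "card J = g" using f by (auto simp: supp_on_def gr_def)
  have "card (rw a J) \<noteq> p a" using n1 by auto
  then have "card (rw t J) \<le> p' t" if t: "t < s" for t
   using DlD(2)[OF J(1) t] p' t by (cases "t = a"; cases "t = b") auto
  then show ?thesis using J DlD[OF J(1)] by (simp add: gr_def Dl_def)
 qed
 then show ?thesis by (auto simp: supp_on_def)
qed

lemma cE_cyc:
 fixes z :: "(nat \<times> nat) set => 'a::field_char_0"
 assumes z: "z \<in> cyc (cells s n) (Dl s n p w) g" and ab: "a \<noteq> b" "a < s" "b < s"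
  and p': "Suc (p' a) = p a" "p' b = Suc (p b)" "\<And>t. t < s ==> t \<noteq> a ==> t \<noteq> b ==> p' t = p t"
 shows "cE n p a b z \<in> cyc (cells s n) (Dl s n p' w) g"
proof (rule cycI)
 have z': "z \<in> supp_on (gr (Dl s n p w) g)" "bd (cells s n) z = 0" using z cyc_Dl by blast+
 show "cE n p a b z \<in> supp_on (gr (Dl s n p' w) g)" by (rule cE_supp[OF z'(1) ab p'])
 fix J assume "J \<in> Dl s n p' w"
 from bd_cE[OF supp_Dl_fin[OF z'(1)] ab(2,3) DlD(1)[OF this], of p]
 show "bd (cells s n) (cE n p a b z) J = 0" by (simp add: z'(2) cE_def lin_simps[OF lin_EE])
qed

lemma hh_fix_set:
 assumes T: "T \<subseteq> {..<s}" and R: "R \<subseteq> T \<times> {..<n}"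
 shows "hh TYPE('a::field_char_0) (cells s n) {I\<in>Dl s n p w. {x\<in>I. fst x \<in> T} = R} (g + card R)
  \<le> hD TYPE('a) s n (\<lambda>t. if t \<in> T then 0 else p t) (\<lambda>j. w j - card (cw j R)) g"
proof -
 have fam: "family (cells s n) {I\<in>Dl s n p w. {x\<in>I. fst x \<in> T} = R}" by (rule family_sub[OF family_Dl]) blast
 show ?thesis
 proof (cases "{I\<in>Dl s n p w. {x\<in>I. fst x \<in> T} = R} = {}")
  case True
  then have "gr {I\<in>Dl s n p w. {x\<in>I. fst x \<in> T} = R} (g + card R) = {}" unfolding gr_def by blast
  from hh_empty_gr[OF fam this, where 'a='a] show ?thesis by (simp only: le0)
 next
  case False
  let ?F = "{I\<in>Dl s n p w. {x\<in>I. fst x \<in> T} = R}"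
  let ?F' = "Dl s n (\<lambda>t. if t \<in> T then 0 else p t) (\<lambda>j. w j - card (cw j R))"
  obtain I0 where I0: "I0 \<in> Dl s n p w" "{x\<in>I0. fst x \<in> T} = R" using False by blast
  have RC: "R \<subseteq> cells s n" using R T by auto
  have fR: "finite R" by (rule finite_subset[OF RC]) simp
  have RI0: "R \<subseteq> I0" using I0(2) by blast
  have rR: "card (rw t R) \<le> p t" if "t < s" for t
   using DlD(2)[OF Dl_subset[OF I0(1) RI0] that] .
  have cR: "card (cw j R) \<le> w j" if "j < n" for j
   using DlD(3)[OF Dl_subset[OF I0(1) RI0] that] .
  have in1: "I - R \<in> ?F'" "R \<subseteq> I" if I: "I \<in> ?F" for I
  proof -
   have ID: "I \<in> Dl s n p w" and IR: "{x\<in>I. fst x \<in> T} = R" using I by auto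
   show RI: "R \<subseteq> I" using IR by blast
   have "card (rw t (I - R)) \<le> (if t \<in> T then 0 else p t)" if "t < s" for t
   proof (cases "t \<in> T")
    case True
    then have "rw t (I - R) = {}" using IR by (auto simp: rw_def)
    then show ?thesis using True by simp
   next
    case False
    then show ?thesis using DlD(2)[OF Dl_subset[OF ID Diff_subset] that] by simp
   qed
   moreover have "card (cw j (I - R)) \<le> w j - card (cw j R)" if "j < n" for j
   proof -
    have "cw j (I - R) = cw j I - cw j R" by (auto simp: cw_def)
    then have "card (cw j (I - R)) = card (cw j I) - card (cw j R)"
     using fin_cw(1)[OF RC] cw_mono[OF RI] by (simp add: card_Diff_subset)
    then show ?thesis using DlD(3)[OF ID that] by simp
   qed
   ultimately show "I - R \<in> ?F'" using DlD(1)[OF ID] by (auto simp: Dl_def)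
  qed
  have in2: "I \<union> R \<in> ?F" "I \<inter> R = {}" if I: "I \<in> ?F'" for I
  proof -
   have IC: "I \<subseteq> cells s n" by (rule DlD(1)[OF I])
   have r0: "rw t I = {}" if "t \<in> T" for t
    using DlD(2)[OF I, of t] that T fin_rw(1)[OF IC, of t] by auto
   then have T0: "{x\<in>I. fst x \<in> T} = {}" by (auto simp: rw_def)
   then show IR: "I \<inter> R = {}" using R by auto
   have "card (rw t (I \<union> R)) \<le> p t" if "t < s" for t
   proof (cases "t \<in> T")
    case True
    then have "rw t (I \<union> R) = rw t R" using r0[OF True] by (auto simp: rw_def)
    then show ?thesis using rR[OF that] by simp
   next
    case False
    then have "rw t (I \<union> R) = rw t I" using R by (auto simp: rw_def)
    then show ?thesis using DlD(2)[OF I that] False by simp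
   qed
   moreover have "card (cw j (I \<union> R)) \<le> w j" if "j < n" for j
   proof -
    have "cw j (I \<union> R) = cw j I \<union> cw j R" by (auto simp: cw_def)
    then have "card (cw j (I \<union> R)) \<le> card (cw j I) + card (cw j R)" by (simp only: card_Un_le)
    then show ?thesis using DlD(3)[OF I that] cR[OF that] by simp
   qed
   ultimately have "I \<union> R \<in> Dl s n p w" using IC RC by (simp add: Dl_def)
   moreover have "{x\<in>I \<union> R. fst x \<in> T} = R" using T0 R by auto
   ultimately show "I \<union> R \<in> ?F" by simp
  qed
  have "hh TYPE('a) (cells s n) ?F (g + card R) \<le> hh TYPE('a) (cells s n) ?F' g"
  proof (rule hh_iso[where \<beta> = "\<lambda>I. I - R" and \<sigma> = "\<lambda>I. \<Prod>x\<in>I - R. sg x R", OF fam family_Dl])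
   show "bij_betw (\<lambda>I. I - R) ?F ?F'"
   proof (rule bij_betw_byWitness[where f' = "\<lambda>I. I \<union> R"])
    show "\<forall>I\<in>?F. I - R \<union> R = I" "\<forall>I\<in>?F'. I \<union> R - R = I"
     by (intro ballI, drule in1(2), simp only: Un_Diff_cancel2 Un_absorb2)
      (intro ballI, drule in2(2), simp only: Un_Diff Diff_cancel Un_empty_right Diff_triv)
    show "(\<lambda>I. I - R) ` ?F \<subseteq> ?F'" by (intro image_subsetI in1(1))
    show "(\<lambda>I. I \<union> R) ` ?F' \<subseteq> ?F" by (intro image_subsetI in2(1))
   qed
   show "card I = card (I - R) + card R" if "I \<in> ?F" for I
    using card_Diff_subset[OF fR in1(2)[OF that]] card_mono[OF familyD(3)[OF fam that] in1(2)[OF that]] by simp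
   show "(\<Prod>x\<in>I - R. sg x R) * (\<Prod>x\<in>I - R. sg x R) = (1 :: 'a)" for I
    by (simp add: sg_sq[OF fR] flip: prod.distrib)
   fix u :: "(nat \<times> nat) set => 'a" and J assume u: "u \<in> supp_on ?F'" and J: "J \<in> ?F"
   let ?\<sigma> = "\<lambda>I. \<Prod>x\<in>I - R. sg x R :: 'a"
   have fJ: "finite J" "R \<subseteq> J" by (rule familyD(3)[OF fam J]) (rule in1(2)[OF J])
   have "bd (cells s n) (\<lambda>I. if I \<in> ?F then ?\<sigma> I * u (I - R) else 0) J
     = (\<Sum>x\<in>cells s n - J. sg x J * (if insert x J \<in> ?F then ?\<sigma> (insert x J) * u (insert x J - R) else 0))"
    by (simp add: bd_apply)
   also have "\<dots> = (\<Sum>x\<in>cells s n - J. ?\<sigma> J * (sg x (J - R) * u (insert x (J - R))))"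
   proof (intro sum.cong refl)
    fix x assume x: "x \<in> cells s n - J"
    then have xK: "x \<notin> R" "insert x J - R = insert x (J - R)" using fJ(2) by blast+
    show "sg x J * (if insert x J \<in> ?F then ?\<sigma> (insert x J) * u (insert x J - R) else 0)
      = ?\<sigma> J * (sg x (J - R) * u (insert x (J - R)))"
    proof (cases "insert x J \<in> ?F")
     case True
     have "J = (J - R) \<union> R" using fJ(2) by blast
     then have "sg x J = sg x (J - R) * (sg x R :: 'a)"
      using sg_Un[of "J - R" R x, where 'a='a] fJ(1) fR by auto
     moreover have "?\<sigma> (insert x J) = sg x R * ?\<sigma> J"
      unfolding xK(2) using x fJ(1) by simp
     ultimately show ?thesis using True by (simp add: xK(2) sg_sq'[OF fR] mult_ac)
    next
     case False
     have "insert x (J - R) \<notin> ?F'"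
     proof
      assume m: "insert x (J - R) \<in> ?F'"
      have e: "insert x (J - R) \<union> R = insert x J" using fJ(2) by blast
      show False using in2(1)[OF m] unfolding e by (rule notE[OF False])
     qed
     then have u0: "u (insert x (J - R)) = 0" using u by (simp add: supp_on_def)
     show ?thesis unfolding xK(2) u0 if_not_P[OF False] by (simp only: mult_zero_right)
    qed
   qed
   also have "\<dots> = ?\<sigma> J * (\<Sum>x\<in>cells s n - J. sg x (J - R) * u (insert x (J - R)))"
    by (simp add: sum_distrib_left)
   also have "(\<Sum>x\<in>cells s n - J. sg x (J - R) * u (insert x (J - R)))
     = (\<Sum>x\<in>cells s n - (J - R). sg x (J - R) * u (insert x (J - R)))"
   proof (rule sum.mono_neutral_left)
    have "insert x (J - R) \<notin> ?F'" if "x \<in> R" for x using in2(2)[of "insert x (J - R)"] that by blast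
    then show "\<forall>x\<in>cells s n - (J - R) - (cells s n - J). sg x (J - R) * u (insert x (J - R)) = 0"
     using u by (auto simp: supp_on_def)
   qed auto
   also have "\<dots> = bd (cells s n) u (J - R)" by (simp add: bd_apply)
   finally show "bd (cells s n) (\<lambda>I. if I \<in> ?F then ?\<sigma> I * u (I - R) else 0) J
     = ?\<sigma> J * bd (cells s n) u (J - R)" .
  qed
  then show ?thesis by (simp add: hD_def)
 qed
qed

text \<open>When V modulo B has dimension at most 1, a single coordinate y of the quotient map
  decides membership in B.\<close>

lemma exists_detector:
 fixes V :: "('b => 'a::field) set"
 assumes "fs.subspace V" "findim V" "fs.subspace B" "B \<subseteq> V" "fs.dim V \<le> Suc (fs.dim B)"
 obtains T :: "('b => 'a) => 'b => 'a" and y where "lin T" "\<And>b. b \<in> B ==> T b y = 0"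
  "\<And>v. v \<in> V ==> T v y = 0 ==> v \<in> B"
proof -
 obtain T :: "('b => 'a) => 'b => 'a" where T: "lin T" "\<And>x. T x = 0 \<longleftrightarrow> x \<in> B"
  by (rule exists_projection[OF assms(3)]) (rule that)
 have TB: "T b y = 0" if "b \<in> B" for b y using T(2)[of b] that by simp
 show ?thesis
 proof (cases "\<exists>v0\<in>V. T v0 \<noteq> 0")
  case False
  then show ?thesis using that[OF T(1), of undefined] TB T(2) by blast
 next
  case True
  then obtain v0 y where v0: "v0 \<in> V" "T v0 y \<noteq> 0" by (auto simp: fun_eq_iff)
  have "fs.dim V = fs.dim {v\<in>V. T v = 0} + fs.dim (T ` V)" by (rule rank_nullity[OF T(1) assms(1,2)])
  moreover have "{v\<in>V. T v = 0} = B" using T(2) assms(4) by auto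
  ultimately have d1: "fs.dim (T ` V) \<le> 1" using assms(5) by simp
  define ev :: "('b => 'a) => 'b => 'a" where "ev f = (\<lambda>_. f y)" for f
  have lev: "lin ev" by (rule linI) (auto simp: ev_def)
  have sT: "fs.subspace (T ` V)" by (rule fsp.linear_subspace_image[OF T(1) assms(1)])
  have fT: "findim (T ` V)" by (rule findim_image[OF T(1) assms(2)])
  have "ev (T v0) \<noteq> 0" using v0(2) by (auto simp: ev_def fun_eq_iff)
  then have "fs.dim (ev ` T ` V) \<noteq> 0" using dim_eq_0D[OF findim_image[OF lev fT]] v0(1) by blast
  then have "fs.dim {f\<in>T ` V. ev f = 0} = 0" using rank_nullity[OF lev sT fT] d1 by simp
  moreover have "findim {f\<in>T ` V. ev f = 0}" by (rule findim_mono[OF fT]) auto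
  ultimately have k: "f = 0" if "f \<in> T ` V" "ev f = 0" for f using dim_eq_0D that by blast
  have "v \<in> B" if "v \<in> V" "T v y = 0" for v
  proof -
   have "T v = 0" by (rule k[OF imageI[OF that(1)]]) (use that(2) in \<open>simp add: ev_def fun_eq_iff\<close>)
   then show ?thesis using T(2) by blast
  qed
  then show ?thesis using that[OF T(1), of y] TB by blast
 qed
qed

lemma adj_cr:
 fixes f g :: "'c::linorder set => 'a::field_char_0"
 assumes "finite C" "x \<in> C"
 shows "(\<Sum>J\<in>Pow C. cr x f J * g J) = (\<Sum>J\<in>Pow C. f J * an x g J)"
proof -
 have "(\<Sum>J\<in>Pow C. cr x f J * g J) = (\<Sum>J\<in>insert x ` {J\<in>Pow C. x \<notin> J}. sg x (J - {x}) * f (J - {x}) * g J)"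
 proof (rule sum.mono_neutral_cong_right)
  show "\<forall>J\<in>Pow C - insert x ` {J\<in>Pow C. x \<notin> J}. cr x f J * g J = 0"
  proof
   fix J assume J: "J \<in> Pow C - insert x ` {J\<in>Pow C. x \<notin> J}"
   have "x \<notin> J"
   proof
    assume "x \<in> J"
    then have "J = insert x (J - {x})" by blast
    moreover have "J - {x} \<in> {J\<in>Pow C. x \<notin> J}" using J by blast
    ultimately show False using J by blast
   qed
   then show "cr x f J * g J = 0" by (simp add: cr_def)
  qed
 qed (use assms in \<open>auto simp: cr_def\<close>)
 also have "\<dots> = (\<Sum>J\<in>{J\<in>Pow C. x \<notin> J}. sg x J * f J * g (insert x J))"
 proof (subst sum.reindex)
  show "inj_on (insert x) {J\<in>Pow C. x \<notin> J}" by (rule inj_onI) (metis (no_types, lifting) Diff_insert_absorb mem_Collect_eq)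
 qed (simp add: o_def)
 also have "\<dots> = (\<Sum>J\<in>Pow C. f J * an x g J)"
  by (rule sum.mono_neutral_cong_left) (use assms in \<open>auto simp: an_def\<close>)
 finally show ?thesis .
qed

lemma adj_EE:
 fixes f g :: "(nat \<times> nat) set => 'a::field_char_0"
 assumes "a < s" "b < s"
 shows "(\<Sum>J\<in>Pow (cells s n). EE n a b f J * g J) = (\<Sum>J\<in>Pow (cells s n). f J * EE n b a g J)"
proof -
 have "(\<Sum>J\<in>Pow (cells s n). cr (a, j) (an (b, j) f) J * g J) = (\<Sum>J\<in>Pow (cells s n). f J * cr (b, j) (an (a, j) g) J)"
  if "j < n" for j
  using adj_cr[of "cells s n" "(a, j)" "an (b, j) f" g] adj_cr[of "cells s n" "(b, j)" "an (a, j) g" f] that assms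
  by (simp add: mult.commute)
 then have "(\<Sum>j<n. \<Sum>J\<in>Pow (cells s n). cr (a, j) (an (b, j) f) J * g J)
   = (\<Sum>j<n. \<Sum>J\<in>Pow (cells s n). f J * cr (b, j) (an (a, j) g) J)" by simp
 then show ?thesis unfolding EE_def sum_apply sum_distrib_left sum_distrib_right
  by (simp add: sum.swap[of _ "Pow (cells s n)"])
qed

section \<open>Order seven, column total 13: homology inside a gl_3-kernel\<close>

abbreviation (input) ka :: "nat => nat => nat => nat => nat" where
 "ka x y z \<equiv> (\<lambda>t. if t = 0 then x else if t = 1 then y else z)"
abbreviation (input) Wa :: "nat list => nat => nat => nat => (nat \<times> nat) set set" where
 "Wa m x y z \<equiv> WW 7 {0, 1, 2} (ka x y z) m"

text \<open>The image of (E_20, E_21) is measured through its annihilator, which by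
  \<open>adj_EE\<close> lies in the kernel of (f, g) -> E_02 f + E_12 g. By \<open>gl3\<close> that
  kernel embeds under E_20 into weight (0, 1, 5), which accounts for the last term.\<close>

lemma EE_ker_dim:
 fixes m :: "nat list"
 defines "K \<equiv> {f \<in> supp_on (Wa m 1 2 3). EE 7 2 0 f = 0 \<and> EE 7 2 1 f = (0 :: _ => 'a::field_char_0)}"
 shows "fs.dim K + (card (Wa m 0 2 4) + card (Wa m 1 1 4)) \<le> card (Wa m 1 2 3) + card (Wa m 0 1 5)"
proof -
 let ?W0 = "Wa m 1 2 3" and ?W1 = "Wa m 0 2 4" and ?W2 = "Wa m 1 1 4" and ?W3 = "Wa m 0 1 5"
 let ?C = "cells 3 7"
 have fin: "finite ?W0" "finite ?W1" "finite ?W2" "finite ?W3" by simp_all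
 have disj: "?W1 \<inter> ?W2 = {}" by (auto simp: WW_def)
 have sub: "WW 7 {0, 1, 2} k m \<subseteq> Pow ?C" for k by (auto simp: WW_def)
 have E20: "EE 7 2 0 f \<in> supp_on ?W1" if "f \<in> supp_on ?W0" for f :: "_ => 'a" by (rule EE_supp[OF that]) auto
 have E21: "EE 7 2 1 f \<in> supp_on ?W2" if "f \<in> supp_on ?W0" for f :: "_ => 'a" by (rule EE_supp[OF that]) auto
 have E02: "EE 7 0 2 f \<in> supp_on ?W0" if "f \<in> supp_on ?W1" for f :: "_ => 'a" by (rule EE_supp[OF that]) auto
 have E12: "EE 7 1 2 f \<in> supp_on ?W0" if "f \<in> supp_on ?W2" for f :: "_ => 'a" by (rule EE_supp[OF that]) auto
 have E20': "EE 7 2 0 f \<in> supp_on ?W3" if "f \<in> supp_on ?W2" for f :: "_ => 'a" by (rule EE_supp[OF that]) auto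
 let ?T = "\<lambda>f :: _ => 'a. EE 7 2 0 f + EE 7 2 1 f"
 have lT: "lin ?T" by (rule linI) (auto simp: lin_simps[OF lin_EE] fun_eq_iff algebra_simps)
 \<comment> \<open>The two summands of \<open>?T\<close> live on disjoint weights, so the sum
   vanishes only if both do.\<close>
 have ker: "{f\<in>supp_on ?W0. ?T f = 0} = K"
 proof (intro equalityI subsetI)
  fix f assume f: "f \<in> {f\<in>supp_on ?W0. ?T f = 0}"
  have "EE 7 2 0 f J = 0 \<and> EE 7 2 1 f J = 0" for J
  proof -
   have "EE 7 2 0 f J + EE 7 2 1 f J = 0"
   proof -
    have "?T f = 0" using f by blast
    from fun_cong[OF this, of J] show ?thesis by (simp only: plus_fun_apply zero_fun_apply)
   qed
   moreover have "EE 7 2 0 f J = 0 \<or> EE 7 2 1 f J = 0"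
   proof (cases "J \<in> ?W1")
    case True
    then have "J \<notin> ?W2" using disj by blast
    moreover have "EE 7 2 1 f \<in> supp_on ?W2" by (rule E21) (use f in blast)
    ultimately show ?thesis unfolding supp_on_def by blast
   next
    case False
    moreover have "EE 7 2 0 f \<in> supp_on ?W1" by (rule E20) (use f in blast)
    ultimately show ?thesis unfolding supp_on_def by blast
   qed
   ultimately show ?thesis by auto
  qed
  then show "f \<in> K" using f by (auto simp: K_def fun_eq_iff)
 qed (auto simp: K_def)
 let ?V = "?T ` supp_on ?W0" and ?X = "?W1 \<union> ?W2"
 have VX: "?V \<subseteq> supp_on ?X" using E20 E21 by (auto simp: supp_on_def)
 have rn: "card ?W0 = fs.dim K + fs.dim ?V"
  using rank_nullity[OF lT subspace_supp_on[of ?W0] findim_supp_on[OF fin(1)]] ker fin(1) by simp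
 let ?P = "{f\<in>supp_on ?X. \<forall>v\<in>?V. (\<Sum>x\<in>?X. v x * f x) = 0}"
 let ?Q = "{f\<in>supp_on ?X. EE 7 0 2 (res ?W1 f) + EE 7 1 2 (res ?W2 f) = (0 :: _ => 'a)}"
 have "?P \<subseteq> ?Q"
 proof
  fix \<phi> assume \<phi>: "\<phi> \<in> ?P"
  let ?G = "EE 7 0 2 (res ?W1 \<phi>) + EE 7 1 2 (res ?W2 \<phi>)"
  have rs: "res ?W1 \<phi> \<in> supp_on ?W1" "res ?W2 \<phi> \<in> supp_on ?W2" by (auto simp: supp_on_def res_def)
  have "?G J = 0" for J
  proof (cases "J \<in> ?W0")
   case True
   define f where "f = (\<lambda>I. if I = J then 1 else 0 :: 'a)"
   have f: "f \<in> supp_on ?W0" using True by (auto simp: f_def supp_on_def)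
   have JC: "J \<in> Pow ?C" using True sub by blast
   have ff: "(\<Sum>I\<in>Pow ?C. f I * h I) = h J" for h :: "_ => 'a"
   proof -
    have "(\<Sum>I\<in>Pow ?C. f I * h I) = (\<Sum>I\<in>Pow ?C. if I = J then h I else 0)" by (intro sum.cong) (auto simp: f_def)
    then show ?thesis using JC by simp
   qed
   have "?G J = (\<Sum>I\<in>Pow ?C. f I * EE 7 0 2 (res ?W1 \<phi>) I) + (\<Sum>I\<in>Pow ?C. f I * EE 7 1 2 (res ?W2 \<phi>) I)"
    by (simp add: ff)
   also have "\<dots> = (\<Sum>I\<in>Pow ?C. EE 7 2 0 f I * res ?W1 \<phi> I) + (\<Sum>I\<in>Pow ?C. EE 7 2 1 f I * res ?W2 \<phi> I)"
    by (simp add: adj_EE[of _ 3])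
   also have "\<dots> = (\<Sum>I\<in>Pow ?C. ?T f I * \<phi> I)"
    unfolding sum.distrib[symmetric]
   proof (rule sum.cong[OF refl])
    fix I
    show "EE 7 2 0 f I * res ?W1 \<phi> I + EE 7 2 1 f I * res ?W2 \<phi> I = ?T f I * \<phi> I"
     using E20[OF f] E21[OF f] disj \<phi> by (auto simp: res_def supp_on_def distrib_right)
   qed
   also have "\<dots> = (\<Sum>I\<in>?X. ?T f I * \<phi> I)"
    by (rule sum.mono_neutral_right) (use sub \<phi> in \<open>auto simp: supp_on_def\<close>)
   also have "\<dots> = 0" using \<phi> f by blast
   finally show ?thesis .
  next
   case False
   then show ?thesis using E02[OF rs(1)] E12[OF rs(2)] by (simp add: supp_on_def)
  qed
  then show "\<phi> \<in> ?Q" using \<phi> by (auto simp: fun_eq_iff)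
 qed
 then have "fs.dim ?P \<le> fs.dim ?Q" using fin by (intro dim_mono findim_mono[OF findim_supp_on[of ?X]]) auto
 also have "\<dots> \<le> card ?W3"
 proof (rule ker_pair_dim[OF lin_EE lin_EE lin_EE[of 7 2 0] fin(2-4) E20'])
  \<comment> \<open>Translates the indices 1, 2, 3 of \<open>gl3\<close> into the rows 0, 1, 2;
    index 0 is sent to 3 to keep the map injective.\<close>
  define r :: "nat => nat" where "r i = (if i = 0 then 3 else if i \<le> 3 then i - 1 else i)" for i
  have inj: "inj r" by (rule injI) (auto simp: r_def split: if_splits)
  have r: "r 1 = 0" "r 2 = 1" "r 3 = 2" by (simp_all add: r_def)
  fix f g :: "(nat \<times> nat) set => 'a"
  assume "f \<in> supp_on ?W1" "g \<in> supp_on ?W2" "EE 7 0 2 f + EE 7 1 2 g = 0" "EE 7 2 0 g = 0"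
  then show "f = 0 \<and> g = 0" using gl3_EE[OF inj, of f 7 m g] unfolding r by simp
 qed
 finally have "fs.dim ?P \<le> card ?W3" .
 moreover have "card ?X \<le> fs.dim ?V + fs.dim ?P" by (rule perp_dim[OF _ VX]) (use fin in simp)
 moreover have "card ?X = card ?W1 + card ?W2" using disj fin by (intro card_Un_disjoint)
 ultimately show ?thesis using rn by linarith
qed

abbreviation (input) tp :: "(nat \<times> nat) set" where "tp \<equiv> {0, 1, 2} \<times> {..<7}"
abbreviation (input) bt :: "(nat \<times> nat) set" where "bt \<equiv> {3, 4} \<times> {..<7}"

text \<open>The coefficient of e_R when a chain is expanded along the rows 0, 1, 2; it is a chain on
  the rows 3, 4.\<close>

definition sl :: "(nat \<times> nat) set => ((nat \<times> nat) set => 'a::field_char_0) => (nat \<times> nat) set => 'a" where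
 "sl R f K = (if K \<subseteq> bt then f (R \<union> K) else 0)"

lemma lin_sl: "lin (sl R)"
 by (rule linI) (auto simp: sl_def fun_eq_iff)

lemma cells57: "cells 5 7 = tp \<union> bt" "tp \<inter> bt = {}"
proof -
 have "{..<5::nat} = {0, 1, 2, 3, 4}" by auto
 then show "cells 5 7 = tp \<union> bt" by auto
qed auto

lemma rw_Un_split: "R \<subseteq> tp ==> K \<subseteq> bt ==> t \<in> {0, 1, 2} ==> rw t (R \<union> K) = rw t R"
 "R \<subseteq> tp ==> K \<subseteq> bt ==> t \<notin> {0, 1, 2} ==> rw t (R \<union> K) = rw t K"
 "R \<subseteq> tp ==> K \<subseteq> bt ==> card (cw j (R \<union> K)) = card (cw j R) + card (cw j K)"
proof -
 assume a: "R \<subseteq> tp" "K \<subseteq> bt"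
 show "t \<in> {0, 1, 2} ==> rw t (R \<union> K) = rw t R" "t \<notin> {0, 1, 2} ==> rw t (R \<union> K) = rw t K"
  using a by (auto simp: rw_def)
 have "cw j (R \<union> K) = cw j R \<union> cw j K" by (auto simp: cw_def)
 moreover have "cw j R \<subseteq> {0, 1, 2}" "cw j K \<subseteq> {3, 4}" using a by (auto simp: cw_def)
 ultimately show "card (cw j (R \<union> K)) = card (cw j R) + card (cw j K)"
  using card_Un_disjoint[of "cw j R" "cw j K"] finite_subset by fastforce
qed

lemma card_top: "R \<subseteq> tp ==> card R = card (rw 0 R) + card (rw 1 R) + card (rw 2 R)"
proof -
 assume "R \<subseteq> tp"
 then have "R \<subseteq> cells 3 7" by auto
 from card_rows[OF this] show ?thesis by (simp add: numeral_eq_Suc)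
qed

abbreviation (input) p0 :: "(nat => nat) => nat => nat" where "p0 p \<equiv> (\<lambda>t. if t \<in> {0, 1, 2} then 0 else p t)"
abbreviation (input) wm :: "nat list => (nat \<times> nat) set => nat => nat" where "wm l R \<equiv> (\<lambda>j. l ! j - card (cw j R))"

lemma sl_supp:
 fixes f :: "(nat \<times> nat) set => 'a::field_char_0"
 assumes f: "f \<in> supp_on (gr (Dl 5 7 p ((!) l)) g)" and R: "R \<subseteq> tp"
 shows "sl R f \<in> supp_on (gr (Dl 5 7 (p0 p) (wm l R)) (g - card R))"
proof -
 have fR: "finite R" by (rule finite_subset[OF R]) simp
 have "K \<in> gr (Dl 5 7 (p0 p) (wm l R)) (g - card R)" if n0: "sl R f K \<noteq> 0" for K
 proof -
  have K: "K \<subseteq> bt" "f (R \<union> K) \<noteq> 0" using n0 by (auto simp: sl_def split: if_splits)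
  have fK: "finite K" by (rule finite_subset[OF K(1)]) simp
  have I: "R \<union> K \<in> Dl 5 7 p ((!) l)" "card (R \<union> K) = g" using K(2) f by (auto simp: supp_on_def gr_def)
  have "R \<inter> K = {}" using R K(1) cells57(2) by blast
  then have "card K = g - card R" using I(2) fR fK by (simp add: card_Un_disjoint)
  moreover have "card (rw t K) \<le> p0 p t" if "t < 5" for t
  proof (cases "t \<in> {0, 1, 2}")
   case True
   then have "rw t K = {}" using K(1) by (auto simp: rw_def)
   then show ?thesis using True by simp
  next
   case False then show ?thesis using DlD(2)[OF I(1) that] rw_Un_split(2)[OF R K(1) False] by simp
  qed
  moreover have "card (cw j K) \<le> wm l R j" if "j < 7" for j
   using DlD(3)[OF I(1) that] rw_Un_split(3)[OF R K(1), of j] by simp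
  ultimately show ?thesis using K(1) cells57 by (auto simp: gr_def Dl_def)
 qed
 then show ?thesis by (auto simp: supp_on_def)
qed

text \<open>With six cells in R the top rows are saturated, so only bottom cells contribute to the
  boundary. These come after all cells of R in the lexicographic order, and the even size of R makes
  the sign 1.\<close>

lemma sl_bd:
 fixes f :: "(nat \<times> nat) set => 'a::field_char_0"
 assumes f: "f \<in> supp_on (gr (Dl 5 7 p ((!) l)) g)" and R: "R \<subseteq> tp" "card R = 6" and p: "p 0 + p 1 + p 2 = 6"
 shows "sl R (bd (cells 5 7) f) = bd (cells 5 7) (sl R f)"
proof
 fix K
 let ?C = "cells 5 7"
 have fR: "finite R" by (rule finite_subset[OF R(1)]) simp
 show "sl R (bd ?C f) K = bd ?C (sl R f) K"
 proof (cases "K \<subseteq> bt")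
  case False
  then have "bd ?C (sl R f) K = 0" by (intro bd_eq_0) (auto simp: sl_def)
  then show ?thesis using False by (simp add: sl_def)
 next
  case True
  have fK: "finite K" by (rule finite_subset[OF True]) simp
  have dj: "R \<inter> K = {}" using R(1) True cells57(2) by blast
  have top: "f (insert x (R \<union> K)) = 0" if x: "x \<in> tp - R" for x
  proof (rule ccontr)
   assume "f (insert x (R \<union> K)) \<noteq> 0"
   then have "insert x (R \<union> K) \<in> Dl 5 7 p ((!) l)" using f by (auto simp: supp_on_def gr_def)
   then have D: "insert x R \<in> Dl 5 7 p ((!) l)" by (rule Dl_subset) auto
   have "card (insert x R) = 7" using x fR R(2) by simp
   moreover have "card (insert x R) \<le> p 0 + p 1 + p 2"
    using card_top[of "insert x R"] x R(1) DlD(2)[OF D, of 0] DlD(2)[OF D, of 1] DlD(2)[OF D, of 2] by auto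
   ultimately show False using p by simp
  qed
  have sgn: "sg x (R \<union> K) = (sg x K :: 'a)" if "x \<in> bt" for x
  proof -
   have "{y\<in>R. y < x} = R" using R(1) that by (auto simp: less_prod_def)
   then have "sg x R = (1 :: 'a)" using R(2) fR by (simp add: sg_def)
   then show ?thesis using sg_Un[OF fR fK dj, of x, where 'a='a] by simp
  qed
  have "bd ?C f (R \<union> K) = (\<Sum>x\<in>?C - (R \<union> K). sg x (R \<union> K) * f (insert x (R \<union> K)))" by (simp add: bd_apply)
  also have "\<dots> = (\<Sum>x\<in>bt - K. sg x K * f (R \<union> insert x K))"
  proof (rule sum.mono_neutral_cong_right)
   show "bt - K \<subseteq> ?C - (R \<union> K)" using cells57 R(1) by blast
   show "\<forall>x\<in>?C - (R \<union> K) - (bt - K). sg x (R \<union> K) * f (insert x (R \<union> K)) = 0"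
   proof
    fix x assume "x \<in> ?C - (R \<union> K) - (bt - K)"
    then have "x \<in> tp - R" using cells57(1) by blast
    from top[OF this] show "sg x (R \<union> K) * f (insert x (R \<union> K)) = 0" by simp
   qed
   show "sg x (R \<union> K) * f (insert x (R \<union> K)) = sg x K * f (R \<union> insert x K)" if "x \<in> bt - K" for x
    using sgn[of x] that by simp
  qed simp
  also have "\<dots> = (\<Sum>x\<in>?C - K. sg x K * sl R f (insert x K))"
  proof (rule sum.mono_neutral_cong_left)
   show "bt - K \<subseteq> ?C - K" using cells57 by blast
   show "sg x K * f (R \<union> insert x K) = sg x K * sl R f (insert x K)" if "x \<in> bt - K" for x
    using that True by (simp add: sl_def)
   show "\<forall>x\<in>?C - K - (bt - K). sg x K * sl R f (insert x K) = 0" by (auto simp: sl_def)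
  qed simp
  finally show ?thesis using True by (simp add: sl_def bd_apply)
 qed
qed

text \<open>The move happens among top cells, which precede all bottom cells, so its signs do not
  see K; it therefore commutes with slicing and with any linear functional of the slice.\<close>

lemma sl_EE:
 fixes f :: "(nat \<times> nat) set => 'a::field_char_0"
 assumes R: "R \<subseteq> tp" and K: "K \<subseteq> bt" and ab: "a \<in> {0, 1, 2}" "b \<in> {0, 1, 2}" and h: "lin h"
  and \<psi>: "\<And>I. I \<subseteq> tp ==> \<psi> I = h (sl I f) y"
 shows "EE 7 b a \<psi> R = h (sl R (EE 7 b a f)) y"
proof -
 have fR: "finite R" by (rule finite_subset[OF R]) simp
 have s1: "sg x (I \<union> K) = (sg x I :: 'a)" if "x \<in> tp" "I \<subseteq> tp" "K \<subseteq> bt" for x I K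
 proof -
  have fin: "finite I" "finite K" by (rule finite_subset[OF that(2)], simp) (rule finite_subset[OF that(3)], simp)
  have "\<not> y < x" if "y \<in> K" for y using that \<open>K \<subseteq> bt\<close> \<open>x \<in> tp\<close> by (auto simp: less_prod_def)
  then have "{y\<in>I \<union> K. y < x} = {y\<in>I. y < x}" by auto
  then show ?thesis using fin by (simp add: sg_def)
 qed
 let ?I = "\<lambda>j. insert (a, j) (R - {(b, j)})"
 let ?c = "\<lambda>j. if (b, j) \<in> R \<and> (a, j) \<notin> R - {(b, j)} then sg (b, j) (R - {(b, j)}) * sg (a, j) (R - {(b, j)}) else (0 :: 'a)"
 have It: "?I j \<subseteq> tp" if "j < 7" for j using R ab that by auto
 have g: "cr (b, j) (an (a, j) g) R = ?c j * g (?I j)" for j and g :: "(nat \<times> nat) set => 'a"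
  by (simp add: cr_def an_def)
 have "sl R (EE 7 b a f) = (\<Sum>j<7. fscale (?c j) (sl (?I j) f))"
 proof
  fix K
  show "sl R (EE 7 b a f) K = (\<Sum>j<7. fscale (?c j) (sl (?I j) f)) K"
  proof (cases "K \<subseteq> bt")
   case True
   have "cr (b, j) (an (a, j) f) (R \<union> K) = ?c j * f (?I j \<union> K)" if j: "j < 7" for j
   proof -
    have n: "(b, j) \<notin> K" "(a, j) \<notin> K" using ab True by auto
    have e: "(R \<union> K) - {(b, j)} = (R - {(b, j)}) \<union> K" using n by blast
    have sgs: "sg (b, j) ((R - {(b, j)}) \<union> K) = (sg (b, j) (R - {(b, j)}) :: 'a)"
     "sg (a, j) ((R - {(b, j)}) \<union> K) = (sg (a, j) (R - {(b, j)}) :: 'a)"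
     using s1[of _ "R - {(b, j)}" K] ab j R True by auto
    show ?thesis unfolding cr_def an_def e sgs using n by (simp add: e)
   qed
   then show ?thesis using True by (simp add: sl_def EE_def sum_apply)
  qed (simp add: sl_def sum_apply)
 qed
 then have "h (sl R (EE 7 b a f)) y = (\<Sum>j<7. ?c j * h (sl (?I j) f) y)"
  by (simp add: fsp.linear_sum[OF h] lin_simps[OF h] sum_apply)
 also have "\<dots> = (\<Sum>j<7. ?c j * \<psi> (?I j))" using \<psi>[OF It] by (intro sum.cong refl) simp
 also have "\<dots> = EE 7 b a \<psi> R" unfolding EE_def sum_apply by (simp only: g)
 finally show ?thesis ..
qed

lemma lt5: "(t::nat) < 5 \<longleftrightarrow> t = 0 \<or> t = 1 \<or> t = 2 \<or> t = 3 \<or> t = 4"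
 by auto

lemma hh_restrict:
 assumes F: "family C F" and C: "C' \<subseteq> C" "\<And>I. I \<in> F ==> I \<subseteq> C'"
 shows "hh TYPE('a::field_char_0) C F g = hh TYPE('a) C' F g"
proof -
 have "res F (bd C f) = res F (bd C' f)" if f: "f \<in> supp_on (gr F k)" for k and f :: "'b set => 'a"
 proof
  fix J
  have "bd C f J = bd C' f J" if "J \<in> F"
  proof -
   have "bd C f J = (\<Sum>x\<in>C' - J. sg x J * f (insert x J))"
    unfolding bd_apply[OF familyD(1)[OF F]]
   proof (rule sum.mono_neutral_right)
    show "\<forall>x\<in>C - J - (C' - J). sg x J * f (insert x J) = 0"
    proof
     fix x assume x: "x \<in> C - J - (C' - J)"
     have "insert x J \<notin> F" using C(2)[of "insert x J"] x by blast
     then show "sg x J * f (insert x J) = 0" using f by (simp add: supp_on_def gr_def)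
    qed
   qed (use familyD(1)[OF F] C(1) in auto)
   then show ?thesis by (simp only: bd_apply[OF finite_subset[OF C(1) familyD(1)[OF F]]])
  qed
  then show "res F (bd C f) J = res F (bd C' f) J" by (simp add: res_def)
 qed
 then have "cyc C F g = (cyc C' F g :: ('b set => 'a) set)" "bnd C F g = (bnd C' F g :: ('b set => 'a) set)"
  unfolding cyc_def bnd_def by auto
 then show ?thesis by (simp add: hh_def)
qed

text \<open>Take four positions with maximal sum. A sum of at most 7 would leave an entry at most 1
  among them, hence by maximality all three outer entries at most 1, and the total would be at most
  10.\<close>

lemma four_of_seven:
 assumes "l \<in> WS 7 11"
 obtains U where "U \<subseteq> {..<7}" "card U = 4" "8 \<le> (\<Sum>t\<in>U. l ! t)"
proof -
 let ?X = "{U. U \<subseteq> {..<7::nat} \<and> card U = 4}"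
 have fX: "finite ?X" by (rule finite_subset[of _ "Pow {..<7}"]) auto
 have nX: "{..<4} \<in> ?X" by auto
 obtain U where U: "U \<in> ?X" "\<And>V. V \<in> ?X ==> (\<Sum>t\<in>V. l ! t) \<le> (\<Sum>t\<in>U. l ! t)"
 proof -
  have "\<exists>U\<in>?X. \<forall>V\<in>?X. (\<Sum>t\<in>V. l ! t) \<le> (\<Sum>t\<in>U. l ! t)"
  proof -
   let ?M = "Max ((\<lambda>U. \<Sum>t\<in>U. l ! t) ` ?X)"
   have "?M \<in> (\<lambda>U. \<Sum>t\<in>U. l ! t) ` ?X" by (rule Max_in) (use fX nX in blast)+
   then obtain U where "U \<in> ?X" "?M = (\<Sum>t\<in>U. l ! t)" by auto
   moreover have "(\<Sum>t\<in>V. l ! t) \<le> ?M" if "V \<in> ?X" for V by (rule Max_ge) (use fX that in blast)+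
   ultimately show ?thesis by auto
  qed
  then show ?thesis using that by (elim bexE) blast
 qed
 have fU: "finite U" using U(1) finite_subset by auto
 have "8 \<le> (\<Sum>t\<in>U. l ! t)"
 proof (rule ccontr)
  assume n: "\<not> ?thesis"
  have "\<exists>t\<in>U. l ! t \<le> 1"
  proof (rule ccontr)
   assume "\<not> ?thesis"
   then have "(\<Sum>t\<in>U. 2) \<le> (\<Sum>t\<in>U. l ! t)" by (intro sum_mono) (metis Suc_1 not_less_eq_eq One_nat_def)
   then show False using n U(1) by simp
  qed
  then obtain t where t: "t \<in> U" "l ! t \<le> 1" by blast
  have out: "l ! i \<le> 1" if i: "i \<in> {..<7} - U" for i
  proof -
   have m: "insert i (U - {t}) \<in> ?X" using U(1) t(1) i fU by (auto simp: card_gt_0_iff)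
   have "(\<Sum>t\<in>insert i (U - {t}). l ! t) = l ! i + (\<Sum>t\<in>U - {t}. l ! t)" using i fU by simp
   moreover have "(\<Sum>t\<in>U. l ! t) = l ! t + (\<Sum>t\<in>U - {t}. l ! t)" by (rule sum.remove[OF fU t(1)])
   ultimately show ?thesis using U(2)[OF m] t(2) by simp
  qed
  have "(\<Sum>i<7. l ! i) = (\<Sum>i\<in>{..<7} - U. l ! i) + (\<Sum>i\<in>U. l ! i)"
   by (rule sum.subset_diff) (use U(1) in auto)
  moreover have "(\<Sum>i\<in>{..<7} - U. l ! i) \<le> (\<Sum>i\<in>{..<7} - U. 1)" by (rule sum_mono) (rule out)
  moreover have "card ({..<7} - U) = 3" using U(1) fU by (simp add: card_Diff_subset)
  ultimately show False using WS_D(2)[OF assms] n by simp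
 qed
 then show ?thesis using that[of U] U(1) by blast
qed

text \<open>Only rows 2, 3, 4 are occupied. After transposition to a 7 x 3 grid,
  \<open>vanish_large\<close> applies with c = 3 and the rows of \<open>four_of_seven\<close>: 4 + 4
  + 5 = 10 + 3 and 3 * 2 + 11 < 8 + 10.\<close>

lemma HL_00445: "HL TYPE('a::field_char_0) 7 [0,0,4,4,5] 11 10 = 0"
 unfolding HL_def
proof (intro sum.neutral ballI)
 fix l assume l: "l \<in> WS 7 11"
 let ?F = "Dl 5 7 ((!) [0,0,4,4,5]) ((!) l)" and ?C = "{2,3,4} \<times> {..<7}"
 define \<phi> :: "nat \<times> nat => nat \<times> nat" where "\<phi> x = (snd x, fst x - 2)" for x
 have z: "(t, j) \<notin> I" if I: "I \<in> ?F" "t = 0 \<or> t = 1" for t j I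
 proof -
  have "card (rw t I) \<le> 0" using DlD(2)[OF I(1), of t] I(2) by auto
  then have "rw t I = {}" using fin_rw(1)[OF DlD(1)[OF I(1)], of t] by simp
  then show ?thesis by (auto simp: rw_def)
 qed
 have sub: "I \<subseteq> ?C" if I: "I \<in> ?F" for I
 proof
  fix x assume x: "x \<in> I"
  obtain t j where e: "x = (t, j)" by (cases x)
  have "t < 5" "j < 7" using x e DlD(1)[OF I] by auto
  moreover have "\<not> (t = 0 \<or> t = 1)"
  proof
   assume h: "t = 0 \<or> t = 1"
   from z[OF I h, of j] x e show False by simp
  qed
  ultimately show "x \<in> ?C" using e by auto
 qed
 have CC: "?C \<subseteq> cells 5 7" by auto
 have fam: "family ?C ?F"
 proof (rule familyI)
  show "I \<subseteq> ?C" if "I \<in> ?F" for I by (rule sub[OF that])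
  show "K \<in> ?F" if "I \<in> ?F" "J \<in> ?F" "J \<subseteq> K" "K \<subseteq> I" for I J K by (rule Dl_subset[OF that(1,4)])
 qed simp
 have inj: "inj_on \<phi> ?C" by (rule inj_onI) (auto simp: \<phi>_def)
 have im: "\<phi> ` ?C = cells 7 3"
 proof (intro equalityI subsetI)
  fix y assume "y \<in> cells 7 3"
  then have "y = \<phi> (snd y + 2, fst y)" "(snd y + 2, fst y) \<in> ?C" by (auto simp: \<phi>_def)
  then show "y \<in> \<phi> ` ?C" by blast
 qed (auto simp: \<phi>_def)
 have rc: "card (rw t (\<phi> ` I)) = card (cw t I)" "cw j (\<phi> ` I) = rw (j + 2) I" if "I \<subseteq> ?C" for I t j
 proof -
  have "rw t (\<phi> ` I) = (\<lambda>a. a - 2) ` cw t I" by (force simp: \<phi>_def rw_def cw_def)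
  moreover have "inj_on (\<lambda>a. a - 2) (cw t I)"
  proof (rule inj_onI)
   have ge: "2 \<le> a" if "a \<in> cw t I" for a
   proof -
    have "(a, t) \<in> ?C" using that \<open>I \<subseteq> ?C\<close> unfolding cw_def by blast
    then show ?thesis by auto
   qed
   fix a b assume "a \<in> cw t I" "b \<in> cw t I" "a - 2 = b - 2"
   then show "a = b" using ge[of a] ge[of b] by linarith
  qed
  ultimately show "card (rw t (\<phi> ` I)) = card (cw t I)" by (simp add: card_image)
  show "cw j (\<phi> ` I) = rw (j + 2) I"
  proof (intro equalityI subsetI)
   fix t assume "t \<in> cw j (\<phi> ` I)"
   then obtain x where x: "x \<in> I" "\<phi> x = (t, j)" unfolding cw_def by force
   have "x \<in> ?C" using x(1) that by blast
   then have "x = (j + 2, t)" using x(2) by (cases x) (auto simp: \<phi>_def)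
   then show "t \<in> rw (j + 2) I" using x(1) by (simp add: rw_def)
  next
   fix t assume "t \<in> rw (j + 2) I"
   then have "(j + 2, t) \<in> I" by (simp add: rw_def)
   then have "\<phi> (j + 2, t) \<in> \<phi> ` I" by (rule imageI)
   then show "t \<in> cw j (\<phi> ` I)" by (simp add: \<phi>_def cw_def)
  qed
 qed
 have imF: "(`) \<phi> ` ?F = Dl 7 3 ((!) l) ((!) [4,4,5])"
 proof (intro equalityI subsetI)
  fix J assume "J \<in> (`) \<phi> ` ?F"
  then obtain I where I: "I \<in> ?F" "J = \<phi> ` I" by blast
  have "J \<subseteq> cells 7 3" using sub[OF I(1)] im I(2) by blast
  moreover have "card (rw t J) \<le> l ! t" if "t < 7" for t
   using rc(1)[OF sub[OF I(1)], of t] DlD(3)[OF I(1) that] I(2) by simp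
  moreover have "card (cw j J) \<le> [4,4,5] ! j" if "j < 3" for j
   using rc(2)[OF sub[OF I(1)], of j] DlD(2)[OF I(1), of "j + 2"] I(2) that by simp
  ultimately show "J \<in> Dl 7 3 ((!) l) ((!) [4,4,5])" by (simp add: Dl_def)
 next
  fix J assume J: "J \<in> Dl 7 3 ((!) l) ((!) [4,4,5])"
  obtain I where I: "I \<subseteq> ?C" "J = \<phi> ` I" using DlD(1)[OF J] im by (metis subset_image_iff)
  have "card (rw t I) \<le> [0,0,4,4,5] ! t" if "t < 5" for t
  proof (cases "t < 2")
   case True
   then have "rw t I = {}" using I(1) by (auto simp: rw_def)
   then show ?thesis by simp
  next
   case False
   then have t: "t = (t - 2) + 2" "t - 2 < 3" using that by auto
   have "card (rw t I) \<le> [4,4,5] ! (t - 2)" using rc(2)[OF I(1), of "t - 2"] DlD(3)[OF J t(2)] I(2) t(1) by simp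
   then show ?thesis using False by (simp add: numeral_2_eq_2 nth_Cons' split: if_splits)
  qed
  moreover have "card (cw j I) \<le> l ! j" if "j < 7" for j
   using rc(1)[OF I(1), of j] DlD(2)[OF J that] I(2) by simp
  ultimately have "I \<in> ?F" using I(1) CC by (auto simp: Dl_def)
  then show "J \<in> (`) \<phi> ` ?F" using I(2) by blast
 qed
 obtain U where U: "U \<subseteq> {..<7}" "card U = 4" "8 \<le> (\<Sum>t\<in>U. l ! t)" by (rule four_of_seven[OF l])
 have "hD TYPE('a) 5 7 ((!) [0,0,4,4,5]) ((!) l) 10 = hh TYPE('a) ?C ?F 10"
  unfolding hD_def by (rule hh_restrict[OF family_Dl CC sub])
 also have "\<dots> \<le> hD TYPE('a) 7 3 ((!) l) ((!) [4,4,5]) 10"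
  using hh_reindex[OF fam inj, of 10, where 'a='a] by (simp only: im imF hD_def)
 also have "\<dots> = 0"
 proof (rule vanish_large[OF U(1)])
  show "card U = Suc 3" using U(2) by simp
  show "(\<Sum>j<3. [4,4,5] ! j) = 10 + (3::nat)" by (simp add: numeral_eq_Suc)
  show "3 * (3 - 1) + (\<Sum>t<7. l ! t) < (\<Sum>t\<in>U. l ! t) + 10" using U(3) WS_D(2)[OF l] by simp
 qed
 finally have "hD TYPE('a) 5 7 ((!) [0,0,4,4,5]) ((!) l) 10 = 0" by simp
 moreover have "length [0,0,4,4,5::nat] = 5" by simp
 ultimately show "hD TYPE('a) (length [0,0,4,4,5::nat]) 7 ((!) [0,0,4,4,5]) ((!) l) 10 = 0" by (simp only:)
qed

text \<open>These row bounds arise from (1, 2, 3, 4, 5) by moving one unit from row 0 or row 1 to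
  row 2. Vanishing here turns every moved cycle into a boundary.\<close>

lemma HL_moved:
 shows HL_02445: "HL TYPE('a::field_char_0) 7 [0,2,4,4,5] 13 12 = 0"
  and HL_11445: "HL TYPE('a) 7 [1,1,4,4,5] 13 12 = 0"
proof -
 have 1: "HL TYPE('a) 7 [0,1,4,4,5] 13 12 = 0" "HL TYPE('a) 7 [0,0,4,4,5] 12 11 = 0"
  by (rule HL_large[where U = "{3,4}"]; simp)+
 show "HL TYPE('a) 7 [0,2,4,4,5] 13 12 = 0"
  using HL_R1[of "Suc 0" "[0,2,4,4,5]" 1 7 13 12, where 'a='a] 1 HL_00445[where 'a='a] by (simp add: numeral_2_eq_2)
 have 2: "HL TYPE('a) 7 [0,1,4,4,5] 12 11 = 0"
  using HL_R1[of "Suc 0" "[0,1,4,4,5]" 0 7 12 11, where 'a='a] 1 HL_00445[where 'a='a] by simp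
 show "HL TYPE('a) 7 [1,1,4,4,5] 13 12 = 0"
  using HL_R1[of 0 "[1,1,4,4,5]" 0 7 13 12, where 'a='a] 1 2 by simp
qed

lemma HL_zeroD:
 assumes "HL TYPE('a::field_char_0) n ps N g = 0" "l \<in> WS n N"
 shows "hD TYPE('a) (length ps) n ((!) ps) ((!) l) g = 0"
 using assms by (simp add: HL_def)

lemma sum_card_WW:
 assumes S: "finite S" and N: "(\<Sum>t\<in>S. k t) = N"
 shows "(\<Sum>m\<in>WS n N. card (WW n S k m)) = (\<Prod>t\<in>S. n choose k t)"
proof -
 let ?A = "{I. I \<subseteq> S \<times> {..<n} \<and> (\<forall>t\<in>S. card (rw t I) = k t)}"
 have cN: "(\<Sum>j<n. card (cw j I)) = N" if I: "I \<in> ?A" for I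
 proof -
  obtain s where s: "S \<subseteq> {..<s}" using S finite_nat_iff_bounded by blast
  have Is: "I \<subseteq> cells s n" using I s by auto
  have "card I = (\<Sum>t\<in>S. card (rw t I))" unfolding card_rows[OF Is]
  proof (rule sum.mono_neutral_right)
   have "rw i I = {}" if "i \<notin> S" for i using I that by (auto simp: rw_def)
   then show "\<forall>i\<in>{..<s} - S. card (rw i I) = 0" by simp
  qed (use s in auto)
  then show ?thesis using card_cols[OF Is] I N by simp
 qed
 have "(\<Sum>m\<in>WS n N. card (WW n S k m)) = card (\<Union>m\<in>WS n N. WW n S k m)"
 proof (rule card_UN_disjoint[symmetric])
  show "\<forall>i\<in>WS n N. \<forall>j\<in>WS n N. i \<noteq> j --> WW n S k i \<inter> WW n S k j = {}"
  proof (intro ballI impI equals0I)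
   fix i j I assume a: "i \<in> WS n N" "j \<in> WS n N" "i \<noteq> j" "I \<in> WW n S k i \<inter> WW n S k j"
   have "i = j" by (rule nth_equalityI) (use a WS_D(1)[of _ n N] in \<open>auto simp: WW_def\<close>)
   then show False using a(3) by simp
  qed
 qed (use S in auto)
 also have "(\<Union>m\<in>WS n N. WW n S k m) = ?A"
 proof (intro equalityI subsetI)
  fix I assume I: "I \<in> ?A"
  let ?m = "map (\<lambda>j. card (cw j I)) [0..<n]"
  have "(\<Sum>j<n. ?m ! j) = N" using cN[OF I] by simp
  then have "?m \<in> WS n N" by (intro WS_I) simp_all
  moreover have "I \<in> WW n S k ?m" using I by (simp add: WW_def)
  ultimately show "I \<in> (\<Union>m\<in>WS n N. WW n S k m)" by blast
 qed (auto simp: WW_def)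
 also have "card ?A = card (PiE S (\<lambda>t. {R. R \<subseteq> {..<n} \<and> card R = k t}))"
 proof (rule bij_betw_same_card)
  show "bij_betw (\<lambda>I. \<lambda>t\<in>S. rw t I) ?A (PiE S (\<lambda>t. {R. R \<subseteq> {..<n} \<and> card R = k t}))"
  proof (rule bij_betw_byWitness[where f' = "\<lambda>f. Sigma S f"])
   show "\<forall>I\<in>?A. Sigma S (\<lambda>t\<in>S. rw t I) = I" by (auto simp: rw_def)
   show "\<forall>f\<in>PiE S (\<lambda>t. {R. R \<subseteq> {..<n} \<and> card R = k t}). (\<lambda>t\<in>S. rw t (Sigma S f)) = f"
   proof
    fix f assume f: "f \<in> PiE S (\<lambda>t. {R. R \<subseteq> {..<n} \<and> card R = k t})"
    have "(\<lambda>t\<in>S. rw t (Sigma S f)) t = f t" for t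
     using PiE_arb[OF f, of t] by (cases "t \<in> S") (auto simp: rw_def)
    then show "(\<lambda>t\<in>S. rw t (Sigma S f)) = f" by (rule ext)
   qed
   show "(\<lambda>I. \<lambda>t\<in>S. rw t I) ` ?A \<subseteq> PiE S (\<lambda>t. {R. R \<subseteq> {..<n} \<and> card R = k t})" by (auto simp: rw_def)
   show "Sigma S ` PiE S (\<lambda>t. {R. R \<subseteq> {..<n} \<and> card R = k t}) \<subseteq> ?A"
   proof (rule image_subsetI)
    fix f assume f: "f \<in> PiE S (\<lambda>t. {R. R \<subseteq> {..<n} \<and> card R = k t})"
    have r: "rw t (Sigma S f) = f t" if "t \<in> S" for t using that by (auto simp: rw_def)
    show "Sigma S f \<in> ?A" using PiE_mem[OF f] r by auto
   qed
  qed
 qed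
 also have "\<dots> = (\<Prod>t\<in>S. n choose k t)"
  unfolding card_PiE[OF S] using n_subsets[of "{..<n}"] by (intro prod.cong refl) simp
 finally show ?thesis .
qed

abbreviation (input) P5 :: "nat => nat" where "P5 \<equiv> (!) [1,2,3,4,5]"

lemma top_of_Dl:
 assumes "R \<in> Dl 5 7 P5 w" "R \<subseteq> tp"
 shows "card R \<le> 6" "card R = 6 ==> card (rw 0 R) = 1 \<and> card (rw 1 R) = 2 \<and> card (rw 2 R) = 3"
 using card_top[OF assms(2)] DlD(2)[OF assms(1), of 0] DlD(2)[OF assms(1), of 1] DlD(2)[OF assms(1), of 2] by auto

text \<open>Chains bounding the slices over saturated tops are glued to one chain V. Then z - bd V
  is a cycle on sets with at most five top cells, a subcomplex whose homology vanishes in degree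
  12.\<close>

lemma v_exact:
 fixes z :: "(nat \<times> nat) set => 'a::field_char_0"
 assumes l: "l \<in> WS 7 13" and z: "z \<in> cyc (cells 5 7) (Dl 5 7 P5 ((!) l)) 12"
  and sl: "\<And>R. R \<in> Dl 5 7 P5 ((!) l) ==> R \<subseteq> tp ==> card R = 6 ==>
   sl R z \<in> bnd (cells 5 7) (Dl 5 7 (p0 P5) (wm l R)) 6"
 shows "z \<in> bnd (cells 5 7) (Dl 5 7 P5 ((!) l)) 12"
proof -
 let ?C = "cells 5 7" and ?F = "Dl 5 7 P5 ((!) l)"
 define top where "top I = {x\<in>I. fst x \<in> {0, 1, 2::nat}}" for I :: "(nat \<times> nat) set"
 define bot where "bot I = {x\<in>I. fst x \<notin> {0, 1, 2::nat}}" for I :: "(nat \<times> nat) set"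
 have tb: "I = top I \<union> bot I" for I by (auto simp: top_def bot_def)
 have tsub: "top I \<subseteq> tp" "bot I \<subseteq> bt" if "I \<subseteq> ?C" for I
 proof -
  show "top I \<subseteq> tp"
  proof
   fix x assume x: "x \<in> top I"
   then have "x \<in> cells 5 7" "fst x \<in> {0, 1, 2}" using that unfolding top_def by blast+
   then show "x \<in> tp" by (simp only: mem_Times_iff)
  qed
  show "bot I \<subseteq> bt"
  proof
   fix x assume x: "x \<in> bot I"
   then have "x \<in> tp \<union> bt" "fst x \<notin> {0, 1, 2}" using that unfolding bot_def cells57(1) by blast+
   then show "x \<in> bt" by (simp only: mem_Times_iff Un_iff) simp
  qed
 qed
 let ?Y = "{I\<in>?F. card (top I) \<le> 5}"
 have finF: "finite I" if "I \<in> ?F" for I by (rule familyD(3)[OF family_Dl that])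
 have tmono: "card (top J) \<le> card (top I)" if "J \<subseteq> I" "I \<in> ?F" for I J
  by (rule card_mono) (use that finF[of I] in \<open>auto simp: top_def\<close>)
 have Ycl: "closed_in ?F ?Y"
  unfolding closed_in_def
 proof (intro conjI ballI impI)
  fix I J assume "I \<in> ?Y" "J \<in> ?F" "J \<subseteq> I"
  then show "J \<in> ?Y" using tmono[of J I] by auto
 qed auto
 note fY = conjunct1[OF family_closed[OF family_Dl Ycl]]
 have hY: "hh TYPE('a) ?C ?Y 12 = 0"
 proof -
  have "hh TYPE('a) ?C {I\<in>?Y. top I = R} 12 = 0" if R: "R \<in> top ` ?Y" for R
  proof -
   obtain I where I: "I \<in> ?F" "card R \<le> 5" "R = top I" using R by auto
   have Rtp: "R \<subseteq> tp" using tsub(1)[OF DlD(1)[OF I(1)]] I(3) by simp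
   have RD: "R \<in> ?F" by (rule Dl_subset[OF I(1)]) (auto simp: I(3) top_def)
   have e: "{I\<in>?Y. top I = R} = {I\<in>?F. {x\<in>I. fst x \<in> {0, 1, 2}} = R}"
    using I(2) by (auto simp: top_def)
   have "hh TYPE('a) ?C {I\<in>?F. {x\<in>I. fst x \<in> {0, 1, 2}} = R} ((12 - card R) + card R)
     \<le> hD TYPE('a) 5 7 (p0 P5) (wm l R) (12 - card R)"
    by (rule hh_fix_set) (use Rtp in auto)
   also have "\<dots> = 0"
   \<comment> \<open>Both active rows are in U, so the condition reads 6 < 12 - card R; this is
     where the bound of five top cells is used.\<close>
   proof (rule vanish_large[where U = "{3, 4}" and c = 1])
    have "(\<Sum>j<7. wm l R j) = (\<Sum>j<7. l ! j) - (\<Sum>j<7. card (cw j R))"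
     by (rule sum_subtractf_nat) (use DlD(3)[OF RD] in simp)
    then show "(\<Sum>j<7. wm l R j) = 12 - card R + 1"
     using card_cols[OF DlD(1)[OF RD]] WS_D(2)[OF l] I(2) by simp
    show "1 * (7 - 1) + (\<Sum>t<5. p0 P5 t) < (\<Sum>t\<in>{3, 4}. p0 P5 t) + (12 - card R)"
     using I(2) by (simp add: numeral_eq_Suc lessThan_Suc)
   qed auto
   finally show ?thesis using I(2) e by simp
  qed
  then have "(\<Sum>R\<in>top ` ?Y. hh TYPE('a) ?C {I\<in>?Y. top I = R} 12) = 0" by simp
  moreover have "hh TYPE('a) ?C ?Y 12 \<le> (\<Sum>R\<in>top ` ?Y. hh TYPE('a) ?C {I\<in>?Y. top I = R} 12)"
   by (rule hh_union[OF fY]) (auto simp: top_def)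
  ultimately show ?thesis by simp
 qed
 define G where "G R = Dl 5 7 (p0 P5) (wm l R)" for R
 define u where "u R = (SOME u. u \<in> supp_on (gr (G R) 7) \<and> sl R z = bd ?C u)" for R
 have u: "u R \<in> supp_on (gr (G R) 7) \<and> sl R z = bd ?C (u R)" if R: "R \<in> ?F" "R \<subseteq> tp" "card R = 6" for R
 proof -
  have "\<exists>u\<in>supp_on (gr (G R) (Suc 6)). sl R z = bd ?C u"
   using sl[OF R] by (simp only: bnd_Dl G_def)
  then have "\<exists>u. u \<in> supp_on (gr (G R) 7) \<and> sl R z = bd ?C u" by (simp add: Bex_def)
  then show ?thesis unfolding u_def by (rule someI_ex)
 qed
 define V where "V I = (if I \<in> ?F \<and> card (top I) = 6 then u (top I) (bot I) else 0)" for I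
 have V: "V \<in> supp_on (gr ?F (Suc 12))"
 proof -
  have "I \<in> gr ?F 13" if n0: "V I \<noteq> 0" for I
  proof -
   have I: "I \<in> ?F" "card (top I) = 6" "u (top I) (bot I) \<noteq> 0" using n0 by (auto simp: V_def split: if_splits)
   have "top I \<in> ?F" by (rule Dl_subset[OF I(1)]) (auto simp: top_def)
   then have "bot I \<in> gr (G (top I)) 7" using u[of "top I"] I tsub(1)[OF DlD(1)[OF I(1)]] by (auto simp: supp_on_def)
   then have "card (bot I) = 7" by (simp add: gr_def)
   moreover have "card I = card (top I) + card (bot I)"
    using finF[OF I(1)] by (subst tb) (rule card_Un_disjoint, auto simp: top_def bot_def)
   ultimately show ?thesis using I by (simp add: gr_def)
  qed
  then show ?thesis by (auto simp: supp_on_def)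
 qed
 have key: "bd ?C V I = z I" if I: "I \<in> ?F" "card (top I) = 6" for I
 proof -
  let ?R = "top I" and ?K = "bot I"
  have Rs: "?R \<subseteq> I" by (auto simp: top_def)
  have R: "?R \<in> ?F" "?R \<subseteq> tp" by (rule Dl_subset[OF I(1) Rs], rule tsub(1)[OF DlD(1)[OF I(1)]])
  have K: "?K \<subseteq> bt" by (rule tsub(2)[OF DlD(1)[OF I(1)]])
  note uR = u[OF R I(2)]
  have slV: "sl ?R V = u ?R"
  proof
   fix K
   show "sl ?R V K = u ?R K"
   proof (cases "K \<subseteq> bt \<and> ?R \<union> K \<in> ?F")
    case True
    have "top (?R \<union> K) = ?R" "bot (?R \<union> K) = K" using True by (auto simp: top_def bot_def)
    then show ?thesis using True I(2) by (simp add: sl_def V_def)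
   next
    case False
    have "u ?R K = 0"
    proof (rule ccontr)
     assume "u ?R K \<noteq> 0"
     then have KG: "K \<in> Dl 5 7 (p0 P5) (wm l ?R)" using uR by (auto simp: supp_on_def gr_def G_def)
     have r0: "rw t K = {}" if "t \<in> {0, 1, 2}" for t
      using DlD(2)[OF KG, of t] that fin_rw(1)[OF DlD(1)[OF KG], of t] by auto
     have Kb: "K \<subseteq> bt"
     proof
      fix x assume x: "x \<in> K"
      have "fst x \<notin> {0, 1, 2}"
      proof
       assume "fst x \<in> {0, 1, 2}"
       from r0[OF this] have "snd x \<notin> rw (fst x) K" by simp
       then show False using x by (simp add: rw_def)
      qed
      moreover have "x \<in> tp \<union> bt" using DlD(1)[OF KG] x unfolding cells57(1) by blast
      ultimately show "x \<in> bt" by (simp only: mem_Times_iff Un_iff) simp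
     qed
     have "card (rw t (?R \<union> K)) \<le> P5 t" if t: "t < 5" for t
     proof (cases "t \<in> {0, 1, 2}")
      case True then show ?thesis using rw_Un_split(1)[OF R(2) Kb True] DlD(2)[OF R(1) t] by simp
     next
      case f: False
      have "card (rw t K) \<le> P5 t" using DlD(2)[OF KG t] unfolding if_not_P[OF f] .
      then show ?thesis unfolding rw_Un_split(2)[OF R(2) Kb f] .
     qed
     moreover have "card (cw j (?R \<union> K)) \<le> l ! j" if "j < 7" for j
      using rw_Un_split(3)[OF R(2) Kb, of j] DlD(3)[OF KG that] DlD(3)[OF R(1) that] by simp
     ultimately have "?R \<union> K \<in> ?F" using DlD(1)[OF KG] DlD(1)[OF R(1)] by (simp add: Dl_def)
     then show False using False Kb by simp
    qed
    moreover have "sl ?R V K = 0" using False by (auto simp: sl_def V_def)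
    ultimately show ?thesis by simp
   qed
  qed
  have "sl ?R (bd ?C V) = bd ?C (sl ?R V)" by (rule sl_bd[OF V R(2) I(2)]) simp
  then have "sl ?R (bd ?C V) ?K = sl ?R z ?K" using uR slV by simp
  then show ?thesis using K tb[of I] by (simp add: sl_def)
 qed
 let ?z = "z - bd ?C V"
 have z': "z \<in> supp_on (gr ?F 12)" "bd ?C z = 0" using z cyc_Dl by blast+
 have "?z \<in> cyc ?C ?Y 12"
 proof (rule cycI)
  have "?z I = 0" if I: "I \<notin> gr ?Y 12" for I
  proof (cases "I \<in> ?F")
   case True
   have t6: "card (top I) \<le> 6"
   proof (rule top_of_Dl(1)[of _ "(!) l"])
    have "top I \<subseteq> I" by (auto simp: top_def)
    then show "top I \<in> ?F" by (rule Dl_subset[OF True])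
    show "top I \<subseteq> tp" by (rule tsub(1)[OF DlD(1)[OF True]])
   qed
   show ?thesis
   proof (cases "card (top I) = 6")
    case 6: True
    then show ?thesis using key[OF True] by simp
   next
    case False
    then have c12: "card I \<noteq> 12" using I True t6 by (auto simp: gr_def)
    have "bd ?C V \<in> bnd ?C ?F 12" unfolding bnd_Dl using V by (intro bexI[of _ V]) auto
    then have "bd ?C V \<in> cyc ?C ?F 12" by (rule subsetD[OF bnd_cyc[OF family_Dl]])
    from cycD(1)[OF this] have "bd ?C V I = 0" using c12 by (simp add: supp_on_def gr_def)
    moreover have "z I = 0" using z'(1) c12 by (simp add: supp_on_def gr_def)
    ultimately show ?thesis by simp
   qed
  next
   case False
   then show ?thesis using z'(1) bd_outside[OF V False] by (simp add: supp_on_def gr_def)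
  qed
  then show "?z \<in> supp_on (gr ?Y 12)" by (simp add: supp_on_def)
  show "bd ?C ?z J = 0" for J by (simp add: lin_simps[OF lin_bd] z'(2) bd_bd)
 qed
 then have "?z \<in> bnd ?C ?Y 12" by (rule hh_zeroD[OF fY hY])
 then obtain y where y: "y \<in> supp_on (gr ?Y (Suc 12))" "?z = res ?Y (bd ?C y)" by (rule bndE)
 have "res ?Y (bd ?C y) = bd ?C y"
 proof
  fix J show "res ?Y (bd ?C y) J = bd ?C y J"
  proof (cases "J \<in> ?Y")
   case False
   have "bd ?C y J = 0"
   proof (rule bd_eq_0)
    fix x
    have "insert x J \<notin> ?Y"
    proof
     assume a: "insert x J \<in> ?Y"
     then have "insert x J \<in> ?F" by blast
     then have "J \<in> ?F" by (rule Dl_subset) (rule subset_insertI)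
     moreover have "card (top J) \<le> 5" using tmono[of J "insert x J"] a by fastforce
     ultimately show False using False by simp
    qed
    then have "insert x J \<notin> gr ?Y (Suc 12)" unfolding gr_def by blast
    then show "y (insert x J) = 0" using y(1) unfolding supp_on_def by blast
   qed simp
   then show ?thesis using False by (simp add: res_def)
  qed (simp add: res_def)
 qed
 then have "z = bd ?C (V + y)" using y(2) by (simp add: lin_simps[OF lin_bd] fun_eq_iff algebra_simps)
 moreover have "V + y \<in> supp_on (gr ?F (Suc 12))"
  by (rule fs.subspace_add[OF subspace_supp_on V supp_mono[OF y(1) gr_mono]]) blast
 ultimately show ?thesis using bnd_Dl by blast
qed


lemma corner_bottom:
 fixes w :: "nat => nat"
 assumes "(\<Sum>j<7. w j) = 7"
 shows "hD TYPE('a::field_char_0) 5 7 (p0 P5) w 6 \<le> 1 \<and> ((\<exists>j<7. w j \<noteq> 1) --> hD TYPE('a) 5 7 (p0 P5) w 6 = 0)"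
proof (rule corner[where A = "{3, 4}"])
 fix t :: nat assume "t < 5" "t \<notin> {3, 4}"
 then have "t = 0 \<or> t = 1 \<or> t = 2" by simp arith
 then have "t \<in> {0, 1, 2}" by blast
 then show "p0 P5 t = 0" by (simp only: if_True)
next
 show "(\<Sum>j<7. w j) = 6 + 1" using assms by simp
qed simp_all

text \<open>Over a saturated top R, the slice of a cycle has a class in the homology of the two
  bottom rows, which by \<open>corner\<close> is at most one-dimensional and nonzero only for
  constant column bound 1; hence the column bounds \<open>map Suc m\<close> with m the column counts
  of R. The resulting scalars form a function on weight (1, 2, 3) that detects the class by
  \<open>v_exact\<close>. It is killed by E_20 and E_21, because the cycle moved by
  \<open>cE\<close> bounds by \<open>HL_moved\<close>.\<close>

lemma v_weight:
 assumes m: "m \<in> WS 7 6"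
 shows "hD TYPE('a::field_char_0) 5 7 P5 ((!) (map Suc m)) 12
  \<le> fs.dim {f \<in> supp_on (Wa m 1 2 3). EE 7 2 0 f = 0 \<and> EE 7 2 1 f = (0 :: _ => 'a)}"
proof -
 let ?l = "map Suc m" and ?C = "cells 5 7" and ?W = "Wa m 1 2 3"
 let ?F = "Dl 5 7 P5 ((!) ?l)" and ?G = "Dl 5 7 (p0 P5) (\<lambda>_. 1)"
 have len: "length m = 7" by (rule WS_D(1)[OF m])
 have lj: "?l ! j = Suc (m ! j)" if "j < 7" for j using that len by simp
 have l: "?l \<in> WS 7 13"
 proof (rule WS_I)
  have "(\<Sum>j<7. ?l ! j) = (\<Sum>j<7. m ! j + 1)" by (intro sum.cong refl) (simp add: lj)
  then show "(\<Sum>j<7. ?l ! j) = 13" unfolding sum.distrib WS_D(2)[OF m] by simp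
 qed (simp add: len)
 have "hD TYPE('a) 5 7 (p0 P5) (\<lambda>_. 1) 6 \<le> 1"
  by (rule conjunct1[OF corner_bottom]) simp
 then have d1: "fs.dim (cyc ?C ?G 6 :: ((nat \<times> nat) set => 'a) set) \<le> Suc (fs.dim (bnd ?C ?G 6 :: ((nat \<times> nat) set => 'a) set))"
  using dim_cyc[OF family_Dl[of 5 7 "p0 P5" "\<lambda>_. 1"], of 6, where 'a='a] unfolding hD_def by linarith
 obtain T :: "((nat \<times> nat) set => 'a) => (nat \<times> nat) set => 'a" and y
  where T: "lin T" "\<And>b. b \<in> bnd ?C ?G 6 ==> T b y = 0" "\<And>v. v \<in> cyc ?C ?G 6 ==> T v y = 0 ==> v \<in> bnd ?C ?G 6"
  by (rule exists_detector[OF subspace_cyc findim_cyc[OF family_Dl] subspace_bnd bnd_cyc[OF family_Dl] d1]) (rule that)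
 define \<psi> where "\<psi> z I = T (sl I z) y" for z I
 have WD: "R \<subseteq> tp" "card (rw 0 R) = k 0" "card (rw 1 R) = k 1" "card (rw 2 R) = k 2" "j < 7 ==> card (cw j R) = m ! j"
  if "R \<in> WW 7 {0, 1, 2} k m" for R k j using that by (auto simp: WW_def)
 have G: "Dl 5 7 (p0 p') (wm ?l R) = ?G" if "R \<in> WW 7 {0, 1, 2} k m" "p' 3 = 4" "p' 4 = 5" for R k p'
 proof (rule Dl_cong)
  show "p0 p' t = p0 P5 t" if "t < 5" for t
   using that \<open>p' 3 = 4\<close> \<open>p' 4 = 5\<close> by (cases "t = 3"; cases "t = 4") auto
  show "wm ?l R j = 1" if "j < 7" for j using WD(5)[OF \<open>R \<in> _\<close> that] lj[OF that] by simp
 qed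
 let ?\<Psi> = "\<lambda>z. res ?W (\<psi> z)"
 have l\<psi>: "lin ?\<Psi>"
  by (rule linI) (auto simp: res_def \<psi>_def lin_simps[OF lin_sl] lin_simps[OF T(1)] fun_eq_iff)
 have slcyc: "sl R z \<in> cyc ?C (Dl 5 7 (p0 P5) (wm ?l R)) 6" if z: "z \<in> cyc ?C ?F 12" and R: "R \<subseteq> tp" "card R = 6"
  for z :: "(nat \<times> nat) set => 'a" and R
 proof -
  have z': "z \<in> supp_on (gr ?F 12)" "bd ?C z = 0" using z cyc_Dl by blast+
  have "sl R z \<in> supp_on (gr (Dl 5 7 (p0 P5) (wm ?l R)) (12 - card R))" by (rule sl_supp[OF z'(1) R(1)])
  moreover have "bd ?C (sl R z) = 0"
  proof -
   have "bd ?C (sl R z) = sl R (bd ?C z)" by (rule sl_bd[OF z'(1) R, symmetric]) simp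
   also have "\<dots> = 0" unfolding z'(2) by (rule lin_simps(4)[OF lin_sl])
   finally show ?thesis .
  qed
  ultimately show ?thesis unfolding cyc_Dl using R(2) by simp
 qed
 have ker: "z \<in> bnd ?C ?F 12" if z: "z \<in> cyc ?C ?F 12" and z0: "?\<Psi> z = 0" for z :: "(nat \<times> nat) set => 'a"
 proof (rule v_exact[OF l z])
  fix R assume R: "R \<in> ?F" "R \<subseteq> tp" "card R = 6"
  note rows = top_of_Dl(2)[OF R]
  let ?GR = "Dl 5 7 (p0 P5) (wm ?l R)"
  have c: "sl R z \<in> cyc ?C ?GR 6" by (rule slcyc[OF z R(2,3)])
  show "sl R z \<in> bnd ?C ?GR 6"
  proof (cases "\<forall>j<7. wm ?l R j = 1")
   case True
   have "card (cw j R) = m ! j" if "j < 7" for j using True[rule_format, OF that] lj[OF that] by simp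
   then have W: "R \<in> ?W" using rows R(2) by (simp add: WW_def)
   have "T (sl R z) y = 0" using fun_cong[OF z0, of R] W by (simp add: res_def \<psi>_def)
   moreover have "?GR = ?G" by (rule G[OF W]) simp_all
   ultimately show ?thesis using T(3) c by simp
  next
   case False
   have sw: "(\<Sum>j<7. wm ?l R j) = (\<Sum>j<7. ?l ! j) - (\<Sum>j<7. card (cw j R))"
    by (rule sum_subtractf_nat) (use DlD(3)[OF R(1)] in simp)
   have "hD TYPE('a) 5 7 (p0 P5) (wm ?l R) 6 = 0"
   proof (rule mp[OF conjunct2[OF corner_bottom]])
    show "(\<Sum>j<7. wm ?l R j) = 7" using sw card_cols[OF DlD(1)[OF R(1)]] WS_D(2)[OF l] R(3) by simp
    show "\<exists>j<7. wm ?l R j \<noteq> 1" using False by blast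
   qed
   from hh_zeroD[OF family_Dl this[unfolded hD_def] c] show ?thesis .
  qed
 qed
 have img: "EE 7 2 a (?\<Psi> z) = 0"
  if z: "z \<in> cyc ?C ?F 12" and a: "a = 0 \<and> k = ka 0 2 4 \<and> p' = (!) [0,2,4,4,5] \<or> a = 1 \<and> k = ka 1 1 4 \<and> p' = (!) [1,1,4,4,5]"
  for z :: "(nat \<times> nat) set => 'a" and a k and p' :: "nat => nat"
 proof -
  have a': "a \<in> {0, 1, 2}" "2 \<in> {0, 1, 2::nat}" "a \<noteq> 2" "a < 5" using a by auto
  have sW: "?\<Psi> z \<in> supp_on ?W" by (auto simp: res_def supp_on_def)
  have sE: "EE 7 2 a (?\<Psi> z) \<in> supp_on (WW 7 {0, 1, 2} k m)"
   by (rule EE_supp[OF sW]) (use a in auto)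
  have h0: "hD TYPE('a) 5 7 p' ((!) ?l) 12 = 0"
   using a HL_zeroD[OF HL_02445 l, where 'a='a] HL_zeroD[OF HL_11445 l, where 'a='a] by (auto simp: numeral_eq_Suc)
  have "cE 7 P5 a 2 z \<in> cyc ?C (Dl 5 7 p' ((!) ?l)) 12"
   by (rule cE_cyc[OF z]) (use a in \<open>auto simp: lt5\<close>)
  from hh_zeroD[OF family_Dl h0[unfolded hD_def] this]
  obtain u where u: "u \<in> supp_on (gr (Dl 5 7 p' ((!) ?l)) (Suc 12))" "cE 7 P5 a 2 z = bd ?C u" unfolding bnd_Dl by blast
  have "EE 7 2 a (?\<Psi> z) R = 0" for R
  proof (cases "R \<in> WW 7 {0, 1, 2} k m")
   case True
   note R = WD[OF True]
   have RC: "R \<subseteq> cells 5 7" using R(1) cells57(1) by blast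
   have k: "k 0 + k 1 + k 2 = 6" "k 2 = 4" "p' 0 + p' 1 + p' 2 = 6" "p' 3 = 4" "p' 4 = 5" using a by auto
   have R6: "card R = 6" using card_top[OF R(1)] R(2-4) k(1) by simp
   have "EE 7 2 a (?\<Psi> z) R = EE 7 2 a (\<psi> z) R"
    unfolding EE_def sum_apply
   proof (rule sum.cong[OF refl])
    fix j assume "j \<in> {..<7::nat}"
    then have j: "j < 7" by simp
    show "cr (2, j) (an (a, j) (?\<Psi> z)) R = cr (2, j) (an (a, j) (\<psi> z)) R"
    proof (cases "(2, j) \<in> R \<and> (a, j) \<notin> R")
     case t: True
     let ?I = "insert (a, j) (R - {(2, j)})"
     note sh = move_shape[OF RC conjunct2[OF t] conjunct1[OF t] a'(3)[symmetric] a'(4) refl]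
     have "?I \<subseteq> tp" using R(1) a'(1) j by auto
     moreover have "card (rw t ?I) = ka 1 2 3 t" if "t \<in> {0, 1, 2}" for t
      using sh(3,4) sh(5)[of 0] sh(5)[of 1] R(2-4) a that by auto
     moreover have "card (cw i ?I) = m ! i" if "i < 7" for i using sh(6)[of i] R(5)[OF that] by simp
     ultimately have "?I \<in> ?W" by (simp add: WW_def)
     then show ?thesis by (simp add: cr_def an_def res_def)
    next
     case False
     then show ?thesis using a'(3) by (auto simp: cr_def an_def)
    qed
   qed
   also have "\<dots> = T (sl R (EE 7 2 a z)) y"
    by (rule sl_EE[OF R(1) empty_subsetI a'(1,2) T(1)]) (simp add: \<psi>_def)
   \<comment> \<open>The diagonal term of \<open>cE\<close> is absent on this slice: R has four
     cells in row 2, above the bound 3, so z vanishes on R joined with K.\<close>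
   also have "sl R (EE 7 2 a z) = sl R (cE 7 P5 a 2 z)"
   proof
    fix K
    show "sl R (EE 7 2 a z) K = sl R (cE 7 P5 a 2 z) K"
    proof (cases "K \<subseteq> bt")
     case True
     have "z (R \<union> K) = 0"
     proof (rule ccontr)
      assume "z (R \<union> K) \<noteq> 0"
      then have "R \<union> K \<in> ?F" using cycD(2)[OF z] by (auto simp: supp_on_def)
      from DlD(2)[OF this, of 2] have "card (rw 2 R) \<le> 3" using rw_Un_split(1)[OF R(1) True, of 2] by simp
      then show False using R(4) k(2) by simp
     qed
     then show ?thesis by (simp add: sl_def cE_def)
    qed (simp add: sl_def)
   qed
   also have "sl R (cE 7 P5 a 2 z) = bd ?C (sl R u)" unfolding u(2) by (rule sl_bd[OF u(1) R(1) R6 k(3)])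
   also have "T (bd ?C (sl R u)) y = 0"
   proof (rule T(2))
    have "sl R u \<in> supp_on (gr (Dl 5 7 (p0 p') (wm ?l R)) (Suc 12 - card R))" by (rule sl_supp[OF u(1) R(1)])
    then have "sl R u \<in> supp_on (gr ?G (Suc 6))" unfolding G[of R k p', OF True k(4,5)] R6 by simp
    then show "bd ?C (sl R u) \<in> bnd ?C ?G 6" unfolding bnd_Dl by blast
   qed
   finally show ?thesis .
  next
   case False
   then show ?thesis using sE by (simp add: supp_on_def)
  qed
  then show ?thesis by (simp add: fun_eq_iff)
 qed
 let ?K = "{f \<in> supp_on ?W. EE 7 2 0 f = 0 \<and> EE 7 2 1 f = (0 :: _ => 'a)}"
 let ?Z = "cyc ?C ?F 12 :: ((nat \<times> nat) set => 'a) set"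
 have "fs.dim ?Z = fs.dim {z\<in>?Z. ?\<Psi> z = 0} + fs.dim (?\<Psi> ` ?Z)"
  by (rule rank_nullity[OF l\<psi> subspace_cyc findim_cyc[OF family_Dl]])
 moreover have "fs.dim {z\<in>?Z. ?\<Psi> z = 0} \<le> fs.dim (bnd ?C ?F 12 :: ((nat \<times> nat) set => 'a) set)"
  by (rule dim_mono[OF findim_mono[OF findim_cyc[OF family_Dl] bnd_cyc[OF family_Dl]]]) (use ker in blast)
 moreover have "fs.dim (?\<Psi> ` ?Z) \<le> fs.dim ?K"
 proof (rule dim_mono)
  show "findim ?K" by (rule findim_mono[OF findim_supp_on[of ?W]]) auto
  show "?\<Psi> ` ?Z \<subseteq> ?K"
  proof (rule image_subsetI)
   fix z assume z: "z \<in> ?Z"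
   have "?\<Psi> z \<in> supp_on ?W" by (auto simp: res_def supp_on_def)
   moreover have "EE 7 2 0 (?\<Psi> z) = 0" by (rule img[OF z, of 0 "ka 0 2 4" "(!) [0,2,4,4,5]"]) simp
   moreover have "EE 7 2 1 (?\<Psi> z) = 0" by (rule img[OF z, of 1 "ka 1 1 4" "(!) [1,1,4,4,5]"]) simp
   ultimately show "?\<Psi> z \<in> ?K" by blast
  qed
 qed
 ultimately show ?thesis unfolding hD_def hh_def by linarith
qed

text \<open>A zero column bound cannot leave the constant bound 1 for the bottom rows, so only the
  lists \<open>map Suc m\<close> contribute. The constant is 2842 = 7 * 21 * 35 + 7 * 21 - 21 * 35 -
  7 * 7 * 35, from \<open>EE_ker_dim\<close> summed over all m.\<close>

lemma HL_v: "HL TYPE('a::field_char_0) 7 [1,2,3,4,5] 13 12 \<le> 2842"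
proof -
 have z: "hD TYPE('a) 5 7 P5 ((!) l) 12 = 0" if l: "l \<in> WS 7 13" "j < 7" "l ! j = 0" for l j
  unfolding hD_def
 proof (rule hh_zeroI[OF family_Dl])
  fix z :: "(nat \<times> nat) set => 'a" assume z: "z \<in> cyc (cells 5 7) (Dl 5 7 P5 ((!) l)) 12"
  have z': "z \<in> supp_on (gr (Dl 5 7 P5 ((!) l)) 12)" "bd (cells 5 7) z = 0" using z cyc_Dl by blast+
  show "z \<in> bnd (cells 5 7) (Dl 5 7 P5 ((!) l)) 12"
  proof (rule v_exact[OF l(1) z])
   fix R assume R: "R \<in> Dl 5 7 P5 ((!) l)" "R \<subseteq> tp" "card R = 6"
   have sw: "(\<Sum>j<7. wm l R j) = (\<Sum>j<7. l ! j) - (\<Sum>j<7. card (cw j R))"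
    by (rule sum_subtractf_nat) (use DlD(3)[OF R(1)] in simp)
   have h: "hD TYPE('a) 5 7 (p0 P5) (wm l R) 6 = 0"
   proof (rule mp[OF conjunct2[OF corner_bottom]])
    show "(\<Sum>j<7. wm l R j) = 7" using sw card_cols[OF DlD(1)[OF R(1)]] WS_D(2)[OF l(1)] R(3) by simp
    show "\<exists>j<7. wm l R j \<noteq> 1" using l(2,3) by (intro exI[of _ j]) simp
   qed
   have "sl R z \<in> supp_on (gr (Dl 5 7 (p0 P5) (wm l R)) (12 - card R))" by (rule sl_supp[OF z'(1) R(2)])
   moreover have "bd (cells 5 7) (sl R z) = sl R (bd (cells 5 7) z)" by (rule sl_bd[OF z'(1) R(2,3), symmetric]) simp
   ultimately have "sl R z \<in> cyc (cells 5 7) (Dl 5 7 (p0 P5) (wm l R)) 6"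
    unfolding cyc_Dl z'(2) lin_simps(4)[OF lin_sl] using R(3) by simp
   then show "sl R z \<in> bnd (cells 5 7) (Dl 5 7 (p0 P5) (wm l R)) 6" by (rule hh_zeroD[OF family_Dl h[unfolded hD_def]])
  qed
 qed
 let ?K = "\<lambda>m. fs.dim {f \<in> supp_on (Wa m 1 2 3). EE 7 2 0 f = 0 \<and> EE 7 2 1 f = (0 :: _ => 'a)}"
 have "HL TYPE('a) 7 [1,2,3,4,5] 13 12 = (\<Sum>l\<in>WS 7 13. hD TYPE('a) 5 7 P5 ((!) l) 12)"
  by (simp add: HL_def numeral_eq_Suc)
 also have "\<dots> = (\<Sum>l\<in>map Suc ` WS 7 6. hD TYPE('a) 5 7 P5 ((!) l) 12)"
 proof (rule sum.mono_neutral_right[OF finite_WS])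
  show "map Suc ` WS 7 6 \<subseteq> WS 7 13"
  proof (rule image_subsetI)
   fix m assume m: "m \<in> WS 7 6"
   have "(\<Sum>j<7. map Suc m ! j) = (\<Sum>j<7. m ! j + 1)" by (intro sum.cong refl) (simp add: WS_D(1)[OF m])
   then have "(\<Sum>j<7. map Suc m ! j) = 13" unfolding sum.distrib WS_D(2)[OF m] by simp
   then show "map Suc m \<in> WS 7 13" using WS_D(1)[OF m] by (intro WS_I) simp_all
  qed
  show "\<forall>l\<in>WS 7 13 - map Suc ` WS 7 6. hD TYPE('a) 5 7 P5 ((!) l) 12 = 0"
  proof
   fix l assume l: "l \<in> WS 7 13 - map Suc ` WS 7 6"
   then have lw: "l \<in> WS 7 13" by simp
   have "\<exists>j<7. l ! j = 0"
   proof (rule ccontr)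
    assume "\<not> ?thesis"
    then have pos: "0 < l ! j" if "j < 7" for j using that by simp
    let ?m = "map (\<lambda>x. x - 1) l"
    have "map Suc ?m = l" by (rule nth_equalityI) (use pos WS_D(1)[OF lw] in auto)
    moreover have "?m \<in> WS 7 6"
    proof (rule WS_I)
     have "(\<Sum>j<7. ?m ! j) = (\<Sum>j<7. l ! j - 1)" by (intro sum.cong refl) (simp add: WS_D(1)[OF lw])
     also have "\<dots> = (\<Sum>j<7. l ! j) - (\<Sum>j<7::nat. 1)" by (rule sum_subtractf_nat) (use pos in \<open>simp add: Suc_le_eq\<close>)
     finally show "(\<Sum>j<7. ?m ! j) = 6" using WS_D(2)[OF lw] by simp
    qed (simp add: WS_D(1)[OF lw])
    ultimately have "l \<in> map Suc ` WS 7 6" by (metis imageI)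
    then show False using l by simp
   qed
   then show "hD TYPE('a) 5 7 P5 ((!) l) 12 = 0" using z[OF lw] by (elim exE conjE)
  qed
 qed
 also have "\<dots> = (\<Sum>m\<in>WS 7 6. hD TYPE('a) 5 7 P5 ((!) (map Suc m)) 12)"
  by (rule sum.reindex[unfolded o_def]) (simp add: inj_on_def)
 also have "\<dots> \<le> (\<Sum>m\<in>WS 7 6. ?K m)" by (rule sum_mono) (rule v_weight)
 finally have 1: "HL TYPE('a) 7 [1,2,3,4,5] 13 12 \<le> (\<Sum>m\<in>WS 7 6. ?K m)" .
 have "(\<Sum>m\<in>WS 7 6. ?K m + (card (Wa m 0 2 4) + card (Wa m 1 1 4)))
   \<le> (\<Sum>m\<in>WS 7 6. card (Wa m 1 2 3) + card (Wa m 0 1 5))"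
  by (rule sum_mono) (rule EE_ker_dim)
 moreover have c: "(\<Sum>m\<in>WS 7 6. card (Wa m x y z)) = (7 choose x) * (7 choose y) * (7 choose z)" if "x + y + z = 6" for x y z
  using sum_card_WW[of "{0, 1, 2}" "ka x y z" 6 7] that by simp
 ultimately have "(\<Sum>m\<in>WS 7 6. ?K m) + (21 * 35 + 7 * 7 * 35) \<le> 7 * 21 * 35 + 7 * 21"
  unfolding sum.distrib by (simp add: c choose_rows)
 then show ?thesis using 1 by simp
qed

section \<open>Order seven, column total 15: homology as a gl_3-cokernel\<close>

lemma AA_anti: "AA n a (AA n b f) = - AA n b (AA n a (f :: _ => 'a::field_char_0))"
proof -
 have "AA n a (AA n b f) = (\<Sum>j<n. \<Sum>k<n. an (a, j) (an (b, k) f))"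
  by (simp add: AA_def fsp.linear_sum[OF lin_an])
 also have "\<dots> = (\<Sum>k<n. \<Sum>j<n. an (a, j) (an (b, k) f))" by (rule sum.swap)
 also have "\<dots> = (\<Sum>k<n. \<Sum>j<n. - an (b, k) (an (a, j) f))" by (intro sum.cong refl an_an)
 also have "\<dots> = - AA n b (AA n a f)" by (simp add: AA_def fsp.linear_sum[OF lin_an] sum_negf)
 finally show ?thesis .
qed

lemma AA_sq: "AA n a (AA n a f) = (0 :: _ => 'a::field_char_0)"
 by (rule neg_self_eq) (rule AA_anti)

lemma bd_AA: "bd (cells s n) f = (\<Sum>t<s. AA n t f)"
 by (simp add: bd_def AA_def sum.cartesian_product)

lemma AA_EE:
 assumes f: "f \<in> fin_supp" and t: "t \<noteq> b"
 shows "AA n t (EE n b a f) = EE n b a (AA n t (f :: _ => 'a::field_char_0))"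
  and "AA n b (EE n b a f) = EE n b a (AA n b f) + AA n a f"
proof -
 have g: "AA n t (EE n b a f) = (if t = b then AA n a f else 0) + EE n b a (AA n t f)" for t
 proof -
  have "AA n t (EE n b a f) = (\<Sum>k<n. \<Sum>j<n. an (t, k) (cr (b, j) (an (a, j) f)))"
   unfolding AA_def EE_def by (simp add: fsp.linear_sum[OF lin_an])
  also have "\<dots> = (\<Sum>k<n. \<Sum>j<n. (if t = b \<and> k = j then an (a, j) f else 0) + cr (b, j) (an (a, j) (an (t, k) f)))"
   by (intro sum.cong refl) (simp add: an_cr_if lin_simps[OF lin_cr] an_an[of _ "(a, _)"])
  also have "\<dots> = (\<Sum>k<n. \<Sum>j<n. if t = b \<and> k = j then an (a, j) f else 0)
    + (\<Sum>j<n. \<Sum>k<n. cr (b, j) (an (a, j) (an (t, k) f)))"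
   unfolding sum.distrib by (intro arg_cong2[where f="(+)"] refl) (rule sum.swap)
  also have "(\<Sum>k<n. \<Sum>j<n. if t = b \<and> k = j then an (a, j) f else 0) = (if t = b then AA n a f else 0)"
   by (cases "t = b") (simp_all add: AA_def)
  also have "(\<Sum>j<n. \<Sum>k<n. cr (b, j) (an (a, j) (an (t, k) f))) = EE n b a (AA n t f)"
   unfolding EE_def AA_def by (simp add: fsp.linear_sum[OF lin_an] fsp.linear_sum[OF lin_cr])
  finally show ?thesis .
 qed
 show "AA n t (EE n b a f) = EE n b a (AA n t f)" using g[of t] t by simp
 show "AA n b (EE n b a f) = EE n b a (AA n b f) + AA n a f" unfolding g[of b] by (simp only: if_True add.commute simp_thms)
qed

text \<open>The rows in T are filled exactly to their bounds. Such families are the successive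
  quotients that occur when row bounds are raised by 1.\<close>

definition AF :: "(nat => nat) => nat list => nat set => (nat \<times> nat) set set" where
 "AF p l T = {I\<in>Dl 5 7 p ((!) l). \<forall>t\<in>T. card (rw t I) = p t}"

lemma family_AF: "family (cells 5 7) (AF p l T)"
 unfolding AF_def
proof (rule family_sub[OF family_Dl], rule ballI)
 fix I J K t
 assume a: "I \<in> Dl 5 7 p ((!) l)" "\<forall>t\<in>T. card (rw t I) = p t" "\<forall>t\<in>T. card (rw t J) = p t" "J \<subseteq> K" "K \<subseteq> I"
  "K \<in> Dl 5 7 p ((!) l)" "t \<in> T"
 have "card (rw t J) \<le> card (rw t K)" by (rule card_mono[OF fin_rw(1)[OF DlD(1)[OF a(6)]] rw_mono[OF a(4)]])
 moreover have "card (rw t K) \<le> card (rw t I)" by (rule card_mono[OF fin_rw(1)[OF DlD(1)[OF a(1)]] rw_mono[OF a(5)]])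
 ultimately show "card (rw t K) = p t" using a(2,3,7) by (metis le_antisym)
qed

lemma AF_D: "I \<in> AF p l T ==> I \<in> Dl 5 7 p ((!) l)" "I \<in> AF p l T ==> t \<in> T ==> card (rw t I) = p t"
 by (auto simp: AF_def)

lemma AA_nonzero:
 fixes f :: "(nat \<times> nat) set => 'a::field_char_0"
 assumes "AA n t f J \<noteq> 0"
 obtains j where "j < n" "(t, j) \<notin> J" "f (insert (t, j) J) \<noteq> 0"
proof -
 have "\<exists>j\<in>{..<n}. an (t, j) f J \<noteq> 0"
 proof (rule ccontr)
  assume "\<not> ?thesis"
  then have "AA n t f J = 0" unfolding AA_def sum_apply by (intro sum.neutral) simp
  then show False using assms by simp
 qed
 then obtain j where "j < n" "an (t, j) f J \<noteq> 0" by auto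
 then show ?thesis using that[of j] by (auto simp: an_def split: if_splits)
qed

lemma rw_insert: "rw u (insert (t, j) J) = (if u = t then insert j (rw t J) else rw u J)"
 by (auto simp: rw_def)

lemma AA_AF:
 assumes f: "f \<in> supp_on (AF p l T)" and t: "t \<notin> T" and n0: "AA 7 t f J \<noteq> (0 :: 'a::field_char_0)"
 shows "J \<in> AF p l T" "Suc (card (rw t J)) \<le> p t \<or> 5 \<le> t" "\<exists>j. (t, j) \<notin> J \<and> insert (t, j) J \<in> AF p l T"
proof -
 obtain j where j: "j < 7" "(t, j) \<notin> J" "f (insert (t, j) J) \<noteq> 0" by (rule AA_nonzero[OF n0])
 have I: "insert (t, j) J \<in> AF p l T" using j(3) f by (auto simp: supp_on_def)
 have JD: "J \<in> Dl 5 7 p ((!) l)" by (rule Dl_subset[OF AF_D(1)[OF I]]) auto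
 have "card (rw u J) = p u" if "u \<in> T" for u
 proof -
  have "u \<noteq> t" using t that by blast
  then show ?thesis using AF_D(2)[OF I that] by (simp add: rw_insert)
 qed
 then show "J \<in> AF p l T" using JD by (simp add: AF_def)
 have "card (insert j (rw t J)) = Suc (card (rw t J))"
  using j(2) fin_rw(1)[OF DlD(1)[OF JD], of t] by (simp add: rw_def)
 then show "Suc (card (rw t J)) \<le> p t \<or> 5 \<le> t" using DlD(2)[OF AF_D(1)[OF I], of t] by (auto simp: rw_insert)
 show "\<exists>j. (t, j) \<notin> J \<and> insert (t, j) J \<in> AF p l T" using I j(2) by blast
qed

lemma AA_supp_AF:
 assumes f: "f \<in> supp_on (gr (AF p l T) (Suc g))" and t: "t \<notin> T"
 shows "AA 7 t f \<in> supp_on (gr (AF p l T) g :: (nat \<times> nat) set set)"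
proof -
 have f': "f \<in> supp_on (AF p l T)" by (rule supp_gr[OF f])
 have "J \<in> gr (AF p l T) g" if n0: "AA 7 t f J \<noteq> 0" for J
 proof -
  obtain j where j: "(t, j) \<notin> J" "f (insert (t, j) J) \<noteq> 0" by (rule AA_nonzero[OF n0])
  have "card (insert (t, j) J) = Suc g" using j(2) f by (auto simp: supp_on_def gr_def)
  moreover have "finite J" using familyD(3)[OF family_AF AA_AF(1)[OF f' t n0]] .
  ultimately show ?thesis using AA_AF(1)[OF f' t n0] j(1) by (simp add: gr_def)
 qed
 then show ?thesis by (auto simp: supp_on_def)
qed

text \<open>Removing a cell from a row in T leaves the family, so only the other rows contribute to
  the restricted boundary.\<close>

lemma res_bd_AF:
 fixes f :: "(nat \<times> nat) set => 'a::field_char_0"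
 assumes f: "f \<in> supp_on (AF p l T)" and T: "T \<subseteq> {..<5}"
 shows "res (AF p l T) (bd (cells 5 7) f) = (\<Sum>t\<in>{..<5} - T. AA 7 t f)"
proof
 fix J
 show "res (AF p l T) (bd (cells 5 7) f) J = (\<Sum>t\<in>{..<5} - T. AA 7 t f) J"
 proof (cases "J \<in> AF p l T")
  case True
  have "AA 7 t f J = 0" if t: "t \<in> T" for t
  proof (rule ccontr)
   assume "AA 7 t f J \<noteq> 0"
   then obtain j where j: "(t, j) \<notin> J" "f (insert (t, j) J) \<noteq> 0" by (rule AA_nonzero)
   have I: "insert (t, j) J \<in> AF p l T" using j(2) f by (auto simp: supp_on_def)
   have "card (insert j (rw t J)) = Suc (card (rw t J))"
    using j(1) fin_rw(1)[OF DlD(1)[OF AF_D(1)[OF True]], of t] by (simp add: rw_def)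
   then show False using AF_D(2)[OF I t] AF_D(2)[OF True t] by (simp add: rw_insert)
  qed
  then have "(\<Sum>t\<in>T. AA 7 t f J) = 0" by simp
  then show ?thesis using True T by (simp add: res_def bd_AA sum_apply sum.subset_diff[OF T])
 next
  case False
  then have "AA 7 t f J = 0" if "t \<in> {..<5} - T" for t using AA_AF(1)[OF f, of t J] that by auto
  then show ?thesis using False by (simp add: res_def sum_apply)
 qed
qed

text \<open>The connecting map on the level of chains. X becomes a boundary after row t is allowed
  one more cell. The part x2 of the bounding chain that uses the extra cell is a cycle of the
  quotient, and its only trace in X is its row-t boundary.\<close>

lemma AF_step:
 fixes X :: "(nat \<times> nat) set => 'a::field_char_0"
 assumes X: "X \<in> cyc (cells 5 7) (AF p l T) g" and t: "t < 5" "t \<notin> T" "T \<subseteq> {..<5}"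
  and h: "hh TYPE('a) (cells 5 7) (AF (p(t := Suc (p t))) l T) g = 0"
 obtains x1 x2 where "x1 \<in> supp_on (gr (AF p l T) (Suc g))"
  "x2 \<in> cyc (cells 5 7) (AF (p(t := Suc (p t))) l (insert t T)) (Suc g)"
  "X = (\<Sum>u\<in>{..<5} - T. AA 7 u x1) + AA 7 t x2"
proof -
 let ?C = "cells 5 7" and ?q = "p(t := Suc (p t))"
 let ?F = "AF ?q l T" and ?Y = "AF p l T" and ?Z = "AF ?q l (insert t T)"
 have YF: "I \<in> ?Y \<longleftrightarrow> I \<in> ?F \<and> card (rw t I) \<le> p t" for I
 proof
  assume I: "I \<in> ?Y"
  have "card (rw u I) \<le> ?q u" if "u < 5" for u using DlD(2)[OF AF_D(1)[OF I] that] by (cases "u = t") auto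
  then have "I \<in> Dl 5 7 ?q ((!) l)" using DlD[OF AF_D(1)[OF I]] by (simp add: Dl_def)
  moreover have "card (rw u I) = ?q u" if "u \<in> T" for u using AF_D(2)[OF I that] t(2) that by auto
  ultimately show "I \<in> ?F \<and> card (rw t I) \<le> p t" using DlD(2)[OF AF_D(1)[OF I] t(1)] by (simp add: AF_def)
 next
  assume I: "I \<in> ?F \<and> card (rw t I) \<le> p t"
  then have IF: "I \<in> ?F" by blast
  have "card (rw u I) \<le> p u" if "u < 5" for u using DlD(2)[OF AF_D(1)[OF IF] that] I by (cases "u = t") auto
  then have "I \<in> Dl 5 7 p ((!) l)" using DlD[OF AF_D(1)[OF IF]] by (simp add: Dl_def)
  moreover have "card (rw u I) = p u" if "u \<in> T" for u using AF_D(2)[OF IF that] t(2) that by (cases "u = t") auto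
  ultimately show "I \<in> ?Y" by (simp add: AF_def)
 qed
 have FY: "?F - ?Y = ?Z"
 proof (intro equalityI subsetI)
  fix I assume I: "I \<in> ?F - ?Y"
  then have "\<not> card (rw t I) \<le> p t" using YF by blast
  moreover have "card (rw t I) \<le> Suc (p t)" using DlD(2)[OF AF_D(1)[of I ?q l T] t(1)] I by simp
  ultimately show "I \<in> ?Z" using I by (simp add: AF_def)
 next
  fix I assume I: "I \<in> ?Z"
  then have "card (rw t I) = Suc (p t)" "I \<in> ?F" by (auto simp: AF_def)
  then show "I \<in> ?F - ?Y" using YF by auto
 qed
 have cl: "closed_in ?F ?Y"
  unfolding closed_in_def
 proof (intro conjI ballI impI subsetI)
  fix I J assume a: "I \<in> ?Y" "J \<in> ?F" "J \<subseteq> I"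
  have "card (rw t J) \<le> card (rw t I)" by (rule card_mono[OF fin_rw(1)[OF DlD(1)[OF AF_D(1)[OF a(1)]]] rw_mono[OF a(3)]])
  then show "J \<in> ?Y" using a(1,2) YF[of I] YF[of J] by simp
 qed (use YF in blast)
 have YsubF: "?Y \<subseteq> ?F" using YF by blast
 have "X \<in> cyc ?C ?F g"
 proof (rule cycI)
  show "X \<in> supp_on (gr ?F g)" by (rule supp_mono[OF cycD(1)[OF X] gr_mono[OF YsubF]])
  show "bd ?C X J = 0" if "J \<in> ?F" for J
   using cycD(3)[OF X, of J] closed_bd[OF _ cl _ cycD(2)[OF X], of ?C J] that by (cases "J \<in> ?Y") auto
 qed
 from hh_zeroD[OF family_AF h this] obtain x where x: "x \<in> supp_on (gr ?F (Suc g))" "X = res ?F (bd ?C x)" by (rule bndE)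
 let ?x1 = "res ?Y x" and ?x2 = "res ?Z x"
 have s1: "?x1 \<in> supp_on (gr ?Y (Suc g))" by (rule res_mem[OF x(1) YsubF])
 have s2: "?x2 \<in> supp_on (gr ?Z (Suc g))" by (rule res_mem[OF x(1)]) (use FY in blast)
 have sp: "bd ?C x J = bd ?C ?x1 J + bd ?C ?x2 J" for J
  using bd_split[OF _ cl supp_gr[OF x(1)], of ?C J] unfolding FY by simp
 have c2: "?x2 \<in> cyc ?C ?Z (Suc g)"
 proof (rule cycI[OF s2])
  fix J assume J: "J \<in> ?Z"
  then have JF: "J \<in> ?F - ?Y" using FY by blast
  have "X J = 0" using cycD(2)[OF X] JF by (simp add: supp_on_def)
  then have "bd ?C x J = 0" using JF by (simp add: x(2) res_def)
  moreover have "bd ?C ?x1 J = 0" by (rule closed_bd[OF _ cl JF supp_gr[OF s1]]) simp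
  ultimately show "bd ?C ?x2 J = 0" using sp[of J] by simp
 qed
 have "X = (\<Sum>u\<in>{..<5} - T. AA 7 u ?x1) + AA 7 t ?x2"
 proof
  fix J
  have r1: "res ?Y (bd ?C ?x1) J = (\<Sum>u\<in>{..<5} - T. AA 7 u ?x1) J"
   by (rule fun_cong[OF res_bd_AF[OF supp_gr[OF s1] t(3)]])
  have s2F: "?x2 \<in> supp_on ?F" using s2 FY by (auto simp: supp_on_def gr_def)
  show "X J = ((\<Sum>u\<in>{..<5} - T. AA 7 u ?x1) + AA 7 t ?x2) J"
  proof (cases "J \<in> ?Y")
   case True
   have "AA 7 u ?x2 J = 0" if "u \<noteq> t" for u
   proof (rule ccontr)
    assume "AA 7 u ?x2 J \<noteq> 0"
    then obtain j where j: "?x2 (insert (u, j) J) \<noteq> 0" by (rule AA_nonzero)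
    then have "insert (u, j) J \<in> ?Z" using s2 by (auto simp: supp_on_def gr_def)
    from AF_D(2)[OF this, of t] have "card (rw t J) = Suc (p t)" using that by (simp add: rw_insert)
    then show False using True YF[of J] by simp
   qed
   then have "bd ?C ?x2 J = AA 7 t ?x2 J" unfolding bd_AA sum_apply using t(1)
    by (subst sum.remove[of _ t]) auto
   moreover have "X J = bd ?C x J" using True YsubF by (auto simp: x(2) res_def)
   ultimately show ?thesis using r1 True sp[of J] by (simp add: res_def)
  next
   case False
   have "AA 7 t ?x2 J = 0"
   proof (rule ccontr)
    assume n0: "AA 7 t ?x2 J \<noteq> 0"
    have "J \<in> ?F" by (rule AA_AF(1)[OF s2F t(2) n0])
    moreover have "card (rw t J) \<le> p t" using AA_AF(2)[OF s2F t(2) n0] t(1) by simp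
    ultimately show False using False YF by blast
   qed
   moreover have "X J = 0" using cycD(2)[OF X] False by (simp add: supp_on_def)
   ultimately show ?thesis using r1 False by (simp add: res_def)
  qed
 qed
 from that[OF s1 c2 this] show ?thesis .
qed

text \<open>Freezing the rows of T, which carry c cells in all, leaves complexes on the other rows
  with column total 15 - c and degree g - c.\<close>

lemma hh_AF_zero:
 assumes T: "T \<subseteq> {..<5}" and c: "(\<Sum>t\<in>T. p t) = c" "c \<le> g" and l: "l \<in> WS 7 15"
  and h: "\<And>w. (\<Sum>j<7. w j) = 15 - c ==> hD TYPE('a::field_char_0) 5 7 (\<lambda>t. if t \<in> T then 0 else p t) w (g - c) = 0"
 shows "hh TYPE('a) (cells 5 7) (AF p l T) g = 0"
proof -
 let ?\<rho> = "\<lambda>I. {x\<in>I. fst x \<in> T}" and ?C = "cells 5 7" and ?F = "AF p l T"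
 have "hh TYPE('a) ?C {I\<in>?F. ?\<rho> I = R} g = 0" if R: "R \<in> ?\<rho> ` ?F" for R
 proof -
  obtain I where I: "I \<in> ?F" "R = ?\<rho> I" using R by blast
  have ID: "I \<in> Dl 5 7 p ((!) l)" by (rule AF_D(1)[OF I(1)])
  have RI: "R \<subseteq> I" using I(2) by blast
  have RD: "R \<in> Dl 5 7 p ((!) l)" by (rule Dl_subset[OF ID RI])
  have RT: "R \<subseteq> T \<times> {..<7}" using I(2) DlD(1)[OF ID] by auto
  have rR: "rw t R = (if t \<in> T then rw t I else {})" for t using I(2) by (auto simp: rw_def)
  have "card R = (\<Sum>t<5. card (rw t R))" by (rule card_rows[OF DlD(1)[OF RD]])
  also have "\<dots> = (\<Sum>t\<in>T. card (rw t R))" by (rule sum.mono_neutral_right) (use T rR in auto)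
  also have "\<dots> = c" unfolding c(1)[symmetric] using AF_D(2)[OF I(1)] rR by (intro sum.cong) auto
  finally have cR: "card R = c" .
  have e: "{I\<in>?F. ?\<rho> I = R} = {I\<in>Dl 5 7 p ((!) l). ?\<rho> I = R}"
  proof (intro equalityI subsetI)
   fix K assume K: "K \<in> {I\<in>Dl 5 7 p ((!) l). ?\<rho> I = R}"
   have "rw t K = rw t R" if "t \<in> T" for t using K that by (auto simp: rw_def)
   then have "card (rw t K) = p t" if "t \<in> T" for t using that rR[of t] AF_D(2)[OF I(1) that] by simp
   then show "K \<in> {I\<in>?F. ?\<rho> I = R}" using K by (simp add: AF_def)
  qed (auto simp: AF_def)
  have "hh TYPE('a) ?C {I\<in>Dl 5 7 p ((!) l). ?\<rho> I = R} ((g - c) + card R)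
    \<le> hD TYPE('a) 5 7 (\<lambda>t. if t \<in> T then 0 else p t) (\<lambda>j. l ! j - card (cw j R)) (g - c)"
   by (rule hh_fix_set[OF T RT])
  also have "\<dots> = 0"
  proof (rule h)
   have "(\<Sum>j<7. l ! j - card (cw j R)) = (\<Sum>j<7. l ! j) - (\<Sum>j<7. card (cw j R))"
    by (rule sum_subtractf_nat) (use DlD(3)[OF RD] in simp)
   then show "(\<Sum>j<7. l ! j - card (cw j R)) = 15 - c" using card_cols[OF DlD(1)[OF RD]] cR WS_D(2)[OF l] by simp
  qed
  finally show ?thesis unfolding e using cR c(2) by simp
 qed
 then have "(\<Sum>R\<in>?\<rho> ` ?F. hh TYPE('a) ?C {I\<in>?F. ?\<rho> I = R} g) = 0" by simp
 moreover have "hh TYPE('a) ?C ?F g \<le> (\<Sum>R\<in>?\<rho> ` ?F. hh TYPE('a) ?C {I\<in>?F. ?\<rho> I = R} g)"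
  by (rule hh_union[OF family_AF]) blast
 ultimately show ?thesis by simp
qed

text \<open>After transposition at most three of the seven row bounds are nonzero, since they sum to
  3, and \<open>vanish_regular\<close> applies because 3 + 2 \<le> 1 + 2 + 2.\<close>

lemma HL_12200: "HL TYPE('a::field_char_0) 7 [1,2,2,0,0] 3 2 = 0"
 unfolding HL_def
proof (intro sum.neutral ballI)
 fix l assume l: "l \<in> WS 7 3"
 let ?A = "{t\<in>{..<7}. l ! t \<noteq> 0}"
 have "card ?A = (\<Sum>t\<in>?A. 1)" by simp
 also have "\<dots> \<le> (\<Sum>t\<in>?A. l ! t)" by (rule sum_mono) auto
 also have "\<dots> \<le> (\<Sum>t<7. l ! t)" by (rule sum_mono2) auto
 finally have cA: "card ?A \<le> 3" using WS_D(2)[OF l] by simp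
 have len: "length [1,2,2,0,0::nat] = 5" by simp
 have "hD TYPE('a) 7 5 ((!) l) ((!) [1,2,2,0,0]) 2 = 0"
 proof (rule vanish_regular[where A = ?A])
  show "card ?A + 2 \<le> (\<Sum>j<5. [1,2,2,0,0] ! j)" using cA by (simp add: numeral_eq_Suc)
  show "2 < (\<Sum>t<7. l ! t)" using WS_D(2)[OF l] by simp
 qed auto
 then show "hD TYPE('a) (length [1,2,2,0,0::nat]) 7 ((!) [1,2,2,0,0]) ((!) l) 2 = 0"
  using hD_transpose[of 5 7 "(!) [1,2,2,0,0]" "(!) l" 2, where 'a='a] unfolding len by simp
qed

text \<open>Here moving one unit from row 3 or row 4 to row 2 leads to (1, 2, 3, 4, 5): the target
  bounds are reached from these, whereas \<open>HL_moved\<close> treats bounds reached from the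
  target.\<close>

lemma HL_moved_u:
 shows HL_12255: "HL TYPE('a::field_char_0) 7 [1,2,2,5,5] 15 12 = 0"
  and HL_12246: "HL TYPE('a) 7 [1,2,2,4,6] 15 12 = 0"
proof -
 have T: "{0, 1} \<subseteq> supp_rows (1 # 2 # ps)" for ps by auto
 have 1: "HL TYPE('a) 7 [1,2,2,5,6] 15 12 = 0" "HL TYPE('a) 7 [1,2,2,4,7] 15 12 = 0"
  "HL TYPE('a) 7 [1,2,2,6,0] 9 7 = 0" "HL TYPE('a) 7 [1,2,2,5,0] 8 6 = 0"
  by (rule HL_small[OF T]; simp)+
 have 2: "HL TYPE('a) 7 [1,2,2,5,0] 9 7 = 0"
  using HL_R2[of 3 "[1,2,2,5,0]" 7 9 7, where 'a='a] 1 HL_12200[where 'a='a] by (simp add: numeral_eq_Suc)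
 have 3: "HL TYPE('a) 7 [1,2,2,4,0] 8 6 = 0"
  using HL_R2[of 3 "[1,2,2,4,0]" 7 8 6, where 'a='a] 1 HL_12200[where 'a='a] by (simp add: numeral_eq_Suc)
 show "HL TYPE('a) 7 [1,2,2,5,5] 15 12 = 0"
  using HL_R2[of 4 "[1,2,2,5,5]" 7 15 12, where 'a='a] 1 2 by (simp add: numeral_eq_Suc)
 show "HL TYPE('a) 7 [1,2,2,4,6] 15 12 = 0"
  using HL_R2[of 4 "[1,2,2,4,6]" 7 15 12, where 'a='a] 1 3 by (simp add: numeral_eq_Suc)
qed


abbreviation (input) ku :: "nat => nat => nat => nat => nat" where
 "ku x y z \<equiv> (\<lambda>t. if t = 4 then x else if t = 3 then y else z)"
abbreviation (input) Wu :: "nat list => nat => nat => nat => (nat \<times> nat) set set" where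
 "Wu l x y z \<equiv> WW 7 {2, 3, 4} (ku x y z) l"

text \<open>The composite of the three connecting maps of \<open>AF_step\<close> for the rows 2, 3,
  4.\<close>

definition GG :: "((nat \<times> nat) set => 'a::field_char_0) => (nat \<times> nat) set => 'a" where
 "GG x = AA 7 4 (AA 7 3 (AA 7 2 x))"

lemma lin_GG: "lin GG"
 unfolding GG_def by (intro lin_comp[OF lin_AA] lin_AA)

text \<open>E_2a commutes with every row boundary except that of row 2, which produces an extra
  \<open>AA 7 a\<close>. As a is 3 or 4, the extra term contains the boundary of row a twice and
  vanishes.\<close>

lemma GG_EE:
 assumes x: "x \<in> fin_supp" and a: "a = 3 \<or> a = 4"
 shows "GG (EE 7 2 a x) = EE 7 2 a (GG (x :: _ => 'a::field_char_0))"
proof -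
 have z: "AA 7 4 (AA 7 3 (AA 7 a x)) = 0"
 proof (cases "a = 3")
  case True then show ?thesis by (simp add: AA_sq lin_simps[OF lin_AA])
 next
  case False
  then have "a = 4" using a by simp
  then show ?thesis by (simp add: AA_anti[of 7 3 4] lin_simps[OF lin_AA] AA_sq)
 qed
 have 1: "AA 7 2 (EE 7 2 a x) = EE 7 2 a (AA 7 2 x) + AA 7 a x" by (rule AA_EE(2)[OF x, of 3]) simp
 have 2: "AA 7 3 (EE 7 2 a (AA 7 2 x)) = EE 7 2 a (AA 7 3 (AA 7 2 x))" by (rule AA_EE(1)) simp_all
 have 3: "AA 7 4 (EE 7 2 a (AA 7 3 (AA 7 2 x))) = EE 7 2 a (AA 7 4 (AA 7 3 (AA 7 2 x)))" by (rule AA_EE(1)) simp_all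
 show ?thesis unfolding GG_def 1 lin_simps(1)[OF lin_AA] 2 3 z by simp
qed

definition XX :: "(nat => nat) => nat list => (nat \<times> nat) set set" where
 "XX k l = {I. I \<subseteq> cells 5 7 \<and> (\<forall>t<5. card (rw t I) = k t) \<and> (\<forall>j<7. card (cw j I) \<le> l ! j)}"

lemma AA_XX:
 assumes f: "f \<in> supp_on (XX k l)" and t: "t < 5" "k t = Suc q"
 shows "AA 7 t f \<in> supp_on (XX (k(t := q)) l :: (nat \<times> nat) set set)"
proof -
 have "J \<in> XX (k(t := q)) l" if n0: "AA 7 t f J \<noteq> 0" for J
 proof -
  obtain j where j: "j < 7" "(t, j) \<notin> J" "f (insert (t, j) J) \<noteq> 0" by (rule AA_nonzero[OF n0])
  have I: "insert (t, j) J \<in> XX k l" using j(3) f by (auto simp: supp_on_def)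
  then have IC: "insert (t, j) J \<subseteq> cells 5 7" by (simp add: XX_def)
  then have JC: "J \<subseteq> cells 5 7" by blast
  have "card (rw u J) = (k(t := q)) u" if "u < 5" for u
  proof -
   have c: "card (rw u (insert (t, j) J)) = k u" using I that by (simp add: XX_def)
   show ?thesis
   proof (cases "u = t")
    case True
    have "j \<notin> rw t J" using j(2) by (simp add: rw_def)
    then have "card (insert j (rw t J)) = Suc (card (rw t J))" using fin_rw(1)[OF JC] by simp
    then show ?thesis using c True t(2) by (simp add: rw_insert)
   next
    case False then show ?thesis using c by (simp add: rw_insert)
   qed
  qed
  moreover have "card (cw i J) \<le> l ! i" if "i < 7" for i
  proof -
   have "card (cw i J) \<le> card (cw i (insert (t, j) J))" by (rule card_mono[OF fin_cw(1)[OF IC] cw_mono]) blast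
   also have "\<dots> \<le> l ! i" using I that by (simp add: XX_def)
   finally show ?thesis .
  qed
  ultimately show ?thesis using JC by (simp add: XX_def)
 qed
 then show ?thesis by (auto simp: supp_on_def)
qed

lemma AA_XX_0:
 assumes f: "f \<in> supp_on (XX k l)" and t: "t < 5" "k t = 0"
 shows "AA 7 t f = (0 :: _ => 'a::field_char_0)"
proof
 fix J
 show "AA 7 t f J = 0 J"
 proof (rule ccontr)
  assume "AA 7 t f J \<noteq> 0 J"
  then have "AA 7 t f J \<noteq> 0" by simp
  then obtain j where j: "f (insert (t, j) J) \<noteq> 0" by (rule AA_nonzero)
  then have I: "insert (t, j) J \<in> XX k l" using f by (auto simp: supp_on_def)
  then have "rw t (insert (t, j) J) = {}" using t fin_rw(1)[of "insert (t, j) J" 5 7 t] by (auto simp: XX_def)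
  then show False by (simp add: rw_insert)
 qed
qed

abbreviation (input) kx :: "nat => nat => nat => nat => nat" where
 "kx x y z \<equiv> (\<lambda>t. if t = 4 then x else if t = 3 then y else if t = 2 then z else 0)"

lemma Wu_XX: "WW 7 {2, 3, 4} (ku x y z) l \<subseteq> XX (kx x y z) l"
proof
 fix I assume I: "I \<in> WW 7 {2, 3, 4} (ku x y z) l"
 have "rw t I = {}" if "t = 0 \<or> t = 1" for t using I that by (auto simp: WW_def rw_def)
 then have "card (rw t I) = kx x y z t" if "t < 5" for t using I that by (auto simp: WW_def lt5)
 then show "I \<in> XX (kx x y z) l" using I by (auto simp: XX_def WW_def)
qed

lemma XX_gr:
 assumes "k 0 + k 1 + k 2 + k 3 + k 4 = g" "\<And>t. t < 5 ==> k t \<le> p t"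
 shows "XX k l \<subseteq> gr (Dl 5 7 p ((!) l)) g"
proof
 fix I assume I: "I \<in> XX k l"
 then have IC: "I \<subseteq> cells 5 7" by (simp add: XX_def)
 have "card I = (\<Sum>t<5. card (rw t I))" by (rule card_rows[OF IC])
 also have "\<dots> = g" using I assms(1) by (simp add: XX_def numeral_eq_Suc)
 finally show "I \<in> gr (Dl 5 7 p ((!) l)) g" using I assms(2) by (simp add: XX_def gr_def Dl_def)
qed

lemma GG_supp:
 assumes f: "f \<in> supp_on (Wu l (Suc x) (Suc y) (Suc z))"
 shows "GG f \<in> supp_on (XX (kx x y z) l)" "bd (cells 5 7) (GG f) = (0 :: _ => 'a::field_char_0)"
proof -
 have f0: "f \<in> supp_on (XX (kx (Suc x) (Suc y) (Suc z)) l)" by (rule supp_mono[OF f Wu_XX])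
 have "AA 7 2 f \<in> supp_on (XX ((kx (Suc x) (Suc y) (Suc z))(2 := z)) l)" by (rule AA_XX[OF f0]) simp_all
 moreover have "(kx (Suc x) (Suc y) (Suc z))(2 := z) = kx (Suc x) (Suc y) z" by auto
 ultimately have f1: "AA 7 2 f \<in> supp_on (XX (kx (Suc x) (Suc y) z) l)" by simp
 have "AA 7 3 (AA 7 2 f) \<in> supp_on (XX ((kx (Suc x) (Suc y) z)(3 := y)) l)" by (rule AA_XX[OF f1]) simp_all
 moreover have "(kx (Suc x) (Suc y) z)(3 := y) = kx (Suc x) y z" by auto
 ultimately have f2: "AA 7 3 (AA 7 2 f) \<in> supp_on (XX (kx (Suc x) y z) l)" by simp
 have "AA 7 4 (AA 7 3 (AA 7 2 f)) \<in> supp_on (XX ((kx (Suc x) y z)(4 := x)) l)" by (rule AA_XX[OF f2]) simp_all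
 moreover have "(kx (Suc x) y z)(4 := x) = kx x y z" by auto
 ultimately show f3: "GG f \<in> supp_on (XX (kx x y z) l)" by (simp add: GG_def)
 have "AA 7 t (GG f) = 0" if t: "t < 5" for t
 proof (cases "t = 0 \<or> t = 1")
  case True then show ?thesis by (intro AA_XX_0[OF f3]) auto
 next
  case False
  then consider "t = 2" | "t = 3" | "t = 4" using t by (auto simp: lt5)
  then show ?thesis
  proof cases
   case 1 then show ?thesis by (simp add: GG_def AA_anti[of 7 2 4] AA_anti[of 7 2 3] lin_simps[OF lin_AA] AA_sq)
  next
   case 2 then show ?thesis by (simp add: GG_def AA_anti[of 7 3 4] lin_simps[OF lin_AA] AA_sq)
  next
   case 3 then show ?thesis by (simp add: GG_def AA_sq)
  qed
 qed
 then show "bd (cells 5 7) (GG f) = 0" by (simp add: bd_AA)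
qed

lemma GG_supp':
 assumes "f \<in> supp_on (Wu l x' y' z')" "x' = Suc x" "y' = Suc y" "z' = Suc z"
 shows "GG f \<in> supp_on (XX (kx x y z) l) \<and> bd (cells 5 7) (GG f) = (0 :: _ => 'a::field_char_0)"
 using GG_supp[of f x y z l] assms by blast

text \<open>GG x is a cycle for row bounds with one unit more in row a and one less in row 2, and
  bounds a chain u there by \<open>HL_moved_u\<close>. Moving u with \<open>cE\<close> gives a chain
  bounded by GG (E_2a x), since row a of GG x sits at its bound and the diagonal term of
  \<open>cE\<close> disappears.\<close>

lemma GG_EE_bnd:
 fixes x :: "(nat \<times> nat) set => 'a::field_char_0"
 assumes l: "l \<in> WS 7 15"
  and c: "x \<in> supp_on (Wu l 6 6 3) \<and> a = 3 \<or> x \<in> supp_on (Wu l 7 5 3) \<and> a = 4"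
 shows "GG (EE 7 2 a x) \<in> bnd (cells 5 7) (Dl 5 7 ((!) [1,2,3,4,5]) ((!) l)) 12"
proof -
 let ?C = "cells 5 7" and ?F = "Dl 5 7 ((!) [1,2,3,4,5]) ((!) l)"
 define p :: "nat => nat" where "p = (if a = 3 then (!) [1,2,2,5,5] else (!) [1,2,2,4,6])"
 define k where "k = (if a = 3 then kx 5 5 2 else kx 6 4 2)"
 have a: "a = 3 \<or> a = 4" using c by auto
 have xf: "x \<in> fin_supp" using c supp_fin_supp[of "{2, 3, 4}" x 7] by auto
 have G: "GG x \<in> supp_on (XX k l)" "bd ?C (GG x) = 0"
 proof -
  have g1: "GG x \<in> supp_on (XX (kx 5 5 2) l) \<and> bd ?C (GG x) = 0" if "x \<in> supp_on (Wu l 6 6 3)"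
   by (rule GG_supp'[OF that]) simp_all
  have g2: "GG x \<in> supp_on (XX (kx 6 4 2) l) \<and> bd ?C (GG x) = 0" if "x \<in> supp_on (Wu l 7 5 3)"
   by (rule GG_supp'[OF that]) simp_all
  show "GG x \<in> supp_on (XX k l)" "bd ?C (GG x) = 0" using c g1 g2 unfolding k_def by auto
 qed
 have kp: "k t \<le> p t" if "t < 5" for t using that a by (auto simp: k_def p_def lt5)
 have kg: "k 0 + k 1 + k 2 + k 3 + k 4 = 12" using a by (auto simp: k_def)
 have "GG x \<in> cyc ?C (Dl 5 7 p ((!) l)) 12" unfolding cyc_Dl using supp_mono[OF G(1) XX_gr[OF kg kp]] G(2) by simp
 moreover have "hD TYPE('a) 5 7 p ((!) l) 12 = 0"
  using a HL_zeroD[OF HL_12255 l, where 'a='a] HL_zeroD[OF HL_12246 l, where 'a='a] by (auto simp: p_def numeral_eq_Suc)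
 ultimately have "GG x \<in> bnd ?C (Dl 5 7 p ((!) l)) 12" unfolding hD_def by (intro hh_zeroD[OF family_Dl])
 then obtain u where u: "u \<in> supp_on (gr (Dl 5 7 p ((!) l)) (Suc 12))" "GG x = bd ?C u" unfolding bnd_Dl by blast
 have cs: "cE 7 p a 2 u \<in> supp_on (gr ?F (Suc 12))"
  by (rule cE_supp[OF u(1)]) (use a in \<open>auto simp: p_def lt5\<close>)
 have "GG (EE 7 2 a x) = bd ?C (cE 7 p a 2 u)"
 proof
  fix J
  show "GG (EE 7 2 a x) J = bd ?C (cE 7 p a 2 u) J"
  proof (cases "J \<in> ?F")
   case True
   have "GG x J = 0 \<or> p a = card (rw a J)"
   proof (rule disjCI)
    assume "p a \<noteq> card (rw a J)"
    have "J \<notin> XX k l"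
     proof
      assume "J \<in> XX k l"
      then have "card (rw a J) = k a" using a by (auto simp: XX_def)
      then show False using \<open>p a \<noteq> card (rw a J)\<close> a by (auto simp: k_def p_def)
     qed
    then show "GG x J = 0" using G(1) by (simp add: supp_on_def)
   qed
   then have "cE 7 p a 2 (GG x) J = EE 7 2 a (GG x) J" by (auto simp: cE_def)
   then show ?thesis using bd_cE[OF supp_Dl_fin[OF u(1)] _ _ DlD(1)[OF True], of a 2 p] a GG_EE[OF xf a] u(2) by auto
  next
   case False
   have "EE 7 2 a (GG x) J = 0"
   proof (rule ccontr)
    assume n0: "EE 7 2 a (GG x) J \<noteq> 0"
    have "cE 7 p a 2 (GG x) \<in> supp_on (gr ?F 12)"
     by (rule cE_supp[OF supp_mono[OF G(1) XX_gr[OF kg kp]]]) (use a in \<open>auto simp: p_def lt5\<close>)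
    then have c0: "cE 7 p a 2 (GG x) J = 0" using False by (simp add: supp_on_def gr_def)
    have "GG x J = 0 \<or> p a = card (rw a J)"
    proof (rule disjCI)
     assume "p a \<noteq> card (rw a J)"
     have "J \<notin> XX k l"
     proof
      assume "J \<in> XX k l"
      then have "card (rw a J) = k a" using a by (auto simp: XX_def)
      then show False using \<open>p a \<noteq> card (rw a J)\<close> a by (auto simp: k_def p_def)
     qed
     then show "GG x J = 0" using G(1) by (simp add: supp_on_def)
    qed
    then show False using c0 n0 by (auto simp: cE_def)
   qed
   then show ?thesis using bd_outside[OF cs False] GG_EE[OF xf a] by simp
  qed
 qed
 then show ?thesis unfolding bnd_Dl using cs by blast
qed

text \<open>Rows 4, 3, 2 are raised in turn, and each enlarged family has no homology in the
  relevant degree by \<open>vanish_small\<close>. The final cycle has exactly 6, 5, 4 cells in these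
  rows; these 15 cells leave the rows 0 and 1 empty and exhaust all column bounds.\<close>

lemma GG_surj:
 fixes z :: "(nat \<times> nat) set => 'a::field_char_0"
 assumes l: "l \<in> WS 7 15" and z: "z \<in> cyc (cells 5 7) (Dl 5 7 ((!) [1,2,3,4,5]) ((!) l)) 12"
 obtains x where "x \<in> supp_on (Wu l 6 5 4)" "z - GG x \<in> bnd (cells 5 7) (Dl 5 7 ((!) [1,2,3,4,5]) ((!) l)) 12"
proof -
 let ?C = "cells 5 7"
 define p where "p = (!) [1,2,3,4,5::nat]"
 define p1 where "p1 = p(4 := Suc (p 4))"
 define p2 where "p2 = p1(3 := Suc (p1 3))"
 define p3 where "p3 = p2(2 := Suc (p2 2))"
 let ?F = "Dl 5 7 p ((!) l)"
 have ps: "p 0 = 1" "p 1 = 2" "p 2 = 3" "p 3 = 4" "p 4 = 5" "p (Suc 0) = 2" by (simp_all add: p_def)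
 have A0: "AF p l {} = ?F" by (simp add: AF_def)
 have small: "hD TYPE('a) 5 7 q w g = 0"
  if "length qs = 5" "\<And>t. t < 5 ==> q t = qs ! t" "(\<Sum>j<7. w j) = N" "{0, 1} \<subseteq> supp_rows qs"
   "length (filter (\<lambda>x. x \<noteq> 0) qs) + g \<le> N + 2" "(\<Sum>t\<in>{0, 1}. qs ! t) + g < sum_list qs" for q qs w g N
 proof -
  have "hD TYPE('a) 5 7 q w g = hD TYPE('a) (length qs) 7 ((!) qs) w g"
   unfolding that(1) by (rule hD_cong) (simp_all add: that(2))
  also have "\<dots> = 0" by (rule hD_small[OF that(3,4)]) (use that(5,6) in simp_all)
  finally show ?thesis .
 qed
 have h1: "hh TYPE('a) ?C (AF p1 l {}) 12 = 0"
  by (rule hh_AF_zero[where c = 0, OF _ _ _ l], simp, simp, simp, rule small[of "[1,2,3,4,6]"])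
   (auto simp: p1_def ps lt5)
 have h2: "hh TYPE('a) ?C (AF p2 l {4}) 13 = 0"
  by (rule hh_AF_zero[where c = 6, OF _ _ _ l], simp, simp add: p2_def p1_def ps, simp, rule small[of "[1,2,3,5,0]"])
   (auto simp: p2_def p1_def ps lt5)
 have h3: "hh TYPE('a) ?C (AF p3 l {3, 4}) 14 = 0"
  by (rule hh_AF_zero[where c = 11, OF _ _ _ l], simp, simp add: p3_def p2_def p1_def ps, simp, rule small[of "[1,2,4,0,0]"])
   (auto simp: p3_def p2_def p1_def ps lt5)
 have z0: "z \<in> cyc ?C (AF p l {}) 12" unfolding A0 using z unfolding p_def .
 obtain x1 x2 where s1: "x1 \<in> supp_on (gr (AF p l {}) (Suc 12))" "x2 \<in> cyc ?C (AF p1 l {4}) (Suc 12)"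
  "z = (\<Sum>u\<in>{..<5} - {}. AA 7 u x1) + AA 7 4 x2"
  by (rule AF_step[OF z0, of 4]) (use h1 in \<open>simp_all add: p1_def[symmetric]\<close>)
 obtain y1 y2 where s2: "y1 \<in> supp_on (gr (AF p1 l {4}) (Suc 13))" "y2 \<in> cyc ?C (AF p2 l {3, 4}) (Suc 13)"
  "x2 = (\<Sum>u\<in>{..<5} - {4}. AA 7 u y1) + AA 7 3 y2"
  by (rule AF_step[of x2 p1 l "{4}" 13 3]) (use s1(2) h2 in \<open>simp_all add: p2_def[symmetric]\<close>)
 obtain v1 v2 where s3: "v1 \<in> supp_on (gr (AF p2 l {3, 4}) (Suc 14))" "v2 \<in> cyc ?C (AF p3 l {2, 3, 4}) (Suc 14)"
  "y2 = (\<Sum>u\<in>{..<5} - {3, 4}. AA 7 u v1) + AA 7 2 v2"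
  by (rule AF_step[of y2 p2 l "{3, 4}" 14 2]) (use s2(2) h3 in \<open>simp_all add: p3_def[symmetric]\<close>)
 have set1: "{..<5} - {} = {0, 1, 2, 3, 4::nat}" "{..<5} - {4} = {0, 1, 2, 3::nat}" "{..<5} - {3, 4} = {0, 1, 2::nat}" "{..<5} = {0, 1, 2, 3, 4::nat}"
  by (auto simp: lt5)
 \<comment> \<open>The row-4 boundary anticommutes with the other row boundaries and squares to
   zero, so the missing summand u = 4 costs nothing and the sum completes to a full boundary.
   \<open>e2\<close> repeats this for rows 3 and 4.\<close>
 have e1: "AA 7 4 (\<Sum>u\<in>{..<5} - {4}. AA 7 u y1) = - bd ?C (AA 7 4 y1)"
  unfolding bd_AA unfolding set1(2) unfolding set1(4)
  by (simp add: lin_simps[OF lin_AA] AA_anti[of 7 0 4] AA_anti[of 7 2 4] AA_anti[of 7 3 4] AA_anti[of 7 "Suc 0" 4] AA_sq)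
 have e2: "AA 7 4 (AA 7 3 (\<Sum>u\<in>{..<5} - {3, 4}. AA 7 u v1)) = bd ?C (AA 7 4 (AA 7 3 v1))"
  unfolding bd_AA unfolding set1(3) unfolding set1(4)
  by (simp add: lin_simps[OF lin_AA] AA_anti[of 7 0 4] AA_anti[of 7 2 4] AA_anti[of 7 3 4]
    AA_anti[of 7 0 3] AA_anti[of 7 2 3] AA_anti[of 7 "Suc 0" 4] AA_anti[of 7 "Suc 0" 3] AA_sq)
 have "z - GG v2 = bd ?C (x1 - AA 7 4 y1 + AA 7 4 (AA 7 3 v1))"
  unfolding lin_simps(1)[OF lin_bd] lin_simps(3)[OF lin_bd] e2[symmetric]
  using e1 unfolding GG_def s1(3) s2(3) s3(3) lin_simps(1)[OF lin_AA] bd_AA by simp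
 moreover have "x1 - AA 7 4 y1 + AA 7 4 (AA 7 3 v1) \<in> supp_on (gr ?F (Suc 12))"
 proof (intro fs.subspace_add fs.subspace_diff subspace_supp_on)
  show "x1 \<in> supp_on (gr ?F (Suc 12))" using s1(1) unfolding A0 .
  have down: "AA 7 4 f \<in> supp_on (gr ?F (Suc 12))" if f: "f \<in> supp_on (gr (AF p1 l {4}) (Suc 13))" for f :: "_ => 'a"
  proof -
   have fD: "f \<in> supp_on (gr (AF p1 l {}) (Suc (Suc 12)))" using f by (auto simp: supp_on_def gr_def AF_def)
   have g1: "AA 7 4 f \<in> supp_on (gr (AF p1 l {}) (Suc 12))" by (rule AA_supp_AF[OF fD]) simp
   have "J \<in> gr ?F (Suc 12)" if n0: "AA 7 4 f J \<noteq> 0" for J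
   proof -
    have J: "J \<in> Dl 5 7 p1 ((!) l)" "card J = Suc 12" using g1 n0 by (auto simp: supp_on_def gr_def AF_def)
    have "Suc (card (rw 4 J)) \<le> p1 4" using AA_AF(2)[OF supp_gr[OF fD] _ n0] by simp
    then have "card (rw t J) \<le> p t" if "t < 5" for t
     using DlD(2)[OF J(1) that] by (cases "t = 4") (auto simp: p1_def)
    then show ?thesis using J DlD[OF J(1)] by (simp add: gr_def Dl_def)
   qed
   then show ?thesis by (auto simp: supp_on_def)
  qed
  show "AA 7 4 y1 \<in> supp_on (gr ?F (Suc 12))" by (rule down[OF s2(1)])
  have fD: "v1 \<in> supp_on (gr (AF p2 l {4}) (Suc (Suc 13)))" using s3(1) by (auto simp: supp_on_def gr_def AF_def)
  have g1: "AA 7 3 v1 \<in> supp_on (gr (AF p2 l {4}) (Suc 13))" by (rule AA_supp_AF[OF fD]) simp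
  have "J \<in> gr (AF p1 l {4}) (Suc 13)" if n0: "AA 7 3 v1 J \<noteq> 0" for J
  proof -
   have J: "J \<in> AF p2 l {4}" "card J = Suc 13" using g1 n0 by (auto simp: supp_on_def gr_def)
   have "Suc (card (rw 3 J)) \<le> p2 3" using AA_AF(2)[OF supp_gr[OF fD] _ n0] by simp
   then have "card (rw t J) \<le> p1 t" if "t < 5" for t
    using DlD(2)[OF AF_D(1)[OF J(1)] that] by (cases "t = 3") (auto simp: p2_def)
   moreover have "card (rw 4 J) = p1 4" using AF_D(2)[OF J(1), of 4] by (simp add: p2_def)
   ultimately show ?thesis using J(2) DlD[OF AF_D(1)[OF J(1)]] by (simp add: gr_def AF_def Dl_def)
  qed
  then have "AA 7 3 v1 \<in> supp_on (gr (AF p1 l {4}) (Suc 13))" by (auto simp: supp_on_def)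
  then show "AA 7 4 (AA 7 3 v1) \<in> supp_on (gr ?F (Suc 12))" by (rule down)
 qed
 ultimately have "z - GG v2 \<in> bnd ?C (Dl 5 7 ((!) [1,2,3,4,5]) ((!) l)) 12"
  unfolding p_def[symmetric] bnd_Dl by blast
 moreover have "v2 \<in> supp_on (Wu l 6 5 4)"
 proof -
  have "I \<in> Wu l 6 5 4" if n0: "v2 I \<noteq> 0" for I
  proof -
   have I: "I \<in> AF p3 l {2, 3, 4}" "card I = 15" using cycD(1)[OF s3(2)] n0 by (auto simp: supp_on_def gr_def)
   have IC: "I \<subseteq> cells 5 7" by (rule DlD(1)[OF AF_D(1)[OF I(1)]])
   have r: "card (rw 2 I) = 4" "card (rw 3 I) = 5" "card (rw 4 I) = 6"
    using AF_D(2)[OF I(1)] by (simp_all add: p3_def p2_def p1_def ps)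
   have "card I = card (rw 0 I) + card (rw 1 I) + card (rw 2 I) + card (rw 3 I) + card (rw 4 I)"
    unfolding card_rows[OF IC] by (simp add: set1)
   then have "card (rw 0 I) = 0" "card (rw 1 I) = 0" using r I(2) by simp_all
   then have r0: "rw 0 I = {}" "rw 1 I = {}" using fin_rw(1)[OF IC] by simp_all
   have "I \<subseteq> {2, 3, 4} \<times> {..<7}"
   proof
    fix x assume x: "x \<in> I"
    obtain t j where tj: "x = (t, j)" by (cases x)
    have "t < 5" "j < 7" using IC x tj by auto
    moreover have "j \<in> rw t I" using x tj by (simp add: rw_def)
    then have "t \<noteq> 0" "t \<noteq> 1" using r0 by (metis empty_iff)+
    ultimately show "x \<in> {2, 3, 4} \<times> {..<7}" using tj by (auto simp: lt5)
   qed
   moreover have "card (cw j I) = l ! j" if j: "j < 7" for j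
   proof (rule ccontr)
    assume "card (cw j I) \<noteq> l ! j"
    then have "card (cw j I) < l ! j" using DlD(3)[OF AF_D(1)[OF I(1)] j] by simp
    then have "(\<Sum>j<7. card (cw j I)) < (\<Sum>j<7. l ! j)"
     using DlD(3)[OF AF_D(1)[OF I(1)]] j by (intro sum_strict_mono_ex1) auto
    then show False using card_cols[OF IC] I(2) WS_D(2)[OF l] by simp
   qed
   ultimately show ?thesis using r by (simp add: WW_def)
  qed
  then show ?thesis by (auto simp: supp_on_def)
 qed
 ultimately show ?thesis using that by blast
qed

text \<open>The homology is a quotient of weight (6, 5, 4), with rows listed as 4, 3, 2, by
  \<open>GG_surj\<close>. The quotient kills the image of (E_24, E_23) from weights (7, 5, 3) and
  (6, 6, 3), and by the dual gl_3 argument the kernel of that map embeds under E_42 into weight (7,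
  6, 2).\<close>

lemma u_weight:
 assumes l: "l \<in> WS 7 15"
 shows "hD TYPE('a::field_char_0) 5 7 ((!) [1,2,3,4,5]) ((!) l) 12 + (card (Wu l 7 5 3) + card (Wu l 6 6 3))
  \<le> card (Wu l 6 5 4) + card (Wu l 7 6 2)"
proof -
 let ?C = "cells 5 7" and ?F = "Dl 5 7 ((!) [1,2,3,4,5]) ((!) l)"
 let ?W0 = "Wu l 6 5 4" and ?W1 = "Wu l 7 5 3" and ?W2 = "Wu l 6 6 3" and ?W3 = "Wu l 7 6 2"
 let ?Z = "cyc ?C ?F 12 :: ((nat \<times> nat) set => 'a) set" and ?B = "bnd ?C ?F 12 :: ((nat \<times> nat) set => 'a) set"
 have fin: "finite ?W0" "finite ?W1" "finite ?W2" "finite ?W3" by simp_all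
 have disj: "?W1 \<inter> ?W2 = {}" by (auto simp: WW_def)
 have E24: "EE 7 2 4 f \<in> supp_on ?W0" if "f \<in> supp_on ?W1" for f :: "_ => 'a" by (rule EE_supp[OF that]) auto
 have E23: "EE 7 2 3 f \<in> supp_on ?W0" if "f \<in> supp_on ?W2" for f :: "_ => 'a" by (rule EE_supp[OF that]) auto
 have E42: "EE 7 4 2 f \<in> supp_on ?W3" if "f \<in> supp_on ?W2" for f :: "_ => 'a" by (rule EE_supp[OF that]) auto
 let ?X = "?W1 \<union> ?W2"
 let ?T = "\<lambda>f :: _ => 'a. EE 7 2 4 (res ?W1 f) + EE 7 2 3 (res ?W2 f)"
 have rs: "res ?W1 f \<in> supp_on ?W1" "res ?W2 f \<in> supp_on ?W2" for f :: "_ => 'a" by (auto simp: supp_on_def res_def)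
 have lT: "lin ?T"
  by (rule linI) (auto simp: lin_simps[OF lin_EE] lin_simps[OF lin_res] fun_eq_iff algebra_simps)
 have kd: "fs.dim {f\<in>supp_on ?X. ?T f = 0} \<le> card ?W3"
 proof (rule ker_pair_dim[OF lin_EE lin_EE lin_EE[of 7 4 2] fin(2-4) E42])
  define r :: "nat => nat" where "r i = (if i = 1 then 4 else if i = 2 then 3 else if i = 3 then 2 else if i = 4 then 1 else i)" for i
  have inj: "inj r" by (rule inj_on_inverseI[where g = r]) (simp add: r_def)
  have r: "r 1 = 4" "r 2 = 3" "r 3 = 2" by (simp_all add: r_def)
  have S: "{4, 3, 2} = {2, 3, 4::nat}" by auto
  fix f g :: "(nat \<times> nat) set => 'a"
  assume "f \<in> supp_on ?W1" "g \<in> supp_on ?W2" "EE 7 2 4 f + EE 7 2 3 g = 0" "EE 7 4 2 g = 0"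
  moreover have nn: "7 - 1 = (6::nat)" "7 - 2 = (5::nat)" "7 - 4 = (3::nat)" by simp_all
  ultimately show "f = 0 \<and> g = 0" using gl3_EE_dual[OF inj, of f 7 l g] unfolding r S nn by simp
 qed
 have rT: "card ?X = fs.dim {f\<in>supp_on ?X. ?T f = 0} + fs.dim (?T ` supp_on ?X)"
  using rank_nullity[OF lT subspace_supp_on[of ?X] findim_supp_on[of ?X]] fin by simp
 have cX: "card ?X = card ?W1 + card ?W2" using disj fin by (intro card_Un_disjoint)
 obtain \<pi> :: "((nat \<times> nat) set => 'a) => (nat \<times> nat) set => 'a" where \<pi>: "lin \<pi>" "\<And>x. \<pi> x = 0 \<longleftrightarrow> x \<in> ?B"
  by (rule exists_projection[OF subspace_bnd[of ?C ?F 12]]) (rule that)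
 have lg: "lin (\<lambda>x :: (nat \<times> nat) set => 'a. \<pi> (GG x))" by (rule lin_comp[OF lin_GG \<pi>(1)])
 have "fs.dim ?Z = fs.dim {z\<in>?Z. \<pi> z = 0} + fs.dim (\<pi> ` ?Z)"
  by (rule rank_nullity[OF \<pi>(1) subspace_cyc findim_cyc[OF family_Dl]])
 moreover have "fs.dim {z\<in>?Z. \<pi> z = 0} = fs.dim ?B"
  by (rule arg_cong[where f = fs.dim]) (use \<pi>(2) bnd_cyc[OF family_Dl[of 5 7 "(!) [1,2,3,4,5]" "(!) l"], of 12, where 'b='a] in blast)
 moreover have "\<pi> ` ?Z \<subseteq> (\<lambda>x. \<pi> (GG x)) ` supp_on ?W0"
 proof (rule image_subsetI)
  fix z assume "z \<in> ?Z"
  then obtain x where x: "x \<in> supp_on ?W0" "z - GG x \<in> ?B" by (rule GG_surj[OF l])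
  then have "\<pi> z = \<pi> (GG x)" using \<pi>(2)[of "z - GG x"] by (simp add: lin_simps[OF \<pi>(1)])
  then show "\<pi> z \<in> (\<lambda>x. \<pi> (GG x)) ` supp_on ?W0" using x(1) by blast
 qed
 then have "fs.dim (\<pi> ` ?Z) \<le> fs.dim ((\<lambda>x. \<pi> (GG x)) ` supp_on ?W0)"
  by (intro dim_mono findim_image[OF lg]) (simp_all add: findim_supp_on)
 moreover have "card ?W0 = fs.dim {x\<in>supp_on ?W0. \<pi> (GG x) = 0} + fs.dim ((\<lambda>x. \<pi> (GG x)) ` supp_on ?W0)"
  using rank_nullity[OF lg subspace_supp_on[of ?W0] findim_supp_on[OF fin(1)]] fin(1) by simp
 moreover have "fs.dim (?T ` supp_on ?X) \<le> fs.dim {x\<in>supp_on ?W0. \<pi> (GG x) = 0}"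
 proof (rule dim_mono)
  show "findim {x\<in>supp_on ?W0. \<pi> (GG x) = 0}" by (rule findim_mono[OF findim_supp_on[OF fin(1)]]) auto
  show "?T ` supp_on ?X \<subseteq> {x\<in>supp_on ?W0. \<pi> (GG x) = 0}"
  proof (rule image_subsetI)
   fix f :: "(nat \<times> nat) set => 'a"
   have "?T f \<in> supp_on ?W0" by (rule fs.subspace_add[OF subspace_supp_on E24[OF rs(1)] E23[OF rs(2)]])
   moreover have "GG (EE 7 2 4 (res ?W1 f)) \<in> ?B" by (rule GG_EE_bnd[OF l]) (use rs in blast)
   moreover have "GG (EE 7 2 3 (res ?W2 f)) \<in> ?B" by (rule GG_EE_bnd[OF l]) (use rs in blast)
   ultimately have "?T f \<in> supp_on ?W0 \<and> GG (?T f) \<in> ?B"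
    unfolding lin_simps(1)[OF lin_GG] using fs.subspace_add[OF subspace_bnd[of ?C ?F 12]] by blast
   then show "?T f \<in> {x\<in>supp_on ?W0. \<pi> (GG x) = 0}" using \<pi>(2) by blast
  qed
 qed
 ultimately show ?thesis using kd rT cX unfolding hD_def hh_def by linarith
qed

text \<open>The four weights are the complements, row by row in seven columns, of those in
  \<open>HL_v\<close>, so the same alternating sum 2842 results.\<close>

lemma HL_u: "HL TYPE('a::field_char_0) 7 [1,2,3,4,5] 15 12 \<le> 2842"
proof -
 have "(\<Sum>l\<in>WS 7 15. hD TYPE('a) 5 7 ((!) [1,2,3,4,5]) ((!) l) 12 + (card (Wu l 7 5 3) + card (Wu l 6 6 3)))
  \<le> (\<Sum>l\<in>WS 7 15. card (Wu l 6 5 4) + card (Wu l 7 6 2))"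
  by (rule sum_mono) (rule u_weight)
 moreover have c: "(\<Sum>l\<in>WS 7 15. card (Wu l x y z)) = (7 choose x) * (7 choose y) * (7 choose z)" if "x + y + z = 15" for x y z
  using sum_card_WW[of "{2, 3, 4}" "ku x y z" 15 7] that by simp
 moreover have "HL TYPE('a) 7 [1,2,3,4,5] 15 12 = (\<Sum>l\<in>WS 7 15. hD TYPE('a) 5 7 ((!) [1,2,3,4,5]) ((!) l) 12)"
  by (simp add: HL_def numeral_eq_Suc)
 moreover have "7 choose 6 = (7::nat)" by (rule binomialI) (simp_all add: fact_numeral)
 ultimately show ?thesis unfolding sum.distrib by (simp add: c choose_rows)
qed

section \<open>Koszul operators over the squarefree algebra\<close>

type_synonym 'a pch = "(nat \<times> nat) set \<times> nat set => 'a"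

lemma supp_onD: "f \<in> supp_on D ==> y \<notin> D ==> f y = 0"
 by (auto simp: supp_on_def)

definition de :: "nat => nat set => nat set" where "de i S = (if i = 0 then S else S - {i})"
definition ie :: "nat => nat set => nat set" where "ie i S = (if i = 0 then S else insert i S)"

text \<open>The component S is the squarefree monomial that is the product of x_i over i in S, with
  x_i^2 = 0 and x_0 = 1; index 0 therefore leaves S alone in \<open>de\<close> and
  \<open>ie\<close>. \<open>vw n t\<close> is multiplication by sum_i x_i e_(t,i),
  \<open>vi n t\<close> is its transpose, and \<open>Wop n s\<close> multiplies by these elements
  for all rows t < s.\<close>

definition vw :: "nat => nat => 'a::field_char_0 pch => 'a pch" where
 "vw n t h = (\<lambda>(J, S). \<Sum>i<n. if i = 0 \<or> i \<in> S then cr (t, i) (\<lambda>I. h (I, de i S)) J else 0)"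

definition vi :: "nat => nat => 'a::field_char_0 pch => 'a pch" where
 "vi n t h = (\<lambda>(J, S). \<Sum>i<n. if i = 0 \<or> i \<notin> S then an (t, i) (\<lambda>I. h (I, ie i S)) J else 0)"

primrec Wop :: "nat => nat => 'a::field_char_0 pch => 'a pch" where
 "Wop n 0 h = h"
| "Wop n (Suc t) h = vw n t (Wop n t h)"

lemma lin_pointwise:
 assumes "\<And>f g y. F (f + g) y = F f y + F g y" "\<And>c f y. F (fscale c f) y = c * F f y"
 shows "lin F"
 by (rule linI) (auto simp: fun_eq_iff assms)

lemma cr_add: "cr x (\<lambda>I. f I + g I) J = cr x f J + cr x g J" and cr_scale: "cr x (\<lambda>I. c * f I) J = c * cr x f J"
 and an_add: "an x (\<lambda>I. f I + g I) J = an x f J + an x g J" and an_scale: "an x (\<lambda>I. c * f I) J = c * an x f J"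
 by (auto simp: cr_def an_def algebra_simps)

lemma lin_vw: "lin (vw n t)"
proof (rule lin_pointwise)
 fix f g :: "'a pch" and c y
 show "vw n t (f + g) y = vw n t f y + vw n t g y"
  by (cases y) (auto simp: vw_def cr_add sum.distrib[symmetric] intro!: sum.cong)
 show "vw n t (fscale c f) y = c * vw n t f y"
  by (cases y) (auto simp: vw_def cr_scale sum_distrib_left intro!: sum.cong)
qed

lemma lin_vi: "lin (vi n t)"
proof (rule lin_pointwise)
 fix f g :: "'a pch" and c y
 show "vi n t (f + g) y = vi n t f y + vi n t g y"
  by (cases y) (auto simp: vi_def an_add sum.distrib[symmetric] intro!: sum.cong)
 show "vi n t (fscale c f) y = c * vi n t f y"
  by (cases y) (auto simp: vi_def an_scale sum_distrib_left intro!: sum.cong)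
qed

lemma lin_Wop: "lin (Wop n t)"
proof (rule linI)
 fix f g :: "'a pch" and c
 show "Wop n t (f + g) = Wop n t f + Wop n t g" by (induction t) (simp_all only: Wop.simps lin_simps[OF lin_vw])
 show "Wop n t (fscale c f) = fscale c (Wop n t f)" by (induction t) (simp_all only: Wop.simps lin_simps[OF lin_vw])
qed

lemma vw_anti: "vw n t (vw n u h) = - vw n u (vw n t (h :: 'a::field_char_0 pch))"
proof (rule ext)
 fix y :: "(nat \<times> nat) set \<times> nat set"
 obtain J S where y: "y = (J, S)" by (cases y)
 let ?c = "\<lambda>i k. (i = 0 \<or> i \<in> S) \<and> (k = 0 \<or> k \<in> de i S)"
 have e: "vw n t (vw n u h) (J, S)
   = (\<Sum>i<n. \<Sum>k<n. if ?c i k then cr (t, i) (cr (u, k) (\<lambda>I. h (I, de k (de i S)))) J else 0)" for t u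
 proof -
  have K: "cr (t, i) (\<lambda>I. vw n u h (I, de i S)) J
    = (\<Sum>k<n. if k = 0 \<or> k \<in> de i S then cr (t, i) (cr (u, k) (\<lambda>I. h (I, de k (de i S)))) J else 0)" for i
  proof -
   have "(\<lambda>I. vw n u h (I, de i S)) = (\<Sum>k<n. if k = 0 \<or> k \<in> de i S then cr (u, k) (\<lambda>I. h (I, de k (de i S))) else 0)"
    by (rule ext) (auto simp: vw_def sum_apply intro!: sum.cong)
   then show ?thesis
    by (simp only: fsp.linear_sum[OF lin_cr] sum_apply) (auto simp: lin_simps[OF lin_cr] intro!: sum.cong)
  qed
  have "vw n t (vw n u h) (J, S) = (\<Sum>i<n. if i = 0 \<or> i \<in> S then
    \<Sum>k<n. if k = 0 \<or> k \<in> de i S then cr (t, i) (cr (u, k) (\<lambda>I. h (I, de k (de i S)))) J else 0 else 0)"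
   unfolding vw_def[of n t] prod.case K ..
  also have "\<dots> = (\<Sum>i<n. \<Sum>k<n. if ?c i k then cr (t, i) (cr (u, k) (\<lambda>I. h (I, de k (de i S)))) J else 0)"
  proof (rule sum.cong[OF refl])
   fix i
   show "(if i = 0 \<or> i \<in> S then \<Sum>k<n. if k = 0 \<or> k \<in> de i S then cr (t, i) (cr (u, k) (\<lambda>I. h (I, de k (de i S)))) J else 0 else 0)
    = (\<Sum>k<n. if ?c i k then cr (t, i) (cr (u, k) (\<lambda>I. h (I, de k (de i S)))) J else 0)"
    by (cases "i = 0 \<or> i \<in> S") simp_all
  qed
  finally show ?thesis .
 qed
 have c: "?c i k = ?c k i" for i k by (auto simp: de_def)
 have d: "de k (de i S) = de i (de k S)" for i k :: nat by (auto simp: de_def)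
 have "vw n t (vw n u h) (J, S)
   = (\<Sum>k<n. \<Sum>i<n. if ?c i k then cr (t, i) (cr (u, k) (\<lambda>I. h (I, de k (de i S)))) J else 0)"
  unfolding e by (rule sum.swap)
 also have "\<dots> = (\<Sum>k<n. \<Sum>i<n. - (if ?c k i then cr (u, k) (cr (t, i) (\<lambda>I. h (I, de i (de k S)))) J else 0))"
 proof (intro sum.cong refl)
  fix k i
  have "cr (t, i) (cr (u, k) (\<lambda>I. h (I, de k (de i S)))) J = - cr (u, k) (cr (t, i) (\<lambda>I. h (I, de i (de k S)))) J"
   using fun_cong[OF cr_cr[of "(t, i)" "(u, k)" "\<lambda>I. h (I, de k (de i S))"], of J] unfolding d[of i k] by simp
  then show "(if ?c i k then cr (t, i) (cr (u, k) (\<lambda>I. h (I, de k (de i S)))) J else 0)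
   = - (if ?c k i then cr (u, k) (cr (t, i) (\<lambda>I. h (I, de i (de k S)))) J else 0)"
   unfolding c[of i k] by (simp only: if_distrib[of uminus] minus_zero split: if_splits)
 qed
 also have "\<dots> = - vw n u (vw n t h) (J, S)" unfolding e sum_negf ..
 finally show "vw n t (vw n u h) y = (- vw n u (vw n t h)) y" by (simp add: y)
qed

lemma neg_self_eq': "f = - f ==> f = (0 :: 'a::field_char_0 pch)"
 by (rule neg_self_eq)

lemma vw_sq: "vw n t (vw n t h) = 0"
 by (rule neg_self_eq', rule vw_anti)

lemma Wop_vw: "Wop n d (vw n t h) = fscale ((-1) ^ d) (vw n t (Wop n d h))"
proof (induction d)
 case 0 then show ?case by (simp add: fun_eq_iff)
next
 case (Suc d)
 have "Wop n (Suc d) (vw n t h) = fscale ((-1) ^ d) (vw n d (vw n t (Wop n d h)))"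
  by (simp only: Wop.simps Suc lin_simps(2)[OF lin_vw])
 also have "\<dots> = fscale ((-1) ^ d) (- vw n t (vw n d (Wop n d h)))" by (simp only: vw_anti[of n d t])
 finally show ?case by (simp add: fun_eq_iff)
qed

lemma Wop_vw_0: "t < d ==> Wop n d (vw n t h) = 0"
proof (induction d)
 case (Suc d)
 show ?case
 proof (cases "t = d")
  case True
  have "Wop n (Suc d) (vw n t h) = fscale ((-1) ^ d) (vw n d (vw n d (Wop n d h)))"
   by (subst Wop.simps(2)) (simp only: True Wop_vw lin_simps(2)[OF lin_vw])
  then show ?thesis by (simp only: vw_sq fs.scale_zero_right)
 next
  case False
  then have "t < d" using Suc.prems by simp
  then have "Wop n d (vw n t h) = 0" by (rule Suc.IH)
  then show ?thesis by (simp only: Wop.simps lin_simps(4)[OF lin_vw])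
 qed
qed simp

lemma vw_Wop_0: "t < d ==> vw n t (Wop n d h) = 0"
proof -
 assume "t < d"
 then have "fscale ((-1) ^ d) (vw n t (Wop n d h)) = 0" using Wop_vw[of n d t h] Wop_vw_0[of t d n h] by simp
 then show ?thesis by (simp add: fun_eq_iff)
qed

definition XS :: "nat => nat => (nat => nat) => (nat \<times> nat) set set" where
 "XS s n k = {I. I \<subseteq> cells s n \<and> (\<forall>t<s. card (rw t I) = k t)}"

lemma finite_XS [simp]: "finite (XS s n k)"
 by (rule finite_subset[of _ "Pow (cells s n)"]) (auto simp: XS_def)

lemma XS_insert:
 assumes "(t, i) \<notin> J" "t < s" "i < n"
 shows "insert (t, i) J \<in> XS s n k \<longleftrightarrow> J \<subseteq> cells s n \<and> (\<forall>u<s. card (rw u J) = (if u = t then k t - 1 else k u)) \<and> 1 \<le> k t"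
proof (cases "J \<subseteq> cells s n")
 case True
 have r: "card (rw u (insert (t, i) J)) = (if u = t then Suc (card (rw t J)) else card (rw u J))" for u
 proof -
  have "rw u (insert (t, i) J) = (if u = t then insert i (rw t J) else rw u J)" by (auto simp: rw_def)
  moreover have "i \<notin> rw t J" using assms(1) by (simp add: rw_def)
  ultimately show ?thesis using fin_rw(1)[OF True, of t] by simp
 qed
 show ?thesis
 proof
  assume "insert (t, i) J \<in> XS s n k"
  then have a: "card (rw u (insert (t, i) J)) = k u" if "u < s" for u using that by (simp add: XS_def)
  have "card (rw u J) = (if u = t then k t - 1 else k u)" if "u < s" for u using a[OF that] r[of u] by (cases "u = t") auto
  moreover have "1 \<le> k t" using a[OF assms(2)] r[of t] by simp
  ultimately show "J \<subseteq> cells s n \<and> (\<forall>u<s. card (rw u J) = (if u = t then k t - 1 else k u)) \<and> 1 \<le> k t" using True by simp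
 next
  assume b: "J \<subseteq> cells s n \<and> (\<forall>u<s. card (rw u J) = (if u = t then k t - 1 else k u)) \<and> 1 \<le> k t"
  have "card (rw u (insert (t, i) J)) = k u" if "u < s" for u
   using b that r[of u] by (cases "u = t") auto
  then show "insert (t, i) J \<in> XS s n k" using True assms by (simp add: XS_def)
 qed
next
 case False then show ?thesis by (auto simp: XS_def)
qed

abbreviation (input) SS :: "nat => nat set set" where "SS n \<equiv> Pow {1..<n}"

lemma vw_supp:
 assumes h: "h \<in> supp_on (XS s n k \<times> SS n)" and t: "t < s"
 shows "vw n t h \<in> supp_on (XS s n (k(t := Suc (k t))) \<times> SS n :: ((nat \<times> nat) set \<times> nat set) set)"
proof -
 have "(J, S) \<in> XS s n (k(t := Suc (k t))) \<times> SS n" if n0: "vw n t h (J, S) \<noteq> (0 :: 'a::field_char_0)" for J S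
 proof -
  have "\<exists>i\<in>{..<n}. (if i = 0 \<or> i \<in> S then cr (t, i) (\<lambda>I. h (I, de i S)) J else 0) \<noteq> 0"
  proof (rule ccontr)
   assume "\<not> ?thesis"
   then have "vw n t h (J, S) = 0" unfolding vw_def by (simp add: sum.neutral)
   then show False using n0 by simp
  qed
  then obtain i where i: "i < n" "i = 0 \<or> i \<in> S" "cr (t, i) (\<lambda>I. h (I, de i S)) J \<noteq> 0" by (auto split: if_splits)
  then have c: "(t, i) \<in> J" "h (J - {(t, i)}, de i S) \<noteq> 0" by (auto simp: cr_def split: if_splits)
  then have I: "J - {(t, i)} \<in> XS s n k" "de i S \<in> SS n" using h by (auto simp: supp_on_def)
  have "insert (t, i) (J - {(t, i)}) \<in> XS s n (k(t := Suc (k t)))"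
   by (subst XS_insert) (use I(1) t i(1) in \<open>auto simp: XS_def\<close>)
  moreover have "insert (t, i) (J - {(t, i)}) = J" using c(1) by blast
  moreover have "S \<in> SS n" using I(2) i(1) by (cases "i = 0") (auto simp: de_def)
  ultimately show ?thesis by simp
 qed
 then show ?thesis by (auto simp: supp_on_def)
qed

text \<open>Row sizes after the rows below d have been multiplied: the exterior degree of row t
  starts at t + 1 and is raised to t + 2.\<close>

definition kd :: "nat => nat => nat" where "kd d t = (if t < d then t + 2 else t + 1)"

lemma Wop_supp:
 assumes h: "h \<in> supp_on (XS s n (kd 0) \<times> SS n)" and d: "d \<le> s"
 shows "Wop n d h \<in> supp_on (XS s n (kd d) \<times> SS n :: ((nat \<times> nat) set \<times> nat set) set)"
 using d
proof (induction d)
 case 0 then show ?case using h by simp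
next
 case (Suc d)
 have "(kd d)(d := Suc (kd d d)) = kd (Suc d)" by (auto simp: kd_def)
 then show ?case using vw_supp[OF Suc.IH, of d] Suc.prems by simp
qed

definition ao :: "nat => 'a::field_char_0 pch => 'a pch" where
 "ao t h = (\<lambda>(J, S). an (t, 0) (\<lambda>I. h (I, S)) J)"

lemma ao_vw:
 assumes h: "h \<in> supp_on (XS s n k \<times> SS n)" and n: "0 < n"
 shows "ao t (vw n u h) = (if t = u then h else 0) - vw n u (ao t (h :: 'a::field_char_0 pch))"
proof (rule ext)
 fix y :: "(nat \<times> nat) set \<times> nat set"
 obtain J S where y: "y = (J, S)" by (cases y)
 have fs: "(\<lambda>I. h (I, T)) \<in> fin_supp" for T
 proof -
  have "h (I, T) = 0" if "infinite I" for I
  proof -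
   have "I \<notin> XS s n k" using that finite_subset[of I "cells s n"] by (auto simp: XS_def)
   then show ?thesis using h by (simp add: supp_on_def)
  qed
  then show ?thesis by (simp add: fin_supp_def)
 qed
 have "(\<lambda>I. vw n u h (I, S)) = (\<Sum>i<n. if i = 0 \<or> i \<in> S then cr (u, i) (\<lambda>I. h (I, de i S)) else 0)"
  by (rule ext) (auto simp: vw_def sum_apply intro!: sum.cong)
 then have "ao t (vw n u h) (J, S)
   = (\<Sum>i<n. an (t, 0) (if i = 0 \<or> i \<in> S then cr (u, i) (\<lambda>I. h (I, de i S)) else 0) J)"
  by (simp only: ao_def prod.case fsp.linear_sum[OF lin_an] sum_apply)
 also have "\<dots> = (\<Sum>i<n. (if i = 0 then if t = u then h (J, S) else 0 else 0)
   - (if i = 0 \<or> i \<in> S then cr (u, i) (\<lambda>I. ao t h (I, de i S)) J else 0))"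
 proof (rule sum.cong[OF refl])
  fix i
  have e: "(\<lambda>I. ao t h (I, de i S)) = an (t, 0) (\<lambda>I. h (I, de i S))" by (rule ext) (simp add: ao_def)
  show "an (t, 0) (if i = 0 \<or> i \<in> S then cr (u, i) (\<lambda>I. h (I, de i S)) else 0) J
   = (if i = 0 then if t = u then h (J, S) else 0 else 0)
    - (if i = 0 \<or> i \<in> S then cr (u, i) (\<lambda>I. ao t h (I, de i S)) J else 0)"
  proof (cases "i = 0 \<or> i \<in> S")
   case True
   then show ?thesis unfolding e using an_cr_if[OF fs[of "de i S"], of "(t, 0)" "(u, i)"] by (auto simp: de_def)
  next
   case False then show ?thesis by (simp add: lin_simps(4)[OF lin_an])
  qed
 qed
 also have "\<dots> = (if t = u then h (J, S) else 0) - vw n u (ao t h) (J, S)"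
  using n by (simp add: sum_subtractf vw_def)
 finally show "ao t (vw n u h) y = ((if t = u then h else 0) - vw n u (ao t h)) y" by (simp add: y)
qed

abbreviation (input) UU :: "nat => nat => ((nat \<times> nat) set \<times> nat set) set" where
 "UU s n \<equiv> XS s n (kd 0) \<times> SS n"

text \<open>Contraction with e_(d,0) undoes multiplication in row d on chains that avoid column 0,
  because the coefficient x_0 = 1 is a unit.\<close>

lemma Wop_inj:
 assumes h: "h \<in> supp_on (UU s n)" and h0: "\<And>t I S. t < s ==> (t, 0) \<in> I ==> h (I, S) = (0 :: 'a::field_char_0)"
  and n: "0 < n" and d: "d \<le> s"
 shows "Wop n d h = 0 ==> h = 0"
 using d
proof (induction d)
 case (Suc d)
 have sub: "(\<lambda>I. h (I, S)) (insert (t, 0) J) = 0" if "t < s" for t J S using h0[OF that] by simp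
 have ao0: "ao t h = 0" if "t < s" for t
  by (rule ext) (auto simp: ao_def an_def h0[OF that] split: prod.splits)
 have aoW: "ao d (Wop n e h) = 0" if "e \<le> d" for e
  using that
 proof (induction e)
  case 0 then show ?case using ao0 Suc.prems by simp
 next
  case (Suc e)
  have "ao d (Wop n e h) = 0" by (rule Suc.IH) (use Suc.prems in simp)
  then show ?case using ao_vw[OF Wop_supp[OF h, of e], of d e] n Suc.prems \<open>Suc d \<le> s\<close> by (simp add: lin_simps[OF lin_vw])
 qed
 have "Wop n d h = ao d (vw n d (Wop n d h))"
  using ao_vw[OF Wop_supp[OF h, of d], of d d] n Suc.prems aoW[of d] by (simp add: lin_simps[OF lin_vw])
 also have "\<dots> = 0" using Suc.prems(1) by (simp add: ao_def an_def fun_eq_iff)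
 finally show ?case using Suc by simp
qed simp

lemma card_rows_avoid:
 assumes "\<And>t. t < s ==> c t < n"
 shows "card {I\<in>XS s n k. \<forall>t<s. (t, c t) \<notin> I} = (\<Prod>t<s. (n - 1) choose k t)"
proof -
 let ?A = "{I\<in>XS s n k. \<forall>t<s. (t, c t) \<notin> I}" and ?P = "PiE {..<s} (\<lambda>t. {R. R \<subseteq> {..<n} - {c t} \<and> card R = k t})"
 have "bij_betw (\<lambda>I. \<lambda>t\<in>{..<s}. rw t I) ?A ?P"
 proof (rule bij_betw_byWitness[where f' = "\<lambda>f. Sigma {..<s} f"])
  show "\<forall>I\<in>?A. Sigma {..<s} (\<lambda>t\<in>{..<s}. rw t I) = I" by (auto simp: rw_def XS_def)
  have r: "rw t (Sigma {..<s} f) = f t" if "t < s" for t f using that by (auto simp: rw_def)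
  show "\<forall>f\<in>?P. (\<lambda>t\<in>{..<s}. rw t (Sigma {..<s} f)) = f"
  proof
   fix f assume f: "f \<in> ?P"
   have "(\<lambda>t\<in>{..<s}. rw t (Sigma {..<s} f)) t = f t" for t
    using PiE_arb[OF f, of t] r[of t f] by (cases "t < s") auto
   then show "(\<lambda>t\<in>{..<s}. rw t (Sigma {..<s} f)) = f" by (rule ext)
  qed
  show "(\<lambda>I. \<lambda>t\<in>{..<s}. rw t I) ` ?A \<subseteq> ?P"
  proof (rule image_subsetI)
   fix I assume I: "I \<in> ?A"
   have "rw t I \<subseteq> {..<n} - {c t} \<and> card (rw t I) = k t" if "t < s" for t
    using I that by (auto simp: XS_def rw_def)
   then show "(\<lambda>t\<in>{..<s}. rw t I) \<in> ?P" by simp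
  qed
  show "Sigma {..<s} ` ?P \<subseteq> ?A"
  proof (rule image_subsetI)
   fix f assume f: "f \<in> ?P"
   have ft: "f t \<subseteq> {..<n} - {c t} \<and> card (f t) = k t" if "t < s" for t using PiE_mem[OF f, of t] that by simp
   have "Sigma {..<s} f \<subseteq> cells s n" using ft by auto
   then show "Sigma {..<s} f \<in> ?A" using ft r[of _ f] by (auto simp: XS_def)
  qed
 qed
 then have "card ?A = card ?P" by (rule bij_betw_same_card)
 also have "\<dots> = (\<Prod>t<s. card {R. R \<subseteq> {..<n} - {c t} \<and> card R = k t})" by (rule card_PiE) simp
 also have "\<dots> = (\<Prod>t<s. (n - 1) choose k t)"
  by (intro prod.cong refl) (use assms in \<open>simp add: n_subsets\<close>)
 finally show ?thesis .
qed

text \<open>The two defects. \<open>E1\<close> contains, under the coordinate pairing, everything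
  orthogonal to the inputs of degree at most 1 and to the kernel of \<open>Wop n s\<close>.
  \<open>E2\<close> contains every element of the image of \<open>Wop n s\<close> that is lost when
  only coefficients of degree at least n - 2 are read.\<close>

definition E1 :: "nat => nat => 'a::field_char_0 pch set" where
 "E1 s n = {h \<in> supp_on (XS s n (kd 0) \<times> {S\<in>SS n. 2 \<le> card S}). \<forall>t<s. vi n t h = 0}"

definition E2 :: "nat => nat => 'a::field_char_0 pch set" where
 "E2 s n = {h \<in> supp_on (XS s n (kd s) \<times> {S\<in>SS n. card S + 2 < n}). \<forall>t<s. vw n t h = 0}"

lemma fs_sum_delta:
 "finite X ==> (\<Sum>x\<in>X. (if x = y then 1 else 0) * f x) = (if y \<in> X then f y else (0::'a::field))"
proof -
 assume "finite X"
 then have "(\<Sum>x\<in>X. (if x = y then 1 else 0) * f x) = (\<Sum>x\<in>X. if x = y then f x else 0)" by (intro sum.cong) auto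
 then show ?thesis using \<open>finite X\<close> by simp
qed

text \<open>On all of the domain the rank is at least the left side, by injectivity on chains
  avoiding column 0. Passing to inputs of degree at most 1 loses the codimension of V1 plus the
  kernel. The annihilator of that sum lies in \<open>E1\<close>, because the kernel contains the
  image of every \<open>vw n t\<close> with t < s.\<close>

lemma rank_Wop:
 assumes n: "n = s + 2"
 defines "V1 \<equiv> supp_on (XS s n (kd 0) \<times> {S\<in>SS n. card S \<le> 1}) :: 'a::field_char_0 pch set"
 shows "2 ^ (n - 1) * (\<Prod>t<s. (n - 1) choose Suc t) \<le> fs.dim (Wop n s ` V1) + fs.dim (E1 s n :: 'a pch set)"
proof -
 let ?U = "UU s n" and ?W = "Wop n s :: 'a pch => 'a pch"
 have fU: "finite ?U" by simp
 let ?K = "{h\<in>supp_on ?U. ?W h = 0}"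
 have sK: "fs.subspace ?K" by (auto simp: fs.subspace_def supp_on_def lin_simps[OF lin_Wop])
 have V1U: "V1 \<subseteq> supp_on ?U" by (auto simp: V1_def supp_on_def)
 have sV1: "fs.subspace V1" by (simp add: V1_def)
 define V where "V = {x + y |x y. x \<in> V1 \<and> y \<in> ?K}"
 have sV: "fs.subspace V" unfolding V_def by (rule fs.subspace_sums[OF sV1 sK])
 have VU: "V \<subseteq> supp_on ?U" unfolding V_def using V1U fs.subspace_add[OF subspace_supp_on[of ?U]] by blast
 have fV: "findim V" by (rule findim_mono[OF findim_supp_on[OF fU] VU])
 have WV: "?W ` V = ?W ` V1"
 proof
  show "?W ` V \<subseteq> ?W ` V1" by (auto simp: V_def lin_simps[OF lin_Wop])
  have "V1 \<subseteq> V"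
  proof
  fix x assume "x \<in> V1"
  then show "x \<in> V" unfolding V_def mem_Collect_eq using fs.subspace_0[OF sK]
   by (intro exI[of _ x] exI[of _ 0] conjI) simp_all
  qed
  then show "?W ` V1 \<subseteq> ?W ` V" by blast
 qed
 have 1: "fs.dim V \<le> fs.dim ?K + fs.dim (?W ` V1)"
 proof -
  have "fs.dim {v\<in>V. ?W v = 0} \<le> fs.dim ?K"
   by (rule dim_mono[OF findim_mono[OF findim_supp_on[OF fU]]]) (use VU in auto)
  then show ?thesis using rank_nullity[OF lin_Wop sV fV, of n s] unfolding WV by linarith
 qed
 have 2: "card ?U = fs.dim ?K + fs.dim (?W ` supp_on ?U)"
  using rank_nullity[OF lin_Wop subspace_supp_on[of ?U] findim_supp_on[OF fU], of n s] fU by simp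
 have 3: "card ?U \<le> fs.dim V + fs.dim {f\<in>supp_on ?U. \<forall>v\<in>V. (\<Sum>x\<in>?U. v x * f x) = 0}"
  by (rule perp_dim[OF fU VU])
 have "{f\<in>supp_on ?U. \<forall>v\<in>V. (\<Sum>x\<in>?U. v x * f x) = 0} \<subseteq> E1 s n"
 proof
  fix f :: "'a pch" assume f: "f \<in> {f\<in>supp_on ?U. \<forall>v\<in>V. (\<Sum>x\<in>?U. v x * f x) = 0}"
  have V1V: "V1 \<subseteq> V"
  proof
  fix x assume "x \<in> V1"
  then show "x \<in> V" unfolding V_def mem_Collect_eq using fs.subspace_0[OF sK]
   by (intro exI[of _ x] exI[of _ 0] conjI) simp_all
  qed
  have KV: "?K \<subseteq> V"
  proof
  fix x assume "x \<in> ?K"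
  then show "x \<in> V" unfolding V_def mem_Collect_eq using fs.subspace_0[OF sV1]
   by (intro exI[of _ 0] exI[of _ x] conjI) simp_all
  qed
  have "f y = 0" if y: "y \<notin> XS s n (kd 0) \<times> {S\<in>SS n. 2 \<le> card S}" for y
  proof (cases "y \<in> ?U")
   case True
   then have "(\<lambda>x. if x = y then 1 else 0) \<in> V1" using y by (auto simp: V1_def supp_on_def)
   then have d: "(\<lambda>x. if x = y then 1 else 0) \<in> V" using V1V by blast
   have "\<forall>v\<in>V. (\<Sum>x\<in>?U. v x * f x) = 0" using f by blast
   from bspec[OF this d] have "(\<Sum>x\<in>?U. (if x = y then 1 else 0) * f x) = 0" .
   then show ?thesis using True unfolding fs_sum_delta[OF fU] by simp
  next
   case False
   have "f \<in> supp_on ?U" using f by blast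
   then show ?thesis using False by (rule supp_onD)
  qed
  moreover have "vi n t f = 0" if t: "t < s" for t
  proof (rule ext)
   fix y :: "(nat \<times> nat) set \<times> nat set"
   obtain J S where y: "y = (J, S)" by (cases y)
   show "vi n t f y = 0 y"
   proof (cases "S \<in> SS n \<and> J \<in> XS s n ((kd 0)(t := t))")
    case False
    have "an (t, i) (\<lambda>I. f (I, ie i S)) J = 0" if i: "i < n" for i
    proof (rule ccontr)
     assume n0: "an (t, i) (\<lambda>I. f (I, ie i S)) J \<noteq> 0"
     then have a: "(t, i) \<notin> J" "f (insert (t, i) J, ie i S) \<noteq> 0" by (auto simp: an_def split: if_splits)
     then have "(insert (t, i) J, ie i S) \<in> ?U" using f by (auto simp: supp_on_def)
     then have b: "insert (t, i) J \<in> XS s n (kd 0)" "ie i S \<in> SS n" by auto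
     have "J \<in> XS s n ((kd 0)(t := t))" using b(1) unfolding XS_insert[OF a(1) t i]
      by (auto simp: XS_def kd_def split: if_splits)
     moreover have "S \<in> SS n" using b(2) by (auto simp: ie_def split: if_splits)
     ultimately show False using False by simp
    qed
    then have "(\<Sum>i<n. if i = 0 \<or> i \<notin> S then an (t, i) (\<lambda>I. f (I, ie i S)) J else 0) = 0"
     by (intro sum.neutral) simp
    then show ?thesis by (simp add: y vi_def)
   next
    case True
    \<comment> \<open>Orthogonality of f to \<open>vw n t\<close> applied to this indicator is the
      vanishing of the transposed operator on f at (J, S).\<close>
    define \<delta> where "\<delta> = (\<lambda>x. if x = (J, S) then 1 else 0 :: 'a)"
    have "\<delta> \<in> supp_on (XS s n ((kd 0)(t := t)) \<times> SS n)" using True by (auto simp: \<delta>_def supp_on_def)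
    from vw_supp[OF this t] have vU: "vw n t \<delta> \<in> supp_on ?U"
    proof -
     have "((kd 0)(t := t))(t := Suc (((kd 0)(t := t)) t)) = kd 0" by (auto simp: kd_def)
     then show ?thesis using vw_supp[OF \<open>\<delta> \<in> _\<close> t] by simp
    qed
    have "vw n t \<delta> \<in> ?K" using vU Wop_vw_0[OF t, of n \<delta>] by simp
    then have z: "(\<Sum>x\<in>?U. vw n t \<delta> x * f x) = 0" using KV f by blast
    let ?T = "\<lambda>i x. if (i = 0 \<or> i \<in> snd x) \<and> fst x = insert (t, i) J \<and> (t, i) \<notin> J \<and> de i (snd x) = S then sg (t, i) J * f x else 0"
    have "vw n t \<delta> x * f x = (\<Sum>i<n. ?T i x)" for x
    proof -
     obtain I R where x: "x = (I, R)" by (cases x)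
     have "(if i = 0 \<or> i \<in> R then cr (t, i) (\<lambda>I. \<delta> (I, de i R)) I else 0) * f x = ?T i x" for i
     proof -
      have "(t, i) \<in> I \<and> I - {(t, i)} = J \<longleftrightarrow> I = insert (t, i) J \<and> (t, i) \<notin> J" by blast
      then show ?thesis by (auto simp: x cr_def \<delta>_def)
     qed
     then show ?thesis by (simp add: x vw_def sum_distrib_right)
    qed
    then have "(\<Sum>x\<in>?U. \<Sum>i<n. ?T i x) = 0" using z by simp
    then have z2: "(\<Sum>i<n. \<Sum>x\<in>?U. ?T i x) = 0" by (simp only: sum.swap[of _ "{..<n}"])
    have "(\<Sum>x\<in>?U. ?T i x) = (if i = 0 \<or> i \<notin> S then an (t, i) (\<lambda>I. f (I, ie i S)) J else 0)" if i: "i < n" for i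
    proof -
     have "?T i x = (if x = (insert (t, i) J, ie i S) then
       (if (i = 0 \<or> i \<notin> S) \<and> (t, i) \<notin> J then sg (t, i) J * f x else 0) else 0)" for x
      by (cases x) (auto simp: de_def ie_def)
     then have "(\<Sum>x\<in>?U. ?T i x) = (\<Sum>x\<in>?U. if x = (insert (t, i) J, ie i S) then
       (if (i = 0 \<or> i \<notin> S) \<and> (t, i) \<notin> J then sg (t, i) J * f x else 0) else 0)" by (simp only:)
     also have "\<dots> = (if (i = 0 \<or> i \<notin> S) \<and> (t, i) \<notin> J then sg (t, i) J * f (insert (t, i) J, ie i S) else 0)"
      using f fU by (auto simp: supp_on_def)
     finally show ?thesis by (simp add: an_def)
    qed
    then have "vi n t f (J, S) = 0" unfolding vi_def prod.case using z2 by simp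
    then show ?thesis by (simp add: y)
   qed
  qed
  ultimately show "f \<in> E1 s n" by (simp add: E1_def supp_on_def)
 qed
 then have 4: "fs.dim {f\<in>supp_on ?U. \<forall>v\<in>V. (\<Sum>x\<in>?U. v x * f x) = 0} \<le> fs.dim (E1 s n :: 'a pch set)"
  by (rule dim_mono[rotated]) (rule findim_mono[OF findim_supp_on[OF fU]], auto simp: E1_def supp_on_def)
 let ?Y = "{I\<in>XS s n (kd 0). \<forall>t<s. (t, 0) \<notin> I} \<times> SS n"
 have fU0: "finite ?Y" by simp
 have "card ?Y = fs.dim {h\<in>supp_on ?Y. ?W h = 0} + fs.dim (?W ` supp_on ?Y)"
  using rank_nullity[OF lin_Wop subspace_supp_on[of ?Y] findim_supp_on[OF fU0], of n s] fU0 by simp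
 moreover have "{h\<in>supp_on ?Y. ?W h = 0} \<subseteq> {0}"
 proof
  fix h assume h: "h \<in> {h\<in>supp_on ?Y. ?W h = 0}"
  have "h = 0"
  proof (rule Wop_inj[of h s n s])
   show "h \<in> supp_on ?U" using h by (auto simp: supp_on_def)
   show "h (I, S) = 0" if "t < s" "(t, 0) \<in> I" for t I S using h that by (auto simp: supp_on_def)
  qed (use h n in auto)
  then show "h \<in> {0}" by simp
 qed
 then have "fs.dim {h\<in>supp_on ?Y. ?W h = 0} \<le> fs.dim ({0} :: 'a pch set)"
  by (rule dim_mono[rotated]) (auto simp: findim_def)
 moreover have "fs.dim ({0} :: 'a pch set) = 0" using fs.dim_le_card[of "{0 :: 'a pch}" "{}"] by simp
 moreover have "fs.dim (?W ` supp_on ?Y) \<le> fs.dim (?W ` supp_on ?U)"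
  by (rule dim_mono[OF findim_image[OF lin_Wop findim_supp_on[OF fU]]]) (auto simp: supp_on_def)
 moreover have "card ?Y = (\<Prod>t<s. (n - 1) choose Suc t) * 2 ^ (n - 1)"
  using card_rows_avoid[of s "\<lambda>_. 0" n "kd 0"] n by (simp add: card_cartesian_product card_Pow kd_def)
 ultimately show ?thesis using 1 2 3 4 unfolding mult.commute[of "2 ^ (n - 1) :: nat"] by linarith
qed

section \<open>The input defect as top homology of grid families\<close>

lemma joint_dim:
 assumes "finite L" "fs.subspace V" "findim (V :: ('b => 'a::field) set)"
  and "\<And>l. l \<in> L ==> lin (F l) \<and> F l ` V \<subseteq> C l \<and> findim (C l :: ('c => 'a) set)"
  and "\<And>v. v \<in> V ==> (\<And>l. l \<in> L ==> F l v = 0) ==> v = 0"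
 shows "fs.dim V \<le> (\<Sum>l\<in>L. fs.dim (C l))"
 using assms
proof (induction L arbitrary: V rule: finite_induct)
 case empty
 have "v = 0" if "v \<in> V" for v by (rule empty.prems(4)[OF that]) simp
 then have "V \<subseteq> {0}" by blast
 then have "fs.dim V \<le> fs.dim ({0} :: ('b => 'a) set)" by (rule dim_mono[rotated]) (auto simp: findim_def)
 then have "fs.dim V \<le> 0" using fs.dim_le_card[of "{0 :: 'b => 'a}" "{}"] by simp
 then show ?case unfolding sum.empty .
next
 case (insert l L)
 have V: "fs.subspace V" by (rule insert.prems(1))
 have V2: "findim V" by (rule insert.prems(2))
 have "lin (F l) \<and> F l ` V \<subseteq> C l \<and> findim (C l)" by (rule insert.prems(3)) simp
 then have l: "lin (F l)" "F l ` V \<subseteq> C l" "findim (C l)" by blast+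
 let ?V = "{v\<in>V. F l v = 0}"
 have sV: "fs.subspace ?V" using V by (auto simp: fs.subspace_def lin_simps[OF l(1)])
 have fV: "findim ?V" by (rule findim_mono[OF insert.prems(2)]) auto
 have "fs.dim ?V \<le> (\<Sum>l\<in>L. fs.dim (C l))"
 proof (rule insert.IH[OF sV fV])
  fix l' assume "l' \<in> L"
  have "lin (F l') \<and> F l' ` V \<subseteq> C l' \<and> findim (C l')"
   by (rule insert.prems(3)) (use \<open>l' \<in> L\<close> in simp)
  then show "lin (F l') \<and> F l' ` ?V \<subseteq> C l' \<and> findim (C l')" by blast
 next
  fix v assume v: "v \<in> ?V" "\<And>l. l \<in> L ==> F l v = 0"
  show "v = 0"
  proof (rule insert.prems(4))
   fix l' assume "l' \<in> insert l L"
   then show "F l' v = 0" using v by (cases "l' = l") auto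
  qed (use v in blast)
 qed
 moreover have "fs.dim (F l ` V) \<le> fs.dim (C l)" by (rule dim_mono[OF l(3,2)])
 ultimately have "fs.dim V \<le> fs.dim (C l) + (\<Sum>l\<in>L. fs.dim (C l))"
  using rank_nullity[OF l(1) V V2] by linarith
 then show ?case unfolding sum.insert[OF insert.hyps] .
qed

abbreviation (input) ps :: "nat => nat list" where "ps s \<equiv> map Suc [0..<s]"

text \<open>\<open>vi\<close> preserves a column grading: for j \<ge> 1 let l ! j be the number of
  cells in column j, plus 1 when j is not in S. Given l, the set S is therefore recovered from I as
  the set of full columns. Column 0 receives its count plus card S - 2, which makes the total N = P
  + s - 1 for n = s + 2.\<close>

definition Sl :: "nat => nat list => (nat \<times> nat) set => nat set" where
 "Sl n l I = {j\<in>{1..<n}. card (cw j I) = l ! j}"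

abbreviation (input) FQ :: "nat => nat => nat list => (nat \<times> nat) set set" where
 "FQ s n l \<equiv> DQ {1..<n} s n ((!) (ps s)) ((!) l)"

definition Zl :: "nat => nat => nat list => nat => 'a::field_char_0 pch => (nat \<times> nat) set => 'a" where
 "Zl s n l P h I = (if I \<in> gr (FQ s n l) P then h (I, Sl n l I) else 0)"

lemma DQ_D: "I \<in> DQ Q s n p w ==> I \<in> Dl s n p w" "I \<in> DQ Q s n p w ==> j \<in> Q ==> w j \<le> Suc (card (cw j I))"
 by (auto simp: DQ_def)

lemma sum_split0: "0 < n ==> (\<Sum>j<n. f j) = f 0 + (\<Sum>j\<in>{1..<n}. f (j::nat) :: nat)"
proof -
 assume "0 < n"
 then have "{..<n} = insert 0 {1..<n}" by auto
 then show ?thesis by simp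
qed

lemma col0_count:
 assumes J: "J \<in> FQ s n l" and l: "l \<in> WS n N" and n: "0 < n"
 shows "l ! 0 + card J + (n - 1) = N + card (cw 0 J) + card (Sl n l J)"
proof -
 have JC: "J \<subseteq> cells s n" by (rule DlD(1)[OF DQ_D(1)[OF J]])
 have lj: "l ! j = card (cw j J) + (if j \<in> Sl n l J then 0 else 1)" if "j \<in> {1..<n}" for j
  using DQ_D(2)[OF J that] DlD(3)[OF DQ_D(1)[OF J], of j] that by (auto simp: Sl_def)
 have "(\<Sum>j\<in>{1..<n}. l ! j) = (\<Sum>j\<in>{1..<n}. card (cw j J)) + (\<Sum>j\<in>{1..<n}. if j \<in> Sl n l J then 0 else 1)"
  unfolding sum.distrib[symmetric] by (rule sum.cong[OF refl lj])
 also have "(\<Sum>j\<in>{1..<n}. if j \<in> Sl n l J then 0 else 1) = card ({1..<n} - Sl n l J)"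
  by (simp add: sum.If_cases) (rule arg_cong[where f = card], auto)
 also have "\<dots> = (n - 1) - card (Sl n l J)" by (subst card_Diff_subset) (auto simp: Sl_def)
 finally have a: "(\<Sum>j\<in>{1..<n}. l ! j) = (\<Sum>j\<in>{1..<n}. card (cw j J)) + ((n - 1) - card (Sl n l J))" .
 have "card (Sl n l J) \<le> card {1..<n}" by (rule card_mono) (auto simp: Sl_def)
 then show ?thesis
  using a WS_D(2)[OF l] card_cols[OF JC] sum_split0[OF n, of "(!) l"] sum_split0[OF n, of "\<lambda>j. card (cw j J)"] by simp
qed

lemma one_deficit:
 assumes J: "J \<subseteq> cells s n" "\<And>t. t < s ==> card (rw t J) \<le> Suc t" "Suc (card J) = (\<Sum>t<s. Suc t)"
 obtains t where "t < s" "card (rw t J) = t" "\<And>u. u < s ==> u \<noteq> t ==> card (rw u J) = Suc u"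
proof -
 have "(\<Sum>t<s. Suc t - card (rw t J)) = (\<Sum>t<s. Suc t) - (\<Sum>t<s. card (rw t J))"
  by (rule sum_subtractf_nat) (use J(2) in simp)
 also have "\<dots> = 1" using card_rows[OF J(1)] J(3) by simp
 finally have "\<exists>a\<in>{..<s}. Suc a - card (rw a J) = 1 \<and> (\<forall>b\<in>{..<s}. a \<noteq> b --> Suc b - card (rw b J) = 0)"
  using sum_eq_1_iff[of "{..<s}" "\<lambda>t. Suc t - card (rw t J)"] by simp
 then obtain t where t: "t < s" "Suc t - card (rw t J) = 1" "\<And>u. u < s ==> u \<noteq> t ==> Suc u - card (rw u J) = 0" by auto
 show ?thesis
 proof (rule that[OF t(1)])
  show "card (rw t J) = t" using t(2) J(2)[OF t(1)] by simp
  show "card (rw u J) = Suc u" if "u < s" "u \<noteq> t" for u using t(3)[OF that] J(2)[OF that(1)] by simp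
 qed
qed

text \<open>In degree P all rows are full, so a set with one cell less has its deficit in exactly
  one row t, and the boundary there is the single equation \<open>vi n t h = 0\<close>. Thus the s
  equations defining \<open>E1\<close> become one cycle condition.\<close>

lemma Zl_cyc:
 fixes h :: "'a::field_char_0 pch"
 assumes h: "h \<in> E1 s n" and l: "l \<in> WS n N" and n: "n = s + 2" "1 \<le> s"
  and P: "P = (\<Sum>t<s. Suc t)" and N: "N = P + s - 1"
 shows "Zl s n l P h \<in> cyc (cells s n) (FQ s n l) P"
proof (rule cycI)
 show "Zl s n l P h \<in> supp_on (gr (FQ s n l) P)" by (simp add: supp_on_def Zl_def)
 fix J assume J: "J \<in> FQ s n l"
 note JD = DlD[OF DQ_D(1)[OF J]]
 have P1: "1 \<le> P" unfolding P using n(2) by (cases s) simp_all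
 show "bd (cells s n) (Zl s n l P h) J = 0"
 proof (cases "Suc (card J) = P")
  case False
  have fJ: "finite J" by (rule finite_subset[OF JD(1)]) simp
  show ?thesis
  proof (rule bd_eq_0)
   fix x assume "x \<in> cells s n - J"
   then have "card (insert x J) \<noteq> P" using False fJ by simp
   then show "Zl s n l P h (insert x J) = 0" by (simp add: Zl_def gr_def)
  qed simp
 next
  case True
  have rows: "card (rw t J) \<le> Suc t" if "t < s" for t using JD(2)[OF that] that by simp
  obtain t where t: "t < s" "card (rw t J) = t" "\<And>u. u < s ==> u \<noteq> t ==> card (rw u J) = Suc u"
   by (rule one_deficit[OF JD(1) rows]) (use True P in auto)
  have fJ: "finite J" by (rule finite_subset[OF JD(1)]) simp
  let ?S = "Sl n l J"
  \<comment> \<open>Hence column 0 has room for another cell exactly when card S \<ge> 2, which is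
    the support condition of \<open>E1\<close>.\<close>
  have cnt: "l ! 0 + 1 = card (cw 0 J) + card ?S" using col0_count[OF J l] n True N P1 by simp
  have off: "Zl s n l P h (insert (u, i) J) = 0" if "(u, i) \<in> cells s n - J" "u \<noteq> t" for u i
  proof (rule ccontr)
   assume "Zl s n l P h (insert (u, i) J) \<noteq> 0"
   then have K: "insert (u, i) J \<in> Dl s n ((!) (ps s)) ((!) l)" by (auto simp: Zl_def gr_def DQ_def split: if_splits)
   have "rw u (insert (u, i) J) = insert i (rw u J)" "i \<notin> rw u J" using that by (auto simp: rw_def)
   then have "card (rw u (insert (u, i) J)) = Suc (Suc u)" using t(3)[of u] that fin_rw(1)[OF JD(1), of u] by auto
   then show False using DlD(2)[OF K, of u] that by auto
  qed
  have trm: "(if (t, i) \<notin> J then sg (t, i) J * Zl s n l P h (insert (t, i) J) else 0)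
   = (if i = 0 \<or> i \<notin> ?S then an (t, i) (\<lambda>I. h (I, ie i ?S)) J else 0)" if i: "i < n" for i
  proof (cases "(t, i) \<in> J")
   case True then show ?thesis by (simp add: an_def)
  next
   case tJ: False
   let ?K = "insert (t, i) J"
   have KC: "?K \<subseteq> cells s n" using JD(1) t(1) i by auto
   have rK: "card (rw u ?K) = Suc u" if "u < s" for u
   proof (cases "u = t")
    case True
    have "rw t ?K = insert i (rw t J)" "i \<notin> rw t J" using tJ by (auto simp: rw_def)
    then show ?thesis using t(2) True fin_rw(1)[OF JD(1), of t] by simp
   next
    case False
    then have "rw u ?K = rw u J" by (auto simp: rw_def)
    then show ?thesis using t(3)[OF that False] by simp
   qed
   have cK: "card (cw j ?K) = (if j = i then Suc (card (cw i J)) else card (cw j J))" for j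
   proof (cases "j = i")
    case True
    have "cw i ?K = insert t (cw i J)" "t \<notin> cw i J" using tJ by (auto simp: cw_def)
    then show ?thesis using True fin_cw(1)[OF JD(1), of i] by simp
   next
    case False
    then have "cw j ?K = cw j J" by (auto simp: cw_def)
    then show ?thesis using False by simp
   qed
   have cardK: "card ?K = P" using tJ fJ \<open>Suc (card J) = P\<close> by simp
   have inK: "?K \<in> gr (FQ s n l) P \<longleftrightarrow> Suc (card (cw i J)) \<le> l ! i"
   proof
    assume "?K \<in> gr (FQ s n l) P"
    then have "?K \<in> Dl s n ((!) (ps s)) ((!) l)" by (simp add: gr_def DQ_def)
    from DlD(3)[OF this i] show "Suc (card (cw i J)) \<le> l ! i" using cK[of i] by simp
   next
    assume a: "Suc (card (cw i J)) \<le> l ! i"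
    have "card (cw j ?K) \<le> l ! j" if "j < n" for j using cK[of j] a JD(3)[OF that] by (cases "j = i") auto
    then have "?K \<in> Dl s n ((!) (ps s)) ((!) l)" using KC rK by (simp add: Dl_def)
    moreover have "l ! j \<le> Suc (card (cw j ?K))" if "j \<in> {1..<n}" for j
     using cK[of j] DQ_D(2)[OF J that] by (cases "j = i") auto
    ultimately show "?K \<in> gr (FQ s n l) P" using cardK by (simp add: gr_def DQ_def)
   qed
   show ?thesis
   proof (cases "i = 0")
    case True
    have SK: "Sl n l ?K = ?S" using cK True by (auto simp: Sl_def)
    show ?thesis
    proof (cases "Suc (card (cw 0 J)) \<le> l ! 0")
     case le: True
     then show ?thesis using inK True tJ SK by (simp add: Zl_def an_def ie_def)
    next
     case False
     then have "card ?S < 2" using cnt by linarith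
     then have "h (?K, ?S) = 0" using h by (auto simp: E1_def supp_on_def)
     moreover have "Zl s n l P h ?K = 0" using inK False True by (simp add: Zl_def)
     ultimately show ?thesis using True by (simp add: an_def ie_def)
    qed
   next
    case False
    then have iQ: "i \<in> {1..<n}" using i by simp
    have le: "card (cw i J) \<le> l ! i" "l ! i \<le> Suc (card (cw i J))" using JD(3)[OF i] DQ_D(2)[OF J iQ] by auto
    show ?thesis
    proof (cases "i \<in> ?S")
     case True
     then have "\<not> Suc (card (cw i J)) \<le> l ! i" by (simp add: Sl_def)
     then show ?thesis using inK True False by (simp add: Zl_def)
    next
     case iS: False
     then have e: "l ! i = Suc (card (cw i J))" using le iQ by (auto simp: Sl_def)
     have "Sl n l ?K = insert i ?S" using cK e iQ by (auto simp: Sl_def)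
     then show ?thesis using inK e iS False tJ by (simp add: Zl_def an_def ie_def)
    qed
   qed
  qed
  have "bd (cells s n) (Zl s n l P h) J = (\<Sum>u<s. \<Sum>i<n. if (u, i) \<notin> J then sg (u, i) J * Zl s n l P h (insert (u, i) J) else 0)"
   unfolding bd_def sum_apply sum.cartesian_product by (rule sum.cong[OF refl]) (auto simp: an_def)
  also have "\<dots> = (\<Sum>i<n. if (t, i) \<notin> J then sg (t, i) J * Zl s n l P h (insert (t, i) J) else 0)"
  proof -
   have "(\<Sum>u\<in>{..<s} - {t}. \<Sum>i<n. if (u, i) \<notin> J then sg (u, i) J * Zl s n l P h (insert (u, i) J) else 0) = 0"
    by (intro sum.neutral ballI) (use off in auto)
   then show ?thesis using t(1) by (simp add: sum.remove[of "{..<s}" t])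
  qed
  also have "\<dots> = vi n t h (J, ?S)" unfolding vi_def prod.case using trm by (intro sum.cong) auto
  also have "\<dots> = 0" using h t(1) by (simp add: E1_def)
  finally show ?thesis .
 qed
qed

text \<open>The graded pieces \<open>Zl\<close> jointly determine h. They are cycles in the top
  degree P, where there are no boundaries, so dimensions of cycle spaces are homology
  numbers.\<close>

lemma dim_E1:
 assumes n: "n = s + 2" "1 \<le> s" and P: "P = (\<Sum>t<s. Suc t)" and N: "N = P + s - 1"
 shows "fs.dim (E1 s n :: 'a::field_char_0 pch set) \<le> HQ TYPE('a) {1..<n} n (ps s) N P"
proof -
 let ?C = "\<lambda>l. cyc (cells s n) (FQ s n l) P :: ((nat \<times> nat) set => 'a) set"
 have sE: "fs.subspace (E1 s n :: 'a pch set)"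
  by (auto simp: E1_def fs.subspace_def supp_on_def lin_simps[OF lin_vi])
 have fE: "findim (E1 s n :: 'a pch set)"
  by (rule findim_mono[OF findim_supp_on[of "UU s n"]]) (auto simp: E1_def supp_on_def)
 have "fs.dim (E1 s n :: 'a pch set) \<le> (\<Sum>l\<in>WS n N. fs.dim (?C l))"
 proof (rule joint_dim[where F = "\<lambda>l. Zl s n l P", OF finite_WS sE fE])
  fix l assume l: "l \<in> WS n N"
  show "lin (Zl s n l P :: 'a pch => _) \<and> Zl s n l P ` E1 s n \<subseteq> ?C l \<and> findim (?C l)"
  proof (intro conjI image_subsetI)
   show "lin (Zl s n l P :: 'a pch => _)" by (rule linI) (auto simp: Zl_def fun_eq_iff)
   show "Zl s n l P h \<in> ?C l" if "h \<in> E1 s n" for h by (rule Zl_cyc[OF that l n P N])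
   show "findim (?C l)" by (rule findim_cyc[OF family_DQ])
  qed
 next
  fix h :: "'a pch" assume h: "h \<in> E1 s n" and z: "\<And>l. l \<in> WS n N ==> Zl s n l P h = 0"
  have "h (I, S) = 0" for I S
  proof (rule ccontr)
   assume n0: "h (I, S) \<noteq> 0"
   then have I: "I \<in> XS s n (kd 0)" "S \<subseteq> {1..<n}" "2 \<le> card S" using h by (auto simp: E1_def supp_on_def)
   have IC: "I \<subseteq> cells s n" and Ir: "card (rw t I) = Suc t" if "t < s" for t using I(1) that by (auto simp: XS_def kd_def)
   have IC: "I \<subseteq> cells s n" using I(1) by (auto simp: XS_def)
   have cI: "card I = P" unfolding card_rows[OF IC] P using Ir by simp
   \<comment> \<open>The grading to which (I, S) belongs. As card S \<ge> 2, the entry at 0 is not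
     truncated and is at least the number of cells of I in column 0.\<close>
   define f where "f j = (if j = 0 then card (cw 0 I) + card S - 2 else card (cw j I) + (if j \<in> S then 0 else 1))" for j
   let ?l = "map f [0..<n]"
   have lj: "?l ! j = f j" if "j < n" for j using that by simp
   have cS: "card S \<le> n - 1" using card_mono[OF _ I(2)] by simp
   have "(\<Sum>j\<in>{1..<n}. f j) = (\<Sum>j\<in>{1..<n}. card (cw j I) + (if j \<in> S then 0 else 1))"
    by (intro sum.cong) (auto simp: f_def)
   also have "\<dots> = (\<Sum>j\<in>{1..<n}. card (cw j I)) + card ({1..<n} - S)"
    unfolding sum.distrib by (simp add: sum.If_cases) (rule arg_cong[where f = card], auto)
   also have "card ({1..<n} - S) = n - 1 - card S" using I(2) by (simp add: card_Diff_subset finite_subset)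
   finally have s1: "(\<Sum>j\<in>{1..<n}. f j) = (\<Sum>j\<in>{1..<n}. card (cw j I)) + (n - 1 - card S)" .
   have "(\<Sum>j<n. ?l ! j) = (\<Sum>j<n. f j)" by (intro sum.cong refl) (simp add: lj)
   also have "\<dots> = f 0 + (\<Sum>j\<in>{1..<n}. f j)" by (rule sum_split0) (use n in simp)
   also have "\<dots> = N"
    unfolding s1 using cI card_cols[OF IC] sum_split0[of n "\<lambda>j. card (cw j I)"] n N cS I(3) by (simp add: f_def)
   finally have l: "?l \<in> WS n N" by (intro WS_I) simp_all
   have Sl: "Sl n ?l I = S" using I(2) by (auto simp: Sl_def f_def split: if_splits)
   have "card (cw j I) \<le> ?l ! j" if "j < n" for j using that I(3) by (auto simp: f_def)
   then have "I \<in> Dl s n ((!) (ps s)) ((!) ?l)" using IC Ir by (simp add: Dl_def)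
   moreover have "?l ! j \<le> Suc (card (cw j I))" if "j \<in> {1..<n}" for j using that by (simp add: f_def)
   ultimately have "I \<in> gr (FQ s n ?l) P" using cI by (simp add: gr_def DQ_def)
   then have "Zl s n ?l P h I = h (I, S)" by (simp add: Zl_def Sl)
   then show False using z[OF l] n0 by simp
  qed
  then show "h = 0" by (simp add: fun_eq_iff)
 qed
 also have "\<dots> = HQ TYPE('a) {1..<n} n (ps s) N P"
  unfolding HQ_def
 proof (rule sum.cong[OF refl])
  fix l
  have "gr (FQ s n l) (Suc P) = {}"
  proof -
   have "card I \<le> P" if "I \<in> FQ s n l" for I
    unfolding card_rows[OF DlD(1)[OF DQ_D(1)[OF that]]] P
    using DlD(2)[OF DQ_D(1)[OF that]] by (intro sum_mono) simp
   then show ?thesis by (force simp: gr_def)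
  qed
  then have "bnd (cells s n) (FQ s n l) P \<subseteq> ({0} :: ((nat \<times> nat) set => 'a) set)"
   by (auto simp: bnd_def supp_on_def lin_simps[OF lin_rbd] fun_eq_iff[symmetric])
    (metis (no_types, lifting) ext lin_rbd lin_simps(4) zero_fun_def)
  then have "fs.dim (bnd (cells s n) (FQ s n l) P :: ((nat \<times> nat) set => 'a) set) \<le> fs.dim ({0} :: ((nat \<times> nat) set => 'a) set)"
   by (rule dim_mono[rotated]) (auto simp: findim_def)
  then have "fs.dim (bnd (cells s n) (FQ s n l) P :: ((nat \<times> nat) set => 'a) set) = 0"
   using fs.dim_le_card[of "{0 :: (nat \<times> nat) set => 'a}" "{}"] by simp
  then show "fs.dim (?C l) = hh TYPE('a) (cells (length (ps s)) n) (DQ {1..<n} (length (ps s)) n ((!) (ps s)) ((!) l)) P"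
   by (simp add: hh_def)
 qed
 finally show ?thesis .
qed

section \<open>The flattening and the polynomial condition on its rank\<close>

lemma polynomial_sum: "(\<And>x. x \<in> X ==> polynomial_fun (f x)) ==> polynomial_fun (\<lambda>T. \<Sum>x\<in>X. f x T)"
 by (induction X rule: infinite_finite_induct) (simp_all add: polynomial_fun.const polynomial_fun.add)

lemma polynomial_prod: "(\<And>x. x \<in> X ==> polynomial_fun (f x)) ==> polynomial_fun (\<lambda>T. \<Prod>x\<in>X. f x T)"
 by (induction X rule: infinite_finite_induct) (simp_all add: polynomial_fun.const polynomial_fun.mult)

text \<open>The polynomial is a minor. Fix preimages a of a basis of the image at T and a linear map
  g that reads coordinates in this basis. The matrix of coordinates of \<Phi> S (a j) is the
  identity at S = T, and it is singular as soon as the image at S has dimension below the size of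
  the basis.\<close>

lemma rank_polynomial:
 fixes \<Phi> :: "'a tensor => ('x => 'a::field) => 'y => 'a"
 assumes l: "\<And>T. lin (\<Phi> T)" and Y: "\<And>T g. g \<in> supp_on X ==> \<Phi> T g \<in> supp_on Y"
  and p: "\<And>g y. polynomial_fun (\<lambda>T. \<Phi> T g y)" and fin: "finite X" "finite Y"
  and c: "c < fs.dim (\<Phi> T ` supp_on X)"
 obtains f where "polynomial_fun f" "f T \<noteq> 0" "\<And>S. fs.dim (\<Phi> S ` supp_on X) \<le> c ==> f S = 0"
proof -
 have fI: "findim (\<Phi> S ` supp_on X)" for S by (rule findim_image[OF l findim_supp_on[OF fin(1)]])
 obtain B where B: "B \<subseteq> \<Phi> T ` supp_on X" "fs.independent B" "card B = fs.dim (\<Phi> T ` supp_on X)"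
  using fs.basis_exists by metis
 have fB: "finite B" by (rule findim_indep[OF fI B(1,2)])
 define R where "R = card B"
 obtain e where e: "bij_betw e {..<R} B"
  using ex_bij_betw_nat_finite[OF fB] by (auto simp: R_def atLeast0LessThan)
 have eB: "e i \<in> B" if "i < R" for i using e that by (auto simp: bij_betw_def)
 have "\<exists>a. a \<in> supp_on X \<and> \<Phi> T a = e i" if "i < R" for i using eB[OF that] B(1) by fastforce
 then obtain a where a: "\<And>i. i < R ==> a i \<in> supp_on X \<and> \<Phi> T (a i) = e i" by metis
 have "\<exists>g :: ('y => 'a) => ('y => 'a) => 'a. lin g \<and> (\<forall>x\<in>B. g x = (\<lambda>z. if z = x then 1 else 0))"
  by (rule fsp.linear_independent_extend[OF B(2)])
 then obtain g :: "('y => 'a) => ('y => 'a) => 'a" where g: "lin g" "\<And>x. x \<in> B ==> g x = (\<lambda>z. if z = x then 1 else 0)" by blast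
 define \<delta> where "\<delta> y = (\<lambda>z. if z = y then 1 else 0 :: 'a)" for y :: 'y
 have gY: "(\<Sum>y\<in>Y. v y * g (\<delta> y) z) = g v z" if v: "v \<in> supp_on Y" for v z
 proof -
  have "v = (\<Sum>y\<in>Y. fscale (v y) (\<delta> y))"
  proof
   fix x
   have "(\<Sum>y\<in>Y. fscale (v y) (\<delta> y)) x = (\<Sum>y\<in>Y. if y = x then v y else 0)"
    by (simp add: sum_apply \<delta>_def) (intro sum.cong, auto)
   then show "v x = (\<Sum>y\<in>Y. fscale (v y) (\<delta> y)) x" using v fin(2) by (auto simp: supp_on_def)
  qed
  then have "g v = g (\<Sum>y\<in>Y. fscale (v y) (\<delta> y))" by simp
  then show ?thesis by (simp add: fsp.linear_sum[OF g(1)] lin_simps[OF g(1)] sum_apply)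
 qed
 define M where "M S = mat R R (\<lambda>(i, j). \<Sum>y\<in>Y. \<Phi> S (a j) y * g (\<delta> y) (e i))" for S
 have MC: "M S \<in> carrier_mat R R" for S by (simp add: M_def)
 have Me: "M S $$ (i, j) = g (\<Phi> S (a j)) (e i)" if "i < R" "j < R" for S i j
  using that gY[OF Y] a by (simp add: M_def)
 show ?thesis
 proof (rule that[of "\<lambda>S. det (M S)"])
  have "polynomial_fun (\<lambda>S. \<Sum>p | p permutes {0..<R}. signof p * (\<Prod>i = 0..<R. M S $$ (i, p i)))"
  proof (intro polynomial_sum polynomial_fun.mult polynomial_fun.const polynomial_prod)
   fix p' i assume "p' \<in> {p. p permutes {0..<R}}" "i \<in> {0..<R}"
   then have "i < R" "p' i < R" using permutes_in_image[of p' "{0..<R}" i] by auto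
   then have "(\<lambda>S. M S $$ (i, p' i)) = (\<lambda>S. \<Sum>y\<in>Y. \<Phi> S (a (p' i)) y * g (\<delta> y) (e i))" by (simp add: M_def)
   then show "polynomial_fun (\<lambda>S. M S $$ (i, p' i))"
    by (simp only:) (intro polynomial_sum polynomial_fun.mult polynomial_fun.const p)
  qed
  then show "polynomial_fun (\<lambda>S. det (M S))" by (simp only: det_def'[OF MC])
  have "M T = 1\<^sub>m R"
  proof (rule eq_matI)
   fix i j assume "i < dim_row (1\<^sub>m R)" "j < dim_col (1\<^sub>m R)"
   then have ij: "i < R" "j < R" by auto
   have "e i = e j \<longleftrightarrow> i = j" using e ij by (auto simp: bij_betw_def inj_on_def)
   then show "M T $$ (i, j) = 1\<^sub>m R $$ (i, j)" using ij a[OF ij(2)] g(2)[OF eB[OF ij(2)]] Me[OF ij, of T] by simp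
  qed (simp_all add: M_def)
  then show "det (M T) \<noteq> 0" by simp
  fix S assume S: "fs.dim (\<Phi> S ` supp_on X) \<le> c"
  let ?F = "\<lambda>k :: nat => 'a. \<Sum>j<R. fscale (k j) (\<Phi> S (a j))"
  have lF: "lin ?F"
   by (rule linI) (simp_all add: fs.scale_left_distrib sum.distrib fs.scale_sum_right fscale_def fun_eq_iff sum_apply sum_distrib_left algebra_simps)
  have sI: "fs.subspace (\<Phi> S ` supp_on X)" by (rule fsp.linear_subspace_image[OF l]) simp
  have "?F ` supp_on {..<R} \<subseteq> \<Phi> S ` supp_on X"
   using a by (auto intro!: fs.subspace_sum[OF sI] fs.subspace_scale[OF sI])
  then have "fs.dim (?F ` supp_on {..<R}) \<le> c" using dim_mono[OF fI] S le_trans by blast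
  then have kd: "fs.dim {k\<in>supp_on {..<R}. ?F k = 0} \<noteq> 0"
   using rank_nullity[OF lF subspace_supp_on[of "{..<R}"] findim_supp_on[of "{..<R}"]] c B(3) by (simp add: R_def)
  have "\<exists>k\<in>supp_on {..<R}. ?F k = 0 \<and> k \<noteq> 0"
  proof (rule ccontr)
   assume "\<not> ?thesis"
   then have "{k\<in>supp_on {..<R}. ?F k = 0} \<subseteq> {0}" by blast
   then have "fs.dim {k\<in>supp_on {..<R}. ?F k = 0} \<le> fs.dim ({0} :: (nat => 'a) set)"
    by (rule dim_mono[rotated]) (auto simp: findim_def)
   then show False using kd fs.dim_le_card[of "{0 :: nat => 'a}" "{}"] by simp
  qed
  then obtain k where k: "k \<in> supp_on {..<R}" "?F k = 0" "k \<noteq> 0" by blast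
  have "vec R k \<noteq> 0\<^sub>v R"
  proof
   assume "vec R k = 0\<^sub>v R"
   then have "k j = 0" if "j < R" for j using that by (metis index_vec index_zero_vec(1))
   then show False using k(1,3) by (auto simp: supp_on_def fun_eq_iff)
  qed
  moreover have "M S *\<^sub>v vec R k = 0\<^sub>v R"
  proof (rule eq_vecI)
   fix i assume "i < dim_vec (0\<^sub>v R)"
   then have i: "i < R" by simp
   have "(M S *\<^sub>v vec R k) $ i = (\<Sum>j<R. M S $$ (i, j) * k j)"
    using i MC[of S] by (simp add: scalar_prod_def atLeast0LessThan M_def)
   also have "\<dots> = (\<Sum>j<R. k j * g (\<Phi> S (a j)) (e i))" using Me[OF i] by (intro sum.cong) auto
   also have "\<dots> = g (?F k) (e i)" by (simp add: fsp.linear_sum[OF g(1)] lin_simps[OF g(1)] sum_apply)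
   also have "\<dots> = 0" using k(2) by (simp add: lin_simps[OF g(1)])
   finally show "(M S *\<^sub>v vec R k) $ i = 0\<^sub>v R $ i" using i by simp
  qed (simp add: M_def)
  ultimately show "det (M S) = 0" unfolding det_0_iff_vec_prod_zero[OF MC] by (intro exI[of _ "vec R k"]) simp
 qed
qed

primrec CR :: "nat => (nat => nat) => ((nat \<times> nat) set => 'a::field_char_0) => (nat \<times> nat) set => 'a" where
 "CR 0 i f = f"
| "CR (Suc t) i f = cr (t, i t) (CR t i f)"

lemma lin_CR: "lin (CR d i)"
proof (rule linI)
 fix f g :: "(nat \<times> nat) set => 'a" and c
 show "CR d i (f + g) = CR d i f + CR d i g" by (induction d) (simp_all only: CR.simps lin_simps[OF lin_cr])
 show "CR d i (fscale c f) = fscale c (CR d i f)" by (induction d) (simp_all only: CR.simps lin_simps[OF lin_cr])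
qed

lemma CR_cong: "(\<And>t. t < d ==> i t = i' t) ==> CR d i f = CR d i' f"
 by (induction d) simp_all

lemma CR_supp: "f \<in> supp_on (Pow (cells s n)) ==> d \<le> s ==> (\<And>t. t < d ==> i t < n) ==> CR d i f \<in> supp_on (Pow (cells s n))"
proof (induction d)
 case (Suc d)
 then have c: "CR d i f \<in> supp_on (Pow (cells s n))" and m: "(d, i d) \<in> cells s n" by auto
 have "CR d i f (I - {(d, i d)}) = 0" if "\<not> I \<subseteq> cells s n" for I
 proof -
  have "\<not> I - {(d, i d)} \<subseteq> cells s n" using that m by blast
  then show ?thesis by (intro supp_onD[OF c]) simp
 qed
 then show ?case unfolding CR.simps by (simp add: supp_on_def cr_def)
qed simp

text \<open>Tensor slots 0,...,s-1 multiply exterior generators into the rows, slot s is the output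
  index j, and slot s + 1 is contracted with the second index of g.\<close>

definition Fl :: "nat => 'a::field_char_0 tensor => ((nat \<times> nat) set \<times> nat => 'a) => (nat \<times> nat) set \<times> nat => 'a" where
 "Fl s T g = (\<lambda>(J, j). \<Sum>i\<in>multi_index (s + 2) (\<lambda>_. s + 2).
  if i s = j then T i * CR s i (\<lambda>I. g (I, i (Suc s))) J else 0)"

lemma CR_lincomb: "CR d i (\<lambda>I. f I + g I) J = CR d i f J + CR d i g J" "CR d i (\<lambda>I. c * f I) J = c * CR d i f J"
 using fun_cong[OF lin_simps(1)[OF lin_CR, of d i f g], of J] fun_cong[OF lin_simps(2)[OF lin_CR, of d i c f], of J]
 by (simp_all add: plus_fun_def fscale_def)

lemma lin_Fl: "lin (Fl s T)"
proof (rule linI)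
 fix f g :: "(nat \<times> nat) set \<times> nat => 'a" and c
 show "Fl s T (f + g) = Fl s T f + Fl s T g"
  by (rule ext) (auto simp: Fl_def CR_lincomb sum.distrib[symmetric] algebra_simps intro!: sum.cong split: prod.splits)
 show "Fl s T (fscale c f) = fscale c (Fl s T f)"
  by (rule ext) (auto simp: Fl_def CR_lincomb sum_distrib_left algebra_simps intro!: sum.cong split: prod.splits)
qed

lemma Fl_sum: "Fl s (\<lambda>i. \<Sum>l<k. T l i) g = (\<Sum>l<(k::nat). Fl s (T l) g)"
proof (induction k)
 case 0 show ?case by (auto simp: Fl_def fun_eq_iff intro!: sum.neutral)
next
 case (Suc k)
 have "Fl s (\<lambda>i. A i + B i) g = Fl s A g + Fl s B g" for A B
  by (rule ext) (auto simp: Fl_def sum.distrib[symmetric] algebra_simps intro!: sum.cong split: prod.splits)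
 then show ?case using Suc by simp
qed

lemma polynomial_Fl: "polynomial_fun (\<lambda>T. Fl s T g y)"
proof -
 obtain J j where y: "y = (J, j)" by (cases y)
 have "polynomial_fun (\<lambda>T. if i s = j then T i * CR s i (\<lambda>I. g (I, i (Suc s))) J else 0)" for i
  by (cases "i s = j") (simp_all add: polynomial_fun.const polynomial_fun.mult polynomial_fun.coord)
 then show ?thesis unfolding y Fl_def prod.case by (intro polynomial_sum)
qed

abbreviation (input) DX :: "nat => ((nat \<times> nat) set \<times> nat) set" where "DX s \<equiv> XS s (s + 2) (kd 0) \<times> {..<s + 2}"

lemma Fl_supp:
 assumes "g \<in> supp_on (DX s)"
 shows "Fl s T g \<in> supp_on (Pow (cells s (s + 2)) \<times> {..<s + 2})"
proof -
 have "Fl s T g (J, j) = 0" if n: "(J, j) \<notin> Pow (cells s (s + 2)) \<times> {..<s + 2}" for J j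
  unfolding Fl_def prod.case
 proof (intro sum.neutral ballI)
  fix i assume i: "i \<in> multi_index (s + 2) (\<lambda>_. s + 2)"
  then have it: "i t < s + 2" if "t < s + 2" for t using that by (auto simp: multi_index_def PiE_def Pi_def)
  have "(\<lambda>I. g (I, i (Suc s))) \<in> supp_on (Pow (cells s (s + 2)))" using assms by (auto simp: supp_on_def XS_def)
  then have "CR s i (\<lambda>I. g (I, i (Suc s))) \<in> supp_on (Pow (cells s (s + 2)))" by (rule CR_supp) (use it in auto)
  then show "(if i s = j then T i * CR s i (\<lambda>I. g (I, i (Suc s))) J else 0) = 0"
   using n it[of s] by (auto simp: supp_on_def)
 qed
 then show ?thesis by (auto simp: supp_on_def)
qed

lemma sum_PiE_Suc:
 fixes F :: "(nat => nat) => 'a::comm_monoid_add"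
 shows "(\<Sum>i\<in>PiE {..<Suc d} (\<lambda>_. A). F i) = (\<Sum>a\<in>A. \<Sum>i\<in>PiE {..<d} (\<lambda>_. A). F (i(d := a)))"
proof -
 have "PiE {..<Suc d} (\<lambda>_. A) = (\<lambda>(y, g). g(d := y)) ` (A \<times> PiE {..<d} (\<lambda>_. A))"
  unfolding lessThan_Suc by (rule PiE_insert_eq)
 moreover have "inj_on (\<lambda>(y, g). g(d := y)) (A \<times> PiE {..<d} (\<lambda>_. A))" by (rule inj_combinator) simp
 ultimately show ?thesis by (simp add: sum.reindex sum.cartesian_product case_prod_unfold)
qed

lemma sum_PiE_Suc_Suc:
 fixes n :: nat
 shows "(\<Sum>i\<in>PiE {..<s + 2} (\<lambda>_. {..<n}). f i)
  = (\<Sum>k<n. \<Sum>j<n. \<Sum>i\<in>PiE {..<s} (\<lambda>_. {..<n}). f (i(s := j, Suc s := k)))"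
 unfolding add_2_eq_Suc' sum_PiE_Suc ..

lemma Fl_eq:
 "Fl s T g (J, j) = (if j < s + 2 then \<Sum>k<s + 2. \<Sum>i\<in>PiE {..<s} (\<lambda>_. {..<s + 2}).
  T (i(s := j, Suc s := k)) * CR s i (\<lambda>I. g (I, k)) J else 0)"
proof -
 have "Fl s T g (J, j) = (\<Sum>k<s + 2. \<Sum>j'<s + 2. \<Sum>i\<in>PiE {..<s} (\<lambda>_. {..<s + 2}).
  if j' = j then T (i(s := j', Suc s := k)) * CR s (i(s := j', Suc s := k)) (\<lambda>I. g (I, k)) J else 0)"
 proof -
  have u: "(i(s := j', Suc s := k)) s = j'" "(i(s := j', Suc s := k)) (Suc s) = k" for i :: "nat => nat" and j' k
   by simp_all
  show ?thesis unfolding Fl_def prod.case multi_index_def sum_PiE_Suc_Suc u ..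
 qed
 also have "\<dots> = (\<Sum>k<s + 2. \<Sum>j'<s + 2. if j' = j then \<Sum>i\<in>PiE {..<s} (\<lambda>_. {..<s + 2}).
  T (i(s := j', Suc s := k)) * CR s i (\<lambda>I. g (I, k)) J else 0)"
 proof (intro sum.cong refl)
  fix k j'
  have e: "CR s (i(s := j', Suc s := k)) f = CR s i f" for i f by (rule CR_cong) simp
  show "(\<Sum>i\<in>PiE {..<s} (\<lambda>_. {..<s + 2}).
   if j' = j then T (i(s := j', Suc s := k)) * CR s (i(s := j', Suc s := k)) (\<lambda>I. g (I, k)) J else 0)
   = (if j' = j then \<Sum>i\<in>PiE {..<s} (\<lambda>_. {..<s + 2}). T (i(s := j', Suc s := k)) * CR s i (\<lambda>I. g (I, k)) J else 0)"
   unfolding e by (cases "j' = j") simp_all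
 qed
 finally show ?thesis by simp
qed

definition wg :: "nat => (nat => nat => 'a::field_char_0) => nat => ((nat \<times> nat) set => 'a) => (nat \<times> nat) set => 'a" where
 "wg n a t f = (\<Sum>i<n. fscale (a t i) (cr (t, i) f))"

primrec Ww :: "nat => (nat => nat => 'a::field_char_0) => nat => ((nat \<times> nat) set => 'a) => (nat \<times> nat) set => 'a" where
 "Ww n a 0 f = f"
| "Ww n a (Suc t) f = wg n a t (Ww n a t f)"

lemma lin_wg: "lin (wg n a t)"
 unfolding wg_def by (rule lin_sum) (rule linI, simp_all add: lin_simps[OF lin_cr] fs.scale_right_distrib mult.commute)

lemma lin_Ww: "lin (Ww n a d)"
proof (rule linI)
 fix f g :: "(nat \<times> nat) set => 'a" and c
 show "Ww n a d (f + g) = Ww n a d f + Ww n a d g" by (induction d) (simp_all only: Ww.simps lin_simps[OF lin_wg])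
 show "Ww n a d (fscale c f) = fscale c (Ww n a d f)" by (induction d) (simp_all only: Ww.simps lin_simps[OF lin_wg])
qed

lemma Ww_expand: "Ww n a d f = (\<Sum>i\<in>PiE {..<d} (\<lambda>_. {..<n}). fscale (\<Prod>t<d. a t (i t)) (CR d i f))"
proof (induction d)
 case 0 show ?case by (simp add: fun_eq_iff)
next
 case (Suc d)
 have c: "CR d (i(d := k)) f = CR d i f" for i k by (rule CR_cong) simp
 have "(\<Prod>t<d. a t ((i(d := k)) t)) = (\<Prod>t<d. a t (i t))" for i k by (intro prod.cong) auto
 then have P: "(\<Prod>t<Suc d. a t ((i(d := k)) t)) = a d k * (\<Prod>t<d. a t (i t))" for i k
  by (simp add: mult.commute)
 have CS: "CR (Suc d) (i(d := k)) f = cr (d, k) (CR d i f)" for i k by (simp add: c)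
 show ?case unfolding sum_PiE_Suc P CS
  unfolding Ww.simps Suc wg_def fsp.linear_sum[OF lin_cr] lin_simps(2)[OF lin_cr] fs.scale_sum_right fs.scale_scale
  by (rule refl)
qed

lemma wg_anti: "wg n a t (wg n a u f) = - wg n a u (wg n a t f)"
proof -
 have e: "wg n a t (wg n a u f) = (\<Sum>i<n. \<Sum>k<n. fscale (a t i * a u k) (cr (t, i) (cr (u, k) f)))" for t u
  by (simp add: wg_def fsp.linear_sum[OF lin_cr] lin_simps[OF lin_cr] fs.scale_sum_right)
 have "wg n a t (wg n a u f) = (\<Sum>k<n. \<Sum>i<n. fscale (a t i * a u k) (cr (t, i) (cr (u, k) f)))"
  unfolding e by (rule sum.swap)
 also have "\<dots> = (\<Sum>k<n. \<Sum>i<n. - fscale (a u k * a t i) (cr (u, k) (cr (t, i) f)))"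
  by (intro sum.cong refl) (simp only: cr_cr[of "(t, _)"] fs.scale_minus_right mult.commute)
 also have "\<dots> = - wg n a u (wg n a t f)" unfolding e by (simp add: sum_negf)
 finally show ?thesis .
qed

lemma Ww_wg_0: "t < d ==> Ww n a d (wg n a t f) = 0"
proof -
 have c: "Ww n a d (wg n a t f) = fscale ((-1) ^ d) (wg n a t (Ww n a d f))" for d
 proof (induction d)
  case 0 show ?case by (simp add: fun_eq_iff)
 next
  case (Suc d)
  have "Ww n a (Suc d) (wg n a t f) = fscale ((-1) ^ d) (wg n a d (wg n a t (Ww n a d f)))"
   by (simp only: Ww.simps Suc lin_simps[OF lin_wg])
  then show ?case by (simp add: wg_anti[of n a d t] fun_eq_iff)
 qed
 have sq: "wg n a t (wg n a t g) = 0" for g by (rule neg_self_eq) (rule wg_anti)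
 show "t < d ==> Ww n a d (wg n a t f) = 0"
 proof (induction d)
  case (Suc d)
  show ?case
  proof (cases "t = d")
   case True
   show ?thesis unfolding Ww.simps c lin_simps(2)[OF lin_wg] True[symmetric] sq by (rule fs.scale_zero_right)
  next
   case False then show ?thesis using Suc by (simp only: Ww.simps less_Suc_eq simp_thms lin_simps[OF lin_wg])
  qed
 qed simp
qed

lemma an_wg:
 assumes "f \<in> fin_supp" "c < n"
 shows "an (t, c) (wg n a t f) = fscale (a t c) f - wg n a t (an (t, c) f)"
proof -
 have "an (t, c) (wg n a t f) = (\<Sum>i<n. (if i = c then fscale (a t i) f else 0) - fscale (a t i) (cr (t, i) (an (t, c) f)))"
  unfolding wg_def fsp.linear_sum[OF lin_an]
  by (intro sum.cong refl) (auto simp: lin_simps[OF lin_an] an_cr_if[OF assms(1)] fs.scale_right_diff_distrib)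
 then show ?thesis using assms(2) by (simp add: sum_subtractf wg_def)
qed

text \<open>If one of the vectors is zero, the operator is zero. Otherwise pick a nonzero coordinate
  c t of each. Modulo elements killed by \<open>Ww\<close>, every chain can be replaced by one
  avoiding the cells (t, c t), and there are (n - 1) choose (t + 1) such rows of size t + 1.\<close>

lemma rank_Ww:
 "fs.dim (Ww n a s ` supp_on (XS s n (kd 0)) :: ((nat \<times> nat) set => 'a::field_char_0) set) \<le> (\<Prod>t<s. (n - 1) choose Suc t)"
proof (cases "\<forall>t<s. \<exists>c<n. a t c \<noteq> 0")
 case False
 then obtain t where t: "t < s" "\<And>c. c < n ==> a t c = 0" by auto
 have w0: "wg n a t f = 0" for f using t(2) by (simp add: wg_def)
 have "Ww n a d f = 0" if "t < d" for d f
  using that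
 proof (induction d)
  case (Suc d)
  show ?case
  proof (cases "t = d")
   case True
   show ?thesis unfolding Ww.simps True[symmetric] by (rule w0)
  next
   case False
   then have "t < d" using Suc.prems by simp
   then have z: "Ww n a d f = 0" by (rule Suc.IH)
   show ?thesis unfolding Ww.simps z by (rule lin_simps(4)[OF lin_wg])
  qed
 qed simp
 then have "Ww n a s ` supp_on (XS s n (kd 0)) \<subseteq> {0}" using t(1) by auto
 then have "fs.dim (Ww n a s ` supp_on (XS s n (kd 0))) \<le> fs.dim ({0} :: ((nat \<times> nat) set => 'a) set)"
  by (rule dim_mono[rotated]) (auto simp: findim_def)
 then show ?thesis using fs.dim_le_card[of "{0 :: (nat \<times> nat) set => 'a}" "{}"] by simp
next
 case True
 then obtain c where c: "\<And>t. t < s ==> c t < n \<and> a t (c t) \<noteq> 0" by metis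
 have "finite I" if "I \<in> XS s n (kd 0)" for I
  using that finite_subset[of I "cells s n"] by (auto simp: XS_def)
 then have fsp: "f \<in> fin_supp" if "f \<in> supp_on (XS s n (kd 0))" for f :: "(nat \<times> nat) set => 'a"
  using that by (auto simp: supp_on_def fin_supp_def)
 have red: "\<exists>f'\<in>supp_on (XS s n (kd 0)). (\<forall>I. (\<exists>t<d. (t, c t) \<in> I) --> f' I = 0) \<and> Ww n a s f = Ww n a s f'"
  if f: "f \<in> supp_on (XS s n (kd 0))" and d: "d \<le> s" for f d
  using d
 proof (induction d)
  case 0 then show ?case using f by auto
 next
  case (Suc d)
  then obtain f' where f': "f' \<in> supp_on (XS s n (kd 0))" "\<And>I t. t < d ==> (t, c t) \<in> I ==> f' I = 0" "Ww n a s f = Ww n a s f'" by fastforce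
  have ds: "d < s" "c d < n" "a d (c d) \<noteq> 0" using Suc.prems c[of d] by auto
  \<comment> \<open>By \<open>an_wg\<close>, f' minus f2 is a multiple of \<open>wg n a d\<close> of
    something, hence killed by \<open>Ww n a s\<close>, while the contraction makes f2 avoid the
    cell (d, c d).\<close>
  define f2 where "f2 = fscale (1 / a d (c d)) (an (d, c d) (wg n a d f'))"
  have "f' = f2 + fscale (1 / a d (c d)) (wg n a d (an (d, c d) f'))"
   unfolding f2_def an_wg[OF fsp[OF f'(1)] ds(2)] using ds(3) by (auto simp: fun_eq_iff field_simps)
  then have "Ww n a s f' = Ww n a s f2"
   using Ww_wg_0[OF ds(1), of n a "an (d, c d) f'"] by (metis (no_types, lifting) add.right_neutral fs.scale_zero_right lin_simps(1,2)[OF lin_Ww])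
  have nz: "\<exists>i<n. (d, i) \<in> insert (d, c d) I \<and> (d, c d) \<notin> I \<and> f' (insert (d, c d) I - {(d, i)}) \<noteq> 0" if "f2 I \<noteq> 0" for I
  proof -
   have n1: "(d, c d) \<notin> I" "wg n a d f' (insert (d, c d) I) \<noteq> 0" using that by (auto simp: f2_def an_def split: if_splits)
   have "\<exists>i\<in>{..<n}. fscale (a d i) (cr (d, i) f') (insert (d, c d) I) \<noteq> 0"
   proof (rule ccontr)
    assume "\<not> ?thesis"
    then have "wg n a d f' (insert (d, c d) I) = 0" unfolding wg_def sum_apply by (intro sum.neutral) blast
    then show False using n1(2) by simp
   qed
   then obtain i where i: "i < n" "fscale (a d i) (cr (d, i) f') (insert (d, c d) I) \<noteq> 0" by blast
   then have "(d, i) \<in> insert (d, c d) I \<and> f' (insert (d, c d) I - {(d, i)}) \<noteq> 0"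
    by (simp add: cr_def split: if_splits)
   then show ?thesis using n1(1) i(1) by blast
  qed
  have "f2 \<in> supp_on (XS s n (kd 0))"
  proof -
   have "I \<in> XS s n (kd 0)" if n0: "f2 I \<noteq> 0" for I
   proof -
    obtain i where i: "(d, i) \<in> insert (d, c d) I" "(d, c d) \<notin> I" "f' (insert (d, c d) I - {(d, i)}) \<noteq> 0" "i < n" using nz[OF n0] by blast
    let ?H = "insert (d, c d) I - {(d, i)}"
    have H: "?H \<in> XS s n (kd 0)" using i(3) f'(1) by (auto simp: supp_on_def)
    show ?thesis
    proof (cases "i = c d")
     case True then show ?thesis using H i(2) by simp
    next
     case False
     then have dI: "(d, i) \<in> I" using i(1) by auto
     have "?H = insert (d, c d) (I - {(d, i)})" using False by auto
     then have IH: "insert (d, c d) (I - {(d, i)}) \<in> XS s n (kd 0)" using H by simp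
     have n1: "(d, c d) \<notin> I - {(d, i)}" "(d, i) \<notin> I - {(d, i)}" using i(2) by auto
     have "insert (d, i) (I - {(d, i)}) \<in> XS s n (kd 0)"
      using IH unfolding XS_insert[OF n1(1) ds(1,2)] XS_insert[OF n1(2) ds(1) i(4)] .
     then show ?thesis using dI by (simp add: insert_absorb)
    qed
   qed
   then show ?thesis by (auto simp: supp_on_def)
  qed
  moreover have "f2 I = 0" if "t < Suc d" "(t, c t) \<in> I" for I t
  proof (rule ccontr)
   assume "f2 I \<noteq> 0"
   then obtain i where i: "(d, c d) \<notin> I" "f' (insert (d, c d) I - {(d, i)}) \<noteq> 0" using nz by blast
   have td: "t < d" using that i(1) by (cases "t = d") auto
   have "(t, c t) \<in> insert (d, c d) I - {(d, i)}" using that(2) td by auto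
   from f'(2)[OF td this] i(2) show False by simp
  qed
  ultimately show ?case using f'(3) \<open>Ww n a s f' = Ww n a s f2\<close> by (intro bexI[of _ f2]) auto
 qed
 let ?X0 = "{I\<in>XS s n (kd 0). \<forall>t<s. (t, c t) \<notin> I}"
 have "Ww n a s ` supp_on (XS s n (kd 0)) \<subseteq> Ww n a s ` supp_on ?X0"
 proof (rule image_subsetI)
  fix f :: "(nat \<times> nat) set => 'a" assume "f \<in> supp_on (XS s n (kd 0))"
  from red[OF this order_refl] obtain f' where f': "f' \<in> supp_on (XS s n (kd 0))"
   "\<And>I t. t < s ==> (t, c t) \<in> I ==> f' I = 0" "Ww n a s f = Ww n a s f'" by fastforce
  then have "f' \<in> supp_on ?X0" by (auto simp: supp_on_def)
  then show "Ww n a s f \<in> Ww n a s ` supp_on ?X0" using f'(3) by blast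
 qed
 then have "fs.dim (Ww n a s ` supp_on (XS s n (kd 0))) \<le> fs.dim (Ww n a s ` supp_on ?X0)"
  by (rule dim_mono[OF findim_image[OF lin_Ww findim_supp_on], rotated]) simp
 also have "\<dots> \<le> card ?X0"
  using rank_nullity[OF lin_Ww subspace_supp_on[of ?X0] findim_supp_on[of ?X0], of n a s] by simp
 also have "\<dots> = (\<Prod>t<s. (n - 1) choose Suc t)"
  using card_rows_avoid[of s c n "kd 0"] c by (simp add: kd_def)
 finally show ?thesis .
qed

section \<open>Complementation between the two defects\<close>

definition co :: "nat => nat => (nat \<times> nat) set => (nat \<times> nat) set" where
 "co s n I = {x\<in>cells s n. (s - 1 - fst x, snd x) \<notin> I}"

lemma co_sub: "co s n I \<subseteq> cells s n" by (auto simp: co_def)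

lemma co_co: "I \<subseteq> cells s n ==> co s n (co s n I) = I"
 by (auto simp: co_def)

lemma rw_co: "t < s ==> rw t (co s n I) = {..<n} - rw (s - 1 - t) I"
 by (auto simp: co_def rw_def)

lemma card_rw_co: "t < s ==> I \<subseteq> cells s n ==> card (rw t (co s n I)) = n - card (rw (s - 1 - t) I)"
 unfolding rw_co by (subst card_Diff_subset) (auto simp: fin_rw)

lemma sg_row:
 assumes "finite J"
 shows "sg (t, i) J = (-1) ^ card {y\<in>J. fst y < t} * ((-1) ^ card {k\<in>rw t J. k < i} :: 'a::field_char_0)"
proof -
 have e: "{y\<in>J. y < (t, i)} = {y\<in>J. fst y < t} \<union> Pair t ` {k\<in>rw t J. k < i}"
  by (auto simp: less_prod_def rw_def image_iff)
 have f: "finite (rw t J)" using finite_vimageI[OF assms, of "Pair t"] by (simp add: rw_def vimage_def inj_def)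
 have "card {y\<in>J. y < (t, i)} = card {y\<in>J. fst y < t} + card (Pair t ` {k\<in>rw t J. k < i})"
  unfolding e by (rule card_Un_disjoint) (use assms f in auto)
 also have "card (Pair t ` {k\<in>rw t J. k < i}) = card {k\<in>rw t J. k < i}" by (rule card_image) (auto intro: inj_onI)
 finally show ?thesis using assms by (simp add: sg_def power_add)
qed

text \<open>Complements are taken both in the grid and in {1,...,n-1}, exchanging multiplication
  with contraction. Rows are reversed by t -> s - 1 - t because a row of size s - 1 - t + 2 has a
  complement of size t + 1 when n = s + 2. The column signs make the Koszul signs agree up to a
  factor \<open>G\<close> that is independent of the column.\<close>

definition Cm :: "nat => nat => 'a::field_char_0 pch => 'a pch" where
 "Cm s n h = (\<lambda>(I, S). if I \<subseteq> cells s n \<and> S \<subseteq> {1..<n} then (\<Prod>x\<in>I. (-1) ^ snd x) * h (co s n I, {1..<n} - S) else 0)"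

lemma Cm_E2:
 fixes h :: "'a::field_char_0 pch"
 assumes h: "h \<in> E2 s n" and n: "n = s + 2"
 shows "Cm s n h \<in> E1 s n"
proof -
 have "(I, S) \<in> XS s n (kd 0) \<times> {S\<in>SS n. 2 \<le> card S}" if n0: "Cm s n h (I, S) \<noteq> 0" for I S
 proof -
  have a: "I \<subseteq> cells s n" "S \<subseteq> {1..<n}" "h (co s n I, {1..<n} - S) \<noteq> 0" using n0 by (auto simp: Cm_def split: if_splits)
  then have b: "co s n I \<in> XS s n (kd s)" "card ({1..<n} - S) + 2 < n" using h by (auto simp: E2_def supp_on_def)
  have "card ({1..<n} - S) = n - 1 - card S" using a(2) by (simp add: card_Diff_subset finite_subset)
  moreover have "card S \<le> n - 1" using card_mono[OF _ a(2)] by simp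
  ultimately have "2 \<le> card S" using b(2) by linarith
  moreover have "card (rw t I) = kd 0 t" if t: "t < s" for t
  proof -
   have "card (rw t I) = card (rw t (co s n (co s n I)))" by (simp add: co_co[OF a(1)])
   also have "\<dots> = n - card (rw (s - 1 - t) (co s n I))" by (rule card_rw_co[OF t co_sub])
   also have "card (rw (s - 1 - t) (co s n I)) = s - 1 - t + 2" using b(1) t by (simp add: XS_def kd_def)
   finally show ?thesis using n t by (simp add: kd_def)
  qed
  ultimately show ?thesis using a by (simp add: XS_def)
 qed
 then have "Cm s n h \<in> supp_on (XS s n (kd 0) \<times> {S\<in>SS n. 2 \<le> card S})" by (auto simp: supp_on_def)
 moreover have "vi n t (Cm s n h) (J, S) = 0" if t: "t < s" for t J S
 proof (cases "J \<subseteq> cells s n \<and> S \<subseteq> {1..<n}")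
  case False
  have "an (t, i) (\<lambda>I. Cm s n h (I, ie i S)) J = 0" if "i < n" for i
   using False that by (auto simp: an_def Cm_def ie_def)
  then have "(\<Sum>i<n. if i = 0 \<or> i \<notin> S then an (t, i) (\<lambda>I. Cm s n h (I, ie i S)) J else 0) = 0"
   by (intro sum.neutral) simp
  then show ?thesis by (simp add: vi_def)
 next
  case True
  then have JC: "J \<subseteq> cells s n" and SC: "S \<subseteq> {1..<n}" by auto
  have fJ: "finite J" by (rule finite_subset[OF JC]) simp
  define t' where "t' = s - 1 - t"
  have t': "t' < s" "s - 1 - t' = t" using t by (auto simp: t'_def)
  let ?K = "co s n J" and ?S = "{1..<n} - S"
  have fK: "finite ?K" by (rule finite_subset[OF co_sub]) simp
  define G :: 'a where "G = (\<Prod>x\<in>J. (-1) ^ snd x) * ((-1) ^ card {y\<in>J. fst y < t} * (-1) ^ card {y\<in>?K. fst y < t'})"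
  have trm: "(if i = 0 \<or> i \<notin> S then an (t, i) (\<lambda>I. Cm s n h (I, ie i S)) J else 0)
   = G * (if i = 0 \<or> i \<in> ?S then cr (t', i) (\<lambda>I. h (I, de i ?S)) ?K else 0)" if i: "i < n" for i
  proof (cases "(i = 0 \<or> i \<notin> S) \<and> (t, i) \<notin> J")
   case False
   have "(t', i) \<in> ?K \<longleftrightarrow> (t, i) \<notin> J" using i t' by (simp add: co_def)
   then show ?thesis using False i by (auto simp: an_def cr_def)
  next
   case tr: True
   let ?I = "insert (t, i) J"
   have inK: "(t', i) \<in> ?K" using i t' tr by (simp add: co_def)
   have Kd: "?K - {(t', i)} = co s n ?I" using t' t by (auto simp: co_def)
   have IC: "?I \<subseteq> cells s n" using JC t i by auto
   have iS: "ie i S \<subseteq> {1..<n}" using SC i by (auto simp: ie_def)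
   have dS: "{1..<n} - ie i S = de i ?S" by (auto simp: ie_def de_def)
   have iS': "i = 0 \<or> i \<in> ?S" using tr i by auto
   have pr: "(\<Prod>x\<in>?I. (-1) ^ snd x) = (-1) ^ i * (\<Prod>x\<in>J. (-1) ^ snd x :: 'a)" using tr fJ by simp
   let ?a = "card {k\<in>rw t J. k < i}" and ?b = "card {k\<in>rw t' (?K - {(t', i)}). k < i}"
   have s1: "sg (t, i) J = (-1) ^ card {y\<in>J. fst y < t} * ((-1) ^ ?a :: 'a)" by (rule sg_row[OF fJ])
   have s2: "sg (t', i) (?K - {(t', i)}) = (-1) ^ card {y\<in>?K. fst y < t'} * ((-1) ^ ?b :: 'a)"
   proof -
    have "{y\<in>?K - {(t', i)}. fst y < t'} = {y\<in>?K. fst y < t'}" by auto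
    then show ?thesis using sg_row[of "?K - {(t', i)}" t' i, where 'a='a] fK by simp
   qed
   \<comment> \<open>The cells to the left of i in row t and in the complementary row partition the
     columns below i, so the factor (-1)^i turns one Koszul sign into the other.\<close>
   have ab: "?a + ?b = i"
   proof -
    have e: "rw t' (?K - {(t', i)}) = {..<n} - rw t J - {i}"
     using rw_co[OF t'(1), of n J] t'(2) by (auto simp: rw_def)
    have "{k\<in>rw t' (?K - {(t', i)}). k < i} = {..<i} - {k\<in>rw t J. k < i}" unfolding e using i by auto
    moreover have "card ({..<i} - {k\<in>rw t J. k < i}) = i - ?a" by (subst card_Diff_subset) auto
    moreover have "?a \<le> card {..<i}" by (rule card_mono) auto
    ultimately show ?thesis by simp
   qed
   have par: "(-1) ^ ?a * (-1) ^ i = ((-1) ^ ?b :: 'a)"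
   proof -
    have "(-1) ^ ?a * (-1) ^ i = (-1) ^ (?a + ?a) * ((-1) ^ ?b :: 'a)" by (subst ab[symmetric]) (simp add: power_add)
    then show ?thesis by (simp add: power_add flip: power_mult_distrib)
   qed
   have B2: "(-1) ^ card {y\<in>?K. fst y < t'} * (-1) ^ card {y\<in>?K. fst y < t'} = (1 :: 'a)" by (simp flip: power_mult_distrib)
   have A: "an (t, i) (\<lambda>I. Cm s n h (I, ie i S)) J = sg (t, i) J * ((-1) ^ i * (\<Prod>x\<in>J. (-1) ^ snd x) * h (co s n ?I, de i ?S))"
    using tr IC iS by (simp add: an_def Cm_def pr dS del: One_nat_def)
   have B: "cr (t', i) (\<lambda>I. h (I, de i ?S)) ?K = sg (t', i) (?K - {(t', i)}) * h (co s n ?I, de i ?S)"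
    using inK by (simp add: cr_def Kd)
   have D: "sg (t, i) J * ((-1) ^ i * (\<Prod>x\<in>J. (-1) ^ snd x)) = G * sg (t', i) (?K - {(t', i)})"
   proof -
    have "(sg (t, i) J * ((-1) ^ i * (\<Prod>x\<in>J. (-1) ^ snd x)) :: 'a)
     = (\<Prod>x\<in>J. (-1) ^ snd x) * ((-1) ^ card {y\<in>J. fst y < t} * ((-1) ^ ?a * (-1) ^ i))" unfolding s1 by (simp only: mult_ac)
    also have "\<dots> = (\<Prod>x\<in>J. (-1) ^ snd x) * ((-1) ^ card {y\<in>J. fst y < t} * (((-1) ^ card {y\<in>?K. fst y < t'} * (-1) ^ card {y\<in>?K. fst y < t'}) * (-1) ^ ?b))"
     unfolding par B2 by simp
    also have "\<dots> = G * sg (t', i) (?K - {(t', i)})" unfolding s2 G_def by (simp only: mult_ac)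
    finally show ?thesis .
   qed
   have "an (t, i) (\<lambda>I. Cm s n h (I, ie i S)) J
    = (sg (t, i) J * ((-1) ^ i * (\<Prod>x\<in>J. (-1) ^ snd x))) * h (co s n ?I, de i ?S)"
    unfolding A by (simp only: mult.assoc)
   also have "\<dots> = G * cr (t', i) (\<lambda>I. h (I, de i ?S)) ?K" unfolding D B by (simp only: mult.assoc)
   finally have C: "an (t, i) (\<lambda>I. Cm s n h (I, ie i S)) J = G * cr (t', i) (\<lambda>I. h (I, de i ?S)) ?K" .
   have iS'': "i = 0 \<or> i \<notin> S" using tr by blast
   show ?thesis unfolding if_P[OF iS''] if_P[OF iS'] by (rule C)
  qed
  have "vi n t (Cm s n h) (J, S) = G * vw n t' h (?K, ?S)"
   unfolding vi_def vw_def prod.case sum_distrib_left by (rule sum.cong[OF refl]) (rule trm, simp)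
  also have "vw n t' h = 0" using h t'(1) by (simp add: E2_def)
  finally show ?thesis by simp
 qed
 ultimately show ?thesis by (auto simp: E1_def fun_eq_iff)
qed

lemma dim_E2:
 assumes n: "n = s + 2"
 shows "fs.dim (E2 s n :: 'a::field_char_0 pch set) \<le> fs.dim (E1 s n :: 'a pch set)"
proof -
 have lC: "lin (Cm s n :: 'a pch => 'a pch)"
  by (rule linI) (auto simp: Cm_def fun_eq_iff algebra_simps)
 have sE: "fs.subspace (E2 s n :: 'a pch set)"
  by (auto simp: E2_def fs.subspace_def supp_on_def lin_simps[OF lin_vw])
 have fE: "findim (E2 s n :: 'a pch set)"
  by (rule findim_mono[OF findim_supp_on[of "XS s n (kd s) \<times> SS n"]]) (auto simp: E2_def supp_on_def)
 have fE1: "findim (E1 s n :: 'a pch set)"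
  by (rule findim_mono[OF findim_supp_on[of "UU s n"]]) (auto simp: E1_def supp_on_def)
 have "fs.dim (E2 s n :: 'a pch set) \<le> (\<Sum>l\<in>{0::nat}. fs.dim (E1 s n :: 'a pch set))"
 proof (rule joint_dim[where F = "\<lambda>_. Cm s n", OF _ sE fE])
  show "lin (Cm s n :: 'a pch => 'a pch) \<and> Cm s n ` E2 s n \<subseteq> (E1 s n :: 'a pch set) \<and> findim (E1 s n :: 'a pch set)"
  proof (intro conjI image_subsetI)
   show "lin (Cm s n :: 'a pch => 'a pch)" by (rule lC)
   show "Cm s n h \<in> E1 s n" if "h \<in> E2 s n" for h :: "'a pch" by (rule Cm_E2[OF that n])
   show "findim (E1 s n :: 'a pch set)" by (rule fE1)
  qed
  fix h :: "'a pch" assume h: "h \<in> E2 s n" and z: "\<And>l. l \<in> {0::nat} ==> Cm s n h = 0"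
  have z0: "Cm s n h = 0" by (rule z) simp
  have "h (K, S) = 0" for K S
  proof (rule ccontr)
   assume n0: "h (K, S) \<noteq> 0"
   then have K: "K \<subseteq> cells s n" "S \<subseteq> {1..<n}" using h unfolding E2_def supp_on_def XS_def by blast+
   have e: "{1..<n} - ({1..<n} - S) = S" using K(2) by blast
   have "finite (co s n K)" by (rule finite_subset[OF co_sub]) simp
   have "Cm s n h (co s n K, {1..<n} - S) = (\<Prod>x\<in>co s n K. (-1) ^ snd x) * h (K, S)"
    using co_sub[of s n K] by (simp add: Cm_def co_co[OF K(1)] e del: One_nat_def)
   moreover have "(\<Prod>x\<in>co s n K. (-1) ^ snd x) \<noteq> (0 :: 'a)" by (simp add: prod_zero_iff \<open>finite (co s n K)\<close>)
   ultimately show False using fun_cong[OF z0, of "(co s n K, {1..<n} - S)"] n0 by simp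
  qed
  then show "h = 0" by (simp add: fun_eq_iff)
 qed simp
 then show ?thesis by simp
qed

section \<open>The flattening of the permanent tensor\<close>

primrec cnd :: "nat => (nat => nat) => nat set => bool" where
 "cnd 0 i S = True" | "cnd (Suc d) i S = ((i d = 0 \<or> i d \<in> S) \<and> cnd d i (de (i d) S))"

text \<open>In the squarefree algebra with x_0 = 1, \<open>cnd d i S\<close> says that the product
  of the variables x_(i t), t < d, is nonzero and divides the monomial S; \<open>rm d i S\<close> is
  then the quotient monomial.\<close>

primrec rm :: "nat => (nat => nat) => nat set => nat set" where
 "rm 0 i S = S" | "rm (Suc d) i S = rm d i (de (i d) S)"

lemma cnd_cong: "(\<And>t. t < d ==> i t = i' t) ==> cnd d i S = cnd d i' S \<and> rm d i S = rm d i' S"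
 by (induction d arbitrary: S) simp_all

lemma Wop_expand: "Wop n d v (J, S) = (\<Sum>i\<in>PiE {..<d} (\<lambda>_. {..<n}). if cnd d i S then CR d i (\<lambda>I. v (I, rm d i S)) J else 0)"
proof (induction d arbitrary: J S)
 case (Suc d)
 have c: "CR d (i(d := a)) f = CR d i f" "cnd d (i(d := a)) S = cnd d i S" "rm d (i(d := a)) S = rm d i S" for i a f S
  using cnd_cong[of d "i(d := a)" i S] by (auto intro: CR_cong)
 have "Wop n (Suc d) v (J, S) = (\<Sum>a<n. if a = 0 \<or> a \<in> S then cr (d, a) (\<lambda>I. Wop n d v (I, de a S)) J else 0)"
  by (simp add: vw_def)
 also have "\<dots> = (\<Sum>a<n. \<Sum>i\<in>PiE {..<d} (\<lambda>_. {..<n}). if cnd (Suc d) (i(d := a)) S then CR (Suc d) (i(d := a)) (\<lambda>I. v (I, rm (Suc d) (i(d := a)) S)) J else 0)"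
 proof (rule sum.cong[OF refl])
  fix a
  have "(\<lambda>I. Wop n d v (I, de a S)) = (\<Sum>i\<in>PiE {..<d} (\<lambda>_. {..<n}). if cnd d i (de a S) then CR d i (\<lambda>I. v (I, rm d i (de a S))) else 0)"
  proof
   fix I
   show "Wop n d v (I, de a S) = (\<Sum>i\<in>PiE {..<d} (\<lambda>_. {..<n}). if cnd d i (de a S) then CR d i (\<lambda>I. v (I, rm d i (de a S))) else 0) I"
    unfolding sum_apply Suc
   proof (rule sum.cong[OF refl])
    fix i
    show "(if cnd d i (de a S) then CR d i (\<lambda>I. v (I, rm d i (de a S))) I else 0)
     = (if cnd d i (de a S) then CR d i (\<lambda>I. v (I, rm d i (de a S))) else 0) I"
     by (cases "cnd d i (de a S)") simp_all
   qed
  qed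
  then have "cr (d, a) (\<lambda>I. Wop n d v (I, de a S)) J
   = (\<Sum>i\<in>PiE {..<d} (\<lambda>_. {..<n}). cr (d, a) (if cnd d i (de a S) then CR d i (\<lambda>I. v (I, rm d i (de a S))) else 0) J)"
   by (simp only: fsp.linear_sum[OF lin_cr] sum_apply)
  also have "\<dots> = (\<Sum>i\<in>PiE {..<d} (\<lambda>_. {..<n}). if cnd d i (de a S) then cr (d, a) (CR d i (\<lambda>I. v (I, rm d i (de a S)))) J else 0)"
   by (rule sum.cong[OF refl]) (auto simp: lin_simps(4)[OF lin_cr])
  finally have E: "cr (d, a) (\<lambda>I. Wop n d v (I, de a S)) J
   = (\<Sum>i\<in>PiE {..<d} (\<lambda>_. {..<n}). if cnd d i (de a S) then cr (d, a) (CR d i (\<lambda>I. v (I, rm d i (de a S)))) J else 0)" .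
  show "(if a = 0 \<or> a \<in> S then cr (d, a) (\<lambda>I. Wop n d v (I, de a S)) J else 0)
   = (\<Sum>i\<in>PiE {..<d} (\<lambda>_. {..<n}). if cnd (Suc d) (i(d := a)) S then CR (Suc d) (i(d := a)) (\<lambda>I. v (I, rm (Suc d) (i(d := a)) S)) J else 0)"
   unfolding cnd.simps rm.simps CR.simps fun_upd_same c E by (cases "a = 0 \<or> a \<in> S") simp_all
 qed
 also have "\<dots> = (\<Sum>i\<in>PiE {..<Suc d} (\<lambda>_. {..<n}). if cnd (Suc d) i S then CR (Suc d) i (\<lambda>I. v (I, rm (Suc d) i S)) J else 0)"
  by (rule sum_PiE_Suc[symmetric])
 finally show ?case .
qed simp

lemma rm_eq: "0 \<notin> S ==> rm d i S = S - i ` {..<d}"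
 by (induction d arbitrary: S) (auto simp: de_def lessThan_Suc)

lemma cnd_iff: "0 \<notin> S ==> cnd d i S \<longleftrightarrow> (\<forall>t<d. i t = 0 \<or> i t \<in> S) \<and> (\<forall>t<d. \<forall>u<d. i t = i u \<and> i t \<noteq> 0 --> t = u)"
proof (induction d arbitrary: S)
 case (Suc d)
 have "0 \<notin> de (i d) S" using Suc.prems by (auto simp: de_def)
 note IH = Suc.IH[OF this]
 have e: "x \<in> de y S \<longleftrightarrow> x \<in> S \<and> (y = 0 \<or> x \<noteq> y)" for x y by (simp add: de_def)
 show ?case unfolding cnd.simps IH e
 proof (intro iffI conjI allI impI)
  assume a: "(i d = 0 \<or> i d \<in> S) \<and> (\<forall>t<d. i t = 0 \<or> i t \<in> S \<and> (i d = 0 \<or> i t \<noteq> i d))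
   \<and> (\<forall>t<d. \<forall>u<d. i t = i u \<and> i t \<noteq> 0 --> t = u)"
  show "i t = 0 \<or> i t \<in> S" if "t < Suc d" for t using a that by (metis less_SucE)
  show "t = u" if "t < Suc d" "u < Suc d" "i t = i u \<and> i t \<noteq> 0" for t u using a that by (metis less_SucE)
 next
  assume a: "(\<forall>t<Suc d. i t = 0 \<or> i t \<in> S) \<and> (\<forall>t<Suc d. \<forall>u<Suc d. i t = i u \<and> i t \<noteq> 0 --> t = u)"
  show "i d = 0 \<or> i d \<in> S" using a by simp
  show "i t = 0 \<or> i t \<in> S \<and> (i d = 0 \<or> i t \<noteq> i d)" if "t < d" for t using a that by (metis less_SucI less_irrefl lessI)
  show "t = u" if "t < d" "u < d" "i t = i u \<and> i t \<noteq> 0" for t u using a that by (metis less_SucI)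
 qed
qed simp

lemma perm_tensor_eq: "perm_tensor n i = (if i \<in> multi_index n (\<lambda>_. n) \<and> inj_on i {..<n} then 1 else (0::'a::field_char_0))"
proof -
 have pt: "pure_tensor n (\<lambda>j. unit_vec n (\<sigma> j)) i = (if i \<in> multi_index n (\<lambda>_. n) \<and> (\<forall>j<n. \<sigma> j = i j) then 1 else 0 :: 'a)"
  if "\<sigma> permutes {..<n}" for \<sigma>
 proof (cases "i \<in> multi_index n (\<lambda>_. n)")
  case True
  then have il: "i j < n" if "j < n" for j using that by (auto simp: multi_index_def PiE_def Pi_def)
  have "pure_tensor n (\<lambda>j. unit_vec n (\<sigma> j)) i = (\<Prod>j<n. unit_vec n (\<sigma> j) $ i j :: 'a)"
   using True by (simp add: pure_tensor_def)
  also have "\<dots> = (\<Prod>j<n. if \<sigma> j = i j then 1 else 0)"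
  proof (rule prod.cong[OF refl])
   fix j assume "j \<in> {..<n}"
   then have "i j < n" "\<sigma> j < n" using il[of j] permutes_in_image[OF \<open>\<sigma> permutes {..<n}\<close>, of j] by simp_all
   then show "unit_vec n (\<sigma> j) $ i j = (if \<sigma> j = i j then 1 else 0 :: 'a)" by (auto simp: unit_vec_def)
  qed
  also have "\<dots> = (if \<forall>j<n. \<sigma> j = i j then 1 else 0)"
  proof (cases "\<forall>j<n. \<sigma> j = i j")
   case False
   then obtain j where "j < n" "\<sigma> j \<noteq> i j" by blast
   then have "(\<Prod>j<n. if \<sigma> j = i j then 1 else 0 :: 'a) = 0" by (intro prod_zero bexI[of _ j]) simp_all
   then show ?thesis using False by simp
  qed simp
  finally show ?thesis using True by simp
 qed (simp add: pure_tensor_def)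
 have "perm_tensor n i = (\<Sum>\<sigma> | \<sigma> permutes {..<n}. if i \<in> multi_index n (\<lambda>_. n) \<and> (\<forall>j<n. \<sigma> j = i j) then 1 else 0 :: 'a)"
  unfolding perm_tensor_def by (rule sum.cong[OF refl]) (simp add: pt)
 also have "\<dots> = (if i \<in> multi_index n (\<lambda>_. n) \<and> inj_on i {..<n} then 1 else 0)"
 proof (cases "i \<in> multi_index n (\<lambda>_. n) \<and> inj_on i {..<n}")
  case True
  define \<sigma> where "\<sigma> j = (if j < n then i j else j)" for j
  have "i ` {..<n} \<subseteq> {..<n}" using True by (auto simp: multi_index_def PiE_def Pi_def)
  then have im: "i ` {..<n} = {..<n}" using True by (intro card_subset_eq) (auto simp: card_image)
  have "\<sigma> permutes {..<n}"
  proof (rule bij_imp_permutes)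
   have "bij_betw i {..<n} {..<n}" using True im by (simp add: bij_betw_def)
   then show "bij_betw \<sigma> {..<n} {..<n}" by (rule bij_betw_cong[THEN iffD1, rotated]) (simp add: \<sigma>_def)
  qed (simp add: \<sigma>_def)
  moreover have "(\<forall>j<n. \<tau> j = i j) \<longleftrightarrow> \<tau> = \<sigma>" if "\<tau> permutes {..<n}" for \<tau>
   using permutes_not_in[OF that] by (auto simp: \<sigma>_def fun_eq_iff)
  ultimately have "(\<Sum>\<tau> | \<tau> permutes {..<n}. if i \<in> multi_index n (\<lambda>_. n) \<and> (\<forall>j<n. \<tau> j = i j) then 1 else 0 :: 'a)
   = (\<Sum>\<tau> | \<tau> permutes {..<n}. if \<tau> = \<sigma> then 1 else 0)" using True by (intro sum.cong) auto
  then show ?thesis using True \<open>\<sigma> permutes {..<n}\<close> by (simp add: finite_permutations)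
 next
  case False
  have "\<not> (i \<in> multi_index n (\<lambda>_. n) \<and> (\<forall>j<n. \<sigma> j = i j))" if "\<sigma> permutes {..<n}" for \<sigma>
  proof
   assume a: "i \<in> multi_index n (\<lambda>_. n) \<and> (\<forall>j<n. \<sigma> j = i j)"
   have "inj_on i {..<n}" using permutes_inj_on[OF that, of "{..<n}"] a by (simp add: inj_on_def)
   then show False using a False by simp
  qed
  then have "(\<Sum>\<sigma> | \<sigma> permutes {..<n}. if i \<in> multi_index n (\<lambda>_. n) \<and> (\<forall>j<n. \<sigma> j = i j) then 1 else 0 :: 'a) = 0"
   by (intro sum.neutral) auto
  then show ?thesis using False by simp
 qed
 finally show ?thesis .
qed

text \<open>The index tuple is a permutation exactly when the product of its variables is x_1 ...
  x_(n-1) in the squarefree algebra. There are n slots and n - 1 such variables, so exactly one slot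
  is left and must carry index 0; setting x_0 = 1 loses no information.\<close>

lemma perm_cond:
 assumes n: "n = s + 2" and i: "i \<in> PiE {..<s} (\<lambda>_. {..<n})" and jk: "j < n" "k < n"
 shows "perm_tensor n (i(s := j, Suc s := k))
  = (if cnd s i ({1..<n} - {j}) \<and> rm s i ({1..<n} - {j}) = {k} - {0} then 1 else (0::'a::field_char_0))"
proof -
 let ?f = "i(s := j, Suc s := k)" and ?S = "{1..<n} - {j}"
 have it: "i t < n" if "t < s" for t using PiE_mem[OF i, of t] that by simp
 have ft: "?f t < n" if "t < n" for t using that it[of t] jk n by auto
 have mi: "?f \<in> multi_index n (\<lambda>_. n)"
  unfolding multi_index_def using ft PiE_arb[OF i] n by (intro PiE_I) auto
 have dom: "t < s \<or> t = s \<or> t = Suc s" if "t < n" for t using that n by auto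
 have fv: "?f s = j" "?f (Suc s) = k" "t < s ==> ?f t = i t" for t by auto
 have sn: "s < n" "Suc s < n" using n by auto
 have rmS: "rm s i ?S = ?S - i ` {..<s}" by (rule rm_eq) simp
 have cS: "cnd s i ?S \<longleftrightarrow> (\<forall>t<s. i t = 0 \<or> i t \<in> ?S) \<and> (\<forall>t<s. \<forall>u<s. i t = i u \<and> i t \<noteq> 0 --> t = u)"
  by (rule cnd_iff) simp
 have "inj_on ?f {..<n} \<longleftrightarrow> cnd s i ?S \<and> rm s i ?S = {k} - {0}"
 proof
  assume inj: "inj_on ?f {..<n}"
  have eqD: "t = u" if "?f t = ?f u" "t < n" "u < n" for t u using inj_onD[OF inj that(1)] that by simp
  have sub: "?f ` {..<n} \<subseteq> {..<n}" using ft by blast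
  have im: "?f ` {..<n} = {..<n}" by (rule card_subset_eq[OF finite_lessThan sub card_image[OF inj]])
  have "i t = 0 \<or> i t \<in> ?S" if t: "t < s" for t
   using eqD[of t s] t it[OF t] sn fv by auto
  moreover have "t = u" if "t < s" "u < s" "i t = i u" for t u using eqD[of t u] that sn by auto
  moreover have "?S - i ` {..<s} = {k} - {0}"
  proof (intro equalityI subsetI)
   fix x assume x: "x \<in> ?S - i ` {..<s}"
   then have "x \<in> ?f ` {..<n}" unfolding im by simp
   then obtain t where t: "t < n" "x = ?f t" by blast
   then show "x \<in> {k} - {0}" using dom[OF t(1)] x fv by auto
  next
   fix x assume "x \<in> {k} - {0}"
   then have x: "x = k" "k \<noteq> 0" by auto
   have "k \<noteq> j" using eqD[of s "Suc s"] sn fv by auto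
   moreover have "k \<noteq> i t" if "t < s" for t using eqD[of t "Suc s"] sn fv that by auto
   ultimately show "x \<in> ?S - i ` {..<s}" using x jk by auto
  qed
  ultimately show "cnd s i ?S \<and> rm s i ?S = {k} - {0}" unfolding cS rmS by blast
 next
  assume "cnd s i ?S \<and> rm s i ?S = {k} - {0}"
  then have c1: "\<And>t. t < s ==> i t = 0 \<or> i t \<in> ?S" and c2: "\<And>t u. t < s ==> u < s ==> i t = i u ==> i t \<noteq> 0 ==> t = u"
   and c3: "?S - i ` {..<s} = {k} - {0}" unfolding cS rmS by blast+
  let ?A = "{t. t < n \<and> ?f t \<noteq> 0}"
  have kS: "k \<in> ?S \<and> k \<notin> i ` {..<s}" if "k \<noteq> 0"
  proof -
   have "k \<in> ?S - i ` {..<s}" unfolding c3 using that by simp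
   then show ?thesis by simp
  qed
  have injA: "t = u" if tu: "t < n" "u < n" "?f t = ?f u" "?f t \<noteq> 0" for t u
  proof -
   have w: "t = u" if "t < s" "u = s \<or> u = Suc s" "?f t = ?f u" "?f t \<noteq> 0" for t u
    using that c1[of t] kS by (auto simp: fv)
   have w2: "?f s \<noteq> ?f (Suc s)" if "?f s \<noteq> 0" using kS that by auto
   have nz: "?f u \<noteq> 0" using tu(3,4) by metis
   have "t = u" if "t < s" "u < s" using c2[OF that] fv(3)[OF that(1)] fv(3)[OF that(2)] tu(3,4) by metis
   moreover have "t = u" if "t < s" "u = s \<or> u = Suc s" by (rule w[OF that tu(3,4)])
   moreover have "t = u" if "u < s" "t = s \<or> t = Suc s" by (rule w[OF that tu(3)[symmetric] nz, symmetric])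
   moreover have "t = u" if "t = s \<or> t = Suc s" "u = s \<or> u = Suc s"
    using that w2 tu(3,4) nz by (metis (no_types))
   ultimately show ?thesis using dom[OF tu(1)] dom[OF tu(2)] by blast
  qed
  have "?f ` ?A = {1..<n}"
  proof (intro equalityI subsetI)
   fix x assume "x \<in> ?f ` ?A"
   then obtain t where "t < n" "x = ?f t" "?f t \<noteq> 0" by blast
   then show "x \<in> {1..<n}" using ft[of t] by simp
  next
   fix x assume x: "x \<in> {1..<n}"
   consider "x = j" | "x \<in> i ` {..<s}" | "x \<in> ?S - i ` {..<s}" using x by blast
   then show "x \<in> ?f ` ?A"
   proof cases
    case 1 then show ?thesis using x sn by (intro image_eqI[of _ _ s]) auto
   next
    case 2
    then obtain t where "t < s" "x = i t" by blast
    then show ?thesis using x sn by (intro image_eqI[of _ _ t]) auto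
   next
    case 3
    then have "x = k" "k \<noteq> 0" unfolding c3 by auto
    then show ?thesis using sn by (intro image_eqI[of _ _ "Suc s"]) auto
   qed
  qed
  moreover have "inj_on ?f ?A" by (rule inj_onI, elim CollectE conjE, (rule injA; assumption))
  ultimately have "card ?A = n - 1" using card_image[of ?f ?A] by simp
  moreover have AA: "?A \<subseteq> {..<n}" "finite ?A" by auto
  ultimately have c1': "card ({..<n} - ?A) = 1" using n by (simp add: card_Diff_subset)
  show "inj_on ?f {..<n}"
  proof (rule inj_onI)
   fix t u assume tu: "t \<in> {..<n}" "u \<in> {..<n}" "?f t = ?f u"
   show "t = u"
   proof (cases "?f t = 0")
    case True
    obtain z where z: "{..<n} - ?A = {z}" using c1' by (rule card_1_singletonE)
    have "t \<in> {..<n} - ?A" "u \<in> {..<n} - ?A" using True tu by auto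
    then show ?thesis unfolding z by simp
   next
    case False then show ?thesis using injA[of t u] tu by blast
   qed
  qed
 qed
 then show ?thesis unfolding perm_tensor_eq using mi by simp
qed

text \<open>The input index k corresponds to the monomial x_k and the output index j to the product
  of all variables except x_j. With \<open>perm_cond\<close>, the flattening collects exactly the
  terms of \<open>Wop\<close> between these monomials.\<close>

lemma Fl_perm:
 fixes v :: "'a::field_char_0 pch"
 assumes n: "n = s + 2" and v: "v \<in> supp_on (XS s n (kd 0) \<times> {S\<in>SS n. card S \<le> 1})" and j: "j < n"
 shows "Fl s (perm_tensor n) (\<lambda>(I, k). if k < n then v (I, {k} - {0}) else 0) (J, j) = Wop n s v (J, {1..<n} - {j})"
proof -
 let ?S = "{1..<n} - {j}" and ?P = "PiE {..<s} (\<lambda>_. {..<n})"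
 have "Fl s (perm_tensor n) (\<lambda>(I, k). if k < n then v (I, {k} - {0}) else 0) (J, j)
  = (\<Sum>k<n. \<Sum>i\<in>?P. perm_tensor n (i(s := j, Suc s := k)) * CR s i (\<lambda>I. if k < n then v (I, {k} - {0}) else 0) J)"
  using j by (simp add: Fl_eq n)
 also have "\<dots> = (\<Sum>k<n. \<Sum>i\<in>?P. if cnd s i ?S \<and> rm s i ?S = {k} - {0} then CR s i (\<lambda>I. v (I, {k} - {0})) J else 0)"
  by (intro sum.cong refl) (auto simp: perm_cond[OF n _ j])
 also have "\<dots> = (\<Sum>i\<in>?P. \<Sum>k<n. if cnd s i ?S \<and> rm s i ?S = {k} - {0} then CR s i (\<lambda>I. v (I, {k} - {0})) J else 0)"
  by (rule sum.swap)
 also have "\<dots> = (\<Sum>i\<in>?P. if cnd s i ?S then CR s i (\<lambda>I. v (I, rm s i ?S)) J else 0)"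
 proof (rule sum.cong[OF refl])
  fix i
  have rs: "rm s i ?S \<subseteq> {1..<n}" by (subst rm_eq) auto
  show "(\<Sum>k<n. if cnd s i ?S \<and> rm s i ?S = {k} - {0} then CR s i (\<lambda>I. v (I, {k} - {0})) J else 0)
   = (if cnd s i ?S then CR s i (\<lambda>I. v (I, rm s i ?S)) J else 0)"
  proof (cases "\<exists>k<n. rm s i ?S = {k} - {0}")
   case True
   then obtain k where k: "k < n" "rm s i ?S = {k} - {0}" by blast
   have "rm s i ?S = {k'} - {0} \<longleftrightarrow> k' = k" for k' unfolding k(2) by auto
   then have "(\<Sum>k'<n. if cnd s i ?S \<and> rm s i ?S = {k'} - {0} then CR s i (\<lambda>I. v (I, {k'} - {0})) J else 0)
    = (\<Sum>k'<n. if k' = k then (if cnd s i ?S then CR s i (\<lambda>I. v (I, {k} - {0})) J else 0) else 0)"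
    by (intro sum.cong refl) auto
   then show ?thesis using k by simp
  next
   case False
   have "\<not> card (rm s i ?S) \<le> 1"
   proof
    assume "card (rm s i ?S) \<le> 1"
    then consider "rm s i ?S = {}" | x where "rm s i ?S = {x}"
     using finite_subset[OF rs] by (metis One_nat_def card_0_eq card_1_singletonE finite_atLeastLessThan le_Suc_eq le_zero_eq)
    then show False
    proof cases
     case 1 then show False using False n by (metis Diff_cancel zero_less_Suc add_2_eq_Suc')
    next
     case 2
     then have "x < n" "x \<noteq> 0" using rs by auto
     then show False using False 2 by (metis Diff_empty Diff_insert0 singletonD)
    qed
   qed
   then have "(\<lambda>I. v (I, rm s i ?S)) = (\<lambda>_. 0)" using v by (auto simp: supp_on_def fun_eq_iff)
   then have "CR s i (\<lambda>I. v (I, rm s i ?S)) J = 0" using fun_cong[OF lin_simps(4)[OF lin_CR, of s i], of J] by (simp add: zero_fun_def)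
   then show ?thesis using False by simp
  qed
 qed
 also have "\<dots> = Wop n s v (J, ?S)" by (rule Wop_expand[symmetric])
 finally show ?thesis .
qed

text \<open>The map \<rho> reads the coefficients of degree at least n - 2. Elements of the image of
  \<open>Wop n s\<close> are annihilated by every \<open>vw n t\<close>, so what \<rho> kills there
  lies in \<open>E2\<close>; together with \<open>rank_Wop\<close> and \<open>dim_E2\<close> this
  costs the input defect twice.\<close>

lemma rank_Fl_perm:
 assumes n: "n = s + 2"
 shows "2 ^ (n - 1) * (\<Prod>t<s. (n - 1) choose Suc t)
  \<le> fs.dim (Fl s (perm_tensor n :: 'a::field_char_0 tensor) ` supp_on (DX s)) + 2 * fs.dim (E1 s n :: 'a pch set)"
proof -
 let ?V = "supp_on (XS s n (kd 0) \<times> {S\<in>SS n. card S \<le> 1}) :: 'a pch set"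
 let ?W = "Wop n s ` ?V"
 define \<rho> where "\<rho> h = (\<lambda>(J, j). if j < n then h (J, {1..<n} - {j}) else 0)" for h :: "'a pch"
 have l\<rho>: "lin \<rho>" by (rule linI) (auto simp: \<rho>_def fun_eq_iff)
 have fV: "findim ?V" by simp
 have sW: "fs.subspace ?W" by (rule fsp.linear_subspace_image[OF lin_Wop]) simp
 have fW: "findim ?W" by (rule findim_image[OF lin_Wop fV])
 have fE2: "findim (E2 s n :: 'a pch set)"
  by (rule findim_mono[OF findim_supp_on[of "XS s n (kd s) \<times> SS n"]]) (auto simp: E2_def supp_on_def)
 have "{h\<in>?W. \<rho> h = 0} \<subseteq> E2 s n"
 proof
  fix h assume h: "h \<in> {h\<in>?W. \<rho> h = 0}"
  then obtain v where v: "v \<in> ?V" "h = Wop n s v" by blast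
  have "v \<in> supp_on (UU s n)" using v(1) by (auto simp: supp_on_def)
  then have hs: "h \<in> supp_on (XS s n (kd s) \<times> SS n)" unfolding v(2) by (rule Wop_supp) simp
  have "h (J, S) = 0" if S: "S \<subseteq> {1..<n}" "\<not> card S + 2 < n" for J S
  proof -
   have "\<exists>j<n. S = {1..<n} - {j}"
   proof -
    have "card ({1..<n} - S) = n - 1 - card S" using S(1) by (simp add: card_Diff_subset finite_subset)
    then have "card ({1..<n} - S) \<le> 1" using S(2) by linarith
    then consider "{1..<n} - S = {}" | x where "{1..<n} - S = {x}"
     by (metis One_nat_def card_0_eq card_1_singletonE finite_Diff finite_atLeastLessThan le_Suc_eq le_zero_eq)
    then show ?thesis
    proof cases
     case 1 then show ?thesis using S(1) n by (intro exI[of _ 0]) auto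
    next
     case 2 then show ?thesis using S(1) by (intro exI[of _ x]) auto
    qed
   qed
   then obtain j where j: "j < n" "S = {1..<n} - {j}" by blast
   have "\<rho> h = 0" using h by blast
   from fun_cong[OF this, of "(J, j)"] show ?thesis using j by (simp add: \<rho>_def)
  qed
  note Z = this
  have mem: "(J, S) \<in> XS s n (kd s) \<times> {S\<in>SS n. card S + 2 < n}" if nz: "h (J, S) \<noteq> 0" for J S
  proof -
   have m: "(J, S) \<in> XS s n (kd s) \<times> SS n" using supp_onD[OF hs, of "(J, S)"] nz by blast
   have "card S + 2 < n"
   proof (rule ccontr)
    assume "\<not> ?thesis"
    then show False using m nz Z[where S = S and J = J] by auto
   qed
   with m show ?thesis by blast
  qed
  have "h \<in> supp_on (XS s n (kd s) \<times> {S\<in>SS n. card S + 2 < n})"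
   unfolding supp_on_def mem_Collect_eq split_paired_All using mem by blast
  then show "h \<in> E2 s n" using vw_Wop_0 v(2) by (auto simp: E2_def)
 qed
 then have "fs.dim {h\<in>?W. \<rho> h = 0} \<le> fs.dim (E2 s n :: 'a pch set)" by (rule dim_mono[OF fE2])
 moreover have "\<rho> ` ?W \<subseteq> Fl s (perm_tensor n) ` supp_on (DX s)"
 proof
  fix f assume "f \<in> \<rho> ` ?W"
  then obtain v where v: "v \<in> ?V" "f = \<rho> (Wop n s v)" by blast
  let ?g = "\<lambda>(I, k). if k < n then v (I, {k} - {0}) else 0"
  have g: "?g \<in> supp_on (DX s)" using v(1) n by (auto simp: supp_on_def)
  have "Fl s (perm_tensor n) ?g y = f y" for y
  proof -
   obtain J j where y: "y = (J, j)" by (cases y)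
   show ?thesis
   proof (cases "j < n")
    case True then show ?thesis using Fl_perm[OF n v(1) True, of J] by (simp add: y v(2) \<rho>_def)
   next
    case False
    then have "Fl s (perm_tensor n) ?g y = 0" using Fl_supp[OF g, of "perm_tensor n"] n by (auto simp: y supp_on_def)
    then show ?thesis using False by (simp add: y v(2) \<rho>_def)
   qed
  qed
  then have "Fl s (perm_tensor n) ?g = f" by (rule ext)
  then show "f \<in> Fl s (perm_tensor n) ` supp_on (DX s)" using g by blast
 qed
 then have "fs.dim (\<rho> ` ?W) \<le> fs.dim (Fl s (perm_tensor n :: 'a tensor) ` supp_on (DX s))"
  by (rule dim_mono[rotated]) (rule findim_image[OF lin_Fl findim_supp_on], simp)
 ultimately show ?thesis using rank_Wop[OF n, where 'a='a] rank_nullity[OF l\<rho> sW fW] dim_E2[OF n, where 'a='a] by linarith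
qed

section \<open>Pure tensors and the border rank bound\<close>

lemma Fl_pure:
 assumes n: "n = s + 2" and v: "\<And>j. j < n ==> v j \<in> carrier_vec n"
 shows "Fl s (pure_tensor n v) g (J, j) = (if j < n then v s $ j * Ww n (\<lambda>t k. v t $ k) s (\<lambda>I. \<Sum>k<n. v (Suc s) $ k * g (I, k)) J else (0::'a::field_char_0))"
proof (cases "j < n")
 case j: True
 let ?P = "PiE {..<s} (\<lambda>_. {..<n})"
 have pt: "pure_tensor n v (i(s := j, Suc s := k)) = (\<Prod>t<s. v t $ i t) * v s $ j * v (Suc s) $ k" if i: "i \<in> ?P" and k: "k < n" for i k
 proof -
  have "i(s := j, Suc s := k) \<in> multi_index n (\<lambda>j. dim_vec (v j))"
   unfolding multi_index_def
  proof (rule PiE_I)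
   fix t assume t: "t \<in> {..<n}"
   then have "dim_vec (v t) = n" using v[of t] by auto
   then show "(i(s := j, Suc s := k)) t \<in> {..<dim_vec (v t)}" using t k j PiE_mem[OF i, of t] n by auto
  next
   fix t assume "t \<notin> {..<n}"
   then show "(i(s := j, Suc s := k)) t = undefined" using PiE_arb[OF i, of t] n by auto
  qed
  then have "pure_tensor n v (i(s := j, Suc s := k)) = (\<Prod>t<Suc (Suc s). v t $ (i(s := j, Suc s := k)) t)"
   by (simp add: pure_tensor_def n)
  also have "\<dots> = (\<Prod>t<s. v t $ (i(s := j, Suc s := k)) t) * v s $ j * v (Suc s) $ k" by simp
  also have "(\<Prod>t<s. v t $ (i(s := j, Suc s := k)) t) = (\<Prod>t<s. v t $ i t)" by (intro prod.cong) auto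
  finally show ?thesis .
 qed
 have "Fl s (pure_tensor n v) g (J, j) = (\<Sum>k<n. \<Sum>i\<in>?P. (\<Prod>t<s. v t $ i t) * v s $ j * v (Suc s) $ k * CR s i (\<lambda>I. g (I, k)) J)"
 proof -
  have "Fl s (pure_tensor n v) g (J, j) = (\<Sum>k<n. \<Sum>i\<in>?P. pure_tensor n v (i(s := j, Suc s := k)) * CR s i (\<lambda>I. g (I, k)) J)"
   using j unfolding Fl_eq n by (rule if_P)
  also have "\<dots> = (\<Sum>k<n. \<Sum>i\<in>?P. (\<Prod>t<s. v t $ i t) * v s $ j * v (Suc s) $ k * CR s i (\<lambda>I. g (I, k)) J)"
   by (intro sum.cong refl) (simp only: lessThan_iff pt)
  finally show ?thesis .
 qed
 also have "\<dots> = (\<Sum>i\<in>?P. \<Sum>k<n. v s $ j * ((\<Prod>t<s. v t $ i t) * (v (Suc s) $ k * CR s i (\<lambda>I. g (I, k)) J)))"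
  by (subst sum.swap) (simp only: mult_ac)
 also have "\<dots> = v s $ j * (\<Sum>i\<in>?P. (\<Prod>t<s. v t $ i t) * (\<Sum>k<n. v (Suc s) $ k * CR s i (\<lambda>I. g (I, k)) J))"
  by (simp only: sum_distrib_left)
 also have "(\<Sum>i\<in>?P. (\<Prod>t<s. v t $ i t) * (\<Sum>k<n. v (Suc s) $ k * CR s i (\<lambda>I. g (I, k)) J))
  = Ww n (\<lambda>t k. v t $ k) s (\<lambda>I. \<Sum>k<n. v (Suc s) $ k * g (I, k)) J"
 proof -
  have "CR s i (\<lambda>I. \<Sum>k<n. v (Suc s) $ k * g (I, k)) J = (\<Sum>k<n. v (Suc s) $ k * CR s i (\<lambda>I. g (I, k)) J)" for i
  proof -
   have "(\<lambda>I. \<Sum>k<n. v (Suc s) $ k * g (I, k)) = (\<Sum>k<n. fscale (v (Suc s) $ k) (\<lambda>I. g (I, k)))" by (simp add: fun_eq_iff sum_apply)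
   then show ?thesis by (simp add: fsp.linear_sum[OF lin_CR] lin_simps[OF lin_CR] sum_apply)
  qed
  then show ?thesis by (simp add: Ww_expand sum_apply)
 qed
 finally show ?thesis using j by simp
next
 case False then show ?thesis by (simp add: Fl_eq n)
qed

text \<open>Slots s and s + 1 of a pure tensor contribute a factor of rank one, so the flattening
  factors through the image of exterior multiplication by the first s vectors.\<close>

lemma rank_Fl_pure:
 assumes n: "n = s + 2" and v: "\<And>j. j < n ==> v j \<in> carrier_vec n"
 shows "fs.dim (Fl s (pure_tensor n v :: 'a::field_char_0 tensor) ` supp_on (DX s)) \<le> (\<Prod>t<s. (n - 1) choose Suc t)"
proof -
 let ?a = "\<lambda>t k. v t $ k"
 define q where "q F = (\<lambda>(J, j). if j < n then v s $ j * F J else 0)" for F :: "(nat \<times> nat) set => 'a"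
 have lq: "lin q" by (rule linI) (auto simp: q_def fun_eq_iff algebra_simps)
 let ?I = "Ww n ?a s ` supp_on (XS s n (kd 0))"
 have fI: "findim ?I" by (rule findim_image[OF lin_Ww]) simp
 have "Fl s (pure_tensor n v) ` supp_on (DX s) \<subseteq> q ` ?I"
 proof (rule image_subsetI)
  fix g :: "(nat \<times> nat) set \<times> nat => 'a" assume g: "g \<in> supp_on (DX s)"
  let ?F = "\<lambda>I. \<Sum>k<n. v (Suc s) $ k * g (I, k)"
  have "?F \<in> supp_on (XS s n (kd 0))" using g n by (auto simp: supp_on_def intro!: sum.neutral)
  moreover have "Fl s (pure_tensor n v) g = q (Ww n ?a s ?F)"
   by (rule ext) (auto simp: q_def Fl_pure[OF n v])
  ultimately show "Fl s (pure_tensor n v) g \<in> q ` ?I" by blast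
 qed
 then have "fs.dim (Fl s (pure_tensor n v) ` supp_on (DX s)) \<le> fs.dim (q ` ?I)"
  by (rule dim_mono[OF findim_image[OF lq fI]])
 also have "\<dots> \<le> fs.dim ?I"
  using rank_nullity[OF lq fsp.linear_subspace_image[OF lin_Ww] fI] by simp
 also have "\<dots> \<le> (\<Prod>t<s. (n - 1) choose Suc t)" by (rule rank_Ww)
 finally show ?thesis .
qed

lemma dim_sum_image:
 fixes F :: "nat => ('b => 'a::field) => 'c => 'a"
 assumes "\<And>l. lin (F l)" "findim V"
 shows "fs.dim ((\<lambda>v. \<Sum>l<k. F l v) ` V) \<le> (\<Sum>l<k. fs.dim (F l ` V))"
proof -
 have "\<exists>B. finite B \<and> card B = fs.dim (F l ` V) \<and> F l ` V \<subseteq> fs.span B" for l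
 proof -
  obtain B where B: "B \<subseteq> F l ` V" "fs.independent B" "F l ` V \<subseteq> fs.span B" "card B = fs.dim (F l ` V)"
   by (rule fs.basis_exists)
  have "finite B" by (rule findim_indep[OF findim_image[OF assms(1)[of l] assms(2)] B(1,2)])
  then show ?thesis using B(3,4) by (intro exI[of _ B]) simp
 qed
 then obtain B where B: "\<And>l. finite (B l)" "\<And>l. card (B l) = fs.dim (F l ` V)" "\<And>l. F l ` V \<subseteq> fs.span (B l)" by metis
 have "(\<lambda>v. \<Sum>l<k. F l v) ` V \<subseteq> fs.span (\<Union>l<k. B l)"
 proof (rule image_subsetI)
  fix v assume v: "v \<in> V"
  have "F l v \<in> fs.span (\<Union>l<k. B l)" if "l < k" for l
  proof -
   have "F l v \<in> fs.span (B l)" using B(3)[of l] v by blast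
   moreover have "fs.span (B l) \<subseteq> fs.span (\<Union>l<k. B l)" by (rule fs.span_mono) (use that in auto)
   ultimately show ?thesis by blast
  qed
  then show "(\<Sum>l<k. F l v) \<in> fs.span (\<Union>l<k. B l)" by (intro fs.span_sum) simp
 qed
 then have "fs.dim ((\<lambda>v. \<Sum>l<k. F l v) ` V) \<le> card (\<Union>l<k. B l)" by (rule fs.dim_le_card) (use B in auto)
 also have "\<dots> \<le> (\<Sum>l<k. card (B l))" by (rule card_UN_le) simp
 finally show ?thesis using B(2) by simp
qed

lemma sum_of_pure_tensor_rank:
 fixes T :: "'a::field tensor"
 assumes "T \<in> tensor_space d m" "d > 0"
 shows "sum_of_pure_tensors d m (tensor_rank d m T) T"
 unfolding tensor_rank_def using ex_sum_of_pure_tensors[OF assms] by (rule LeastI_ex)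

lemma border_rank_le_rank:
 fixes T :: "'a::field tensor"
 assumes "T \<in> tensor_space d m"
 shows "border_rank d m T \<le> tensor_rank d m T"
 unfolding border_rank_def by (rule Least_le) (use assms in \<open>blast intro: hull_subset[THEN subsetD]\<close>)

lemma border_rank_bound:
 assumes n: "n = s + 2" and K: "K * (\<Prod>t<s. (n - 1) choose Suc t) < fs.dim (Fl s (perm_tensor n :: 'a::field_char_0 tensor) ` supp_on (DX s))"
 shows "Suc K \<le> border_rank n (\<lambda>_. n) (perm_tensor n :: 'a tensor)"
proof (rule ccontr)
 assume a: "\<not> ?thesis"
 let ?T = "perm_tensor n :: 'a tensor" and ?r = "\<Prod>t<s. (n - 1) choose Suc t"
 let ?A = "\<lambda>k. {S \<in> tensor_space n (\<lambda>_. n). tensor_rank n (\<lambda>_. n) S \<le> k} :: 'a tensor set"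
 have Ts: "?T \<in> tensor_space n (\<lambda>_. n)" by (rule perm_tensor_in_tensor_space)
 \<comment> \<open>The tensor rank is one admissible k, so the minimum defining the border rank is
   attained.\<close>
 have "?T \<in> zariski_closed n (\<lambda>_. n) hull ?A (tensor_rank n (\<lambda>_. n) ?T)"
  using Ts by (blast intro: hull_subset[THEN subsetD])
 then have h: "?T \<in> zariski_closed n (\<lambda>_. n) hull ?A (border_rank n (\<lambda>_. n) ?T)"
  unfolding border_rank_def by (rule LeastI)
 obtain f where f: "polynomial_fun f" "f ?T \<noteq> 0" "\<And>S. fs.dim (Fl s S ` supp_on (DX s)) \<le> K * ?r ==> f S = 0"
  by (rule rank_polynomial[of "Fl s" "DX s" "Pow (cells s (s + 2)) \<times> {..<s + 2}" "K * ?r" ?T])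
   (use lin_Fl Fl_supp polynomial_Fl K in auto)
 let ?Z = "{S \<in> tensor_space n (\<lambda>_. n). \<forall>g\<in>{f}. g S = 0}"
 have "?A (border_rank n (\<lambda>_. n) ?T) \<subseteq> ?Z"
 proof
  fix S assume S: "S \<in> ?A (border_rank n (\<lambda>_. n) ?T)"
  define k where "k = tensor_rank n (\<lambda>_. n) S"
  have kK: "k \<le> K" using S a by (simp add: k_def)
  have "sum_of_pure_tensors n (\<lambda>_. n) k S" unfolding k_def by (rule sum_of_pure_tensor_rank) (use S n in auto)
  then obtain v where v: "\<And>l j. l < k ==> j < n ==> v l j \<in> carrier_vec n" "S = (\<lambda>i. \<Sum>l<k. pure_tensor n (v l) i)"
   unfolding sum_of_pure_tensors_def by blast
  have eq: "Fl s S ` supp_on (DX s) = (\<lambda>g. \<Sum>l<k. Fl s (pure_tensor n (v l)) g) ` supp_on (DX s)"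
   unfolding v(2) Fl_sum ..
  have "fs.dim (Fl s S ` supp_on (DX s)) \<le> (\<Sum>l<k. fs.dim (Fl s (pure_tensor n (v l)) ` supp_on (DX s)))"
   unfolding eq by (rule dim_sum_image[OF lin_Fl findim_supp_on]) simp
  also have "\<dots> \<le> (\<Sum>l<k. ?r)" by (rule sum_mono) (rule rank_Fl_pure[OF n], use v(1) in auto)
  also have "\<dots> \<le> K * ?r" using kK by simp
  finally show "S \<in> ?Z" using f(3) S by simp
 qed
 moreover have "zariski_closed n (\<lambda>_. n) ?Z" unfolding zariski_closed_def using f(1) by (intro exI[of _ "{f}"]) simp
 ultimately have "zariski_closed n (\<lambda>_. n) hull ?A (border_rank n (\<lambda>_. n) ?T) \<subseteq> ?Z" by (rule hull_minimal)
 then show False using h f(2) by blast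
qed

section \<open>Glynn's formula and the conclusion\<close>

definition glynn :: "int list list" where
 "glynn = [[1,1,1,1], [1,1,1,-1], [1,1,-1,1], [1,1,-1,-1], [1,-1,1,1], [1,-1,1,-1], [1,-1,-1,1], [1,-1,-1,-1]]"

text \<open>For k = 1, 2, 3 the sign in position k occurs 1 + m_k times, with m_k the multiplicity
  of k among a, b, c, d. The sum over all signs is zero unless all three exponents are even, and
  three odd multiplicities among four indices force a permutation.\<close>

lemma glynn_identity:
 "list_all (\<lambda>a. list_all (\<lambda>b. list_all (\<lambda>c. list_all (\<lambda>d.
  sum_list (map (\<lambda>r. prod_list r * r ! a * r ! b * r ! c * r ! d) glynn) = (if distinct [a, b, c, d] then 8 else 0))
  [0,1,2,3]) [0,1,2,3]) [0,1,2,3]) [0,1,2,3::nat]"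
 by (simp add: glynn_def)

lemma prod_choose:
 "(\<Prod>t<2. 3 choose Suc t) = 9" "(\<Prod>t<3. 4 choose Suc t) = 96"
 "(\<Prod>t<4. 5 choose Suc t) = 2500" "(\<Prod>t<5. 6 choose Suc t) = 162000"
proof -
 have s: "{..<2} = {0, 1::nat}" "{..<3} = {0, 1, 2::nat}" "{..<4} = {0, 1, 2, 3::nat}" "{..<5} = {0, 1, 2, 3, 4::nat}"
  by auto
 have c3: "3 choose Suc 0 = 3" "3 choose Suc 1 = 3" by (simp_all add: numeral_eq_Suc)
 have c4: "4 choose Suc 0 = 4" "4 choose Suc 1 = 6" "4 choose Suc 2 = 4" by (simp_all add: numeral_eq_Suc)
 have c5: "5 choose Suc 0 = 5" "5 choose Suc 1 = 10" "5 choose Suc 2 = 10" "5 choose Suc 3 = 5"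
  by (simp_all add: numeral_eq_Suc)
 have c6: "6 choose Suc 0 = 6" "6 choose Suc 1 = 15" "6 choose Suc 2 = 20" "6 choose Suc 3 = 15" "6 choose Suc 4 = 6"
  by (simp_all add: numeral_eq_Suc)
 have p: "prod f {0, 1::nat} = f 0 * f 1" "prod f {0, 1, 2::nat} = f 0 * (f 1 * f 2)"
  "prod f {0, 1, 2, 3::nat} = f 0 * (f 1 * (f 2 * f 3))"
  "prod f {0, 1, 2, 3, 4::nat} = f 0 * (f 1 * (f 2 * (f 3 * f 4)))" for f :: "nat => nat"
  by simp_all
 show "(\<Prod>t<2. 3 choose Suc t) = 9" unfolding s p c3 by simp
 show "(\<Prod>t<3. 4 choose Suc t) = 96" unfolding s p c4 by simp
 show "(\<Prod>t<4. 5 choose Suc t) = 2500" unfolding s p c5 by simp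
 show "(\<Prod>t<5. 6 choose Suc t) = 162000" unfolding s p c6 by simp
qed

lemma sum_of_pure_tensors_perm4:
 "sum_of_pure_tensors 4 (\<lambda>_. 4) 8 (perm_tensor 4 :: 'a::field_char_0 tensor)"
proof -
 \<comment> \<open>The coefficient of each of the eight terms, the product of its signs divided by
   8, is absorbed into the vector of slot 0.\<close>
 define v :: "nat => nat => 'a vec" where
  "v l j = vec 4 (\<lambda>k. (if j = 0 then of_int (prod_list (glynn ! l)) / 8 else 1) * of_int (glynn ! l ! k))" for l j
 have len: "length glynn = 8" by (simp add: glynn_def)
 have set4: "{..<4::nat} = {0, 1, 2, 3}" by auto
 have "perm_tensor 4 i = (\<Sum>l<8. pure_tensor 4 (v l) i)" for i :: "nat => nat"
 proof (cases "i \<in> multi_index 4 (\<lambda>_. 4)")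
  case False
  then show ?thesis by (simp add: perm_tensor_eq pure_tensor_def v_def)
 next
  case True
  then have i4: "i 0 < 4" "i 1 < 4" "i 2 < 4" "i 3 < 4" by (auto simp: multi_index_def PiE_def Pi_def)
  have mem: "k \<in> set [0,1,2,3]" if "k < 4" for k :: nat using that by auto
  let ?g = "\<lambda>r. prod_list r * r ! i 0 * r ! i 1 * r ! i 2 * r ! i 3 :: int"
  have "pure_tensor 4 (v l) i = of_int (?g (glynn ! l)) / 8" for l
  proof -
   have "pure_tensor 4 (v l) i = (\<Prod>j<4. v l j $ i j)" using True by (simp add: pure_tensor_def v_def)
   also have "\<dots> = v l 0 $ i 0 * (v l 1 $ i 1 * (v l 2 $ i 2 * v l 3 $ i 3))" unfolding set4 by simp
   also have "\<dots> = of_int (?g (glynn ! l)) / 8" using i4 by (simp add: v_def field_simps)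
   finally show ?thesis .
  qed
  then have "(\<Sum>l<8. pure_tensor 4 (v l) i) = (\<Sum>l<8. of_int (?g (glynn ! l)) / 8)" by (intro sum.cong) simp_all
  also have "\<dots> = of_int (\<Sum>l<8. ?g (glynn ! l)) / 8" unfolding of_int_sum sum_divide_distrib ..
  also have "(\<Sum>l<8. ?g (glynn ! l)) = sum_list (map ?g glynn)"
   unfolding sum_list_sum_nth by (auto simp: len atLeast0LessThan intro!: sum.cong)
  also have "\<dots> = (if distinct [i 0, i 1, i 2, i 3] then 8 else 0)"
   using glynn_identity[unfolded list_all_iff, THEN bspec, OF mem[OF i4(1)], THEN bspec, OF mem[OF i4(2)],
     THEN bspec, OF mem[OF i4(3)], THEN bspec, OF mem[OF i4(4)]] .
  finally have eq: "(\<Sum>l<8. pure_tensor 4 (v l) i) = of_int (if distinct [i 0, i 1, i 2, i 3] then 8 else 0) / 8" .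
  have "distinct (map i [0,1,2,3]) \<longleftrightarrow> inj_on i {..<4}" unfolding distinct_map set4 by simp
  then have inj: "inj_on i {..<4} \<longleftrightarrow> distinct [i 0, i 1, i 2, i 3]" by simp
  show ?thesis unfolding perm_tensor_eq inj eq using True by simp
 qed
 moreover have "v l j \<in> carrier_vec 4" for l j by (simp add: v_def)
 ultimately show ?thesis unfolding sum_of_pure_tensors_def by (intro exI[of _ v]) auto
qed

lemma dim_E1_le_ch:
 assumes "n = s + 2" "1 \<le> s" "P = (\<Sum>t<s. Suc t)" "N = P + s - 1"
 shows "fs.dim (E1 s n :: 'a::field_char_0 pch set) \<le> ch TYPE('a) n (map Suc [0..<s]) (n - 1) N P"
proof -
 have "HQ TYPE('a) {1..<n} n (map Suc [0..<s]) N P \<le> ch TYPE('a) n (map Suc [0..<s]) (card {1..<n}) N P"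
  by (rule HQ_le_ch) auto
 from le_trans[OF dim_E1[where 'a = 'a, OF assms] this, unfolded card_atLeastLessThan] show ?thesis .
qed

lemma dim_E1_bounds:
 shows "fs.dim (E1 2 4 :: 'a::field_char_0 pch set) \<le> 1" and "fs.dim (E1 3 5 :: 'a pch set) \<le> 55"
  and "fs.dim (E1 4 6 :: 'a pch set) \<le> 4854" and "fs.dim (E1 5 7 :: 'a pch set) \<le> 808962"
proof -
 have p: "map Suc [0..<2] = [1,2]" "map Suc [0..<3] = [1,2,3]" "map Suc [0..<4] = [1,2,3,4]" "map Suc [0..<5] = [1,2,3,4,5]"
  by (simp_all add: numeral_eq_Suc)
 have c: "4 - 1 = Suc (Suc (Suc 0))" "5 - 1 = Suc (Suc (Suc (Suc 0)))" "6 - 1 = Suc (Suc (Suc (Suc (Suc 0))))"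
  "7 - 1 = Suc (Suc (Suc (Suc (Suc (Suc 0)))))" by simp_all
 have "fs.dim (E1 2 4 :: 'a pch set) \<le> ch TYPE('a) 4 (map Suc [0..<2]) (4 - 1) 4 3"
  by (rule dim_E1_le_ch) (simp_all add: numeral_eq_Suc)
 from le_trans[OF this[unfolded p c] ch4] show "fs.dim (E1 2 4 :: 'a pch set) \<le> 1" .
 have "fs.dim (E1 3 5 :: 'a pch set) \<le> ch TYPE('a) 5 (map Suc [0..<3]) (5 - 1) 8 6"
  by (rule dim_E1_le_ch) (simp_all add: numeral_eq_Suc)
 from le_trans[OF this[unfolded p c] ch5] show "fs.dim (E1 3 5 :: 'a pch set) \<le> 55" .
 have "fs.dim (E1 4 6 :: 'a pch set) \<le> ch TYPE('a) 6 (map Suc [0..<4]) (6 - 1) 13 10"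
  by (rule dim_E1_le_ch) (simp_all add: numeral_eq_Suc)
 from le_trans[OF this[unfolded p c] ch6] show "fs.dim (E1 4 6 :: 'a pch set) \<le> 4854" .
 have "fs.dim (E1 5 7 :: 'a pch set) \<le> ch TYPE('a) 7 (map Suc [0..<5]) (7 - 1) 19 15"
  by (rule dim_E1_le_ch) (simp_all add: numeral_eq_Suc)
 from le_trans[OF this[unfolded p c] ch7]
 have "fs.dim (E1 5 7 :: 'a pch set) \<le> 366919 + 6 * 41748
  + 15 * (6139 + HL TYPE('a) 7 [1,2,3,4,5] 15 12) + 20 * HL TYPE('a) 7 [1,2,3,4,5] 13 12" .
 also have "\<dots> \<le> 366919 + 6 * 41748 + 15 * (6139 + 2842) + 20 * 2842"
  by (intro add_mono mult_le_mono2 order_refl HL_u HL_v)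
 also have "\<dots> = 808962" by simp
 finally show "fs.dim (E1 5 7 :: 'a pch set) \<le> 808962" .
qed

lemma border_rank_perm_ge:
 assumes n: "n = s + 2" and D: "fs.dim (E1 s n :: 'a::field_char_0 pch set) \<le> D"
  and r: "(\<Prod>t<s. (n - 1) choose Suc t) = r" and K: "K * r + 2 * D < 2 ^ (n - 1) * r"
 shows "Suc K \<le> border_rank n (\<lambda>_. n) (perm_tensor n :: 'a tensor)"
proof (rule border_rank_bound[OF n])
 show "K * (\<Prod>t<s. (n - 1) choose Suc t) < fs.dim (Fl s (perm_tensor n :: 'a tensor) ` supp_on (DX s))"
  using rank_Fl_perm[where 'a = 'a, OF n] D K unfolding r by linarith
qed

theorem theorem5p6:
 shows "tensor_rank 4 (\<lambda>_. 4) (perm_tensor 4 :: 'a::field_char_0 tensor) = 8 \<and>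
         border_rank 4 (\<lambda>_. 4) (perm_tensor 4 :: 'a tensor) = 8 \<and>
         border_rank 5 (\<lambda>_. 5) (perm_tensor 5 :: 'a tensor) \<ge> 15 \<and>
         border_rank 6 (\<lambda>_. 6) (perm_tensor 6 :: 'a tensor) \<ge> 29 \<and>
         border_rank 7 (\<lambda>_. 7) (perm_tensor 7 :: 'a tensor) \<ge> 55"
proof -
 have "Suc 7 \<le> border_rank 4 (\<lambda>_. 4) (perm_tensor 4 :: 'a tensor)"
  by (rule border_rank_perm_ge[where s = 2 and r = 9, OF _ dim_E1_bounds(1)]) (simp_all add: prod_choose)
 moreover have "border_rank 4 (\<lambda>_. 4) (perm_tensor 4 :: 'a tensor) \<le> tensor_rank 4 (\<lambda>_. 4) (perm_tensor 4 :: 'a tensor)"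
  by (rule border_rank_le_rank[OF perm_tensor_in_tensor_space])
 moreover have "tensor_rank 4 (\<lambda>_. 4) (perm_tensor 4 :: 'a tensor) \<le> 8"
  unfolding tensor_rank_def by (rule Least_le) (rule sum_of_pure_tensors_perm4)
 moreover have "Suc 14 \<le> border_rank 5 (\<lambda>_. 5) (perm_tensor 5 :: 'a tensor)"
  by (rule border_rank_perm_ge[where s = 3 and r = 96, OF _ dim_E1_bounds(2)]) (simp_all add: prod_choose)
 moreover have "Suc 28 \<le> border_rank 6 (\<lambda>_. 6) (perm_tensor 6 :: 'a tensor)"
  by (rule border_rank_perm_ge[where s = 4 and r = 2500, OF _ dim_E1_bounds(3)]) (simp_all add: prod_choose)
 moreover have "Suc 54 \<le> border_rank 7 (\<lambda>_. 7) (perm_tensor 7 :: 'a tensor)"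
  by (rule border_rank_perm_ge[where s = 5 and r = 162000, OF _ dim_E1_bounds(4)]) (simp_all add: prod_choose)
 ultimately show ?thesis by linarith
qed

end
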